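(* Let $(\Sigma,C)$ be a monoidal theory and let $l,r\colon v_1\to v_2$ be arrows of $\mathbf{S}(\Sigma,C)+\mathbf{Frob}(C)$, forming the rewriting rule $\langle l,r\rangle$. Then for all arrows $a,b\colon w_1\to w_2$ of $\mathbf{S}(\Sigma,C)+\mathbf{Frob}(C)$, $a\Rightarrow_{\langle l,r\rangle} b$ if and only if $[\![\ulcorner a\urcorner]\!]\Rightarrow [\![\ulcorner b\urcorner]\!]$ by DPOI rewriting with the rule $L\leftarrow v_1v_2\rightarrow R$, where $[\![\ulcorner l\urcorner]\!]=(0\to L\leftarrow v_1v_2)$ and $[\![\ulcorner r\urcorner]\!]=(0\to R\leftarrow v_1v_2)$.
   Context: A monoidal theory $(\Sigma,C)$: finite set $C$ of colours, signature $\Sigma$ of operations $o\colon w\to v$, $w,v\in C^{\star}$. $C$-coloured props are symmetric monoidal categories with objects $C^{\star}$ and monoidal product concatenation on objects; $+$ is their coproduct (in the category with identity-on-objects symmetric monoidal functors). $\mathbf{S}(\Sigma,C)$ is the free $C$-coloured prop on $\Sigma$; $\mathbf{Frob}(C)$ is the free $C$-coloured prop on $\mu_c\colon cc\to c,\eta_c\colon\epsilon\to c,\delta_c\colon c\to cc,\varepsilon_c\colon c\to\epsilon$ ($c\in C$) modulo commutative monoid, commutative comonoid, Frobenius ($(\delta_c\oplus id);(id\oplus\mu_c)=\mu_c;\delta_c=(id\oplus\delta_c);(\mu_c\oplus id)$) and separability ($\delta_c;\mu_c=id$) equations. For a word $w=c_1\cdots c_n$, $\mu_w,\eta_w,\delta_w,\varepsilon_w$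 denote the Frobenius structure on $w$ built from those on the $c_i$ using symmetries. Syntactic rewriting: for a rule $\langle l,r\rangle$ with $l,r\colon v_1\to v_2$ and arrows $a,b\colon w_1\to w_2$, $a\Rightarrow_{\langle l,r\rangle}b$ iff there exist a word $u$ and arrows $a_1\colon w_1\to v_1u$, $a_2\colon v_2u\to w_2$ with $a=a_1;(l\oplus id_u);a_2$ and $b=a_1;(r\oplus id_u);a_2$. Folding: for $a\colon w_1\to w_2$, $\ulcorner a\urcorner\colon\epsilon\to w_1w_2$ is $\ulcorner a\urcorner=(\eta_{w_1};\delta_{w_1});(id_{w_1}\oplus a)$. $\mathbf{Hyp}_{\Sigma,C}$: finite directed hypergraphs with nodes labelled in $C$, hyperedges labelled in $\Sigma$ (ordered sources/targets; an $o\colon w\to v$-labelled hyperedge has source labels $w$ and target labels $v$), label-preserving homomorphisms; $0$ is the empty hypergraph. Words are identified with discrete hypergraphs (nodes $0,\dots,k-1$, labelled by the letters). $\mathbf{FTerm}(\Sigma,C)$: $C$-coloured prop with arrows $w\to v$ isomorphism classes of cospans $w\to G\leftarrow v$ in $\mathbf{Hyp}_{\Sigma,C}$, composition by pushout, $\oplus$ disjoint union. $[\![\cdot]\!]\colon\mathbf{S}(\Sigma,C)+\mathbf{Frob}(C)\to\mathbf{FTerm}(\Sigma,C)$ is the prop morphism sending $o\colon c_1\cdots c_m\to b_1\cdots b_n$ to $c_1\cdots c_m\to G_o\leftarrow b_1\cdots b_n$ ($G_o$: nodes labelled $c_1,\dots,c_m,b_1,\dots,b_n$, one hyperedge labelled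 $o$ from the first $m$ to the last $n$ nodes), and $\mu_c\mapsto(cc\to c\leftarrow c)$, $\eta_c\mapsto(\epsilon\to c\leftarrow c)$, $\delta_c\mapsto(c\to c\leftarrow cc)$, $\varepsilon_c\mapsto(c\to c\leftarrow\epsilon)$ (all nodes sent to the single node). DPOI rewriting: given a rule (span) $L\leftarrow J\rightarrow R$ in $\mathbf{Hyp}_{\Sigma,C}$, $(0\to G\leftarrow I)\Rightarrow(0\to H\leftarrow I)$ iff there exist $L\to G$, $R\to H$ and a cospan $J\to K\xleftarrow{q} I$ with maps $K\to G$, $K\to H$ such that the squares $J\to L\to G$ / $J\to K\to G$ and $J\to R\to H$ / $J\to K\to H$ are pushouts, and the given maps $I\to G$, $I\to H$ equal $q;(K\to G)$ and $q;(K\to H)$ respectively. *)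

theory Defs
  imports "HOL-Library.Nat_Bijection"
begin

section \<open>Signatures and coloured props\<close>

record ('c, 'g) signature =
  colours :: "'c set"
  ops :: "'g set"
  arity :: "'g \<Rightarrow> 'c list"
  coarity :: "'g \<Rightarrow> 'c list"

definition wf_signature :: "('c, 'g) signature \<Rightarrow> bool" where
  "wf_signature S \<longleftrightarrow>
     (\<forall>g\<in>ops S. arity S g \<in> lists (colours S) \<and> coarity S g \<in> lists (colours S))"

definition monoidal_theory :: "('c, 'g) signature \<Rightarrow> bool" where
  "monoidal_theory T \<longleftrightarrow> finite (colours T) \<and> wf_signature T"

text \<open>Composition is written in diagrammatic order: \<open>pcomp P f g\<close> is \<open>f;g\<close>.\<close>

record ('c, 'a) cprop =
  pcolours :: "'c set"
  arrows :: "'a set"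
  pdom :: "'a \<Rightarrow> 'c list"
  pcod :: "'a \<Rightarrow> 'c list"
  pid :: "'c list \<Rightarrow> 'a"
  psym :: "'c list \<Rightarrow> 'c list \<Rightarrow> 'a"
  pcomp :: "'a \<Rightarrow> 'a \<Rightarrow> 'a"
  ptensor :: "'a \<Rightarrow> 'a \<Rightarrow> 'a"

definition Arr :: "('c, 'a) cprop \<Rightarrow> 'c list \<Rightarrow> 'c list \<Rightarrow> 'a set" where
  "Arr P w v = {f \<in> arrows P. pdom P f = w \<and> pcod P f = v}"

locale coloured_prop =
  fixes P :: "('c, 'a) cprop"
  assumes arr_words: "f \<in> Arr P w v \<Longrightarrow> w \<in> lists (pcolours P) \<and> v \<in> lists (pcolours P)"
    and id_arr: "w \<in> lists (pcolours P) \<Longrightarrow> pid P w \<in> Arr P w w"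
    and sym_arr: "\<lbrakk>w \<in> lists (pcolours P); v \<in> lists (pcolours P)\<rbrakk> \<Longrightarrow> psym P w v \<in> Arr P (w @ v) (v @ w)"
    and comp_arr: "\<lbrakk>f \<in> Arr P u v; g \<in> Arr P v w\<rbrakk> \<Longrightarrow> pcomp P f g \<in> Arr P u w"
    and tensor_arr: "\<lbrakk>f \<in> Arr P u v; g \<in> Arr P u' v'\<rbrakk> \<Longrightarrow> ptensor P f g \<in> Arr P (u @ u') (v @ v')"
    and id_comp: "f \<in> Arr P u v \<Longrightarrow> pcomp P (pid P u) f = f"
    and comp_id: "f \<in> Arr P u v \<Longrightarrow> pcomp P f (pid P v) = f"
    and comp_assoc: "\<lbrakk>f \<in> Arr P u v; g \<in> Arr P v w; h \<in> Arr P w x\<rbrakk> \<Longrightarrow>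
      pcomp P (pcomp P f g) h = pcomp P f (pcomp P g h)"
    and unit_tensor: "f \<in> Arr P u v \<Longrightarrow> ptensor P (pid P []) f = f"
    and tensor_unit: "f \<in> Arr P u v \<Longrightarrow> ptensor P f (pid P []) = f"
    and tensor_assoc: "\<lbrakk>f \<in> Arr P u v; g \<in> Arr P u' v'; h \<in> Arr P u'' v''\<rbrakk> \<Longrightarrow>
      ptensor P (ptensor P f g) h = ptensor P f (ptensor P g h)"
    and tensor_id: "\<lbrakk>w \<in> lists (pcolours P); v \<in> lists (pcolours P)\<rbrakk> \<Longrightarrow>
      ptensor P (pid P w) (pid P v) = pid P (w @ v)"
    and interchange: "\<lbrakk>f \<in> Arr P u v; g \<in> Arr P v w; f' \<in> Arr P u' v'; g' \<in> Arr P v' w'\<rbrakk> \<Longrightarrow>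
      ptensor P (pcomp P f g) (pcomp P f' g') = pcomp P (ptensor P f f') (ptensor P g g')"
    and sym_natural: "\<lbrakk>f \<in> Arr P u v; g \<in> Arr P u' v'\<rbrakk> \<Longrightarrow>
      pcomp P (ptensor P f g) (psym P v v') = pcomp P (psym P u u') (ptensor P g f)"
    and sym_inverse: "\<lbrakk>w \<in> lists (pcolours P); v \<in> lists (pcolours P)\<rbrakk> \<Longrightarrow>
      pcomp P (psym P w v) (psym P v w) = pid P (w @ v)"
    and sym_hexagon: "\<lbrakk>u \<in> lists (pcolours P); v \<in> lists (pcolours P); w \<in> lists (pcolours P)\<rbrakk> \<Longrightarrow>
      psym P u (v @ w) =
        pcomp P (ptensor P (psym P u v) (pid P w)) (ptensor P (pid P v) (psym P u w))"

text \<open>Identity-on-objects strict symmetric monoidal functors.\<close>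

definition prop_morphism :: "('c, 'a) cprop \<Rightarrow> ('c, 'b) cprop \<Rightarrow> ('a \<Rightarrow> 'b) \<Rightarrow> bool" where
  "prop_morphism P Q F \<longleftrightarrow>
     pcolours P = pcolours Q \<and>
     (\<forall>w v. \<forall>f\<in>Arr P w v. F f \<in> Arr Q w v) \<and>
     (\<forall>w\<in>lists (pcolours P). F (pid P w) = pid Q w) \<and>
     (\<forall>w\<in>lists (pcolours P). \<forall>v\<in>lists (pcolours P). F (psym P w v) = psym Q w v) \<and>
     (\<forall>u v w. \<forall>f\<in>Arr P u v. \<forall>g\<in>Arr P v w. F (pcomp P f g) = pcomp Q (F f) (F g)) \<and>
     (\<forall>f\<in>arrows P. \<forall>g\<in>arrows P. F (ptensor P f g) = ptensor Q (F f) (F g))"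

section \<open>Props presented by generators and equations\<close>

datatype ('c, 'g) pterm =
    TGen 'g
  | TId "'c list"
  | TSym "'c list" "'c list"
  | TSeq "('c, 'g) pterm" "('c, 'g) pterm"
  | TPar "('c, 'g) pterm" "('c, 'g) pterm"

primrec tdom :: "('c, 'g) signature \<Rightarrow> ('c, 'g) pterm \<Rightarrow> 'c list" where
  "tdom S (TGen g) = arity S g"
| "tdom S (TId w) = w"
| "tdom S (TSym w v) = w @ v"
| "tdom S (TSeq s t) = tdom S s"
| "tdom S (TPar s t) = tdom S s @ tdom S t"

primrec tcod :: "('c, 'g) signature \<Rightarrow> ('c, 'g) pterm \<Rightarrow> 'c list" where
  "tcod S (TGen g) = coarity S g"
| "tcod S (TId w) = w"
| "tcod S (TSym w v) = v @ w"
| "tcod S (TSeq s t) = tcod S t"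
| "tcod S (TPar s t) = tcod S s @ tcod S t"

primrec wt :: "('c, 'g) signature \<Rightarrow> ('c, 'g) pterm \<Rightarrow> bool" where
  "wt S (TGen g) \<longleftrightarrow> g \<in> ops S"
| "wt S (TId w) \<longleftrightarrow> w \<in> lists (colours S)"
| "wt S (TSym w v) \<longleftrightarrow> w \<in> lists (colours S) \<and> v \<in> lists (colours S)"
| "wt S (TSeq s t) \<longleftrightarrow> wt S s \<and> wt S t \<and> tcod S s = tdom S t"
| "wt S (TPar s t) \<longleftrightarrow> wt S s \<and> wt S t"

type_synonym ('c, 'g) pequations = "(('c, 'g) pterm \<times> ('c, 'g) pterm) set"

text \<open>The least congruence on well-typed terms containing the laws of strict symmetric
  monoidal categories and the equations \<open>E\<close>.\<close>

inductive peq :: "('c, 'g) signature \<Rightarrow> ('c, 'g) pequations \<Rightarrow>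
    ('c, 'g) pterm \<Rightarrow> ('c, 'g) pterm \<Rightarrow> bool"
  for S E where
  refl: "wt S t \<Longrightarrow> peq S E t t"
| symm: "peq S E s t \<Longrightarrow> peq S E t s"
| trans: "peq S E s t \<Longrightarrow> peq S E t u \<Longrightarrow> peq S E s u"
| seq_cong: "peq S E s s' \<Longrightarrow> peq S E t t' \<Longrightarrow> tcod S s = tdom S t \<Longrightarrow>
    peq S E (TSeq s t) (TSeq s' t')"
| par_cong: "peq S E s s' \<Longrightarrow> peq S E t t' \<Longrightarrow> peq S E (TPar s t) (TPar s' t')"
| equation: "(s, t) \<in> E \<Longrightarrow> wt S s \<Longrightarrow> wt S t \<Longrightarrow> tdom S s = tdom S t \<Longrightarrow> tcod S s = tcod S t \<Longrightarrow>
    peq S E s t"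
| id_seq: "wt S t \<Longrightarrow> peq S E (TSeq (TId (tdom S t)) t) t"
| seq_id: "wt S t \<Longrightarrow> peq S E (TSeq t (TId (tcod S t))) t"
| seq_assoc: "wt S s \<Longrightarrow> wt S t \<Longrightarrow> wt S u \<Longrightarrow> tcod S s = tdom S t \<Longrightarrow> tcod S t = tdom S u \<Longrightarrow>
    peq S E (TSeq (TSeq s t) u) (TSeq s (TSeq t u))"
| unit_par: "wt S t \<Longrightarrow> peq S E (TPar (TId []) t) t"
| par_unit: "wt S t \<Longrightarrow> peq S E (TPar t (TId [])) t"
| par_assoc: "wt S s \<Longrightarrow> wt S t \<Longrightarrow> wt S u \<Longrightarrow>
    peq S E (TPar (TPar s t) u) (TPar s (TPar t u))"
| par_id: "w \<in> lists (colours S) \<Longrightarrow> v \<in> lists (colours S) \<Longrightarrow>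
    peq S E (TPar (TId w) (TId v)) (TId (w @ v))"
| interchange: "wt S s \<Longrightarrow> wt S t \<Longrightarrow> wt S s' \<Longrightarrow> wt S t' \<Longrightarrow>
    tcod S s = tdom S t \<Longrightarrow> tcod S s' = tdom S t' \<Longrightarrow>
    peq S E (TPar (TSeq s t) (TSeq s' t')) (TSeq (TPar s s') (TPar t t'))"
| sym_natural: "wt S s \<Longrightarrow> wt S t \<Longrightarrow>
    peq S E (TSeq (TPar s t) (TSym (tcod S s) (tcod S t)))
            (TSeq (TSym (tdom S s) (tdom S t)) (TPar t s))"
| sym_inverse: "w \<in> lists (colours S) \<Longrightarrow> v \<in> lists (colours S) \<Longrightarrow>
    peq S E (TSeq (TSym w v) (TSym v w)) (TId (w @ v))"
| sym_hexagon: "u \<in> lists (colours S) \<Longrightarrow> v \<in> lists (colours S) \<Longrightarrow> w \<in> lists (colours S) \<Longrightarrow>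
    peq S E (TSym u (v @ w)) (TSeq (TPar (TSym u v) (TId w)) (TPar (TId v) (TSym u w)))"

definition pcls :: "('c, 'g) signature \<Rightarrow> ('c, 'g) pequations \<Rightarrow>
    ('c, 'g) pterm \<Rightarrow> ('c, 'g) pterm set" where
  "pcls S E t = {u. peq S E t u}"

definition rep :: "'x set \<Rightarrow> 'x" where
  "rep X = (SOME t. t \<in> X)"

definition presented_prop :: "('c, 'g) signature \<Rightarrow> ('c, 'g) pequations \<Rightarrow>
    ('c, ('c, 'g) pterm set) cprop" where
  "presented_prop S E =
    \<lparr> pcolours = colours S,
      arrows = {pcls S E t | t. wt S t},
      pdom = (\<lambda>X. tdom S (rep X)),
      pcod = (\<lambda>X. tcod S (rep X)),
      pid = (\<lambda>w. pcls S E (TId w)),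
      psym = (\<lambda>w v. pcls S E (TSym w v)),
      pcomp = (\<lambda>X Y. pcls S E (TSeq (rep X) (rep Y))),
      ptensor = (\<lambda>X Y. pcls S E (TPar (rep X) (rep Y))) \<rparr>"

primrec teval :: "('c, 'a) cprop \<Rightarrow> ('g \<Rightarrow> 'a) \<Rightarrow> ('c, 'g) pterm \<Rightarrow> 'a" where
  "teval R h (TGen g) = h g"
| "teval R h (TId w) = pid R w"
| "teval R h (TSym w v) = psym R w v"
| "teval R h (TSeq s t) = pcomp R (teval R h s) (teval R h t)"
| "teval R h (TPar s t) = ptensor R (teval R h s) (teval R h t)"

text \<open>The extension of an interpretation \<open>h\<close> of the generators to the presented prop.\<close>

definition presented_ext :: "('c, 'a) cprop \<Rightarrow> ('g \<Rightarrow> 'a) \<Rightarrow> ('c, 'g) pterm set \<Rightarrow> 'a" where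
  "presented_ext R h X = teval R h (rep X)"

definition free_prop :: "('c, 'g) signature \<Rightarrow> ('c, ('c, 'g) pterm set) cprop" where
  "free_prop S = presented_prop S {}"

section \<open>Coproducts of props\<close>

text \<open>The coproduct of \<open>P\<close> and \<open>Q\<close> (over the same colours) is generated by all arrows of \<open>P\<close>
  and \<open>Q\<close>, subject to the equations that make the two inclusions prop morphisms. The universal
  property is proved below, in \<open>coprod_universal\<close>.\<close>

definition incl_eqs :: "('c, 'a) cprop \<Rightarrow> ('a \<Rightarrow> 'g) \<Rightarrow> ('c, 'g) pequations" where
  "incl_eqs P i =
     {(TGen (i (pid P w)), TId w) | w. w \<in> lists (pcolours P)} \<union>
     {(TGen (i (psym P w v)), TSym w v) | w v. w \<in> lists (pcolours P) \<and> v \<in> lists (pcolours P)} \<union>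
     {(TGen (i (pcomp P f g)), TSeq (TGen (i f)) (TGen (i g))) | f g.
        f \<in> arrows P \<and> g \<in> arrows P \<and> pcod P f = pdom P g} \<union>
     {(TGen (i (ptensor P f g)), TPar (TGen (i f)) (TGen (i g))) | f g.
        f \<in> arrows P \<and> g \<in> arrows P}"

definition coprod_sig :: "('c, 'a) cprop \<Rightarrow> ('c, 'b) cprop \<Rightarrow> ('c, 'a + 'b) signature" where
  "coprod_sig P Q =
    \<lparr> colours = pcolours P,
      ops = arrows P <+> arrows Q,
      arity = case_sum (pdom P) (pdom Q),
      coarity = case_sum (pcod P) (pcod Q) \<rparr>"

definition coprod_eqs :: "('c, 'a) cprop \<Rightarrow> ('c, 'b) cprop \<Rightarrow> ('c, 'a + 'b) pequations" where
  "coprod_eqs P Q = incl_eqs P Inl \<union> incl_eqs Q Inr"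

definition coprod_prop ::
    "('c, 'a) cprop \<Rightarrow> ('c, 'b) cprop \<Rightarrow> ('c, ('c, 'a + 'b) pterm set) cprop" where
  "coprod_prop P Q = presented_prop (coprod_sig P Q) (coprod_eqs P Q)"

definition coprod_inl ::
    "('c, 'a) cprop \<Rightarrow> ('c, 'b) cprop \<Rightarrow> 'a \<Rightarrow> ('c, 'a + 'b) pterm set" where
  "coprod_inl P Q f = pcls (coprod_sig P Q) (coprod_eqs P Q) (TGen (Inl f))"

definition coprod_inr ::
    "('c, 'a) cprop \<Rightarrow> ('c, 'b) cprop \<Rightarrow> 'b \<Rightarrow> ('c, 'a + 'b) pterm set" where
  "coprod_inr P Q g = pcls (coprod_sig P Q) (coprod_eqs P Q) (TGen (Inr g))"

definition copair ::
    "('c, 'x) cprop \<Rightarrow> ('a \<Rightarrow> 'x) \<Rightarrow> ('b \<Rightarrow> 'x) \<Rightarrow> ('c, 'a + 'b) pterm set \<Rightarrow> 'x" where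
  "copair R F G = presented_ext R (case_sum F G)"

subsection \<open>Universal properties\<close>

lemma wt_words:
  "wf_signature S \<Longrightarrow> wt S t \<Longrightarrow> tdom S t \<in> lists (colours S) \<and> tcod S t \<in> lists (colours S)"
  by (induction t) (auto simp: wf_signature_def)

lemma peq_wt:
  assumes "wf_signature S" "peq S E s t"
  shows "wt S s \<and> wt S t \<and> tdom S s = tdom S t \<and> tcod S s = tcod S t"
  using assms(2)
proof induction
qed (use wt_words[OF assms(1)] in \<open>auto\<close>)

lemma pcls_eq_iff:
  assumes "wf_signature S" "wt S s"
  shows "pcls S E s = pcls S E t \<longleftrightarrow> peq S E s t"
proof
  assume "pcls S E s = pcls S E t"
  then have "peq S E t s" using peq.refl[OF assms(2), of E] by (auto simp: pcls_def)
  then show "peq S E s t" by (rule peq.symm)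
next
  assume "peq S E s t"
  then show "pcls S E s = pcls S E t"
    unfolding pcls_def by (blast intro: peq.symm peq.trans)
qed

lemma pcls_eqI:
  "wf_signature S \<Longrightarrow> peq S E s t \<Longrightarrow> pcls S E s = pcls S E t"
  using pcls_eq_iff peq_wt by metis

lemma peq_rep:
  assumes "wt S t"
  shows "peq S E t (rep (pcls S E t))"
proof -
  have "t \<in> pcls S E t" using peq.refl[OF assms, of E] by (simp add: pcls_def)
  then have "rep (pcls S E t) \<in> pcls S E t" unfolding rep_def by (rule someI)
  then show ?thesis by (simp add: pcls_def)
qed

lemma pcls_wt:
  assumes "wf_signature S" "wt S t"
  shows "pcls S E t \<in> Arr (presented_prop S E) (tdom S t) (tcod S t)"
  using peq_wt[OF assms(1) peq_rep[OF assms(2), of E]] assms(2)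
  by (auto simp: Arr_def presented_prop_def)

lemma presented_arrE:
  assumes "wf_signature S" "X \<in> Arr (presented_prop S E) w v"
  obtains t where "wt S t" "X = pcls S E t" "tdom S t = w" "tcod S t = v"
proof -
  from assms(2) obtain t where t: "wt S t" "X = pcls S E t"
    by (auto simp: Arr_def presented_prop_def)
  with pcls_wt[OF assms(1) t(1), of E] assms(2) show ?thesis
    by (intro that) (auto simp: Arr_def)
qed

lemma pcls_comp:
  assumes "wf_signature S" "wt S (TSeq s t)"
  shows "pcomp (presented_prop S E) (pcls S E s) (pcls S E t) = pcls S E (TSeq s t)"
proof -
  have "peq S E (TSeq s t) (TSeq (rep (pcls S E s)) (rep (pcls S E t)))"
    using assms by (intro peq.seq_cong peq_rep) auto
  then show ?thesis using pcls_eqI[OF assms(1), of E] by (simp add: presented_prop_def)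
qed

lemma pcls_tensor:
  assumes "wf_signature S" "wt S s" "wt S t"
  shows "ptensor (presented_prop S E) (pcls S E s) (pcls S E t) = pcls S E (TPar s t)"
proof -
  have "peq S E (TPar s t) (TPar (rep (pcls S E s)) (rep (pcls S E t)))"
    using assms by (intro peq.par_cong peq_rep) auto
  moreover have "wt S (TPar s t)" using assms by simp
  ultimately show ?thesis using pcls_eqI[OF assms(1), of E] by (simp add: presented_prop_def)
qed

lemma pcls_id: "pid (presented_prop S E) w = pcls S E (TId w)"
  and pcls_sym: "psym (presented_prop S E) w v = pcls S E (TSym w v)"
  and pcolours_presented: "pcolours (presented_prop S E) = colours S"
  by (simp_all add: presented_prop_def)

lemma presented_coloured_prop:
  assumes S: "wf_signature S"
  shows "coloured_prop (presented_prop S E)" (is "coloured_prop ?P")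
proof
  note [elim!] = presented_arrE[OF S]
  note [simp] = pcls_comp[OF S] pcls_tensor[OF S] pcls_id pcls_sym pcolours_presented
  note words = wt_words[OF S]
  show "w \<in> lists (pcolours ?P) \<and> v \<in> lists (pcolours ?P)" if "f \<in> Arr ?P w v" for f w v
    using that words by auto
  show "pid ?P w \<in> Arr ?P w w" if "w \<in> lists (pcolours ?P)" for w
    using pcls_wt[OF S, of "TId w" E] that by simp
  show "psym ?P w v \<in> Arr ?P (w @ v) (v @ w)"
    if "w \<in> lists (pcolours ?P)" "v \<in> lists (pcolours ?P)" for w v
    using pcls_wt[OF S, of "TSym w v" E] that by simp
  show "pcomp ?P f g \<in> Arr ?P u w" if "f \<in> Arr ?P u v" "g \<in> Arr ?P v w" for f g u v w
  proof -
    from that obtain s t where "wt S s" "f = pcls S E s" "tdom S s = u" "tcod S s = v"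
      "wt S t" "g = pcls S E t" "tdom S t = v" "tcod S t = w" by auto
    then show ?thesis using pcls_wt[OF S, of "TSeq s t" E] by simp
  qed
  show "ptensor ?P f g \<in> Arr ?P (u @ u') (v @ v')"
    if "f \<in> Arr ?P u v" "g \<in> Arr ?P u' v'" for f g u v u' v'
  proof -
    from that obtain s t where "wt S s" "f = pcls S E s" "tdom S s = u" "tcod S s = v"
      "wt S t" "g = pcls S E t" "tdom S t = u'" "tcod S t = v'" by auto
    then show ?thesis using pcls_wt[OF S, of "TPar s t" E] by simp
  qed
  show "pcomp ?P (pid ?P u) f = f" if "f \<in> Arr ?P u v" for f u v
    using that by (elim presented_arrE[OF S])
      (clarsimp simp: words, intro pcls_eqI[OF S] peq.id_seq; simp)
  show "pcomp ?P f (pid ?P v) = f" if "f \<in> Arr ?P u v" for f u v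
    using that by (elim presented_arrE[OF S])
      (clarsimp simp: words, intro pcls_eqI[OF S] peq.seq_id; simp)
  show "pcomp ?P (pcomp ?P f g) h = pcomp ?P f (pcomp ?P g h)"
    if "f \<in> Arr ?P u v" "g \<in> Arr ?P v w" "h \<in> Arr ?P w x" for f g h u v w x
    using that by (elim presented_arrE[OF S])
      (clarsimp simp: words, intro pcls_eqI[OF S] peq.seq_assoc; simp)
  show "ptensor ?P (pid ?P []) f = f" if "f \<in> Arr ?P u v" for f u v
    using that by (elim presented_arrE[OF S])
      (clarsimp simp: words, intro pcls_eqI[OF S] peq.unit_par; simp)
  show "ptensor ?P f (pid ?P []) = f" if "f \<in> Arr ?P u v" for f u v
    using that by (elim presented_arrE[OF S])
      (clarsimp simp: words, intro pcls_eqI[OF S] peq.par_unit; simp)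
  show "ptensor ?P (ptensor ?P f g) h = ptensor ?P f (ptensor ?P g h)"
    if "f \<in> Arr ?P u v" "g \<in> Arr ?P u' v'" "h \<in> Arr ?P u'' v''" for f g h u v u' v' u'' v''
    using that by (elim presented_arrE[OF S])
      (clarsimp simp: words, intro pcls_eqI[OF S] peq.par_assoc; simp)
  show "ptensor ?P (pid ?P w) (pid ?P v) = pid ?P (w @ v)"
    if "w \<in> lists (pcolours ?P)" "v \<in> lists (pcolours ?P)" for w v
    using pcls_eqI[OF S peq.par_id[of w S v E]] that by simp
  show "ptensor ?P (pcomp ?P f g) (pcomp ?P f' g') = pcomp ?P (ptensor ?P f f') (ptensor ?P g g')"
    if "f \<in> Arr ?P u v" "g \<in> Arr ?P v w" "f' \<in> Arr ?P u' v'" "g' \<in> Arr ?P v' w'"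
    for f g f' g' u v w u' v' w'
    using that by (elim presented_arrE[OF S])
      (clarsimp simp: words, intro pcls_eqI[OF S] peq.interchange; simp)
  show "pcomp ?P (ptensor ?P f g) (psym ?P v v') = pcomp ?P (psym ?P u u') (ptensor ?P g f)"
    if "f \<in> Arr ?P u v" "g \<in> Arr ?P u' v'" for f g u v u' v'
    using that by (elim presented_arrE[OF S])
      (clarsimp simp: words, intro pcls_eqI[OF S] peq.sym_natural; simp)
  show "pcomp ?P (psym ?P w v) (psym ?P v w) = pid ?P (w @ v)"
    if "w \<in> lists (pcolours ?P)" "v \<in> lists (pcolours ?P)" for w v
    using pcls_eqI[OF S peq.sym_inverse[of w S v E]] that by simp
  show "psym ?P u (v @ w) = pcomp ?P (ptensor ?P (psym ?P u v) (pid ?P w))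
      (ptensor ?P (pid ?P v) (psym ?P u w))"
    if "u \<in> lists (pcolours ?P)" "v \<in> lists (pcolours ?P)" "w \<in> lists (pcolours ?P)" for u v w
    using pcls_eqI[OF S peq.sym_hexagon[of u S v w E]] that by simp
qed

definition interpretation_of ::
    "('c, 'g) signature \<Rightarrow> ('c, 'g) pequations \<Rightarrow> ('c, 'a) cprop \<Rightarrow> ('g \<Rightarrow> 'a) \<Rightarrow> bool" where
  "interpretation_of S E R h \<longleftrightarrow>
     colours S = pcolours R \<and>
     (\<forall>g\<in>ops S. h g \<in> Arr R (arity S g) (coarity S g)) \<and>
     (\<forall>(s, t)\<in>E. wt S s \<and> wt S t \<and> tdom S s = tdom S t \<and> tcod S s = tcod S t
        \<longrightarrow> teval R h s = teval R h t)"

lemma teval_arr: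
  assumes "coloured_prop R" "interpretation_of S E R h"
  shows "wt S t \<Longrightarrow> teval R h t \<in> Arr R (tdom S t) (tcod S t)"
proof -
  interpret coloured_prop R by fact
  show "wt S t \<Longrightarrow> teval R h t \<in> Arr R (tdom S t) (tcod S t)"
    using assms(2) by (induction t)
      (auto simp: interpretation_of_def intro: id_arr sym_arr comp_arr tensor_arr)
qed

lemma teval_peq:
  assumes "coloured_prop R" "wf_signature S" "interpretation_of S E R h" "peq S E s t"
  shows "teval R h s = teval R h t"
proof -
  interpret coloured_prop R by fact
  note A = teval_arr[OF assms(1,3)]
  have C: "colours S = pcolours R" using assms(3) by (simp add: interpretation_of_def)
  show ?thesis using assms(4)
  proof induction
    case (equation s t)
    then show ?case using assms(3) by (auto simp: interpretation_of_def)
  next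
    case (id_seq t)
    then show ?case using id_comp[OF A] by simp
  next
    case (seq_id t)
    then show ?case using comp_id[OF A] by simp
  next
    case (seq_assoc s t u)
    then have "teval R h s \<in> Arr R (tdom S s) (tdom S t)" "teval R h t \<in> Arr R (tdom S t) (tdom S u)"
      "teval R h u \<in> Arr R (tdom S u) (tcod S u)"
      using A[of s] A[of t] A[of u] by auto
    then show ?case by (simp add: comp_assoc)
  next
    case (unit_par t)
    then show ?case using unit_tensor[OF A] by simp
  next
    case (par_unit t)
    then show ?case using tensor_unit[OF A] by simp
  next
    case (par_assoc s t u)
    then show ?case using A[of s] A[of t] A[of u] by (simp add: tensor_assoc)
  next
    case (par_id w v)
    then show ?case
      using coloured_prop.tensor_id[OF assms(1)] C by simp
  next
    case (interchange s t s' t')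
    then have "teval R h s \<in> Arr R (tdom S s) (tdom S t)" "teval R h t \<in> Arr R (tdom S t) (tcod S t)"
      "teval R h s' \<in> Arr R (tdom S s') (tdom S t')" "teval R h t' \<in> Arr R (tdom S t') (tcod S t')"
      using A[of s] A[of t] A[of s'] A[of t'] by auto
    then show ?case by (simp add: coloured_prop.interchange[OF assms(1)])
  next
    case (sym_natural s t)
    then show ?case using coloured_prop.sym_natural[OF assms(1) A A] by simp
  next
    case (sym_inverse w v)
    then show ?case
      using coloured_prop.sym_inverse[OF assms(1)] C by simp
  next
    case (sym_hexagon u v w)
    then show ?case
      using coloured_prop.sym_hexagon[OF assms(1)] C by simp
  qed simp_all
qed

lemma presented_ext_pcls:
  assumes "coloured_prop R" "wf_signature S" "interpretation_of S E R h" "wt S t"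
  shows "presented_ext R h (pcls S E t) = teval R h t"
  unfolding presented_ext_def
  using teval_peq[OF assms(1-3) peq_rep[OF assms(4)]] by simp

lemma presented_ext_morphism:
  assumes R: "coloured_prop R" and S: "wf_signature S" and h: "interpretation_of S E R h"
  shows "prop_morphism (presented_prop S E) R (presented_ext R h)"
proof -
  let ?P = "presented_prop S E" and ?F = "presented_ext R h"
  note [simp] = pcls_comp[OF S] pcls_tensor[OF S] pcls_id pcls_sym pcolours_presented
    presented_ext_pcls[OF R S h]
  have "colours S = pcolours R" using h by (simp add: interpretation_of_def)
  moreover have "?F f \<in> Arr R w v" if "f \<in> Arr ?P w v" for f w v
    using teval_arr[OF R h] presented_arrE[OF S that] by force
  moreover have "?F (pcomp ?P f g) = pcomp R (?F f) (?F g)"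
    if f: "f \<in> Arr ?P u v" and g: "g \<in> Arr ?P v w" for f g u v w
  proof -
    from f g obtain s t where "wt S s" "f = pcls S E s" "tcod S s = v"
      "wt S t" "g = pcls S E t" "tdom S t = v" by (elim presented_arrE[OF S]) blast
    then show ?thesis by simp
  qed
  moreover have "?F (ptensor ?P f g) = ptensor R (?F f) (?F g)"
    if "f \<in> arrows ?P" "g \<in> arrows ?P" for f g
  proof -
    from that obtain s t where "wt S s" "f = pcls S E s" "wt S t" "g = pcls S E t"
      by (auto simp: presented_prop_def)
    then show ?thesis by simp
  qed
  ultimately show ?thesis by (simp add: prop_morphism_def)
qed

lemma presented_ext_unique:
  assumes R: "coloured_prop R" and S: "wf_signature S" and h: "interpretation_of S E R h"
    and F: "prop_morphism (presented_prop S E) R F"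
    and Fh: "\<And>g. g \<in> ops S \<Longrightarrow> F (pcls S E (TGen g)) = h g"
    and X: "X \<in> arrows (presented_prop S E)"
  shows "F X = presented_ext R h X"
proof -
  have C: "pcolours (presented_prop S E) = colours S" by (rule pcolours_presented)
  have *: "wt S t \<Longrightarrow> F (pcls S E t) = teval R h t" for t
  proof (induction t)
    case (TSeq s t)
    then have "F (pcomp (presented_prop S E) (pcls S E s) (pcls S E t)) =
        pcomp R (F (pcls S E s)) (F (pcls S E t))"
      using F pcls_wt[OF S, of s E] pcls_wt[OF S, of t E] unfolding prop_morphism_def by auto
    with TSeq pcls_comp[OF S, of s t E] show ?case by simp
  next
    case (TPar s t)
    then have "F (ptensor (presented_prop S E) (pcls S E s) (pcls S E t)) =
        ptensor R (F (pcls S E s)) (F (pcls S E t))"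
      using F pcls_wt[OF S, of s E] pcls_wt[OF S, of t E]
      unfolding prop_morphism_def by (auto simp: Arr_def)
    with TPar pcls_tensor[OF S, of s t E] show ?case by simp
  qed (use F Fh in \<open>auto simp: prop_morphism_def C pcls_id pcls_sym\<close>)
  from X obtain t where "wt S t" "X = pcls S E t" by (auto simp: presented_prop_def)
  with * presented_ext_pcls[OF R S h] show ?thesis by simp
qed

lemma wf_coprod_sig:
  assumes "coloured_prop P" "coloured_prop Q" "pcolours P = pcolours Q"
  shows "wf_signature (coprod_sig P Q)"
proof -
  have "pdom P f \<in> lists (pcolours P) \<and> pcod P f \<in> lists (pcolours P)" if "f \<in> arrows P" for f
    using coloured_prop.arr_words[OF assms(1), of f] that by (simp add: Arr_def)
  moreover have "pdom Q f \<in> lists (pcolours P) \<and> pcod Q f \<in> lists (pcolours P)"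
    if "f \<in> arrows Q" for f
    using coloured_prop.arr_words[OF assms(2), of f] assms(3) that by (simp add: Arr_def)
  ultimately show ?thesis by (fastforce simp: wf_signature_def coprod_sig_def)
qed

lemma incl_morphism:
  assumes P: "coloured_prop P" and S: "wf_signature S" and C: "pcolours P = colours S"
    and i: "\<And>f. f \<in> arrows P \<Longrightarrow>
      i f \<in> ops S \<and> arity S (i f) = pdom P f \<and> coarity S (i f) = pcod P f"
    and E: "incl_eqs P i \<subseteq> E"
  shows "prop_morphism P (presented_prop S E) (\<lambda>f. pcls S E (TGen (i f)))"
proof -
  interpret P: coloured_prop P by fact
  have wt: "wt S (TGen (i f))" "tdom S (TGen (i f)) = pdom P f" "tcod S (TGen (i f)) = pcod P f"
    if "f \<in> arrows P" for f using i[OF that] by auto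
  have eq: "pcls S E s = pcls S E t"
    if "(s, t) \<in> incl_eqs P i" "wt S s" "wt S t" "tdom S s = tdom S t" "tcod S s = tcod S t" for s t
    using that E by (intro pcls_eqI[OF S] peq.equation) auto
  have "pcls S E (TGen (i f)) \<in> Arr (presented_prop S E) w v" if "f \<in> Arr P w v" for f w v
    using pcls_wt[OF S wt(1), of f E] that wt[of f] by (simp add: Arr_def)
  moreover have "pcls S E (TGen (i (pid P w))) = pid (presented_prop S E) w"
    if "w \<in> lists (pcolours P)" for w
    unfolding pcls_id using P.id_arr[OF that] that C wt
    by (intro eq) (auto simp: incl_eqs_def Arr_def)
  moreover have "pcls S E (TGen (i (psym P w v))) = psym (presented_prop S E) w v"
    if "w \<in> lists (pcolours P)" "v \<in> lists (pcolours P)" for w v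
    unfolding pcls_sym using P.sym_arr[OF that] that C wt
    by (intro eq) (auto simp: incl_eqs_def Arr_def)
  moreover have "pcls S E (TGen (i (pcomp P f g))) =
      pcomp (presented_prop S E) (pcls S E (TGen (i f))) (pcls S E (TGen (i g)))"
    if "f \<in> Arr P u v" "g \<in> Arr P v w" for f g u v w
  proof -
    have fg: "f \<in> arrows P" "g \<in> arrows P" "pcod P f = pdom P g" "pdom P f = u" "pcod P g = w"
      using that by (auto simp: Arr_def)
    have c: "pcomp P f g \<in> arrows P" "pdom P (pcomp P f g) = u" "pcod P (pcomp P f g) = w"
      using P.comp_arr[OF that] by (auto simp: Arr_def)
    have w: "wt S (TSeq (TGen (i f)) (TGen (i g)))" using fg wt by simp
    show ?thesis unfolding pcls_comp[OF S w]
    proof (rule eq[OF _ wt(1)[OF c(1)] w])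
      show "(TGen (i (pcomp P f g)), TSeq (TGen (i f)) (TGen (i g))) \<in> incl_eqs P i"
        using fg by (auto simp: incl_eqs_def)
    qed (use fg c wt in simp_all)
  qed
  moreover have "pcls S E (TGen (i (ptensor P f g))) =
      ptensor (presented_prop S E) (pcls S E (TGen (i f))) (pcls S E (TGen (i g)))"
    if fg: "f \<in> arrows P" "g \<in> arrows P" for f g
  proof -
    have "f \<in> Arr P (pdom P f) (pcod P f)" "g \<in> Arr P (pdom P g) (pcod P g)"
      using fg by (auto simp: Arr_def)
    from P.tensor_arr[OF this] have c: "ptensor P f g \<in> arrows P"
      "pdom P (ptensor P f g) = pdom P f @ pdom P g" "pcod P (ptensor P f g) = pcod P f @ pcod P g"
      by (auto simp: Arr_def)
    have w: "wt S (TPar (TGen (i f)) (TGen (i g)))" using fg wt by simp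
    show ?thesis unfolding pcls_tensor[OF S wt(1)[OF fg(1)] wt(1)[OF fg(2)]]
    proof (rule eq[OF _ wt(1)[OF c(1)] w])
      show "(TGen (i (ptensor P f g)), TPar (TGen (i f)) (TGen (i g))) \<in> incl_eqs P i"
        using fg by (auto simp: incl_eqs_def)
    qed (use fg c wt in simp_all)
  qed
  ultimately show ?thesis unfolding prop_morphism_def using C by (auto simp: pcolours_presented)
qed

lemma coprod_inclusions:
  assumes P: "coloured_prop P" and Q: "coloured_prop Q" and C: "pcolours P = pcolours Q"
  shows "prop_morphism P (coprod_prop P Q) (coprod_inl P Q)"
    and "prop_morphism Q (coprod_prop P Q) (coprod_inr P Q)"
proof -
  note S = wf_coprod_sig[OF assms]
  show "prop_morphism P (coprod_prop P Q) (coprod_inl P Q)"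
    unfolding coprod_prop_def coprod_inl_def[abs_def]
    by (rule incl_morphism[OF P S]) (auto simp: coprod_sig_def coprod_eqs_def)
  show "prop_morphism Q (coprod_prop P Q) (coprod_inr P Q)"
    unfolding coprod_prop_def coprod_inr_def[abs_def]
    by (rule incl_morphism[OF Q S]) (auto simp: coprod_sig_def coprod_eqs_def C)
qed

lemma coprod_interpretation:
  assumes F: "prop_morphism P R F" and G: "prop_morphism Q R G"
  shows "interpretation_of (coprod_sig P Q) (coprod_eqs P Q) R (case_sum F G)"
  using assms unfolding interpretation_of_def prop_morphism_def coprod_eqs_def incl_eqs_def
  by (auto simp: coprod_sig_def Arr_def)

theorem coprod_universal:
  assumes P: "coloured_prop P" and Q: "coloured_prop Q" and R: "coloured_prop R"
    and F: "prop_morphism P R F" and G: "prop_morphism Q R G"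
  shows "coloured_prop (coprod_prop P Q)"
    and "prop_morphism P (coprod_prop P Q) (coprod_inl P Q)"
    and "prop_morphism Q (coprod_prop P Q) (coprod_inr P Q)"
    and "prop_morphism (coprod_prop P Q) R (copair R F G)"
    and "\<And>f. f \<in> arrows P \<Longrightarrow> copair R F G (coprod_inl P Q f) = F f"
    and "\<And>g. g \<in> arrows Q \<Longrightarrow> copair R F G (coprod_inr P Q g) = G g"
    and "\<And>H X. \<lbrakk>prop_morphism (coprod_prop P Q) R H;
          \<And>f. f \<in> arrows P \<Longrightarrow> H (coprod_inl P Q f) = F f;
          \<And>g. g \<in> arrows Q \<Longrightarrow> H (coprod_inr P Q g) = G g;
          X \<in> arrows (coprod_prop P Q)\<rbrakk> \<Longrightarrow> H X = copair R F G X"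
proof -
  have C: "pcolours P = pcolours Q" using F G by (simp add: prop_morphism_def)
  note S = wf_coprod_sig[OF P Q C]
  note I = coprod_interpretation[OF F G]
  show "coloured_prop (coprod_prop P Q)"
    unfolding coprod_prop_def by (rule presented_coloured_prop[OF S])
  show "prop_morphism P (coprod_prop P Q) (coprod_inl P Q)"
    by (rule coprod_inclusions[OF P Q C])
  show "prop_morphism Q (coprod_prop P Q) (coprod_inr P Q)"
    by (rule coprod_inclusions[OF P Q C])
  show "prop_morphism (coprod_prop P Q) R (copair R F G)"
    unfolding coprod_prop_def copair_def by (rule presented_ext_morphism[OF R S I])
  show "copair R F G (coprod_inl P Q f) = F f" if "f \<in> arrows P" for f
    using presented_ext_pcls[OF R S I, of "TGen (Inl f)"] that
    unfolding copair_def coprod_inl_def by (simp add: coprod_sig_def[of P Q] InlI)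
  show "copair R F G (coprod_inr P Q g) = G g" if "g \<in> arrows Q" for g
    using presented_ext_pcls[OF R S I, of "TGen (Inr g)"] that
    unfolding copair_def coprod_inr_def by (simp add: coprod_sig_def[of P Q] InrI)
  show "H X = copair R F G X"
    if H: "prop_morphism (coprod_prop P Q) R H"
      and l: "\<And>f. f \<in> arrows P \<Longrightarrow> H (coprod_inl P Q f) = F f"
      and r: "\<And>g. g \<in> arrows Q \<Longrightarrow> H (coprod_inr P Q g) = G g"
      and X: "X \<in> arrows (coprod_prop P Q)" for H X
    unfolding copair_def
  proof (rule presented_ext_unique[OF R S I])
    show "prop_morphism (presented_prop (coprod_sig P Q) (coprod_eqs P Q)) R H"
      using H by (simp add: coprod_prop_def)
    show "X \<in> arrows (presented_prop (coprod_sig P Q) (coprod_eqs P Q))"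
      using X by (simp add: coprod_prop_def)
    show "H (pcls (coprod_sig P Q) (coprod_eqs P Q) (TGen g)) = case_sum F G g"
      if "g \<in> ops (coprod_sig P Q)" for g
      using that l r by (auto simp: coprod_sig_def coprod_inl_def coprod_inr_def)
  qed
qed

section \<open>The prop of Frobenius structures and folding\<close>

datatype 'c frob_op = Mu 'c | Eta 'c | Delta 'c | Eps 'c

definition frob_sig :: "'c set \<Rightarrow> ('c, 'c frob_op) signature" where
  "frob_sig C =
    \<lparr> colours = C,
      ops = Mu ` C \<union> Eta ` C \<union> Delta ` C \<union> Eps ` C,
      arity = (\<lambda>g. case g of Mu c \<Rightarrow> [c, c] | Eta c \<Rightarrow> [] | Delta c \<Rightarrow> [c] | Eps c \<Rightarrow> [c]),
      coarity = (\<lambda>g. case g of Mu c \<Rightarrow> [c] | Eta c \<Rightarrow> [c] | Delta c \<Rightarrow> [c, c] | Eps c \<Rightarrow> []) \<rparr>"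

definition frob_eqs :: "'c set \<Rightarrow> ('c, 'c frob_op) pequations" where
  "frob_eqs C = (\<Union>c\<in>C.
    let mu = TGen (Mu c); eta = TGen (Eta c); delta = TGen (Delta c); eps = TGen (Eps c);
        i = TId [c]; s = TSym [c] [c]
    in { (TSeq (TPar mu i) mu, TSeq (TPar i mu) mu),
         (TSeq (TPar eta i) mu, i),
         (TSeq (TPar i eta) mu, i),
         (TSeq s mu, mu),
         (TSeq delta (TPar delta i), TSeq delta (TPar i delta)),
         (TSeq delta (TPar eps i), i),
         (TSeq delta (TPar i eps), i),
         (TSeq delta s, delta),
         (TSeq (TPar delta i) (TPar i mu), TSeq mu delta),
         (TSeq (TPar i delta) (TPar mu i), TSeq mu delta),
         (TSeq delta mu, i) })"

definition Frob :: "'c set \<Rightarrow> ('c, ('c, 'c frob_op) pterm set) cprop" where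
  "Frob C = presented_prop (frob_sig C) (frob_eqs C)"

type_synonym ('c, 'o) SFrob_arrow =
  "('c, ('c, 'o) pterm set + ('c, 'c frob_op) pterm set) pterm set"

definition SFrob :: "('c, 'o) signature \<Rightarrow> ('c, ('c, 'o) SFrob_arrow) cprop" where
  "SFrob T = coprod_prop (free_prop T) (Frob (colours T))"

definition frob_arrow :: "('c, 'o) signature \<Rightarrow> 'c frob_op \<Rightarrow> ('c, 'o) SFrob_arrow" where
  "frob_arrow T g = coprod_inr (free_prop T) (Frob (colours T))
     (pcls (frob_sig (colours T)) (frob_eqs (colours T)) (TGen g))"

primrec eta_word :: "('c, 'o) signature \<Rightarrow> 'c list \<Rightarrow> ('c, 'o) SFrob_arrow" where
  "eta_word T [] = pid (SFrob T) []"
| "eta_word T (c # w) = ptensor (SFrob T) (frob_arrow T (Eta c)) (eta_word T w)"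

primrec delta_word :: "('c, 'o) signature \<Rightarrow> 'c list \<Rightarrow> ('c, 'o) SFrob_arrow" where
  "delta_word T [] = pid (SFrob T) []"
| "delta_word T (c # w) =
    pcomp (SFrob T)
      (ptensor (SFrob T) (frob_arrow T (Delta c)) (delta_word T w))
      (ptensor (SFrob T) (pid (SFrob T) [c])
        (ptensor (SFrob T) (psym (SFrob T) [c] w) (pid (SFrob T) w)))"

definition fold_arrow :: "('c, 'o) signature \<Rightarrow> ('c, 'o) SFrob_arrow \<Rightarrow> ('c, 'o) SFrob_arrow" where
  "fold_arrow T a =
    (let w = pdom (SFrob T) a in
      pcomp (SFrob T)
        (pcomp (SFrob T) (eta_word T w) (delta_word T w))
        (ptensor (SFrob T) (pid (SFrob T) w) a))"

definition syn_rewrites :: "('c, 'a) cprop \<Rightarrow> 'a \<times> 'a \<Rightarrow> 'a \<Rightarrow> 'a \<Rightarrow> bool" where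
  "syn_rewrites P rule a b \<longleftrightarrow> (case rule of (l, r) \<Rightarrow>
     \<exists>u\<in>lists (pcolours P).
     \<exists>a1\<in>Arr P (pdom P a) (pdom P l @ u).
     \<exists>a2\<in>Arr P (pcod P l @ u) (pcod P a).
       a = pcomp P (pcomp P a1 (ptensor P l (pid P u))) a2 \<and>
       b = pcomp P (pcomp P a1 (ptensor P r (pid P u))) a2)"

section \<open>Hypergraphs\<close>

text \<open>Finite hypergraphs only matter up to isomorphism, so nodes and hyperedges are taken to be
  natural numbers. The values of the labelling and attachment functions outside \<open>nodes\<close> and
  \<open>edges\<close> are irrelevant; accordingly, maps are compared on the domain hypergraph only.\<close>

record ('c, 'o) hypergraph =
  nodes :: "nat set"
  edges :: "nat set"
  nlabel :: "nat \<Rightarrow> 'c"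
  elabel :: "nat \<Rightarrow> 'o"
  sources :: "nat \<Rightarrow> nat list"
  targets :: "nat \<Rightarrow> nat list"

definition Hyp :: "('c, 'o) signature \<Rightarrow> ('c, 'o) hypergraph set" where
  "Hyp T = {G. finite (nodes G) \<and> finite (edges G) \<and>
     (\<forall>n\<in>nodes G. nlabel G n \<in> colours T) \<and>
     (\<forall>e\<in>edges G. elabel G e \<in> ops T \<and>
        set (sources G e) \<subseteq> nodes G \<and> set (targets G e) \<subseteq> nodes G \<and>
        map (nlabel G) (sources G e) = arity T (elabel G e) \<and>
        map (nlabel G) (targets G e) = coarity T (elabel G e))}"

record hmap =
  nmap :: "nat \<Rightarrow> nat"
  emap :: "nat \<Rightarrow> nat"

definition hyp_hom :: "('c, 'o) hypergraph \<Rightarrow> ('c, 'o) hypergraph \<Rightarrow> hmap set" where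
  "hyp_hom G H = {f.
     nmap f ` nodes G \<subseteq> nodes H \<and> emap f ` edges G \<subseteq> edges H \<and>
     (\<forall>n\<in>nodes G. nlabel H (nmap f n) = nlabel G n) \<and>
     (\<forall>e\<in>edges G. elabel H (emap f e) = elabel G e \<and>
        sources H (emap f e) = map (nmap f) (sources G e) \<and>
        targets H (emap f e) = map (nmap f) (targets G e))}"

definition hid :: hmap where
  "hid = \<lparr> nmap = id, emap = id \<rparr>"

definition hcomp :: "hmap \<Rightarrow> hmap \<Rightarrow> hmap" where
  "hcomp f g = \<lparr> nmap = nmap g \<circ> nmap f, emap = emap g \<circ> emap f \<rparr>"

definition heq :: "('c, 'o) hypergraph \<Rightarrow> hmap \<Rightarrow> hmap \<Rightarrow> bool" where
  "heq G f g \<longleftrightarrow> (\<forall>n\<in>nodes G. nmap f n = nmap g n) \<and> (\<forall>e\<in>edges G. emap f e = emap g e)"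

definition hyp_iso :: "('c, 'o) hypergraph \<Rightarrow> ('c, 'o) hypergraph \<Rightarrow> hmap set" where
  "hyp_iso G H = {f \<in> hyp_hom G H.
     bij_betw (nmap f) (nodes G) (nodes H) \<and> bij_betw (emap f) (edges G) (edges H)}"

text \<open>\<open>pushout T J L K G j k p q\<close>: the square \<open>J \<rightarrow> L \<rightarrow> G\<close> / \<open>J \<rightarrow> K \<rightarrow> G\<close> with maps
  \<open>j : J \<rightarrow> L\<close>, \<open>k : J \<rightarrow> K\<close>, \<open>p : L \<rightarrow> G\<close>, \<open>q : K \<rightarrow> G\<close> is a pushout.\<close>

definition pushout :: "('c, 'o) signature \<Rightarrow> ('c, 'o) hypergraph \<Rightarrow> ('c, 'o) hypergraph \<Rightarrow>
    ('c, 'o) hypergraph \<Rightarrow> ('c, 'o) hypergraph \<Rightarrow> hmap \<Rightarrow> hmap \<Rightarrow> hmap \<Rightarrow> hmap \<Rightarrow> bool" where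
  "pushout T J L K G j k p q \<longleftrightarrow>
     J \<in> Hyp T \<and> L \<in> Hyp T \<and> K \<in> Hyp T \<and> G \<in> Hyp T \<and>
     j \<in> hyp_hom J L \<and> k \<in> hyp_hom J K \<and> p \<in> hyp_hom L G \<and> q \<in> hyp_hom K G \<and>
     heq J (hcomp j p) (hcomp k q) \<and>
     (\<forall>X\<in>Hyp T. \<forall>p'\<in>hyp_hom L X. \<forall>q'\<in>hyp_hom K X. heq J (hcomp j p') (hcomp k q') \<longrightarrow>
        (\<exists>h\<in>hyp_hom G X. heq L (hcomp p h) p' \<and> heq K (hcomp q h) q' \<and>
           (\<forall>h'\<in>hyp_hom G X. heq L (hcomp p h') p' \<and> heq K (hcomp q h') q' \<longrightarrow> heq G h' h)))"

definition discrete :: "'c list \<Rightarrow> ('c, 'o) hypergraph" where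
  "discrete w = \<lparr> nodes = {..<length w}, edges = {}, nlabel = (!) w,
     elabel = (\<lambda>_. undefined), sources = (\<lambda>_. []), targets = (\<lambda>_. []) \<rparr>"

definition hsum :: "('c, 'o) hypergraph \<Rightarrow> ('c, 'o) hypergraph \<Rightarrow> ('c, 'o) hypergraph" where
  "hsum G H =
    \<lparr> nodes = sum_encode ` (nodes G <+> nodes H),
      edges = sum_encode ` (edges G <+> edges H),
      nlabel = case_sum (nlabel G) (nlabel H) \<circ> sum_decode,
      elabel = case_sum (elabel G) (elabel H) \<circ> sum_decode,
      sources = case_sum (map (sum_encode \<circ> Inl) \<circ> sources G)
                         (map (sum_encode \<circ> Inr) \<circ> sources H) \<circ> sum_decode,
      targets = case_sum (map (sum_encode \<circ> Inl) \<circ> targets G)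
                         (map (sum_encode \<circ> Inr) \<circ> targets H) \<circ> sum_decode \<rparr>"

section \<open>Cospans with discrete interfaces\<close>

record ('c, 'o) cospan =
  csrc :: "'c list"
  ctgt :: "'c list"
  apex :: "('c, 'o) hypergraph"
  lleg :: hmap
  rleg :: hmap

definition Cospan :: "('c, 'o) signature \<Rightarrow> ('c, 'o) cospan set" where
  "Cospan T = {c. csrc c \<in> lists (colours T) \<and> ctgt c \<in> lists (colours T) \<and> apex c \<in> Hyp T \<and>
     lleg c \<in> hyp_hom (discrete (csrc c)) (apex c) \<and>
     rleg c \<in> hyp_hom (discrete (ctgt c)) (apex c)}"

definition cospan_iso :: "('c, 'o) cospan \<Rightarrow> ('c, 'o) cospan \<Rightarrow> bool" where
  "cospan_iso c d \<longleftrightarrow> csrc c = csrc d \<and> ctgt c = ctgt d \<and>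
     (\<exists>f\<in>hyp_iso (apex c) (apex d).
        heq (discrete (csrc c) :: ('c, 'o) hypergraph) (hcomp (lleg c) f) (lleg d) \<and>
        heq (discrete (ctgt c) :: ('c, 'o) hypergraph) (hcomp (rleg c) f) (rleg d))"

definition ccls :: "('c, 'o) signature \<Rightarrow> ('c, 'o) cospan \<Rightarrow> ('c, 'o) cospan set" where
  "ccls T c = {d \<in> Cospan T. cospan_iso c d}"

definition id_cospan :: "'c list \<Rightarrow> ('c, 'o) cospan" where
  "id_cospan w = \<lparr> csrc = w, ctgt = w, apex = discrete w, lleg = hid, rleg = hid \<rparr>"

definition sym_cospan :: "'c list \<Rightarrow> 'c list \<Rightarrow> ('c, 'o) cospan" where
  "sym_cospan w v = \<lparr> csrc = w @ v, ctgt = v @ w, apex = discrete (w @ v), lleg = hid,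
     rleg = \<lparr> nmap = (\<lambda>i. if i < length v then length w + i else i - length v), emap = id \<rparr> \<rparr>"

definition is_composite :: "('c, 'o) signature \<Rightarrow>
    ('c, 'o) cospan \<Rightarrow> ('c, 'o) cospan \<Rightarrow> ('c, 'o) cospan \<Rightarrow> bool" where
  "is_composite T c d e \<longleftrightarrow>
     ctgt c = csrc d \<and> csrc e = csrc c \<and> ctgt e = ctgt d \<and>
     (\<exists>p q. pushout T (discrete (ctgt c)) (apex c) (apex d) (apex e) (rleg c) (lleg d) p q \<and>
        heq (discrete (csrc c) :: ('c, 'o) hypergraph) (lleg e) (hcomp (lleg c) p) \<and>
        heq (discrete (ctgt d) :: ('c, 'o) hypergraph) (rleg e) (hcomp (rleg d) q))"

text \<open>The map \<open>w w' \<rightarrow> G + G'\<close> induced by \<open>f : w \<rightarrow> G\<close> and \<open>f' : w' \<rightarrow> G'\<close>, where \<open>k\<close> is the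
  length of \<open>w\<close>.\<close>

definition leg_sum :: "nat \<Rightarrow> hmap \<Rightarrow> hmap \<Rightarrow> hmap" where
  "leg_sum k f f' =
    \<lparr> nmap = (\<lambda>i. if i < k then sum_encode (Inl (nmap f i))
                   else sum_encode (Inr (nmap f' (i - k)))),
      emap = id \<rparr>"

definition cospan_sum :: "('c, 'o) cospan \<Rightarrow> ('c, 'o) cospan \<Rightarrow> ('c, 'o) cospan" where
  "cospan_sum c d =
    \<lparr> csrc = csrc c @ csrc d, ctgt = ctgt c @ ctgt d, apex = hsum (apex c) (apex d),
      lleg = leg_sum (length (csrc c)) (lleg c) (lleg d),
      rleg = leg_sum (length (ctgt c)) (rleg c) (rleg d) \<rparr>"

definition FTerm :: "('c, 'o) signature \<Rightarrow> ('c, ('c, 'o) cospan set) cprop" where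
  "FTerm T =
    \<lparr> pcolours = colours T,
      arrows = {ccls T c | c. c \<in> Cospan T},
      pdom = (\<lambda>A. csrc (rep A)),
      pcod = (\<lambda>A. ctgt (rep A)),
      pid = (\<lambda>w. ccls T (id_cospan w)),
      psym = (\<lambda>w v. ccls T (sym_cospan w v)),
      pcomp = (\<lambda>A B. {e \<in> Cospan T. is_composite T (rep A) (rep B) e}),
      ptensor = (\<lambda>A B. ccls T (cospan_sum (rep A) (rep B))) \<rparr>"

section \<open>The interpretation of string diagrams as cospans\<close>

definition op_cospan :: "('c, 'o) signature \<Rightarrow> 'o \<Rightarrow> ('c, 'o) cospan" where
  "op_cospan T f =
    (let m = length (arity T f); n = length (coarity T f) in
    \<lparr> csrc = arity T f, ctgt = coarity T f,
      apex = \<lparr> nodes = {..<m + n}, edges = {0}, nlabel = (!) (arity T f @ coarity T f),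
               elabel = (\<lambda>_. f), sources = (\<lambda>_. [0..<m]), targets = (\<lambda>_. [m..<m + n]) \<rparr>,
      lleg = hid,
      rleg = \<lparr> nmap = (\<lambda>i. m + i), emap = id \<rparr> \<rparr>)"

definition spider :: "'c list \<Rightarrow> 'c list \<Rightarrow> 'c \<Rightarrow> ('c, 'o) cospan" where
  "spider w v c = \<lparr> csrc = w, ctgt = v, apex = discrete [c],
     lleg = \<lparr> nmap = (\<lambda>_. 0), emap = id \<rparr>, rleg = \<lparr> nmap = (\<lambda>_. 0), emap = id \<rparr> \<rparr>"

definition frob_cospan :: "'c frob_op \<Rightarrow> ('c, 'o) cospan" where
  "frob_cospan g = (case g of
       Mu c \<Rightarrow> spider [c, c] [c] c
     | Eta c \<Rightarrow> spider [] [c] c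
     | Delta c \<Rightarrow> spider [c] [c, c] c
     | Eps c \<Rightarrow> spider [c] [] c)"

definition sem :: "('c, 'o) signature \<Rightarrow> ('c, 'o) SFrob_arrow \<Rightarrow> ('c, 'o) cospan set" where
  "sem T = copair (FTerm T)
     (presented_ext (FTerm T) (\<lambda>f. ccls T (op_cospan T f)))
     (presented_ext (FTerm T) (\<lambda>g. ccls T (frob_cospan g)))"

section \<open>Double-pushout rewriting with interfaces\<close>

text \<open>A rule \<open>(L, j, J, j', R)\<close> stands for the span of \<open>j : J \<rightarrow> L\<close> and \<open>j' : J \<rightarrow> R\<close>;
  \<open>dpoi_step\<close> relates \<open>0 \<rightarrow> G \<leftarrow> I\<close> to \<open>0 \<rightarrow> H \<leftarrow> I\<close> with interface maps \<open>i\<close> and \<open>i'\<close>.\<close>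

type_synonym ('c, 'o) hyp_span =
  "('c, 'o) hypergraph \<times> hmap \<times> ('c, 'o) hypergraph \<times> hmap \<times> ('c, 'o) hypergraph"

definition dpoi_step :: "('c, 'o) signature \<Rightarrow> ('c, 'o) hyp_span \<Rightarrow> ('c, 'o) hypergraph \<Rightarrow>
    ('c, 'o) hypergraph \<times> hmap \<Rightarrow> ('c, 'o) hypergraph \<times> hmap \<Rightarrow> bool" where
  "dpoi_step T rule I Gi Hi \<longleftrightarrow> (case (rule, Gi, Hi) of ((L, j, J, j', R), (G, i), (H, i')) \<Rightarrow>
     i \<in> hyp_hom I G \<and> i' \<in> hyp_hom I H \<and>
     (\<exists>K\<in>Hyp T. \<exists>m\<in>hyp_hom L G. \<exists>m'\<in>hyp_hom R H. \<exists>k\<in>hyp_hom J K. \<exists>q\<in>hyp_hom I K.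
      \<exists>g\<in>hyp_hom K G. \<exists>h\<in>hyp_hom K H.
        pushout T J L K G j k m g \<and> pushout T J R K H j' k m' h \<and>
        heq I i (hcomp q g) \<and> heq I i' (hcomp q h)))"

text \<open>The cospan \<open>0 \<rightarrow> G \<leftarrow> w\<close>; the left leg is the empty map.\<close>

definition rooted :: "('c, 'o) hypergraph \<Rightarrow> 'c list \<Rightarrow> hmap \<Rightarrow> ('c, 'o) cospan" where
  "rooted G w i = \<lparr> csrc = [], ctgt = w, apex = G, lleg = hid, rleg = i \<rparr>"

text \<open>Rewriting of arrows \<open>\<epsilon> \<rightarrow> w\<close> of \<open>FTerm\<close>, i.e. isomorphism classes of cospans, via
  representatives.\<close>

definition dpoi_rewrites :: "('c, 'o) signature \<Rightarrow> ('c, 'o) hyp_span \<Rightarrow>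
    ('c, 'o) cospan set \<Rightarrow> ('c, 'o) cospan set \<Rightarrow> bool" where
  "dpoi_rewrites T rule A B \<longleftrightarrow>
     (\<exists>w G i H i'. rooted G w i \<in> A \<and> rooted H w i' \<in> B \<and>
        dpoi_step T rule (discrete w) (G, i) (H, i'))"

end

theory Submission
  imports Defs
begin

text \<open>
  By the snake equations \<open>a = a1;(l \<oplus> id);a2\<close> is equivalent to \<open>\<ulcorner>a\<urcorner> = \<ulcorner>l\<urcorner>;c\<close> for a context
  \<open>c : v1 v2 \<rightarrow> w1 w2\<close>, so syntactic rewriting means that \<open>\<ulcorner>a\<urcorner> = \<ulcorner>l\<urcorner>;c\<close> and \<open>\<ulcorner>b\<urcorner> = \<ulcorner>r\<urcorner>;c\<close> for a common
  \<open>c\<close>. Composition of cospans is by pushout, so a DPOI step is exactly the same factorisation in \<open>FTerm\<close>, the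
  context being the cospan \<open>v1 v2 \<rightarrow> K \<leftarrow> w1 w2\<close>. It remains to see that the interpretation is full and faithful.

  By duality it suffices to consider arrows \<open>w \<rightarrow> \<epsilon>\<close>. A hypergraph \<open>G\<close> with an interface \<open>w \<rightarrow> G\<close> has a
  normal form: create the states \<open>\<ulcorner>o\<urcorner>\<close> of all hyperedges, merge all wires into their nodes and discard the
  nodes. The wires act on the nodes by commuting operators, so the normal form depends on \<open>G\<close> only up to
  isomorphism. Precomposing a normal form with a generator yields a normal form again, hence every arrow
  \<open>w \<rightarrow> \<epsilon>\<close> equals the normal form of its interpretation. Operations \<open>o\<close> are treated here as \<open>\<ulcorner>o\<urcorner>\<close>
  followed by a cap, and the Frobenius law enters for \<open>\<delta>\<close>, which glues two nodes.
\<close>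

section \<open>Diagram calculus in a coloured prop\<close>

text \<open>Two normal forms are never composed: arrows into the empty word are built by
  precomposition alone, so a normal form changes only at its left interface. This is why an
  operation is traded for its folded state. A state has no inputs and slides past every wire, hence
  hyperedges commute with each other and with whatever acts on the interface. Permutations need no
  coherence theorem, since another enumeration of nodes or hyperedges is reached by adjacent swaps.
  Separability covers the case that the Frobenius law leaves open, a copy whose two outputs already
  end at one node. For cospans the obstacle is that composition is given by a universal property and
  only up to isomorphism. Interfaces are discrete, so a pushout splits into a gluing of node sets
  and a coproduct of edge sets; carriers consist of natural numbers, so test functions into the
  natural numbers suffice. Reducing to an empty right interface requires a single snake equation. As
  the interpretation preserves it, the same bending works in both props, for faithfulness in one and
  for fullness in the other.\<close>

context coloured_prop
begin

abbreviation seq (infixr "\<cdot>" 55) where "f \<cdot> g \<equiv> pcomp P f g"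
abbreviation par (infixr "\<oplus>" 65) where "f \<oplus> g \<equiv> ptensor P f g"
abbreviation I where "I \<equiv> pid P"
abbreviation S where "S \<equiv> psym P"
abbreviation A where "A \<equiv> arrows P"
abbreviation dom where "dom \<equiv> pdom P"
abbreviation cod where "cod \<equiv> pcod P"
abbreviation W where "W \<equiv> lists (pcolours P)"

lemma ArrI: "f \<in> A \<Longrightarrow> f \<in> Arr P (dom f) (cod f)"
  by (simp add: Arr_def)

lemma Arr_iff: "f \<in> Arr P u v \<longleftrightarrow> f \<in> A \<and> dom f = u \<and> cod f = v"
  by (simp add: Arr_def)

lemma dom_W [simp]: "f \<in> A \<Longrightarrow> dom f \<in> W" and cod_W [simp]: "f \<in> A \<Longrightarrow> cod f \<in> W"
  using arr_words[OF ArrI] by blast+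

lemma I_typ [simp]: "w \<in> W \<Longrightarrow> I w \<in> A" "w \<in> W \<Longrightarrow> dom (I w) = w" "w \<in> W \<Longrightarrow> cod (I w) = w"
  using id_arr by (simp_all add: Arr_iff)

lemma S_typ [simp]: "\<lbrakk>w \<in> W; v \<in> W\<rbrakk> \<Longrightarrow> S w v \<in> A" "\<lbrakk>w \<in> W; v \<in> W\<rbrakk> \<Longrightarrow> dom (S w v) = w @ v"
  "\<lbrakk>w \<in> W; v \<in> W\<rbrakk> \<Longrightarrow> cod (S w v) = v @ w"
  using sym_arr by (simp_all add: Arr_iff)

lemma seq_typ [simp]:
  "\<lbrakk>f \<in> A; g \<in> A; cod f = dom g\<rbrakk> \<Longrightarrow> f \<cdot> g \<in> A"
  "\<lbrakk>f \<in> A; g \<in> A; cod f = dom g\<rbrakk> \<Longrightarrow> dom (f \<cdot> g) = dom f"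
  "\<lbrakk>f \<in> A; g \<in> A; cod f = dom g\<rbrakk> \<Longrightarrow> cod (f \<cdot> g) = cod g"
  using comp_arr[of f "dom f" "cod f" g "cod g"] by (auto simp: Arr_iff)

lemma par_typ [simp]:
  "\<lbrakk>f \<in> A; g \<in> A\<rbrakk> \<Longrightarrow> f \<oplus> g \<in> A"
  "\<lbrakk>f \<in> A; g \<in> A\<rbrakk> \<Longrightarrow> dom (f \<oplus> g) = dom f @ dom g"
  "\<lbrakk>f \<in> A; g \<in> A\<rbrakk> \<Longrightarrow> cod (f \<oplus> g) = cod f @ cod g"
  using tensor_arr[OF ArrI ArrI] by (auto simp: Arr_iff)

lemma I_seq [simp]: "f \<in> A \<Longrightarrow> dom f = u \<Longrightarrow> I u \<cdot> f = f"
  and seq_I [simp]: "f \<in> A \<Longrightarrow> cod f = u \<Longrightarrow> f \<cdot> I u = f"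
  using id_comp comp_id ArrI by blast+

lemma seq_assoc [simp]:
  "\<lbrakk>f \<in> A; g \<in> A; h \<in> A; cod f = dom g; cod g = dom h\<rbrakk> \<Longrightarrow> (f \<cdot> g) \<cdot> h = f \<cdot> g \<cdot> h"
  using comp_assoc[of f "dom f" "cod f" g "cod g" h "cod h"] by (auto simp: Arr_iff)

lemma unit_par [simp]: "f \<in> A \<Longrightarrow> I [] \<oplus> f = f" and par_unit [simp]: "f \<in> A \<Longrightarrow> f \<oplus> I [] = f"
  using unit_tensor tensor_unit ArrI by blast+

lemma par_assoc [simp]: "\<lbrakk>f \<in> A; g \<in> A; h \<in> A\<rbrakk> \<Longrightarrow> (f \<oplus> g) \<oplus> h = f \<oplus> g \<oplus> h"
  using tensor_assoc[OF ArrI ArrI ArrI] by blast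

lemma I_par_I [simp]: "\<lbrakk>w \<in> W; v \<in> W\<rbrakk> \<Longrightarrow> I w \<oplus> I v = I (w @ v)"
  by (rule tensor_id)

lemma I_par_I_par [simp]: "\<lbrakk>w \<in> W; v \<in> W; f \<in> A\<rbrakk> \<Longrightarrow> I w \<oplus> I v \<oplus> f = I (w @ v) \<oplus> f"
  using par_assoc[of "I w" "I v" f] by (simp del: par_assoc)

lemma interchange_seq:
  "\<lbrakk>f \<in> A; g \<in> A; f' \<in> A; g' \<in> A; cod f = dom g; cod f' = dom g'\<rbrakk> \<Longrightarrow>
    (f \<cdot> g) \<oplus> (f' \<cdot> g') = (f \<oplus> f') \<cdot> (g \<oplus> g')"
  using interchange[of f "dom f" "cod f" g "cod g" f' "dom f'" "cod f'" g' "cod g'"]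
  by (auto simp: Arr_iff)

text \<open>Whiskering. Diagrams are kept as right-nested composites of layers
  \<open>L a g b\<close>, ideally with one generator per layer; the simp rules below flatten nested
  layers, so that the remaining moves are exchanges of neighbouring layers.\<close>

definition L where "L a g b = I a \<oplus> g \<oplus> I b"

lemma L_typ [simp]:
  "\<lbrakk>a \<in> W; g \<in> A; b \<in> W\<rbrakk> \<Longrightarrow> L a g b \<in> A"
  "\<lbrakk>a \<in> W; g \<in> A; b \<in> W\<rbrakk> \<Longrightarrow> dom (L a g b) = a @ dom g @ b"
  "\<lbrakk>a \<in> W; g \<in> A; b \<in> W\<rbrakk> \<Longrightarrow> cod (L a g b) = a @ cod g @ b"
  by (simp_all add: L_def)

lemma L_Nil [simp]: "g \<in> A \<Longrightarrow> L [] g [] = g"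
  by (simp add: L_def)

lemma L_I [simp]: "\<lbrakk>a \<in> W; u \<in> W; b \<in> W\<rbrakk> \<Longrightarrow> L a (I u) b = I (a @ u @ b)"
  by (simp add: L_def)

lemma L_L [simp]:
  assumes "a \<in> W" "g \<in> A" "b \<in> W" "a' \<in> W" "b' \<in> W"
  shows "L a (L a' g b') b = L (a @ a') g (b' @ b)"
  using assms by (simp add: L_def)

lemma L_seq [simp]:
  assumes "a \<in> W" "b \<in> W" "f \<in> A" "g \<in> A" "cod f = dom g"
  shows "L a (f \<cdot> g) b = L a f b \<cdot> L a g b"
proof -
  have "(f \<cdot> g) \<oplus> I b = (f \<oplus> I b) \<cdot> (g \<oplus> I b)"
    using interchange_seq[of f g "I b" "I b"] assms by simp
  then show ?thesis
    using interchange_seq[of "I a" "I a" "f \<oplus> I b" "g \<oplus> I b"] assms by (simp add: L_def)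
qed

lemma par_L:
  assumes "f \<in> A" "g \<in> A"
  shows "f \<oplus> g = L [] f (dom g) \<cdot> L (cod f) g []"
  using interchange_seq[of f "I (cod f)" "I (dom g)" g] assms by (simp add: L_def)

lemma par_L':
  assumes "f \<in> A" "g \<in> A"
  shows "f \<oplus> g = L (dom f) g [] \<cdot> L [] f (cod g)"
  using interchange_seq[of "I (dom f)" f g "I (cod g)"] assms by (simp add: L_def)

text \<open>Both composites are sequential readings, by \<open>par_L\<close> and
  \<open>par_L'\<close>, of the single layer that contains
  \<open>g \<oplus> L b h c\<close>.\<close>

lemma exch:
  assumes "g \<in> A" "h \<in> A" "a \<in> W" "b \<in> W" "c \<in> W"
  shows "L a g (b @ dom h @ c) \<cdot> L (a @ cod g @ b) h c = L (a @ dom g @ b) h c \<cdot> L a g (b @ cod h @ c)"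
proof -
  have "L a g (b @ dom h @ c) \<cdot> L (a @ cod g @ b) h c = L a (g \<oplus> L b h c) []"
    using assms by (subst par_L) simp_all
  also have "\<dots> = L (a @ dom g @ b) h c \<cdot> L a g (b @ cod h @ c)"
    using assms by (subst par_L') simp_all
  finally show ?thesis .
qed

text \<open>Naturality of the symmetry against the identity on \<open>w\<close>, whiskered;
  \<open>slideR\<close> is the mirror case. These two carry a box through a crossing.\<close>

lemma slideL:
  assumes "f \<in> A" "w \<in> W" "a \<in> W" "b \<in> W"
  shows "L a f (w @ b) \<cdot> L a (S (cod f) w) b = L a (S (dom f) w) b \<cdot> L (a @ w) f b"
proof -
  have "(f \<oplus> I w) \<cdot> S (cod f) w = S (dom f) w \<cdot> (I w \<oplus> f)"
    using sym_natural[OF ArrI[of f] ArrI[of "I w"]] assms by simp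
  then have "L a ((f \<oplus> I w) \<cdot> S (cod f) w) b = L a (S (dom f) w \<cdot> (I w \<oplus> f)) b" by simp
  then show ?thesis using assms by (simp add: par_L)
qed

lemma slideR:
  assumes "f \<in> A" "w \<in> W" "a \<in> W" "b \<in> W"
  shows "L (a @ w) f b \<cdot> L a (S w (cod f)) b = L a (S w (dom f)) b \<cdot> L a f (w @ b)"
proof -
  have "(I w \<oplus> f) \<cdot> S w (cod f) = S w (dom f) \<cdot> (f \<oplus> I w)"
    using sym_natural[OF ArrI[of "I w"] ArrI[of f]] assms by simp
  then have "L a ((I w \<oplus> f) \<cdot> S w (cod f)) b = L a (S w (dom f) \<cdot> (f \<oplus> I w)) b" by simp
  then show ?thesis using assms by (simp add: par_L)
qed

lemma S_inv: "\<lbrakk>a \<in> W; b \<in> W; w \<in> W; v \<in> W\<rbrakk> \<Longrightarrow> L a (S w v) b \<cdot> L a (S v w) b = I (a @ w @ v @ b)"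
  using L_seq[of a b "S w v" "S v w"] sym_inverse by simp

lemma S_append2:
  "\<lbrakk>u \<in> W; v \<in> W; w \<in> W\<rbrakk> \<Longrightarrow> S u (v @ w) = L [] (S u v) w \<cdot> L v (S u w) []"
  using sym_hexagon[of u v w] by (simp add: L_def)

lemma iso_cancel:
  assumes "f \<in> A" "g \<in> A" "h \<in> A" "k \<in> A" "cod f = dom h" "cod g = dom h"
    "cod h = dom k" "h \<cdot> k = I (dom h)" "f \<cdot> h = g \<cdot> h"
  shows "f = g"
proof -
  have "f = f \<cdot> (h \<cdot> k)" using assms(1-8) by simp
  also have "\<dots> = (f \<cdot> h) \<cdot> k" using assms(1-7) by (subst seq_assoc) simp_all
  also have "\<dots> = (g \<cdot> h) \<cdot> k" by (simp only: assms(9))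
  also have "\<dots> = g \<cdot> (h \<cdot> k)" using assms(1-7) by (subst seq_assoc) simp_all
  also have "\<dots> = g" using assms(1-8) by simp
  finally show ?thesis .
qed

text \<open>The hexagon with two empty words makes \<open>S u []\<close> idempotent, and an
  invertible idempotent is the identity.\<close>

lemma S_Nil2 [simp]: assumes "u \<in> W" shows "S u [] = I u"
proof -
  have "S u [] \<cdot> S u [] = S u []" using S_append2[of u "[]" "[]"] assms by simp
  moreover have "S u [] \<cdot> S [] u = I u" using sym_inverse[of u "[]"] assms by simp
  ultimately show ?thesis
    using assms iso_cancel[of "S u []" "I u" "S u []" "S [] u"] by simp
qed

lemma S_Nil1 [simp]: assumes "u \<in> W" shows "S [] u = I u"
  using sym_inverse[of u "[]"] assms by simp

text \<open>The prop axioms contain the hexagon for the second argument only. The one for the first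
  argument follows because both sides become the identity after the invertible crossing
  \<open>S w (u @ v)\<close>.\<close>

lemma S_append1:
  assumes "u \<in> W" "v \<in> W" "w \<in> W"
  shows "S (u @ v) w = L u (S v w) [] \<cdot> L [] (S u w) v"
proof (rule iso_cancel)
  have "(L u (S v w) [] \<cdot> L [] (S u w) v) \<cdot> S w (u @ v) =
    L u (S v w) [] \<cdot> (L [] (S u w) v \<cdot> L [] (S w u) v) \<cdot> L u (S w v) []"
    using assms by (simp add: S_append2)
  also have "\<dots> = I (u @ v @ w)" using assms S_inv[of "[]" v u w] S_inv[of u "[]" v w] by simp
  finally show "S (u @ v) w \<cdot> S w (u @ v) = (L u (S v w) [] \<cdot> L [] (S u w) v) \<cdot> S w (u @ v)"
    using assms sym_inverse[of "u @ v" w] by simp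
qed (use assms sym_inverse[of w "u @ v"] in simp_all)

text \<open>Composites are nested to the right by simp, so an equation between two-layer composites
  does not match in the middle of a diagram. The variants with suffix \<open>_x\<close> carry an
  arbitrary continuation \<open>x\<close> for this purpose.\<close>

lemma seq_cong_x:
  assumes "p \<cdot> q = r \<cdot> s" "p \<in> A" "q \<in> A" "r \<in> A" "s \<in> A" "x \<in> A" "cod p = dom q" "cod r = dom s"
    "cod q = dom x" "cod s = dom x"
  shows "p \<cdot> q \<cdot> x = r \<cdot> s \<cdot> x"
proof -
  have "p \<cdot> q \<cdot> x = (p \<cdot> q) \<cdot> x" using assms(2-) by (subst seq_assoc) simp_all
  also have "\<dots> = r \<cdot> s \<cdot> x" unfolding assms(1) using assms(2-) by simp
  finally show ?thesis .
qed

lemma S_inv_x: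
  assumes "a \<in> W" "b \<in> W" "w \<in> W" "v \<in> W" "x \<in> A" "dom x = a @ w @ v @ b"
  shows "L a (S w v) b \<cdot> L a (S v w) b \<cdot> x = x"
proof -
  have "L a (S w v) b \<cdot> L a (S v w) b \<cdot> x = (L a (S w v) b \<cdot> L a (S v w) b) \<cdot> x"
    using assms by (subst seq_assoc) simp_all
  then show ?thesis using assms S_inv by simp
qed

lemma exch_x:
  assumes "g \<in> A" "h \<in> A" "a \<in> W" "b \<in> W" "c \<in> W" "x \<in> A" "dom x = a @ cod g @ b @ cod h @ c"
  shows "L a g (b @ dom h @ c) \<cdot> L (a @ cod g @ b) h c \<cdot> x
    = L (a @ dom g @ b) h c \<cdot> L a g (b @ cod h @ c) \<cdot> x"
  by (rule seq_cong_x[OF exch]) (use assms in simp_all)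

lemma slideL_x:
  assumes "f \<in> A" "w \<in> W" "a \<in> W" "b \<in> W" "x \<in> A" "dom x = a @ w @ cod f @ b"
  shows "L a f (w @ b) \<cdot> L a (S (cod f) w) b \<cdot> x = L a (S (dom f) w) b \<cdot> L (a @ w) f b \<cdot> x"
  by (rule seq_cong_x[OF slideL]) (use assms in simp_all)

lemma slideR_x:
  assumes "f \<in> A" "w \<in> W" "a \<in> W" "b \<in> W" "x \<in> A" "dom x = a @ cod f @ w @ b"
  shows "L (a @ w) f b \<cdot> L a (S w (cod f)) b \<cdot> x = L a (S w (dom f)) b \<cdot> L a f (w @ b) \<cdot> x"
  by (rule seq_cong_x[OF slideR]) (use assms in simp_all)

text \<open>Naturality of the symmetry with \<open>w\<close> against the box \<open>S u v\<close>;
  the crossings of \<open>w\<close> with two blocks are split by \<open>S_append1\<close>.\<close>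

lemma yang_baxter:
  assumes "u \<in> W" "v \<in> W" "w \<in> W"
  shows "L u (S v w) [] \<cdot> L [] (S u w) v \<cdot> L w (S u v) [] = L [] (S u v) w \<cdot> L v (S u w) [] \<cdot> L [] (S v w) u"
  using slideL[of "S u v" w "[]" "[]"] assms S_append1[of u v w] S_append1[of v u w] by simp

end

section \<open>Separable Frobenius structures on the letters of a prop\<close>

locale frob_prop = coloured_prop P for P :: "('c, 'a) cprop" +
  fixes mu eta delta eps :: "'c \<Rightarrow> 'a"
  assumes mu_arr: "c \<in> pcolours P \<Longrightarrow> mu c \<in> Arr P [c, c] [c]"
    and eta_arr: "c \<in> pcolours P \<Longrightarrow> eta c \<in> Arr P [] [c]"
    and delta_arr: "c \<in> pcolours P \<Longrightarrow> delta c \<in> Arr P [c] [c, c]"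
    and eps_arr: "c \<in> pcolours P \<Longrightarrow> eps c \<in> Arr P [c] []"
    and mu_assoc': "c \<in> pcolours P \<Longrightarrow> (mu c \<oplus> I [c]) \<cdot> mu c = (I [c] \<oplus> mu c) \<cdot> mu c"
    and eta_mu': "c \<in> pcolours P \<Longrightarrow> (eta c \<oplus> I [c]) \<cdot> mu c = I [c]"
    and mu_comm: "c \<in> pcolours P \<Longrightarrow> S [c] [c] \<cdot> mu c = mu c"
    and delta_eps1': "c \<in> pcolours P \<Longrightarrow> delta c \<cdot> (eps c \<oplus> I [c]) = I [c]"
    and delta_eps2': "c \<in> pcolours P \<Longrightarrow> delta c \<cdot> (I [c] \<oplus> eps c) = I [c]"
    and frob1': "c \<in> pcolours P \<Longrightarrow> (delta c \<oplus> I [c]) \<cdot> (I [c] \<oplus> mu c) = mu c \<cdot> delta c"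
    and frob2': "c \<in> pcolours P \<Longrightarrow> (I [c] \<oplus> delta c) \<cdot> (mu c \<oplus> I [c]) = mu c \<cdot> delta c"
    and delta_mu: "c \<in> pcolours P \<Longrightarrow> delta c \<cdot> mu c = I [c]"
begin

abbreviation C where "C \<equiv> pcolours P"

lemma gen_typ [simp]:
  assumes "c \<in> C"
  shows "mu c \<in> A" "dom (mu c) = [c, c]" "cod (mu c) = [c]"
    "eta c \<in> A" "dom (eta c) = []" "cod (eta c) = [c]"
    "delta c \<in> A" "dom (delta c) = [c]" "cod (delta c) = [c, c]"
    "eps c \<in> A" "dom (eps c) = [c]" "cod (eps c) = []"
  using mu_arr eta_arr delta_arr eps_arr assms by (auto simp: Arr_iff)

text \<open>By commutativity a crossing may be inserted before \<open>mu c\<close>; it carries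
  \<open>eta c\<close> to the other side, where the first unit law applies.\<close>

lemma eta_mu2': assumes "c \<in> C" shows "(I [c] \<oplus> eta c) \<cdot> mu c = I [c]"
proof -
  have "(I [c] \<oplus> eta c) \<cdot> mu c = (I [c] \<oplus> eta c) \<cdot> S [c] [c] \<cdot> mu c"
    using assms mu_comm by simp
  also have "\<dots> = (eta c \<oplus> I [c]) \<cdot> mu c"
    using slideR_x[of "eta c" "[c]" "[]" "[]" "mu c"] assms by (simp add: L_def)
  finally show ?thesis using assms eta_mu' by simp
qed

lemma frob_L:
  assumes "c \<in> C" "a \<in> W" "b \<in> W"
  shows mu_assoc: "L a (mu c) (c # b) \<cdot> L a (mu c) b = L (a @ [c]) (mu c) b \<cdot> L a (mu c) b"
    and eta_mu: "L a (eta c) (c # b) \<cdot> L a (mu c) b = I (a @ c # b)"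
    and eta_mu2: "L (a @ [c]) (eta c) b \<cdot> L a (mu c) b = I (a @ c # b)"
    and S_mu: "L a (S [c] [c]) b \<cdot> L a (mu c) b = L a (mu c) b"
    and delta_eps1: "L a (delta c) b \<cdot> L a (eps c) (c # b) = I (a @ c # b)"
    and delta_eps2: "L a (delta c) b \<cdot> L (a @ [c]) (eps c) b = I (a @ c # b)"
    and frob1: "L a (delta c) (c # b) \<cdot> L (a @ [c]) (mu c) b = L a (mu c) b \<cdot> L a (delta c) b"
    and frob2: "L (a @ [c]) (delta c) b \<cdot> L a (mu c) (c # b) = L a (mu c) b \<cdot> L a (delta c) b"
    and delta_mu_L: "L a (delta c) b \<cdot> L a (mu c) b = I (a @ c # b)"
  using assms arg_cong[OF mu_assoc'[OF assms(1)], of "\<lambda>x. L a x b"]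
    arg_cong[OF eta_mu'[OF assms(1)], of "\<lambda>x. L a x b"]
    arg_cong[OF eta_mu2'[OF assms(1)], of "\<lambda>x. L a x b"]
    arg_cong[OF mu_comm[OF assms(1)], of "\<lambda>x. L a x b"]
    arg_cong[OF delta_eps1'[OF assms(1)], of "\<lambda>x. L a x b"]
    arg_cong[OF delta_eps2'[OF assms(1)], of "\<lambda>x. L a x b"]
    arg_cong[OF frob1'[OF assms(1)], of "\<lambda>x. L a x b"]
    arg_cong[OF frob2'[OF assms(1)], of "\<lambda>x. L a x b"]
    arg_cong[OF delta_mu[OF assms(1)], of "\<lambda>x. L a x b"]
  by (simp_all add: par_L)

lemma frob_L_x:
  assumes c: "c \<in> C" "a \<in> W" "b \<in> W" and x: "x \<in> A"
  shows mu_assoc_x: "dom x = a @ c # b \<Longrightarrow> L a (mu c) (c # b) \<cdot> L a (mu c) b \<cdot> x = L (a @ [c]) (mu c) b \<cdot> L a (mu c) b \<cdot> x"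
    and eta_mu_x: "dom x = a @ c # b \<Longrightarrow> L a (eta c) (c # b) \<cdot> L a (mu c) b \<cdot> x = x"
    and eta_mu2_x: "dom x = a @ c # b \<Longrightarrow> L (a @ [c]) (eta c) b \<cdot> L a (mu c) b \<cdot> x = x"
    and S_mu_x: "dom x = a @ c # b \<Longrightarrow> L a (S [c] [c]) b \<cdot> L a (mu c) b \<cdot> x = L a (mu c) b \<cdot> x"
    and delta_eps1_x: "dom x = a @ c # b \<Longrightarrow> L a (delta c) b \<cdot> L a (eps c) (c # b) \<cdot> x = x"
    and delta_eps2_x: "dom x = a @ c # b \<Longrightarrow> L a (delta c) b \<cdot> L (a @ [c]) (eps c) b \<cdot> x = x"
    and frob1_x: "dom x = a @ c # c # b \<Longrightarrow> L a (delta c) (c # b) \<cdot> L (a @ [c]) (mu c) b \<cdot> x = L a (mu c) b \<cdot> L a (delta c) b \<cdot> x"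
    and frob2_x: "dom x = a @ c # c # b \<Longrightarrow> L (a @ [c]) (delta c) b \<cdot> L a (mu c) (c # b) \<cdot> x = L a (mu c) b \<cdot> L a (delta c) b \<cdot> x"
    and delta_mu_x: "dom x = a @ c # b \<Longrightarrow> L a (delta c) b \<cdot> L a (mu c) b \<cdot> x = x"
  using c x seq_assoc[symmetric, of "L a (mu c) (c # b)" "L a (mu c) b" x]
    seq_assoc[symmetric, of "L (a @ [c]) (mu c) b" "L a (mu c) b" x]
    seq_assoc[symmetric, of "L a (eta c) (c # b)" "L a (mu c) b" x]
    seq_assoc[symmetric, of "L (a @ [c]) (eta c) b" "L a (mu c) b" x]
    seq_assoc[symmetric, of "L a (S [c] [c]) b" "L a (mu c) b" x]
    seq_assoc[symmetric, of "L a (delta c) b" "L a (eps c) (c # b)" x]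
    seq_assoc[symmetric, of "L a (delta c) b" "L (a @ [c]) (eps c) b" x]
    seq_assoc[symmetric, of "L a (delta c) (c # b)" "L (a @ [c]) (mu c) b" x]
    seq_assoc[symmetric, of "L (a @ [c]) (delta c) b" "L a (mu c) (c # b)" x]
    seq_assoc[symmetric, of "L a (mu c) b" "L a (delta c) b" x]
    seq_assoc[symmetric, of "L a (delta c) b" "L a (mu c) b" x]
  by (simp_all add: frob_L del: seq_assoc)

end

section \<open>A wire acting on a row of nodes\<close>

context frob_prop
begin

text \<open>\<open>act lab ns x\<close> carries a wire past the wires \<open>ns\<close> up to the node \<open>x\<close> and merges it there;
  \<open>merge lab ns zs\<close>, below, does so for a word \<open>zs\<close> of wires, starting from units at all nodes.\<close>

fun act :: "('n \<Rightarrow> 'c) \<Rightarrow> 'n list \<Rightarrow> 'n \<Rightarrow> 'a" where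
  "act lab [] x = I [lab x]"
| "act lab (n # ns) x = (if x = n then L [] (mu (lab n)) (map lab ns)
     else L [] (S [lab x] [lab n]) (map lab ns) \<cdot> L [lab n] (act lab ns x) [])"

lemma map_W [simp]: "map lab ns \<in> W \<longleftrightarrow> lab ` set ns \<subseteq> C"
  by (auto simp: in_lists_conv_set)

lemma act_typ [simp]:
  assumes "lab ` set ns \<subseteq> C" "x \<in> set ns"
  shows "act lab ns x \<in> A" "dom (act lab ns x) = lab x # map lab ns" "cod (act lab ns x) = map lab ns"
proof -
  have "act lab ns x \<in> A \<and> dom (act lab ns x) = lab x # map lab ns \<and> cod (act lab ns x) = map lab ns"
    using assms
  proof (induction ns)
    case (Cons n ns)
    have "lab x \<in> C" "lab n \<in> C" using Cons.prems by auto
    with Cons show ?case by auto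
  qed simp
  then show "act lab ns x \<in> A" "dom (act lab ns x) = lab x # map lab ns" "cod (act lab ns x) = map lab ns"
    by auto
qed

text \<open>The mixed case of \<open>act_commute\<close>: one wire stops at the head of the row and
  the other passes it. The multiplication slides through the crossing with the passing wire, after
  which the two crossings of the moving wires cancel.\<close>

lemma act_commute_aux:
  assumes "lab ` set (n # ns) \<subseteq> C" "y \<in> set ns" "y \<noteq> n"
  shows "L [lab n] (act lab (n # ns) y) [] \<cdot> act lab (n # ns) n
    = L [] (S [lab n] [lab y]) (map lab (n # ns)) \<cdot> L [lab y] (act lab (n # ns) n) [] \<cdot> act lab (n # ns) y"
proof -
  let ?X = "lab n" and ?Y = "lab y" and ?N = "map lab ns"
  have [simp]: "?X \<in> C" "?Y \<in> C" "lab ` set ns \<subseteq> C" "y \<in> set ns" "?N \<in> W" using assms by auto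
  have "L [] (S [?X] [?Y]) (?X # ?N) \<cdot> L [?Y] (mu ?X) ?N \<cdot> L [] (S [?Y] [?X]) ?N \<cdot> L [?X] (act lab ns y) []
    = L [] (S [?X] [?Y]) (?X # ?N) \<cdot> L [] (S [?Y] [?X]) (?X # ?N) \<cdot> L [?X] (S [?Y] [?X]) ?N
      \<cdot> L [] (mu ?X) (?Y # ?N) \<cdot> L [?X] (act lab ns y) []"
    using slideR_x[of "mu ?X" "[?Y]" "[]" ?N "L [?X] (act lab ns y) []"] S_append2[of "[?Y]" "[?X]" "[?X]"]
    by simp
  also have "\<dots> = L [?X] (S [?Y] [?X]) ?N \<cdot> L [] (mu ?X) (?Y # ?N) \<cdot> L [?X] (act lab ns y) []"
    using S_inv_x[of "[]" "?X # ?N" "[?X]" "[?Y]"] by simp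
  also have "\<dots> = L [?X] (S [?Y] [?X]) ?N \<cdot> L [?X, ?X] (act lab ns y) [] \<cdot> L [] (mu ?X) ?N"
    using exch[of "mu ?X" "act lab ns y" "[]" "[]" "[]"] by simp
  finally show ?thesis using assms by simp
qed

text \<open>This makes the order of the wires irrelevant. If both stop at the head, associativity
  and commutativity are needed; if both go further down, the Yang-Baxter equation brings the
  crossing of the two wires to the front.\<close>

lemma act_commute:
  assumes "lab ` set ns \<subseteq> C" "x \<in> set ns" "y \<in> set ns"
  shows "L [lab x] (act lab ns y) [] \<cdot> act lab ns x
    = L [] (S [lab x] [lab y]) (map lab ns) \<cdot> L [lab y] (act lab ns x) [] \<cdot> act lab ns y"
  using assms
proof (induction ns)
  case (Cons n ns)
  let ?X = "lab x" and ?Y = "lab y" and ?N = "map lab ns" and ?n = "lab n"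
  have [simp]: "?X \<in> C" "?Y \<in> C" "?n \<in> C" "lab ` set ns \<subseteq> C" "?N \<in> W" using Cons.prems by auto
  consider "x = n" "y = n" | "x = n" "y \<noteq> n" | "x \<noteq> n" "y = n" | "x \<noteq> n" "y \<noteq> n" by blast
  then show ?case
  proof cases
    case 1
    then show ?thesis
      using mu_assoc[of ?n "[]" ?N] S_mu_x[of ?n "[]" "?n # ?N" "L [] (mu ?n) ?N"] by simp
  next
    case 2
    then show ?thesis using Cons.prems by (simp only: act_commute_aux list.map) (use act_commute_aux[of lab n ns y] in simp)
  next
    case 3
    then have "act lab (n # ns) x \<in> A" and a: "lab ` set (n # ns) \<subseteq> C" "x \<in> set ns" "x \<noteq> n"
      using Cons.prems by auto
    have "L [] (S [?X] [?Y]) (map lab (n # ns)) \<cdot> L [?Y] (act lab (n # ns) x) [] \<cdot> act lab (n # ns) y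
      = L [] (S [?X] [?Y]) (map lab (n # ns)) \<cdot> L [] (S [?Y] [?X]) (map lab (n # ns))
        \<cdot> L [?X] (act lab (n # ns) y) [] \<cdot> act lab (n # ns) x"
      using act_commute_aux[OF a] 3 by (simp del: act.simps)
    also have "\<dots> = L [?X] (act lab (n # ns) y) [] \<cdot> act lab (n # ns) x"
      using S_inv_x[of "[]" "map lab (n # ns)" "[?X]" "[?Y]"] 3 Cons.prems by (simp del: act.simps)
    finally show ?thesis by simp
  next
    case 4
    then have [simp]: "x \<in> set ns" "y \<in> set ns" using Cons.prems by auto
    have "L [?X] (S [?Y] [?n]) ?N \<cdot> L [?X, ?n] (act lab ns y) [] \<cdot> L [] (S [?X] [?n]) ?N \<cdot> L [?n] (act lab ns x) []
      = L [?X] (S [?Y] [?n]) ?N \<cdot> L [] (S [?X] [?n]) (?Y # ?N) \<cdot> L [?n] (L [?X] (act lab ns y) [] \<cdot> act lab ns x) []"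
      using exch_x[of "S [?X] [?n]" "act lab ns y" "[]" "[]" "[]" "L [?n] (act lab ns x) []"] by simp
    also have "\<dots> = L [] (L [?X] (S [?Y] [?n]) [] \<cdot> L [] (S [?X] [?n]) [?Y] \<cdot> L [?n] (S [?X] [?Y]) []) ?N
      \<cdot> L [?n, ?Y] (act lab ns x) [] \<cdot> L [?n] (act lab ns y) []"
      using Cons.IH by simp
    also have "\<dots> = L [] (S [?X] [?Y]) (?n # ?N) \<cdot> L [?Y] (S [?X] [?n]) ?N \<cdot> L [] (S [?Y] [?n]) (?X # ?N)
      \<cdot> L [?n, ?Y] (act lab ns x) [] \<cdot> L [?n] (act lab ns y) []"
      by (subst yang_baxter) simp_all
    also have "\<dots> = L [] (S [?X] [?Y]) (?n # ?N) \<cdot> L [?Y] (S [?X] [?n]) ?N \<cdot> L [?Y, ?n] (act lab ns x) []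
       \<cdot> L [] (S [?Y] [?n]) ?N \<cdot> L [?n] (act lab ns y) []"
      using exch_x[of "S [?Y] [?n]" "act lab ns x" "[]" "[]" "[]" "L [?n] (act lab ns y) []"] by simp
    finally show ?thesis using 4 by simp
  qed
qed simp

text \<open>With \<open>act_unit\<close> this says that the row of nodes is a module over the monoid
  at \<open>x\<close>. Away from the head, the multiplication slides through the crossing with the
  head node and the induction hypothesis applies below it.\<close>

lemma act_assoc:
  assumes "lab ` set ns \<subseteq> C" "x \<in> set ns"
  shows "L [] (mu (lab x)) (map lab ns) \<cdot> act lab ns x = L [lab x] (act lab ns x) [] \<cdot> act lab ns x"
  using assms
proof (induction ns)
  case (Cons n ns)
  let ?X = "lab x" and ?N = "map lab ns" and ?n = "lab n"
  have [simp]: "?X \<in> C" "?n \<in> C" "lab ` set ns \<subseteq> C" "?N \<in> W" using Cons.prems by auto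
  show ?case
  proof (cases "x = n")
    case True
    then show ?thesis using mu_assoc[of ?n "[]" ?N] by simp
  next
    case False
    then have [simp]: "x \<in> set ns" using Cons.prems by auto
    have "L [] (mu ?X) (?n # ?N) \<cdot> L [] (S [?X] [?n]) ?N \<cdot> L [?n] (act lab ns x) []
      = L [] (S [?X, ?X] [?n]) ?N \<cdot> L [?n] (L [] (mu ?X) ?N \<cdot> act lab ns x) []"
      using slideL_x[of "mu ?X" "[?n]" "[]" ?N "L [?n] (act lab ns x) []"] by simp
    also have "\<dots> = L [?X] (S [?X] [?n]) ?N \<cdot> L [] (S [?X] [?n]) (?X # ?N) \<cdot> L [?n, ?X] (act lab ns x) [] \<cdot> L [?n] (act lab ns x) []"
      using Cons.IH S_append1[of "[?X]" "[?X]" "[?n]"] by simp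
    also have "\<dots> = L [?X] (S [?X] [?n]) ?N \<cdot> L [?X, ?n] (act lab ns x) [] \<cdot> L [] (S [?X] [?n]) ?N \<cdot> L [?n] (act lab ns x) []"
      using exch_x[of "S [?X] [?n]" "act lab ns x" "[]" "[]" "[]" "L [?n] (act lab ns x) []"] by simp
    finally show ?thesis using False by simp
  qed
qed simp

lemma act_unit:
  assumes "lab ` set ns \<subseteq> C" "x \<in> set ns"
  shows "L [] (eta (lab x)) (map lab ns) \<cdot> act lab ns x = I (map lab ns)"
  using assms
proof (induction ns)
  case (Cons n ns)
  let ?X = "lab x" and ?N = "map lab ns" and ?n = "lab n"
  have [simp]: "?X \<in> C" "?n \<in> C" "lab ` set ns \<subseteq> C" "?N \<in> W" using Cons.prems by auto
  show ?case
  proof (cases "x = n")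
    case True
    then show ?thesis using eta_mu[of ?n "[]" ?N] by simp
  next
    case False
    then have [simp]: "x \<in> set ns" using Cons.prems by auto
    have "L [] (eta ?X) (?n # ?N) \<cdot> L [] (S [?X] [?n]) ?N \<cdot> L [?n] (act lab ns x) []
      = L [?n] (L [] (eta ?X) ?N \<cdot> act lab ns x) []"
      using slideL_x[of "eta ?X" "[?n]" "[]" ?N "L [?n] (act lab ns x) []"] by simp
    then show ?thesis using False Cons.IH by simp
  qed
qed simp

section \<open>Merging a word of wires into a row of nodes\<close>

primrec etas where
  "etas [] = I []"
| "etas (c # w) = eta c \<oplus> etas w"

primrec epss where
  "epss [] = I []"
| "epss (c # w) = eps c \<oplus> epss w"

lemma etas_typ [simp]: assumes "w \<in> W" shows "etas w \<in> A" "dom (etas w) = []" "cod (etas w) = w"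
proof -
  have "etas w \<in> A \<and> dom (etas w) = [] \<and> cod (etas w) = w" using assms by (induction w) auto
  then show "etas w \<in> A" "dom (etas w) = []" "cod (etas w) = w" by auto
qed

lemma epss_typ [simp]: assumes "w \<in> W" shows "epss w \<in> A" "dom (epss w) = w" "cod (epss w) = []"
proof -
  have "epss w \<in> A \<and> dom (epss w) = w \<and> cod (epss w) = []" using assms by (induction w) auto
  then show "epss w \<in> A" "dom (epss w) = w" "cod (epss w) = []" by auto
qed

lemma etas_Cons: "c \<in> C \<Longrightarrow> w \<in> W \<Longrightarrow> etas (c # w) = etas w \<cdot> L [] (eta c) w"
  using par_L'[of "eta c" "etas w"] by simp

lemma epss_Cons: "c \<in> C \<Longrightarrow> w \<in> W \<Longrightarrow> epss (c # w) = L [] (eps c) w \<cdot> epss w"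
  using par_L[of "eps c" "epss w"] by simp

primrec merge :: "('n \<Rightarrow> 'c) \<Rightarrow> 'n list \<Rightarrow> 'n list \<Rightarrow> 'a" where
  "merge lab ns [] = etas (map lab ns)"
| "merge lab ns (x # zs) = L [lab x] (merge lab ns zs) [] \<cdot> act lab ns x"

lemma merge_typ [simp]:
  assumes "lab ` set ns \<subseteq> C" "set zs \<subseteq> set ns"
  shows "merge lab ns zs \<in> A" "dom (merge lab ns zs) = map lab zs" "cod (merge lab ns zs) = map lab ns"
proof -
  have "merge lab ns zs \<in> A \<and> dom (merge lab ns zs) = map lab zs \<and> cod (merge lab ns zs) = map lab ns"
    using assms(2)
  proof (induction zs)
    case (Cons z zs)
    have "lab z \<in> C" using Cons.prems assms by auto
    with Cons assms show ?case by auto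
  qed (use assms in simp)
  then show "merge lab ns zs \<in> A" "dom (merge lab ns zs) = map lab zs" "cod (merge lab ns zs) = map lab ns"
    by auto
qed

text \<open>The crossing slides past the merging of the remaining wires and meets the two outermost
  actions, where \<open>act_commute\<close> applies.\<close>

lemma merge_swap:
  assumes "lab ` set ns \<subseteq> C" "x \<in> set ns" "y \<in> set ns" "set zs \<subseteq> set ns"
  shows "L [] (S [lab x] [lab y]) (map lab zs) \<cdot> merge lab ns (y # x # zs) = merge lab ns (x # y # zs)"
proof -
  have [simp]: "lab x \<in> C" "lab y \<in> C" "lab ` set zs \<subseteq> C" using assms by auto
  show ?thesis
    using assms exch_x[of "S [lab x] [lab y]" "merge lab ns zs" "[]" "[]" "[]"
        "L [lab y] (act lab ns x) [] \<cdot> act lab ns y"]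
    by (simp add: act_commute[of lab ns x y])
qed

lemma merge_sym_single:
  assumes "lab ` set ns \<subseteq> C" "x \<in> set ns" "set bs \<subseteq> set ns" "set zs \<subseteq> set ns"
  shows "L [] (S [lab x] (map lab bs)) (map lab zs) \<cdot> merge lab ns (bs @ x # zs) = merge lab ns (x # bs @ zs)"
  using assms(3)
proof (induction bs)
  case Nil
  have "lab x \<in> C" "lab ` set zs \<subseteq> C" using assms by auto
  then show ?case using assms by simp
next
  case (Cons b bs)
  have [simp]: "lab x \<in> C" "lab b \<in> C" "lab ` set zs \<subseteq> C" "lab ` set bs \<subseteq> C" "b \<in> set ns" "set bs \<subseteq> set ns"
    using assms Cons.prems by (auto simp: image_subset_iff subset_iff)
  have "L [] (S [lab x] (map lab (b # bs))) (map lab zs) \<cdot> merge lab ns (b # bs @ x # zs)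
    = L [] (S [lab x] [lab b]) (map lab (bs @ zs)) \<cdot>
      L [lab b] (L [] (S [lab x] (map lab bs)) (map lab zs) \<cdot> merge lab ns (bs @ x # zs)) [] \<cdot> act lab ns b"
    using assms S_append2[of "[lab x]" "[lab b]" "map lab bs"] by simp
  also have "\<dots> = L [] (S [lab x] [lab b]) (map lab (bs @ zs)) \<cdot> merge lab ns (b # x # bs @ zs)"
    using Cons by simp
  finally show ?case using merge_swap[of lab ns x b "bs @ zs"] assms by simp
qed

text \<open>The two hexagons split a crossing of words into crossings of letters, which
  \<open>merge_swap\<close> absorbs. \<open>merge_sym_single\<close> moves one wire past a word; the
  induction here does so for each wire of \<open>as\<close>.\<close>

lemma merge_sym:
  assumes "lab ` set ns \<subseteq> C" "set as \<subseteq> set ns" "set bs \<subseteq> set ns" "set zs \<subseteq> set ns"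
  shows "L [] (S (map lab as) (map lab bs)) (map lab zs) \<cdot> merge lab ns (bs @ as @ zs)
    = merge lab ns (as @ bs @ zs)"
  using assms(2,4)
proof (induction as arbitrary: zs)
  case Nil
  have "lab ` set bs \<subseteq> C" "lab ` set zs \<subseteq> C" using assms Nil by (auto simp: image_subset_iff subset_iff)
  then show ?case using assms Nil by simp
next
  case (Cons a as)
  have [simp]: "lab a \<in> C" "lab ` set zs \<subseteq> C" "lab ` set bs \<subseteq> C" "lab ` set as \<subseteq> C" "a \<in> set ns" "set as \<subseteq> set ns"
    using assms Cons.prems by (auto simp: image_subset_iff subset_iff)
  have "L [] (S (map lab (a # as)) (map lab bs)) (map lab zs) \<cdot> merge lab ns (bs @ (a # as) @ zs)
    = L [lab a] (S (map lab as) (map lab bs)) (map lab zs) \<cdot>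
      L [] (S [lab a] (map lab bs)) (map lab (as @ zs)) \<cdot> merge lab ns (bs @ a # as @ zs)"
    using assms Cons.prems S_append1[of "[lab a]" "map lab as" "map lab bs"] by simp
  also have "\<dots> = L [lab a] (L [] (S (map lab as) (map lab bs)) (map lab zs) \<cdot> merge lab ns (bs @ as @ zs)) [] \<cdot> act lab ns a"
    using assms Cons.prems merge_sym_single[of lab ns a bs "as @ zs"] by simp
  finally show ?case using Cons by simp
qed

lemma merge_mu:
  assumes "lab ` set ns \<subseteq> C" "x \<in> set ns" "set zs \<subseteq> set ns"
  shows "L [] (mu (lab x)) (map lab zs) \<cdot> merge lab ns (x # zs) = merge lab ns (x # x # zs)"
proof -
  have [simp]: "lab x \<in> C" "lab ` set zs \<subseteq> C" using assms by auto
  show ?thesis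
    using assms exch_x[of "mu (lab x)" "merge lab ns zs" "[]" "[]" "[]" "act lab ns x"]
    by (simp add: act_assoc)
qed

lemma merge_eta:
  assumes "lab ` set ns \<subseteq> C" "x \<in> set ns" "set zs \<subseteq> set ns"
  shows "L [] (eta (lab x)) (map lab zs) \<cdot> merge lab ns (x # zs) = merge lab ns zs"
proof -
  have [simp]: "lab x \<in> C" "lab ` set zs \<subseteq> C" using assms by auto
  show ?thesis
    using assms exch_x[of "eta (lab x)" "merge lab ns zs" "[]" "[]" "[]" "act lab ns x"]
    by (simp add: act_unit)
qed

text \<open>No wire ends at the head node, so every action merely crosses it and its unit survives.
  Naturality carries that unit back through the crossings.\<close>

lemma merge_fresh:
  assumes "lab ` set (n # ns) \<subseteq> C" "n \<notin> set zs" "set zs \<subseteq> set ns"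
  shows "merge lab (n # ns) zs = L [] (eta (lab n)) (map lab zs) \<cdot> L [lab n] (merge lab ns zs) []"
  using assms(2,3)
proof (induction zs)
  case Nil
  have [simp]: "lab n \<in> C" "lab ` set ns \<subseteq> C" using assms by auto
  show ?case using etas_Cons[of "lab n" "map lab ns"] exch[of "eta (lab n)" "etas (map lab ns)" "[]" "[]" "[]"] by simp
next
  case (Cons z zs)
  have [simp]: "lab n \<in> C" "lab ` set ns \<subseteq> C" "lab z \<in> C" "lab ` set zs \<subseteq> C" "n \<noteq> z" "z \<in> set ns" "z \<noteq> n" "set zs \<subseteq> set ns"
    using assms Cons.prems by auto
  have "merge lab (n # ns) (z # zs) = L [lab z] (eta (lab n)) (map lab zs) \<cdot> L [lab z, lab n] (merge lab ns zs) []
     \<cdot> L [] (S [lab z] [lab n]) (map lab ns) \<cdot> L [lab n] (act lab ns z) []"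
    using Cons by simp
  also have "\<dots> = L [lab z] (eta (lab n)) (map lab zs) \<cdot> L [] (S [lab z] [lab n]) (map lab zs)
     \<cdot> L [lab n, lab z] (merge lab ns zs) [] \<cdot> L [lab n] (act lab ns z) []"
    using exch_x[of "S [lab z] [lab n]" "merge lab ns zs" "[]" "[]" "[]" "L [lab n] (act lab ns z) []"] by simp
  also have "\<dots> = L [] (eta (lab n)) (map lab (z # zs)) \<cdot> L [lab n, lab z] (merge lab ns zs) [] \<cdot> L [lab n] (act lab ns z) []"
    using slideR_x[of "eta (lab n)" "[lab z]" "[]" "map lab zs" "L [lab n, lab z] (merge lab ns zs) [] \<cdot> L [lab n] (act lab ns z) []"]
    by simp
  finally show ?case by simp
qed

text \<open>Feeding the head node \<open>y\<close> as a wire into \<open>act lab ns x\<close>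
  identifies it with \<open>x\<close>. Wires that ended at \<open>y\<close> are passed on to
  \<open>x\<close> by \<open>act_assoc\<close>, those ending elsewhere commute with the action, and
  the unit of \<open>y\<close> is absorbed by \<open>act_unit\<close>.\<close>

lemma merge_act:
  assumes "lab ` set ns \<subseteq> C" "x \<in> set ns" "y \<noteq> x" "lab y = lab x" "set zs \<subseteq> set (y # ns)"
  shows "merge lab (y # ns) zs \<cdot> act lab ns x = merge lab ns (map (\<lambda>z. if z = y then x else z) zs)"
  using assms(5)
proof (induction zs)
  case Nil
  have [simp]: "lab x \<in> C" using assms by auto
  show ?case using assms etas_Cons[of "lab x" "map lab ns"] act_unit[of lab ns x] by simp
next
  case (Cons z zs)
  let ?r = "\<lambda>z. if z = y then x else z"
  have [simp]: "lab x \<in> C" "lab ` set ns \<subseteq> C" "lab z \<in> C" "lab ` set zs \<subseteq> C" "x \<in> set ns" "set zs \<subseteq> set (y # ns)" "set zs \<subseteq> insert y (set ns)"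
    using assms Cons.prems by (auto simp: image_subset_iff subset_iff)
  have r [simp]: "set (map ?r zs) \<subseteq> set ns" "map lab (map ?r zs) = map lab zs"
    using assms Cons.prems by (auto simp: subset_iff)
  note [simp del] = list.map map_map
  show ?case
  proof (cases "z = y")
    case True
    have "merge lab (y # ns) (z # zs) \<cdot> act lab ns x
       = L [lab x] (merge lab (y # ns) zs) [] \<cdot> L [] (mu (lab x)) (map lab ns) \<cdot> act lab ns x"
      using True assms(4) by (simp add: list.map)
    also have "\<dots> = L [lab x] (merge lab (y # ns) zs \<cdot> act lab ns x) [] \<cdot> act lab ns x"
      using act_assoc[of lab ns x] assms(4) by (simp add: list.map)
    finally show ?thesis using Cons True assms(4) by (simp add: list.map)
  next
    case False
    then have [simp]: "z \<in> set ns" using Cons.prems by auto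
    have "merge lab (y # ns) (z # zs) \<cdot> act lab ns x
       = L [lab z] (merge lab (y # ns) zs) [] \<cdot> L [] (S [lab z] [lab x]) (map lab ns) \<cdot> L [lab x] (act lab ns z) [] \<cdot> act lab ns x"
      using False assms(4) by (simp add: list.map)
    also have "\<dots> = L [lab z] (merge lab (y # ns) zs) [] \<cdot> L [lab z] (act lab ns x) [] \<cdot> act lab ns z"
      using act_commute[of lab ns x z] S_inv_x[of "[]" "map lab ns" "[lab z]" "[lab x]"] assms(4) by (simp add: list.map)
    also have "\<dots> = L [lab z] (merge lab (y # ns) zs \<cdot> act lab ns x) [] \<cdot> act lab ns z"
      using assms(4) by (simp add: list.map)
    finally show ?thesis using Cons False by (simp add: list.map)
  qed
qed

section \<open>Normal forms of hypergraphs without hyperedges\<close>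

definition "discard lab ns zs = merge lab ns zs \<cdot> epss (map lab ns)"

lemma discard_typ [simp]:
  assumes "lab ` set ns \<subseteq> C" "set zs \<subseteq> set ns"
  shows "discard lab ns zs \<in> A" "dom (discard lab ns zs) = map lab zs" "cod (discard lab ns zs) = []"
  using assms by (simp_all add: discard_def)

text \<open>The Frobenius law turns the copy sent to \<open>x\<close> and \<open>y\<close> into a
  multiplication of the incoming wire with everything collected at \<open>y\<close>, followed by a
  copy. One of the two outputs is the discarded node \<open>y\<close> and vanishes by the counit
  law; the other carries the wires of \<open>y\<close> into \<open>x\<close>, as in
  \<open>merge_act\<close>.\<close>

lemma discard_delta:
  assumes "lab ` set ns \<subseteq> C" "x \<in> set ns" "y \<noteq> x" "lab y = lab x" "set zs \<subseteq> set (y # ns)"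
  shows "L [] (delta (lab x)) (map lab zs) \<cdot> discard lab (y # ns) (x # y # zs)
    = discard lab ns (map (\<lambda>z. if z = y then x else z) (x # zs))"
proof -
  let ?r = "\<lambda>z. if z = y then x else z" and ?c = "lab x" and ?N = "map lab ns"
  let ?F = "merge lab (y # ns) zs" and ?a = "act lab ns x"
  have [simp]: "?c \<in> C" "lab ` set ns \<subseteq> C" "lab ` set zs \<subseteq> C" "x \<in> set ns" "set zs \<subseteq> set (y # ns)" "set zs \<subseteq> insert y (set ns)" "lab y = ?c" "x \<noteq> y"
    using assms by (auto simp: image_subset_iff subset_iff)
  have "set (map ?r zs) \<subseteq> set ns" using assms by (auto simp: subset_iff)
  note M = merge_typ[OF assms(1) this]
  have [simp]: "map (lab \<circ> ?r) zs = map lab zs" using assms by (auto simp: subset_iff)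
  have "L [] (delta ?c) (map lab zs) \<cdot> discard lab (y # ns) (x # y # zs)
    = L [] (delta ?c) (map lab zs) \<cdot> L [?c, ?c] ?F [] \<cdot> L [?c] (mu ?c) ?N \<cdot> L [] (S [?c] [?c]) ?N \<cdot> L [?c] ?a []
      \<cdot> L [] (eps ?c) ?N \<cdot> epss ?N"
    by (simp add: discard_def epss_Cons del: epss.simps)
  also have "\<dots> = L [?c] ?F [] \<cdot> L [] (delta ?c) (?c # ?N) \<cdot> L [?c] (mu ?c) ?N \<cdot> L [] (S [?c] [?c]) ?N \<cdot> L [?c] ?a []
      \<cdot> L [] (eps ?c) ?N \<cdot> epss ?N"
    using exch_x[of "delta ?c" ?F "[]" "[]" "[]"] by simp
  also have "\<dots> = L [?c] ?F [] \<cdot> L [] (mu ?c) ?N \<cdot> L [] (delta ?c) ?N \<cdot> L [] (S [?c] [?c]) ?N \<cdot> L [] (eps ?c) (?c # ?N)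
      \<cdot> ?a \<cdot> epss ?N"
    using frob1_x[of ?c "[]" ?N] exch_x[of "eps ?c" ?a "[]" "[]" "[]" "epss ?N"] by simp
  also have "\<dots> = L [?c] ?F [] \<cdot> L [] (mu ?c) ?N \<cdot> ?a \<cdot> epss ?N"
    using slideR_x[of "eps ?c" "[?c]" "[]" ?N "?a \<cdot> epss ?N"] delta_eps2_x[of ?c "[]" ?N "?a \<cdot> epss ?N"] by simp
  also have "\<dots> = L [?c] (?F \<cdot> ?a) [] \<cdot> ?a \<cdot> epss ?N"
    using seq_cong_x[OF act_assoc[of lab ns x], of "epss ?N"] by simp
  also have "\<dots> = L [?c] (merge lab ns (map ?r zs)) [] \<cdot> ?a \<cdot> epss ?N"
    by (simp only: merge_act[OF assms])
  also have "\<dots> = discard lab ns (x # map ?r zs)"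
    using M by (simp add: discard_def del: map_map)
  also have "x # map ?r zs = map ?r (x # zs)" by simp
  finally show ?thesis .
qed

text \<open>Both copies end at the same node, where \<open>merge_mu\<close> joins them again;
  separability cancels the pair.\<close>

lemma discard_delta_same:
  assumes "lab ` set ns \<subseteq> C" "x \<in> set ns" "set zs \<subseteq> set ns"
  shows "L [] (delta (lab x)) (map lab zs) \<cdot> discard lab ns (x # x # zs) = discard lab ns (x # zs)"
proof -
  have t [simp]: "lab x \<in> C" "map lab zs \<in> W" "lab ` set zs \<subseteq> C" using assms by (auto simp: image_subset_iff subset_iff)
  have "discard lab ns (x # x # zs) = L [] (mu (lab x)) (map lab zs) \<cdot> merge lab ns (x # zs) \<cdot> epss (map lab ns)"
    using merge_mu[OF assms, symmetric] assms by (simp add: discard_def del: merge.simps)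
  then show ?thesis
    using delta_mu_x[OF t(1) _ t(2), of "[]" "merge lab ns (x # zs) \<cdot> epss (map lab ns)"] assms
    by (simp add: discard_def del: merge.simps)
qed

text \<open>The unit at the fresh node cancels against the only wire that ends there, so the node
  amounts to a counit on that wire.\<close>

lemma discard_fresh:
  assumes "lab ` set (n # ns) \<subseteq> C" "n \<notin> set zs" "set zs \<subseteq> set ns"
  shows "discard lab (n # ns) (n # zs) = L [] (eps (lab n)) (map lab zs) \<cdot> discard lab ns zs"
proof -
  let ?n = "lab n" and ?N = "map lab ns" and ?Z = "map lab zs" and ?F = "merge lab ns zs"
  have [simp]: "?n \<in> C" "lab ` set ns \<subseteq> C" "lab ` set zs \<subseteq> C" "set zs \<subseteq> set ns"
    using assms by (auto simp: image_subset_iff subset_iff)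
  have "discard lab (n # ns) (n # zs) = L [?n] (eta ?n) ?Z \<cdot> L [?n, ?n] ?F [] \<cdot> L [] (mu ?n) ?N \<cdot> L [] (eps ?n) ?N \<cdot> epss ?N"
    using merge_fresh[OF assms] by (simp add: discard_def epss_Cons del: epss.simps)
  also have "\<dots> = L [?n] (eta ?n) ?Z \<cdot> L [] (mu ?n) ?Z \<cdot> L [?n] ?F [] \<cdot> L [] (eps ?n) ?N \<cdot> epss ?N"
    using exch_x[of "mu ?n" ?F "[]" "[]" "[]" "L [] (eps ?n) ?N \<cdot> epss ?N"] by simp
  also have "\<dots> = L [?n] ?F [] \<cdot> L [] (eps ?n) ?N \<cdot> epss ?N"
    using eta_mu2_x[of ?n "[]" ?Z] by simp
  also have "\<dots> = L [] (eps ?n) ?Z \<cdot> discard lab ns zs"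
    using exch_x[of "eps ?n" ?F "[]" "[]" "[]" "epss ?N"] by (simp add: discard_def)
  finally show ?thesis .
qed

lemma discard_seq:
  assumes "lab ` set ns \<subseteq> C" "set zs \<subseteq> set ns" "set zs' \<subseteq> set ns"
    and "f \<cdot> merge lab ns zs = merge lab ns zs'" "f \<in> A" "cod f = map lab zs"
  shows "f \<cdot> discard lab ns zs = discard lab ns zs'"
proof -
  have "f \<cdot> discard lab ns zs = (f \<cdot> merge lab ns zs) \<cdot> epss (map lab ns)"
    using assms(1-3,5,6) by (simp add: discard_def)
  then show ?thesis unfolding assms(4) by (simp add: discard_def)
qed

text \<open>Enumerations of the nodes differ by a permutation \<open>s\<close>, of which only the compatibility with
  units, counits and \<open>act\<close> is recorded.\<close>

definition reorder :: "('n \<Rightarrow> 'c) \<Rightarrow> 'n list \<Rightarrow> 'n list \<Rightarrow> 'a \<Rightarrow> bool" where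
  "reorder lab ns ns' s \<longleftrightarrow> s \<in> A \<and> dom s = map lab ns \<and> cod s = map lab ns' \<and> set ns = set ns' \<and>
    etas (map lab ns) \<cdot> s = etas (map lab ns') \<and> s \<cdot> epss (map lab ns') = epss (map lab ns) \<and>
    (\<forall>x\<in>set ns. act lab ns x \<cdot> s = L [lab x] s [] \<cdot> act lab ns' x)"

lemma reorder_refl: "lab ` set ns \<subseteq> C \<Longrightarrow> reorder lab ns ns (I (map lab ns))"
proof -
  assume *: "lab ` set ns \<subseteq> C"
  then have "lab x \<in> C" if "x \<in> set ns" for x using that by auto
  with * show ?thesis by (simp add: reorder_def)
qed

lemma reorder_trans:
  assumes r: "reorder lab ns ns' s" "reorder lab ns' ns'' t" and lab: "lab ` set ns \<subseteq> C"
  shows "reorder lab ns ns'' (s \<cdot> t)"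
proof -
  have [simp]: "lab ` set ns' \<subseteq> C" "lab ` set ns'' \<subseteq> C" "s \<in> A" "t \<in> A" "dom s = map lab ns" "cod s = map lab ns'"
    "dom t = map lab ns'" "cod t = map lab ns''" "set ns = set ns'" "set ns'' = set ns'"
    using assms by (auto simp: reorder_def)
  have "(etas (map lab ns) \<cdot> s) \<cdot> t = etas (map lab ns'')" using r by (simp add: reorder_def del: seq_assoc)
  then have 1: "etas (map lab ns) \<cdot> s \<cdot> t = etas (map lab ns'')" using lab by simp
  have 2: "s \<cdot> t \<cdot> epss (map lab ns'') = epss (map lab ns)" using r by (simp add: reorder_def)
  have "act lab ns x \<cdot> s \<cdot> t = L [lab x] (s \<cdot> t) [] \<cdot> act lab ns'' x" if "x \<in> set ns'" for x
  proof -
    have [simp]: "x \<in> set ns" "x \<in> set ns''" "x \<in> set ns'" using that by auto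
    have [simp]: "lab x \<in> C" using lab \<open>x \<in> set ns\<close> by blast
    have "act lab ns x \<cdot> s \<cdot> t = (act lab ns x \<cdot> s) \<cdot> t" using lab by simp
    also have "\<dots> = L [lab x] s [] \<cdot> act lab ns' x \<cdot> t" using r lab by (simp add: reorder_def)
    also have "\<dots> = L [lab x] (s \<cdot> t) [] \<cdot> act lab ns'' x" using r lab by (simp add: reorder_def)
    finally show ?thesis .
  qed
  then show ?thesis using 1 2 lab by (simp add: reorder_def)
qed

lemma reorder_Cons:
  assumes r: "reorder lab ns ns' s" and lab: "lab ` set (n # ns) \<subseteq> C"
  shows "reorder lab (n # ns) (n # ns') (L [lab n] s [])"
proof -
  let ?N = "map lab ns" and ?N' = "map lab ns'"
  have [simp]: "lab n \<in> C" "lab ` set ns \<subseteq> C" "lab ` set ns' \<subseteq> C" "s \<in> A" "dom s = ?N" "cod s = ?N'" "set ns = set ns'"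
    using assms by (auto simp: reorder_def)
  have [simp]: "etas ?N \<cdot> s = etas ?N'" "s \<cdot> epss ?N' = epss ?N" using r by (auto simp: reorder_def)
  have "etas (lab n # ?N) \<cdot> L [lab n] s [] = etas ?N \<cdot> s \<cdot> L [] (eta (lab n)) ?N'"
    using exch[of "eta (lab n)" s "[]" "[]" "[]"] by (simp add: etas_Cons del: etas.simps)
  also have "\<dots> = (etas ?N \<cdot> s) \<cdot> L [] (eta (lab n)) ?N'" by (subst seq_assoc) simp_all
  also have "\<dots> = etas (lab n # ?N')" by (simp add: etas_Cons del: etas.simps seq_assoc)
  finally have "etas (lab n # ?N) \<cdot> L [lab n] s [] = etas (lab n # ?N')" .
  moreover have "L [lab n] s [] \<cdot> epss (lab n # ?N') = epss (lab n # ?N)"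
    using exch_x[of "eps (lab n)" s "[]" "[]" "[]" "epss ?N'"] by (simp add: epss_Cons del: epss.simps)
  moreover have "act lab (n # ns) x \<cdot> L [lab n] s [] = L [lab x, lab n] s [] \<cdot> act lab (n # ns') x"
    if x: "x \<in> set (n # ns)" for x
  proof -
    have [simp]: "lab x \<in> C" using lab x by blast
    show ?thesis
    proof (cases "x = n")
      case True
      then show ?thesis using exch[of "mu (lab n)" s "[]" "[]" "[]"] by simp
    next
      case False
      then have [simp]: "x \<in> set ns'" using x by auto
      have "act lab ns x \<cdot> s = L [lab x] s [] \<cdot> act lab ns' x" using r by (simp add: reorder_def)
      then have "L [lab n] (act lab ns x \<cdot> s) [] = L [lab n] (L [lab x] s [] \<cdot> act lab ns' x) []" by simp
      then show ?thesis using False exch_x[of "S [lab x] [lab n]" s "[]" "[]" "[]" "L [lab n] (act lab ns' x) []"] by simp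
    qed
  qed
  moreover have "lab x \<in> C" if "x \<in> set ns'" for x
    using subsetD[OF \<open>lab ` set ns' \<subseteq> C\<close> imageI[OF that]] .
  ultimately show ?thesis by (simp add: reorder_def del: act.simps etas.simps epss.simps)
qed

text \<open>The case of an adjacent swap. A wire heading for a third node crosses both swapped
  nodes, and the Yang-Baxter equation lets the swap pass it.\<close>

lemma reorder_swap:
  assumes lab: "lab ` set (n # m # ns) \<subseteq> C" and "n \<noteq> m"
  shows "reorder lab (n # m # ns) (m # n # ns) (L [] (S [lab n] [lab m]) (map lab ns))"
proof -
  let ?N = "map lab ns" and ?n = "lab n" and ?m = "lab m"
  have [simp]: "?n \<in> C" "?m \<in> C" "lab ` set ns \<subseteq> C" "n \<noteq> m" "m \<noteq> n" using assms by auto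
  have "L [] (eta ?m) ?N \<cdot> L [] (eta ?n) (?m # ?N) \<cdot> L [] (S [?n] [?m]) ?N = L [] (eta ?n) ?N \<cdot> L [] (eta ?m) (?n # ?N)"
    using slideL[of "eta ?n" "[?m]" "[]" ?N] exch[of "eta ?m" "eta ?n" "[]" "[]" ?N] by simp
  then have 1: "etas (map lab (n # m # ns)) \<cdot> L [] (S [?n] [?m]) ?N = etas (map lab (m # n # ns))"
    by (simp add: etas_Cons del: etas.simps)
  have 2: "L [] (S [?n] [?m]) ?N \<cdot> epss (map lab (m # n # ns)) = epss (map lab (n # m # ns))"
    using slideR_x[of "eps ?m" "[?n]" "[]" ?N "L [] (eps ?n) ?N \<cdot> epss ?N"] exch_x[of "eps ?n" "eps ?m" "[]" "[]" ?N "epss ?N"]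
    by (simp add: epss_Cons del: epss.simps)
  have 3: "act lab (n # m # ns) x \<cdot> L [] (S [?n] [?m]) ?N = L [lab x] (S [?n] [?m]) ?N \<cdot> act lab (m # n # ns) x"
    if x: "x \<in> set (n # m # ns)" for x
  proof -
    have [simp]: "lab x \<in> C" using lab x by blast
    consider "x = n" | "x = m" | "x \<noteq> n" "x \<noteq> m" "x \<in> set ns" using x by auto
    then show ?thesis
    proof cases
      case 1
      then show ?thesis using slideL[of "mu ?n" "[?m]" "[]" ?N] S_append1[of "[?n]" "[?n]" "[?m]"] by simp
    next
      case 2
      then show ?thesis
        using slideR[of "mu ?m" "[?n]" "[]" ?N] S_append2[of "[?n]" "[?m]" "[?m]"]
          S_inv_x[of "[]" "?m # ?N" "[?m]" "[?n]" "L [?m] (S [?n] [?m]) ?N \<cdot> L [] (mu ?m) (?n # ?N)"] by simp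
    next
      case 3
      let ?x = "lab x"
      have "L [] (L [?x] (S [?n] [?m]) [] \<cdot> L [] (S [?x] [?m]) [?n] \<cdot> L [?m] (S [?x] [?n]) []) ?N
        = L [] (L [] (S [?x] [?n]) [?m] \<cdot> L [?n] (S [?x] [?m]) [] \<cdot> L [] (S [?n] [?m]) [?x]) ?N"
        using yang_baxter[of "[?x]" "[?n]" "[?m]"] by simp
      then have *: "L [?x] (S [?n] [?m]) ?N \<cdot> L [] (S [?x] [?m]) (?n # ?N) \<cdot> L [?m] (S [?x] [?n]) ?N
        = L [] (S [?x] [?n]) (?m # ?N) \<cdot> L [?n] (S [?x] [?m]) ?N \<cdot> L [] (S [?n] [?m]) (?x # ?N)"
        using 3 by simp
      have "act lab (n # m # ns) x \<cdot> L [] (S [?n] [?m]) ?N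
        = (L [] (S [?x] [?n]) (?m # ?N) \<cdot> L [?n] (S [?x] [?m]) ?N \<cdot> L [] (S [?n] [?m]) (?x # ?N)) \<cdot> L [?m, ?n] (act lab ns x) []"
        using 3 exch[of "S [?n] [?m]" "act lab ns x" "[]" "[]" "[]"] by simp
      also have "\<dots> = L [lab x] (S [?n] [?m]) ?N \<cdot> act lab (m # n # ns) x"
        unfolding *[symmetric] using 3 by simp
      finally show ?thesis .
    qed
  qed
  have "lab x \<in> C" if "x \<in> set ns" for x using that lab by (meson image_subset_iff list.set_intros(2))
  with 1 2 3 show ?thesis
    by (simp add: reorder_def insert_commute del: act.simps etas.simps epss.simps)
qed

text \<open>As in insertion sort, the tails are matched by the induction hypothesis and the head
  \<open>n\<close> is carried past the prefix \<open>p\<close> by adjacent swaps.\<close>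

lemma reorder_ex:
  assumes "lab ` set ns \<subseteq> C" "distinct ns" "distinct ns'" "set ns = set ns'"
  shows "\<exists>s. reorder lab ns ns' s"
  using assms
proof (induction ns arbitrary: ns')
  case Nil
  then show ?case using reorder_refl[of lab "[]"] by auto
next
  case (Cons n ns)
  then obtain p q where ns': "ns' = p @ n # q" by (metis list.set_intros(1) split_list)
  have "set ns = set (p @ q)" "distinct (p @ q)" using Cons.prems ns' by auto
  then obtain s where s: "reorder lab ns (p @ q) s" using Cons.IH[of "p @ q"] Cons.prems by auto
  have "lab ` set (n # p @ q) \<subseteq> C \<Longrightarrow> distinct (n # p) \<Longrightarrow> \<exists>t. reorder lab (n # p @ q) (p @ n # q) t" for p
  proof (induction p)
    case Nil
    then show ?case using reorder_refl[of lab "n # q"] by auto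
  next
    case (Cons m p)
    then obtain t where t: "reorder lab (n # p @ q) (p @ n # q) t" by auto
    have 1: "reorder lab (n # m # p @ q) (m # n # p @ q) (L [] (S [lab n] [lab m]) (map lab (p @ q)))"
      using Cons.prems by (intro reorder_swap) auto
    have 2: "reorder lab (m # n # p @ q) (m # p @ n # q) (L [lab m] t [])"
      using Cons.prems by (intro reorder_Cons[OF t]) auto
    have "lab ` set (n # m # p @ q) \<subseteq> C" using Cons.prems by auto
    from reorder_trans[OF 1 2 this] show ?case by auto
  qed
  moreover have "lab ` set (n # p @ q) \<subseteq> C"
  proof -
    have "set (n # p @ q) = set (n # ns)" using Cons.prems(4) ns' by auto
    then show ?thesis using Cons.prems(1) by (simp only:)
  qed
  moreover have "distinct (n # p)" using Cons.prems(3) ns' by auto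
  ultimately obtain t where t: "reorder lab (n # p @ q) (p @ n # q) t" by blast
  show ?case
    using reorder_trans[OF reorder_Cons[OF s] t] Cons.prems(1) unfolding ns' by blast
qed

text \<open>The reordering travels backwards through all the actions until the row of units absorbs
  it.\<close>

lemma merge_reorder:
  assumes "reorder lab ns ns' s" "lab ` set ns \<subseteq> C" "set zs \<subseteq> set ns"
  shows "merge lab ns zs \<cdot> s = merge lab ns' zs"
  using assms(3)
proof (induction zs)
  case Nil
  then show ?case using assms by (simp add: reorder_def)
next
  case (Cons z zs)
  have [simp]: "lab z \<in> C" "s \<in> A" "dom s = map lab ns" "cod s = map lab ns'" "lab ` set ns' \<subseteq> C" "set ns = set ns'"
    "z \<in> set ns'" "set zs \<subseteq> set ns'"
    using assms Cons.prems by (auto simp: reorder_def)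
  have "merge lab ns (z # zs) \<cdot> s = L [lab z] (merge lab ns zs \<cdot> s) [] \<cdot> act lab ns' z"
    using assms Cons.prems by (simp add: reorder_def)
  then show ?case using Cons by simp
qed

lemma discard_reorder:
  assumes "lab ` set ns \<subseteq> C" "distinct ns" "distinct ns'" "set ns = set ns'" "set zs \<subseteq> set ns"
  shows "discard lab ns zs = discard lab ns' zs"
proof -
  obtain s where s: "reorder lab ns ns' s" using reorder_ex assms by blast
  then have t: "s \<in> A" "dom s = map lab ns" "cod s = map lab ns'" "s \<cdot> epss (map lab ns') = epss (map lab ns)"
    by (auto simp: reorder_def)
  have "discard lab ns zs = (merge lab ns zs \<cdot> s) \<cdot> epss (map lab ns')"
    using t assms by (simp add: discard_def)
  then show ?thesis using merge_reorder[OF s] assms by (simp add: discard_def)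
qed

text \<open>The recursion consults only the labels and the equality of nodes, hence an injective
  renaming gives literally the same arrow.\<close>

lemma act_relabel:
  assumes "inj_on b (insert x (set ns))" "\<forall>y\<in>insert x (set ns). lab' (b y) = lab y"
  shows "act lab' (map b ns) (b x) = act lab ns x"
  using assms
proof (induction ns)
  case (Cons n ns)
  then have "act lab' (map b ns) (b x) = act lab ns x" by (intro Cons.IH) (auto simp: inj_on_def)
  moreover have "b x = b n \<longleftrightarrow> x = n" using Cons.prems by (auto simp: inj_on_def)
  moreover have m: "map lab' (map b ns) = map lab ns" using Cons.prems by auto
  ultimately show ?case using Cons.prems by (simp add: m del: map_map)
qed simp

lemma merge_relabel:
  assumes "inj_on b (set ns)" "\<forall>y\<in>set ns. lab' (b y) = lab y" "set zs \<subseteq> set ns"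
  shows "merge lab' (map b ns) (map b zs) = merge lab ns zs"
  using assms(3)
proof (induction zs)
  case Nil
  have m: "map lab' (map b ns) = map lab ns" using assms by auto
  show ?case by (simp add: m del: map_map)
next
  case (Cons z zs)
  then have "act lab' (map b ns) (b z) = act lab ns z"
    using assms by (intro act_relabel) (auto simp: insert_absorb)
  then show ?case using Cons assms by simp
qed

lemma discard_relabel:
  assumes "inj_on b (set ns)" "\<forall>y\<in>set ns. lab' (b y) = lab y" "set zs \<subseteq> set ns"
  shows "discard lab' (map b ns) (map b zs) = discard lab ns zs"
proof -
  have m: "map lab' (map b ns) = map lab ns" using assms by auto
  show ?thesis using merge_relabel[OF assms] by (simp add: discard_def m del: map_map)
qed

end

section \<open>Duality\<close>

text \<open>Stated for any \<open>k\<close> and \<open>q\<close> with one snake equation, because it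
  is applied in two props: with \<open>cup\<close> and \<open>cap\<close> for faithfulness, and with
  their images in \<open>FTerm\<close> for fullness.\<close>

lemma (in coloured_prop) bend:
  assumes "a \<in> A" "cod a = v" "k \<in> A" "dom k = []" "cod k = v @ v" "q \<in> A" "dom q = v @ v" "cod q = []"
    and snake: "L v k [] \<cdot> L [] q v = I v"
  shows "L (dom a) k [] \<cdot> L [] (L [] a v \<cdot> q) v = a"
proof -
  have v: "v \<in> W" using assms(1,2) by (metis cod_W)
  have "L (dom a) k [] \<cdot> L [] (L [] a v \<cdot> q) v = a \<cdot> L v k [] \<cdot> L [] q v"
    using assms(1-8) v exch_x[of a k "[]" "[]" "[]" "L [] q v"] by simp
  then show ?thesis unfolding snake using assms by simp
qed

context frob_prop
begin

text \<open>Like \<open>etas\<close> for \<open>eta_word\<close>, this repeats the recursion of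
  \<open>delta_word\<close> over the abstract Frobenius prop; \<open>fold_arrow_name\<close>
  identifies them.\<close>

primrec deltas where
  "deltas [] = I []"
| "deltas (c # w) = (delta c \<oplus> deltas w) \<cdot> (I [c] \<oplus> (S [c] w \<oplus> I w))"

lemma deltas_typ [simp]: assumes "w \<in> W" shows "deltas w \<in> A" "dom (deltas w) = w" "cod (deltas w) = w @ w"
proof -
  have "deltas w \<in> A \<and> dom (deltas w) = w \<and> cod (deltas w) = w @ w" using assms by (induction w) auto
  then show "deltas w \<in> A" "dom (deltas w) = w" "cod (deltas w) = w @ w" by auto
qed

definition "cup w = etas w \<cdot> deltas w"

lemma cup_typ [simp]: assumes "w \<in> W" shows "cup w \<in> A" "dom (cup w) = []" "cod (cup w) = w @ w"
  using assms by (simp_all add: cup_def)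

text \<open>The letter \<open>c\<close> of the second copy is brought next to that of the first and
  contracted, which leaves the same task for \<open>w\<close>. This order of contraction suits the
  induction in \<open>snake\<close>.\<close>

primrec cap where
  "cap [] = I []"
| "cap (c # w) = L [c] (S w [c]) w \<cdot> L [] (mu c) (w @ w) \<cdot> L [] (eps c) (w @ w) \<cdot> cap w"

lemma cap_typ [simp]: assumes "w \<in> W" shows "cap w \<in> A" "dom (cap w) = w @ w" "cod (cap w) = []"
proof -
  have "cap w \<in> A \<and> dom (cap w) = w @ w \<and> cod (cap w) = []" using assms by (induction w) auto
  then show "cap w \<in> A" "dom (cap w) = w @ w" "cod (cap w) = []" by auto
qed

text \<open>Delaying \<open>etas w\<close> until after \<open>delta c\<close> separates the pair of
  \<open>c\<close> wires from the state for \<open>w\<close>.\<close>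

lemma cup_Cons:
  assumes "c \<in> C" "w \<in> W"
  shows "cup (c # w) = (eta c \<cdot> delta c) \<cdot> L [c, c] (cup w) [] \<cdot> L [c] (S [c] w) w"
proof -
  have "cup (c # w) = L [] (eta c) [] \<cdot> L [c] (etas w) [] \<cdot> L [] (delta c) w \<cdot> L [c, c] (deltas w) [] \<cdot> L [c] (S [c] w) w"
    using assms by (simp add: cup_def par_L)
  also have "\<dots> = L [] (eta c) [] \<cdot> L [] (delta c) [] \<cdot> L [c, c] (etas w) [] \<cdot> L [c, c] (deltas w) [] \<cdot> L [c] (S [c] w) w"
    using assms exch_x[of "delta c" "etas w" "[]" "[]" "[]" "L [c, c] (deltas w) [] \<cdot> L [c] (S [c] w) w"] by simp
  finally show ?thesis using assms by (simp add: cup_def)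
qed

text \<open>A state may be created on either side of the wires \<open>w\<close>. Sliding it across
  costs a crossing of \<open>w\<close> with \<open>u @ v\<close>, whose part with \<open>v\<close>
  is then undone by \<open>S v w\<close>.\<close>

lemma slide_state:
  assumes "f \<in> A" "dom f = []" "cod f = u @ v" "u \<in> W" "v \<in> W" "w \<in> W" "a \<in> W" "b \<in> W"
    and "x \<in> A" "dom x = a @ u @ w @ v @ b"
  shows "L (a @ w) f b \<cdot> L a (S w u) (v @ b) \<cdot> x = L a f (w @ b) \<cdot> L (a @ u) (S v w) b \<cdot> x"
proof -
  have "L a f (w @ b) \<cdot> L (a @ u) (S v w) b \<cdot> x
    = L (a @ w) f b \<cdot> L a (S w (u @ v)) b \<cdot> L (a @ u) (S v w) b \<cdot> x"
    using assms slideR_x[of f w a b "L (a @ u) (S v w) b \<cdot> x"] by simp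
  also have "L a (S w (u @ v)) b \<cdot> L (a @ u) (S v w) b \<cdot> x = L a (S w u) (v @ b) \<cdot> x"
    using assms S_inv_x[of "a @ u" b w v x] by (simp add: S_append2)
  finally show ?thesis by simp
qed

text \<open>The Frobenius law rewrites the middle as \<open>mu c\<close> followed by
  \<open>delta c\<close>; the outer unit and counit cancel against these.\<close>

lemma snake1:
  assumes "c \<in> C"
  shows "L [c] (eta c \<cdot> delta c) [] \<cdot> L [] (mu c) [c] \<cdot> L [] (eps c) [c] = I [c]"
  using assms frob2_x[of c "[]" "[]" "L [] (eps c) [c]"] eta_mu2[of c "[]" "[]"] delta_eps1[of c "[]" "[]"]
  by simp

text \<open>The two zigzags have to be disentangled: the one for \<open>c\<close> is pulled out and
  straightened by \<open>snake1\<close>, and the leftover crossings of \<open>c\<close> with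
  \<open>w\<close> cancel once the zigzag for \<open>w\<close> is straight.\<close>

lemma snake:
  assumes "w \<in> W"
  shows "L w (cup w) [] \<cdot> L [] (cap w) w = I w"
  using assms
proof (induction w)
  case Nil
  then show ?case by (simp add: cup_def)
next
  case (Cons c w)
  define p where "p = eta c \<cdot> delta c"
  define q where "q = mu c \<cdot> eps c"
  have [simp]: "c \<in> C" "w \<in> W" "p \<in> A" "dom p = []" "cod p = [c, c]" "q \<in> A" "dom q = [c, c]" "cod q = []"
    using Cons.hyps by (auto simp: p_def q_def)
  have pq: "L [c] p w \<cdot> L [] q (c # w) = I (c # w)"
    using arg_cong[OF snake1[of c], of "\<lambda>x. L [] x w"] by (simp add: p_def q_def)
  have cap: "cap (c # w) = L [c] (S w [c]) w \<cdot> L [] q (w @ w) \<cdot> cap w"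
    by (simp add: q_def)
  have cup: "cup (c # w) = p \<cdot> L [c, c] (cup w) [] \<cdot> L [c] (S [c] w) w"
    by (simp add: cup_Cons p_def)
  let ?R = "L w (S [c] w) w \<cdot> L [] (cap w) (c # w)"
  have "L (c # w) (cup (c # w)) [] \<cdot> L [] (cap (c # w)) (c # w)
    = L (c # w) p [] \<cdot> L (c # w @ [c, c]) (cup w) [] \<cdot> L (c # w @ [c]) (S [c] w) w
      \<cdot> L [c] (S w [c]) (w @ c # w) \<cdot> L [] q (w @ w @ c # w) \<cdot> L [] (cap w) (c # w)"
    unfolding cap cup by simp
  also have "\<dots> = L (c # w) p [] \<cdot> L (c # w @ [c, c]) (cup w) []
      \<cdot> L [c] (S w [c]) (c # w @ w) \<cdot> L [] q (w @ c # w @ w) \<cdot> L w (S [c] w) w \<cdot> L [] (cap w) (c # w)"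
    using exch_x[of "S w [c]" "S [c] w" "[c]" "[]" w "L [] q (w @ w @ c # w) \<cdot> L [] (cap w) (c # w)"]
      exch_x[of q "S [c] w" "[]" "w" w "L [] (cap w) (c # w)"] by simp
  also have "\<dots> = L (c # w) p [] \<cdot> L [c] (S w [c]) [c] \<cdot> L [] q (w @ [c]) \<cdot> L (w @ [c]) (cup w) [] \<cdot> ?R"
    using exch_x[of "S w [c]" "cup w" "[c]" "[c]" "[]" "L [] q (w @ c # w @ w) \<cdot> ?R"]
      exch_x[of q "cup w" "[]" "w @ [c]" "[]" "?R"] by simp
  \<comment> \<open>The state for \<open>c\<close> moves from the right of \<open>w\<close> to its
    left, next to the \<open>q\<close> that contracts it.\<close>
  also have "\<dots> = L [c] p w \<cdot> L [c, c] (S [c] w) [] \<cdot> L [] q (w @ [c]) \<cdot> L (w @ [c]) (cup w) [] \<cdot> ?R"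
    using slide_state[of p "[c]" "[c]" w "[c]" "[]" "L [] q (w @ [c]) \<cdot> L (w @ [c]) (cup w) [] \<cdot> ?R"] by simp
  also have "\<dots> = (L [c] p w \<cdot> L [] q (c # w)) \<cdot> L [] (S [c] w) [] \<cdot> L (w @ [c]) (cup w) [] \<cdot> ?R"
    using exch_x[of q "S [c] w" "[]" "[]" "[]" "L (w @ [c]) (cup w) [] \<cdot> ?R"] by simp
  also have "\<dots> = L [] (S [c] w) [] \<cdot> L (w @ [c]) (cup w) [] \<cdot> ?R"
    unfolding pq by simp
  \<comment> \<open>The state for \<open>w\<close> moves to the left of the remaining letter
    \<open>c\<close>, so that both crossings lie outside the zigzag for \<open>w\<close>.\<close>
  also have "\<dots> = L [] (S [c] w) [] \<cdot> L w (cup w) [c] \<cdot> L (w @ w) (S w [c]) [] \<cdot> L [] (cap w) (c # w)"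
    using slide_state[of "cup w" w w "[c]" w "[]" "L [] (cap w) (c # w)"] by simp
  also have "\<dots> = L [] (S [c] w) [] \<cdot> L [] (L w (cup w) [] \<cdot> L [] (cap w) w) [c] \<cdot> L [] (S w [c]) []"
    using exch[of "cap w" "S w [c]" "[]" "[]" "[]"] by simp
  also have "\<dots> = L [] (S [c] w) [] \<cdot> L [] (S w [c]) []"
    using Cons.IH by simp
  also have "\<dots> = I (c # w)" using S_inv[of "[]" "[]" "[c]" w] by simp
  finally show ?case .
qed

lemma snake_x:
  assumes "w \<in> W" "x \<in> A" "dom x = w"
  shows "L w (cup w) [] \<cdot> L [] (cap w) w \<cdot> x = x"
proof -
  have "L w (cup w) [] \<cdot> L [] (cap w) w \<cdot> x = (L w (cup w) [] \<cdot> L [] (cap w) w) \<cdot> x"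
    using assms by (subst seq_assoc) simp_all
  then show ?thesis unfolding snake[OF assms(1)] using assms by simp
qed

section \<open>Folded arrows and contexts\<close>

definition "name a = cup (dom a) \<cdot> (I (dom a) \<oplus> a)"

lemma name_L: "a \<in> A \<Longrightarrow> name a = cup (dom a) \<cdot> L (dom a) a []"
  by (simp add: name_def L_def)

lemma name_typ [simp]:
  assumes "a \<in> A" shows "name a \<in> A" "dom (name a) = []" "cod (name a) = dom a @ cod a"
  using assms by (simp_all add: name_def)

text \<open>The added cap slides in front of \<open>a\<close>, meets the cup contained in
  \<open>name a\<close>, and the snake equation removes both.\<close>

lemma unname:
  assumes "a \<in> A"
  shows "L (dom a) (name a) [] \<cdot> L [] (cap (dom a)) (cod a) = a"
proof -
  have "L (dom a) (name a) [] \<cdot> L [] (cap (dom a)) (cod a)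
    = L (dom a) (cup (dom a)) [] \<cdot> L [] (cap (dom a)) (dom a) \<cdot> a"
    using assms exch[of "cap (dom a)" a "[]" "[]" "[]"] by (simp add: name_L)
  then show ?thesis using assms snake_x by simp
qed

lemma coname:
  assumes "a \<in> A"
  shows "L (dom a) (cup (cod a)) [] \<cdot> L [] (L [] a (cod a) \<cdot> cap (cod a)) (cod a) = a"
  using assms by (intro bend snake) simp_all

text \<open>The context is chosen before \<open>l\<close>, so that one context serves both sides of
  a rule. The occurrence of \<open>l\<close> is replaced by its name and a cap; the name, being a
  state, is slid out to the very front.\<close>

lemma name_context:
  assumes w: "w1 \<in> W" "u \<in> W"
    and a1: "a1 \<in> Arr P w1 (v1 @ u)" and a2: "a2 \<in> Arr P (v2 @ u) w2" and v: "v1 \<in> W" "v2 \<in> W"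
  shows "\<exists>c\<in>Arr P (v1 @ v2) (w1 @ w2). \<forall>l\<in>Arr P v1 v2. name (a1 \<cdot> L [] l u \<cdot> a2) = name l \<cdot> c"
proof -
  have [simp]: "a1 \<in> A" "dom a1 = w1" "cod a1 = v1 @ u" "a2 \<in> A" "dom a2 = v2 @ u" "cod a2 = w2"
    using a1 a2 by (auto simp: Arr_iff)
  note [simp] = w v
  define x where "x = cup w1 \<cdot> L w1 a1 []"
  have [simp]: "x \<in> A" "dom x = []" "cod x = w1 @ v1 @ u" by (simp_all add: x_def)
  define y where "y = L w1 (cap v1) (v2 @ u) \<cdot> L w1 a2 []"
  have [simp]: "y \<in> A" "dom y = w1 @ v1 @ v1 @ v2 @ u" "cod y = w1 @ w2" by (simp_all add: y_def)
  \<comment> \<open>After \<open>name l\<close> the rest \<open>x\<close> of the diagram is created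
    on its left, and the crossing returns the wires of \<open>l\<close> to their place before
    \<open>u\<close>.\<close>
  let ?c = "L [] x (v1 @ v2) \<cdot> L (w1 @ v1) (S u (v1 @ v2)) [] \<cdot> y"
  have "name (a1 \<cdot> L [] l u \<cdot> a2) = name l \<cdot> ?c" if l: "l \<in> Arr P v1 v2" for l
  proof -
    have [simp]: "l \<in> A" "dom l = v1" "cod l = v2" using l by (auto simp: Arr_iff)
    have n [simp]: "name l \<in> A" "dom (name l) = []" "cod (name l) = v1 @ v2" by simp_all
    have "L w1 l u = L w1 (L v1 (name l) [] \<cdot> L [] (cap v1) v2) u"
      using unname[of l] by simp
    then have l': "L w1 l u = L (w1 @ v1) (name l) u \<cdot> L w1 (cap v1) (v2 @ u)" by simp
    have "name (a1 \<cdot> L [] l u \<cdot> a2) = x \<cdot> L w1 l u \<cdot> L w1 a2 []"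
      by (simp add: name_L x_def)
    also have "\<dots> = x \<cdot> L (w1 @ v1) (name l) u \<cdot> y"
      unfolding l' y_def by simp
    also have "\<dots> = x \<cdot> L (w1 @ v1 @ u) (name l) [] \<cdot> L (w1 @ v1) (S u (v1 @ v2)) [] \<cdot> y"
      using slideR_x[of "name l" u "w1 @ v1" "[]" y] by simp
    also have "\<dots> = name l \<cdot> ?c"
      using exch_x[of x "name l" "[]" "[]" "[]" "L (w1 @ v1) (S u (v1 @ v2)) [] \<cdot> y"] by simp
    finally show ?thesis .
  qed
  moreover have "?c \<in> Arr P (v1 @ v2) (w1 @ w2)" by (simp add: Arr_iff)
  ultimately show ?thesis by blast
qed

text \<open>The arrow \<open>a\<close> is the unfolding of \<open>name l \<cdot> c\<close>, in which
  \<open>l\<close> is already visible behind a cup; everything around it forms the context.\<close>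

lemma context_of_name:
  assumes w: "w1 \<in> W" "w2 \<in> W" "v1 \<in> W" "v2 \<in> W" and c: "c \<in> Arr P (v1 @ v2) (w1 @ w2)"
  shows "\<exists>u\<in>W. \<exists>a1\<in>Arr P w1 (v1 @ u). \<exists>a2\<in>Arr P (v2 @ u) w2.
    \<forall>l\<in>Arr P v1 v2. \<forall>a\<in>Arr P w1 w2. name l \<cdot> c = name a \<longrightarrow> a = a1 \<cdot> L [] l u \<cdot> a2"
proof (intro bexI ballI impI)
  have [simp]: "c \<in> A" "dom c = v1 @ v2" "cod c = w1 @ w2" using c by (auto simp: Arr_iff)
  note [simp] = w
  \<comment> \<open>The bystanders are the input \<open>w1\<close>, kept for the closing cap, and
    the first half of \<open>cup v1\<close>, whose second half feeds \<open>l\<close>.\<close>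
  let ?u = "w1 @ v1"
  let ?a1 = "L w1 (cup v1) [] \<cdot> S ?u v1"
  let ?a2 = "S v2 ?u \<cdot> L w1 c [] \<cdot> L [] (cap w1) w2"
  show "?a1 \<in> Arr P w1 (v1 @ ?u)" "?a2 \<in> Arr P (v2 @ ?u) w2" "?u \<in> W" by (simp_all add: Arr_iff)
  fix l a assume l: "l \<in> Arr P v1 v2" and a: "a \<in> Arr P w1 w2" and eq: "name l \<cdot> c = name a"
  have [simp]: "l \<in> A" "dom l = v1" "cod l = v2" "a \<in> A" "dom a = w1" "cod a = w2"
    using l a by (auto simp: Arr_iff)
  let ?y = "L w1 c [] \<cdot> L [] (cap w1) w2"
  have "a = L w1 (name l \<cdot> c) [] \<cdot> L [] (cap w1) w2"
    unfolding eq using unname[of a] by simp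
  also have "\<dots> = L w1 (cup v1) [] \<cdot> L ?u l [] \<cdot> ?y" by (simp add: name_L)
  also have "L ?u l [] \<cdot> ?y = S ?u v1 \<cdot> S v1 ?u \<cdot> L ?u l [] \<cdot> ?y"
    using S_inv_x[of "[]" "[]" ?u v1 "L ?u l [] \<cdot> ?y"] by simp
  also have "S v1 ?u \<cdot> L ?u l [] \<cdot> ?y = L [] l ?u \<cdot> S v2 ?u \<cdot> ?y"
    using slideL_x[of l ?u "[]" "[]" ?y] by simp
  finally show "a = ?a1 \<cdot> L [] l ?u \<cdot> ?a2" by simp
qed

lemma syn_rewrites_iff_name:
  assumes "l \<in> Arr P v1 v2" "r \<in> Arr P v1 v2" "a \<in> Arr P w1 w2" "b \<in> Arr P w1 w2"
  shows "syn_rewrites P (l, r) a b \<longleftrightarrow>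
    (\<exists>c\<in>Arr P (v1 @ v2) (w1 @ w2). name l \<cdot> c = name a \<and> name r \<cdot> c = name b)"
proof -
  have v: "v1 \<in> W" "v2 \<in> W" "w1 \<in> W" "w2 \<in> W" using assms arr_words by blast+
  have syn: "syn_rewrites P (l, r) a b \<longleftrightarrow>
     (\<exists>u\<in>W. \<exists>a1\<in>Arr P w1 (v1 @ u). \<exists>a2\<in>Arr P (v2 @ u) w2. a = a1 \<cdot> L [] l u \<cdot> a2 \<and> b = a1 \<cdot> L [] r u \<cdot> a2)"
  proof -
    have "(a1 \<cdot> (l \<oplus> I u)) \<cdot> a2 = a1 \<cdot> L [] l u \<cdot> a2" "(a1 \<cdot> (r \<oplus> I u)) \<cdot> a2 = a1 \<cdot> L [] r u \<cdot> a2"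
      if "u \<in> W" "a1 \<in> Arr P w1 (v1 @ u)" "a2 \<in> Arr P (v2 @ u) w2" for u a1 a2
      using that assms by (simp_all add: L_def Arr_iff)
    moreover have "pdom P a = w1" "pcod P a = w2" "pdom P l = v1" "pcod P l = v2"
      using assms by (auto simp: Arr_iff)
    ultimately show ?thesis unfolding syn_rewrites_def by simp
  qed
  show ?thesis
  proof
    assume "syn_rewrites P (l, r) a b"
    then obtain u a1 a2 where u: "u \<in> W" and a1: "a1 \<in> Arr P w1 (v1 @ u)" and a2: "a2 \<in> Arr P (v2 @ u) w2"
      and eq: "a = a1 \<cdot> L [] l u \<cdot> a2" "b = a1 \<cdot> L [] r u \<cdot> a2"
      unfolding syn by blast
    obtain c where "c \<in> Arr P (v1 @ v2) (w1 @ w2)" "\<forall>l\<in>Arr P v1 v2. name (a1 \<cdot> L [] l u \<cdot> a2) = name l \<cdot> c"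
      using name_context[OF v(3) u a1 a2 v(1,2)] by blast
    then show "\<exists>c\<in>Arr P (v1 @ v2) (w1 @ w2). name l \<cdot> c = name a \<and> name r \<cdot> c = name b"
      using assms eq by auto
  next
    assume "\<exists>c\<in>Arr P (v1 @ v2) (w1 @ w2). name l \<cdot> c = name a \<and> name r \<cdot> c = name b"
    then obtain c where c: "c \<in> Arr P (v1 @ v2) (w1 @ w2)" "name l \<cdot> c = name a" "name r \<cdot> c = name b" by blast
    show "syn_rewrites P (l, r) a b"
      unfolding syn using context_of_name[OF v(3,4,1,2) c(1)] c(2,3) assms by metis
  qed
qed

section \<open>Nets of states\<close>

primrec states :: "('e \<Rightarrow> 'a) \<Rightarrow> 'e list \<Rightarrow> 'a" where
  "states st [] = I []"
| "states st (e # es) = st e \<oplus> states st es"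

text \<open>A net is a hypergraph drawn in a Frobenius prop: \<open>ns\<close> enumerates the nodes and \<open>es\<close> the hyperedges,
  \<open>st e\<close> is the folded operation at \<open>e\<close> and \<open>att e\<close> lists the nodes attached to \<open>e\<close>; the wires \<open>zs\<close>
  form the left interface.\<close>

definition is_net where
  "is_net lab ns st att es \<longleftrightarrow> lab ` set ns \<subseteq> C \<and>
    (\<forall>e\<in>set es. st e \<in> A \<and> dom (st e) = [] \<and> cod (st e) = map lab (att e) \<and> set (att e) \<subseteq> set ns)"

definition net where
  "net lab ns st att es zs =
    L (map lab zs) (states st es) [] \<cdot> discard lab ns (zs @ concat (map att es))"

lemma states_typ [simp]:
  assumes "is_net lab ns st att es"
  shows "states st es \<in> A" "dom (states st es) = []" "cod (states st es) = map lab (concat (map att es))"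
proof -
  have "states st es \<in> A \<and> dom (states st es) = [] \<and> cod (states st es) = map lab (concat (map att es))"
    using assms by (induction es) (auto simp: is_net_def)
  then show "states st es \<in> A" "dom (states st es) = []" "cod (states st es) = map lab (concat (map att es))"
    by auto
qed

lemma atts_subset: "is_net lab ns st att es \<Longrightarrow> set (concat (map att es)) \<subseteq> set ns"
  by (auto simp: is_net_def)

lemma net_lab: "is_net lab ns st att es \<Longrightarrow> lab ` set ns \<subseteq> C"
  by (simp add: is_net_def)

lemma sub_W: "lab ` set ns \<subseteq> C \<Longrightarrow> set zs \<subseteq> set ns \<Longrightarrow> map lab zs \<in> W"
  unfolding map_W by blast

lemma net_typ [simp]:
  assumes "is_net lab ns st att es" "set zs \<subseteq> set ns"
  shows "net lab ns st att es zs \<in> A" "dom (net lab ns st att es zs) = map lab zs"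
    "cod (net lab ns st att es zs) = []"
proof -
  note [simp] = states_typ[OF assms(1)] sub_W[OF net_lab[OF assms(1)] assms(2)] net_lab[OF assms(1)] assms(2)
  have "set (zs @ concat (map att es)) \<subseteq> set ns" using atts_subset[OF assms(1)] assms(2) by simp
  note d = discard_typ[OF net_lab[OF assms(1)] this]
  show "net lab ns st att es zs \<in> A" "dom (net lab ns st att es zs) = map lab zs"
    "cod (net lab ns st att es zs) = []"
    using d unfolding net_def by (simp_all del: map_W)
qed

text \<open>The states of the hyperedges are created behind the interface wires, so an arrow on the
  front wires passes them and the laws for \<open>discard\<close> lift to nets. The map
  \<open>r\<close> redirects attachments when two nodes are glued; otherwise it is the identity, as
  in \<open>net_front_id\<close>.\<close>

lemma net_front:
  assumes net: "is_net lab ns st att es" and f: "f \<in> A" "dom f = map lab as" "cod f = map lab as'"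
    and sub: "set as' \<subseteq> set ns" "set zs \<subseteq> set ns" "map lab as \<in> W"
    and r: "\<forall>x\<in>set ns. lab (r x) = lab x"
    and D: "\<And>ws. set ws \<subseteq> set ns \<Longrightarrow>
      L [] f (map lab ws) \<cdot> discard lab ns (as' @ ws) = discard lab ns' (as @ map r ws)"
  shows "L [] f (map lab zs) \<cdot> net lab ns st att es (as' @ zs)
    = net lab ns' st (map r \<circ> att) es (as @ map r zs)"
proof -
  let ?s = "states st es" and ?atts = "concat (map att es)"
  note lab = net_lab[OF net]
  note atts = atts_subset[OF net]
  have sub': "set (as' @ zs @ ?atts) \<subseteq> set ns" using sub atts by simp
  note [simp] = states_typ[OF net] f sub_W[OF lab sub(1)] sub_W[OF lab sub(2)] sub_W[OF lab atts] sub(3)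
    discard_typ[OF lab sub']
  have m: "map lab (map r zs) = map lab zs" using r sub by auto
  have "L [] f (map lab zs) \<cdot> L (map lab as' @ map lab zs) ?s [] \<cdot> discard lab ns (as' @ zs @ ?atts)
    = L (map lab as @ map lab zs) ?s [] \<cdot> L [] f (map lab zs @ map lab ?atts) \<cdot> discard lab ns (as' @ zs @ ?atts)"
    using exch_x[of f ?s "[]" "map lab zs" "[]" "discard lab ns (as' @ zs @ ?atts)"] by (simp del: map_W map_concat)
  also have "L [] f (map lab zs @ map lab ?atts) \<cdot> discard lab ns (as' @ zs @ ?atts)
    = discard lab ns' (as @ map r zs @ map r ?atts)"
    using D[of "zs @ ?atts"] sub atts by simp
  finally show ?thesis by (simp add: net_def m del: map_map) (simp add: map_concat)
qed

text \<open>The state of the first hyperedge moves from behind the interface wires to their front,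
  and \<open>merge_sym\<close> absorbs the crossing. A net thus arises by precomposing one state per
  hyperedge.\<close>

lemma net_Cons:
  assumes net: "is_net lab ns st att (e # es)" and zs: "set zs \<subseteq> set ns"
  shows "net lab ns st att (e # es) zs = L [] (st e) (map lab zs) \<cdot> net lab ns st att es (att e @ zs)"
proof -
  let ?s = "states st es" and ?atts = "concat (map att es)" and ?Z = "map lab zs" and ?E = "map lab (att e)"
  have net': "is_net lab ns st att es" using net by (auto simp: is_net_def)
  have e: "set (att e) \<subseteq> set ns" "st e \<in> A" "dom (st e) = []" "cod (st e) = ?E" using net by (auto simp: is_net_def)
  note lab = net_lab[OF net]
  note atts = atts_subset[OF net']
  have sub': "set (att e @ zs @ ?atts) \<subseteq> set ns" using zs e atts by simp
  note [simp] = states_typ[OF net'] e sub_W[OF lab e(1)] sub_W[OF lab zs] sub_W[OF lab atts]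
  note [simp] = discard_typ[OF lab sub']
  have "L [] (S ?Z ?E) (map lab ?atts) \<cdot> merge lab ns (att e @ zs @ ?atts) = merge lab ns (zs @ att e @ ?atts)"
    using merge_sym[OF lab zs e(1) atts] .
  then have d: "discard lab ns (zs @ att e @ ?atts) = L [] (S ?Z ?E) (map lab ?atts) \<cdot> discard lab ns (att e @ zs @ ?atts)"
    using sub' lab by (intro discard_seq[symmetric]) (auto simp del: map_W map_concat)
  have "net lab ns st att (e # es) zs = L ?Z (st e) [] \<cdot> L (?Z @ ?E) ?s [] \<cdot> discard lab ns (zs @ att e @ ?atts)"
    using zs e atts lab by (simp add: net_def par_L del: map_W map_concat)
  also have "\<dots> = L ?Z (st e) [] \<cdot> L (?Z @ ?E) ?s [] \<cdot> L [] (S ?Z ?E) (map lab ?atts) \<cdot> discard lab ns (att e @ zs @ ?atts)"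
    unfolding d by simp
  also have "\<dots> = L ?Z (st e) [] \<cdot> L [] (S ?Z ?E) [] \<cdot> L (?E @ ?Z) ?s [] \<cdot> discard lab ns (att e @ zs @ ?atts)"
    using exch_x[of "S ?Z ?E" ?s "[]" "[]" "[]" "discard lab ns (att e @ zs @ ?atts)"] by (simp del: map_W map_concat)
  also have "\<dots> = L [] (st e) ?Z \<cdot> L (?E @ ?Z) ?s [] \<cdot> discard lab ns (att e @ zs @ ?atts)"
    using slideR_x[of "st e" ?Z "[]" "[]" "L (?E @ ?Z) ?s [] \<cdot> discard lab ns (att e @ zs @ ?atts)"]
    by (simp del: map_W map_concat)
  finally show ?thesis by (simp add: net_def)
qed

lemma net_front_id:
  assumes "is_net lab ns st att es" "f \<in> A" "dom f = map lab as" "cod f = map lab as'"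
    and "set as' \<subseteq> set ns" "set zs \<subseteq> set ns" "map lab as \<in> W"
    and "\<And>ws. set ws \<subseteq> set ns \<Longrightarrow>
      L [] f (map lab ws) \<cdot> discard lab ns (as' @ ws) = discard lab ns' (as @ ws)"
  shows "L [] f (map lab zs) \<cdot> net lab ns st att es (as' @ zs) = net lab ns' st att es (as @ zs)"
  using net_front[of lab ns st att es f as as' zs "\<lambda>x. x" ns'] assms by (simp add: comp_def)

lemma lab_mem: "lab ` set ns \<subseteq> C \<Longrightarrow> x \<in> set ns \<Longrightarrow> lab x \<in> C"
  by blast

lemma net_mu:
  assumes net: "is_net lab ns st att es" and "x \<in> set ns" "set zs \<subseteq> set ns"
  shows "L [] (mu (lab x)) (map lab zs) \<cdot> net lab ns st att es (x # zs) = net lab ns st att es (x # x # zs)"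
proof -
  note lab = net_lab[OF net]
  have [simp]: "lab x \<in> C" using lab_mem[OF lab assms(2)] .
  have "L [] (mu (lab x)) (map lab zs) \<cdot> net lab ns st att es ([x] @ zs) = net lab ns st att es ([x, x] @ zs)"
  proof (rule net_front_id[OF net])
    show "L [] (mu (lab x)) (map lab ws) \<cdot> discard lab ns ([x] @ ws) = discard lab ns ([x, x] @ ws)"
      if "set ws \<subseteq> set ns" for ws
      using merge_mu[OF lab assms(2) that] that sub_W[OF lab that] lab assms(2)
      by (intro discard_seq) (simp_all del: map_W merge.simps)
  qed (use assms in auto)
  then show ?thesis by simp
qed

lemma net_eta:
  assumes net: "is_net lab ns st att es" and "x \<in> set ns" "set zs \<subseteq> set ns"
  shows "L [] (eta (lab x)) (map lab zs) \<cdot> net lab ns st att es (x # zs) = net lab ns st att es zs"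
proof -
  note lab = net_lab[OF net]
  have [simp]: "lab x \<in> C" using lab_mem[OF lab assms(2)] .
  have "L [] (eta (lab x)) (map lab zs) \<cdot> net lab ns st att es ([x] @ zs) = net lab ns st att es ([] @ zs)"
  proof (rule net_front_id[OF net])
    show "L [] (eta (lab x)) (map lab ws) \<cdot> discard lab ns ([x] @ ws) = discard lab ns ([] @ ws)"
      if "set ws \<subseteq> set ns" for ws
      using merge_eta[OF lab assms(2) that] that sub_W[OF lab that] lab assms(2)
      by (intro discard_seq) (simp_all del: map_W merge.simps)
  qed (use assms in auto)
  then show ?thesis by simp
qed

lemma net_sym:
  assumes net: "is_net lab ns st att es" and "set as \<subseteq> set ns" "set bs \<subseteq> set ns" "set zs \<subseteq> set ns"
  shows "L [] (S (map lab as) (map lab bs)) (map lab zs) \<cdot> net lab ns st att es (bs @ as @ zs)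
    = net lab ns st att es (as @ bs @ zs)"
proof -
  note lab = net_lab[OF net]
  note W = sub_W[OF lab assms(2)] sub_W[OF lab assms(3)]
  have "L [] (S (map lab as) (map lab bs)) (map lab zs) \<cdot> net lab ns st att es ((bs @ as) @ zs)
    = net lab ns st att es ((as @ bs) @ zs)"
  proof (rule net_front_id[OF net])
    show "L [] (S (map lab as) (map lab bs)) (map lab ws) \<cdot> discard lab ns ((bs @ as) @ ws)
      = discard lab ns ((as @ bs) @ ws)" if "set ws \<subseteq> set ns" for ws
      using merge_sym[OF lab assms(2,3) that] that sub_W[OF lab that] lab assms(2,3) W
      by (intro discard_seq) (simp_all del: map_W merge.simps)
  qed (use assms W in \<open>simp_all del: map_W\<close>)
  then show ?thesis by simp
qed

lemma net_delta_same:
  assumes net: "is_net lab ns st att es" and "x \<in> set ns" "set zs \<subseteq> set ns"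
  shows "L [] (delta (lab x)) (map lab zs) \<cdot> net lab ns st att es (x # x # zs) = net lab ns st att es (x # zs)"
proof -
  note lab = net_lab[OF net]
  have [simp]: "lab x \<in> C" using lab_mem[OF lab assms(2)] .
  have "L [] (delta (lab x)) (map lab zs) \<cdot> net lab ns st att es ([x, x] @ zs) = net lab ns st att es ([x] @ zs)"
    by (rule net_front_id[OF net]) (use assms discard_delta_same[OF lab] in auto)
  then show ?thesis by simp
qed

lemma net_delta:
  assumes net: "is_net lab (y # ns) st att es"
    and "x \<in> set ns" "y \<noteq> x" "lab y = lab x" "set zs \<subseteq> set (y # ns)"
  defines "r \<equiv> \<lambda>z. if z = y then x else z"
  shows "L [] (delta (lab x)) (map lab zs) \<cdot> net lab (y # ns) st att es (x # y # zs)
    = net lab ns st (map r \<circ> att) es (x # map r zs)"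
proof -
  have lab: "lab ` set ns \<subseteq> C" using net_lab[OF net] by simp
  have [simp]: "lab x \<in> C" using lab_mem[OF lab assms(2)] .
  have "L [] (delta (lab x)) (map lab zs) \<cdot> net lab (y # ns) st att es ([x, y] @ zs)
    = net lab ns st (map r \<circ> att) es ([x] @ map r zs)"
  proof (rule net_front[OF net])
    show "L [] (delta (lab x)) (map lab ws) \<cdot> discard lab (y # ns) ([x, y] @ ws) = discard lab ns ([x] @ map r ws)"
      if "set ws \<subseteq> set (y # ns)" for ws
      using discard_delta[OF lab assms(2,3,4) that] assms(3) by (simp add: r_def)
  qed (use assms in auto)
  then show ?thesis by simp
qed

lemma net_eps:
  assumes net: "is_net lab ns st att es" and n: "lab n \<in> C" "n \<notin> set ns" "set zs \<subseteq> set ns"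
  shows "L [] (eps (lab n)) (map lab zs) \<cdot> net lab ns st att es zs = net lab (n # ns) st att es (n # zs)"
proof -
  note lab = net_lab[OF net]
  have "L [] (eps (lab n)) (map lab zs) \<cdot> net lab ns st att es ([] @ zs) = net lab (n # ns) st att es ([n] @ zs)"
  proof (rule net_front_id[OF net])
    show "L [] (eps (lab n)) (map lab ws) \<cdot> discard lab ns ([] @ ws) = discard lab (n # ns) ([n] @ ws)"
      if ws: "set ws \<subseteq> set ns" for ws
    proof -
      have "n \<notin> set ws" using ws n(2) by blast
      then show ?thesis using discard_fresh[of lab n ns ws] ws n(1) lab by simp
    qed
  qed (use n in auto)
  then show ?thesis by simp
qed

text \<open>Two applications of \<open>net_Cons\<close> bring both states to the front. They are
  exchanged there, and the crossing of their wires is absorbed by \<open>net_sym\<close>.\<close>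

lemma net_swap_edges:
  assumes net: "is_net lab ns st att (e # d # es)" and zs: "set zs \<subseteq> set ns"
  shows "net lab ns st att (e # d # es) zs = net lab ns st att (d # e # es) zs"
proof -
  let ?Z = "map lab zs" and ?E = "map lab (att e)" and ?D = "map lab (att d)"
  have nets: "is_net lab ns st att (d # e # es)" "is_net lab ns st att (e # es)" "is_net lab ns st att (d # es)"
     "is_net lab ns st att es" using net by (auto simp: is_net_def)
  have e: "set (att e) \<subseteq> set ns" "st e \<in> A" "dom (st e) = []" "cod (st e) = ?E"
    and d: "set (att d) \<subseteq> set ns" "st d \<in> A" "dom (st d) = []" "cod (st d) = ?D" using net by (auto simp: is_net_def)
  note lab = net_lab[OF net]
  note [simp] = e d sub_W[OF lab e(1)] sub_W[OF lab d(1)] sub_W[OF lab zs] net_typ[OF nets(4)]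
  have sub: "set (att e @ zs) \<subseteq> set ns" "set (att d @ zs) \<subseteq> set ns" "set (att d @ att e @ zs) \<subseteq> set ns"
    "set (att e @ att d @ zs) \<subseteq> set ns" using zs by auto
  note [simp] = net_typ[OF nets(4) sub(3)] net_typ[OF nets(4) sub(4)]
  let ?n = "net lab ns st att es"
  have "net lab ns st att (e # d # es) zs = L [] (st e) ?Z \<cdot> L [] (st d) (?E @ ?Z) \<cdot> ?n (att d @ att e @ zs)"
    using net_Cons[OF net zs] net_Cons[OF nets(3) sub(1)] by simp
  also have "\<dots> = L [] (st d) ?Z \<cdot> L ?D (st e) ?Z \<cdot> ?n (att d @ att e @ zs)"
    using exch_x[of "st d" "st e" "[]" "[]" ?Z "?n (att d @ att e @ zs)"] by (simp del: map_W)
  also have "?n (att d @ att e @ zs) = L [] (S ?D ?E) ?Z \<cdot> ?n (att e @ att d @ zs)"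
    using net_sym[OF nets(4) d(1) e(1) zs] by simp
  also have "L ?D (st e) ?Z \<cdot> L [] (S ?D ?E) ?Z \<cdot> ?n (att e @ att d @ zs) = L [] (st e) (?D @ ?Z) \<cdot> ?n (att e @ att d @ zs)"
    using slideR_x[of "st e" ?D "[]" ?Z "?n (att e @ att d @ zs)"] by (simp del: map_W)
  also have "L [] (st d) ?Z \<cdot> \<dots> = net lab ns st att (d # e # es) zs"
    using net_Cons[OF nets(1) zs] net_Cons[OF nets(2) sub(2)] by simp
  finally show ?thesis .
qed

text \<open>The insertion argument of \<open>reorder_ex\<close> again, with
  \<open>net_swap_edges\<close> as the adjacent swap.\<close>

lemma net_edges:
  assumes "is_net lab ns st att es" "set zs \<subseteq> set ns" "distinct es" "distinct es'" "set es = set es'"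
  shows "net lab ns st att es zs = net lab ns st att es' zs"
  using assms
proof (induction es arbitrary: es' zs)
  case Nil
  then show ?case by simp
next
  case (Cons e es)
  then obtain p q where es': "es' = p @ e # q" by (metis list.set_intros(1) split_list)
  have eq: "set es = set (p @ q)" "distinct (p @ q)" using Cons.prems es' by auto
  have net: "is_net lab ns st att es" "is_net lab ns st att (e # p @ q)"
    using Cons.prems(1) eq(1) unfolding is_net_def by auto
  have e: "set (att e) \<subseteq> set ns" using Cons.prems(1) by (simp add: is_net_def)
  have "net lab ns st att (e # es) zs = net lab ns st att (e # p @ q) zs"
    using net_Cons[OF Cons.prems(1,2)] net_Cons[OF net(2) Cons.prems(2)]
      Cons.IH[OF net(1), of "att e @ zs" "p @ q"] Cons.prems eq e by simp
  also have "is_net lab ns st att (e # p @ q) \<Longrightarrow> set zs \<subseteq> set ns \<Longrightarrow>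
    net lab ns st att (e # p @ q) zs = net lab ns st att (p @ e # q) zs" for zs
  proof (induction p arbitrary: zs)
    case (Cons m p)
    have nets: "is_net lab ns st att (m # e # p @ q)" "is_net lab ns st att (m # p @ e # q)"
      "is_net lab ns st att (e # p @ q)" and m: "set (att m) \<subseteq> set ns"
      using Cons.prems(1) unfolding is_net_def by auto
    show ?case
      using net_swap_edges[of lab ns st att e m "p @ q" zs] net_Cons[OF nets(1)] net_Cons[OF nets(2)]
        Cons.IH[OF nets(3), of "att m @ zs"] Cons.prems m by simp
  qed simp
  finally show ?case using es' net(2) Cons.prems(2) by simp
qed

lemma net_nodes:
  assumes "is_net lab ns st att es" "set zs \<subseteq> set ns" "distinct ns" "distinct ns'" "set ns = set ns'"
  shows "net lab ns st att es zs = net lab ns' st att es zs"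
  unfolding net_def using discard_reorder[OF net_lab[OF assms(1)] assms(3-5)] assms(2) atts_subset[OF assms(1)]
  by simp

lemma net_relabel:
  assumes net: "is_net lab ns st att es" "set zs \<subseteq> set ns"
    and b: "inj_on b (set ns)" "\<forall>y\<in>set ns. lab' (b y) = lab y"
    and d: "\<forall>e\<in>set es. st' (d e) = st e \<and> att' (d e) = map b (att e)"
  shows "net lab' (map b ns) st' att' (map d es) (map b zs) = net lab ns st att es zs"
proof -
  have "states st' (map d es) = states st es" using d by (induction es) auto
  moreover have "concat (map att' (map d es)) = map b (concat (map att es))" using d by (induction es) auto
  moreover have "map lab' (map b zs) = map lab zs" using b net by auto
  ultimately show ?thesis
    using discard_relabel[OF b, of "zs @ concat (map att es)"] net atts_subset[OF net(1)]
    by (simp add: net_def del: map_map)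
qed

lemma net_cong:
  assumes "\<And>e. e \<in> set es \<Longrightarrow> st e = st' e \<and> att e = att' e"
  shows "net lab ns st att es zs = net lab ns st' att' es zs"
proof -
  have "states st es = states st' es" using assms by (induction es) auto
  moreover have "map att es = map att' es" using assms by auto
  ultimately show ?thesis by (simp only: net_def)
qed

end

section \<open>Pushouts of hypergraphs along discrete ones\<close>

text \<open>Pushouts of sets; the uniqueness half of the universal property is replaced by joint surjectivity.\<close>

definition spo :: "nat set \<Rightarrow> nat set \<Rightarrow> nat set \<Rightarrow> nat set \<Rightarrow> (nat \<Rightarrow> nat) \<Rightarrow> (nat \<Rightarrow> nat) \<Rightarrow>
    (nat \<Rightarrow> nat) \<Rightarrow> (nat \<Rightarrow> nat) \<Rightarrow> bool" where
  "spo J L K D j k p q \<longleftrightarrow> p ` L \<subseteq> D \<and> q ` K \<subseteq> D \<and> D \<subseteq> p ` L \<union> q ` K \<and> (\<forall>i\<in>J. p (j i) = q (k i)) \<and>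
     (\<forall>\<alpha> \<beta> :: nat \<Rightarrow> nat. (\<forall>i\<in>J. \<alpha> (j i) = \<beta> (k i)) \<longrightarrow>
        (\<exists>\<gamma>. (\<forall>n\<in>L. \<gamma> (p n) = \<alpha> n) \<and> (\<forall>m\<in>K. \<gamma> (q m) = \<beta> m)))"

lemma spoI:
  assumes "\<And>n. n \<in> L \<Longrightarrow> p n \<in> D" "\<And>m. m \<in> K \<Longrightarrow> q m \<in> D" "D \<subseteq> p ` L \<union> q ` K" "\<And>i. i \<in> J \<Longrightarrow> p (j i) = q (k i)"
    and "\<And>\<alpha> \<beta> :: nat \<Rightarrow> nat. \<forall>i\<in>J. \<alpha> (j i) = \<beta> (k i) \<Longrightarrow> \<exists>\<gamma>. (\<forall>n\<in>L. \<gamma> (p n) = \<alpha> n) \<and> (\<forall>m\<in>K. \<gamma> (q m) = \<beta> m)"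
  shows "spo J L K D j k p q"
  unfolding spo_def using assms(1-4) by (auto intro!: assms(5))

lemma spo_mapE:
  assumes "spo J L K D j k p q" "\<forall>i\<in>J. \<alpha> (j i) = \<beta> (k i)"
  obtains \<gamma> :: "nat \<Rightarrow> nat" where "\<And>n. n \<in> L \<Longrightarrow> \<gamma> (p n) = \<alpha> n" "\<And>m. m \<in> K \<Longrightarrow> \<gamma> (q m) = \<beta> m"
proof -
  have "\<forall>\<alpha> \<beta> :: nat \<Rightarrow> nat. (\<forall>i\<in>J. \<alpha> (j i) = \<beta> (k i)) \<longrightarrow>
        (\<exists>\<gamma>. (\<forall>n\<in>L. \<gamma> (p n) = \<alpha> n) \<and> (\<forall>m\<in>K. \<gamma> (q m) = \<beta> m))"
    using assms(1) unfolding spo_def by (elim conjE)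
  from this[THEN spec, THEN spec, THEN mp, OF assms(2)] show thesis using that by blast
qed

lemma spo_set:
  assumes "spo J L K D j k p q"
  shows "p ` L \<subseteq> D" "q ` K \<subseteq> D" "D \<subseteq> p ` L \<union> q ` K" "\<forall>i\<in>J. p (j i) = q (k i)"
  subgoal using assms unfolding spo_def by (elim conjE) assumption
  subgoal using assms unfolding spo_def by (elim conjE) assumption
  subgoal using assms unfolding spo_def by (elim conjE) assumption
  subgoal using assms unfolding spo_def by (elim conjE) assumption
  done

lemma spo_L: "spo J L K D j k p q \<Longrightarrow> n \<in> L \<Longrightarrow> p n \<in> D"
  and spo_K: "spo J L K D j k p q \<Longrightarrow> m \<in> K \<Longrightarrow> q m \<in> D"
  and spo_comm: "spo J L K D j k p q \<Longrightarrow> i \<in> J \<Longrightarrow> p (j i) = q (k i)"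
    apply (drule spo_set(1); force)
   apply (drule spo_set(2); force)
  apply (drule spo_set(4); simp)
  done

lemma spo_cases:
  assumes "spo J L K D j k p q" "x \<in> D"
  obtains n where "n \<in> L" "x = p n" | m where "m \<in> K" "x = q m"
  using spo_set(3)[OF assms(1)] assms(2) by blast

text \<open>The pasting law behind \<open>composite_assoc\<close>: \<open>E\<close> is a gluing of
  \<open>D\<close> and \<open>M\<close>, where \<open>D\<close> glues \<open>L\<close> to
  \<open>K\<close>, and also one of \<open>L\<close> and \<open>F\<close>, where \<open>F\<close>
  glues \<open>K\<close> to \<open>M\<close>. Functions on \<open>E\<close> are induced in two
  stages, over \<open>D\<close> and then over \<open>E\<close>.\<close>

lemma spo_paste:
  assumes 1: "spo J L K D j k p q" and 2: "spo J' D M E (\<lambda>i. q (j' i)) k' p' q'" and 3: "spo J' K M F j' k' p3 q3"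
    and t: "\<And>x. x \<in> K \<Longrightarrow> t (p3 x) = p' (q x)" "\<And>y. y \<in> M \<Longrightarrow> t (q3 y) = q' y"
    and k: "\<And>i. i \<in> J \<Longrightarrow> k i \<in> K" and j': "\<And>i. i \<in> J' \<Longrightarrow> j' i \<in> K" and k': "\<And>i. i \<in> J' \<Longrightarrow> k' i \<in> M"
  shows "spo J L F E j (\<lambda>i. p3 (k i)) (\<lambda>n. p' (p n)) t"
proof (rule spoI)
  show "p' (p n) \<in> E" if "n \<in> L" for n using spo_L[OF 2 spo_L[OF 1 that]] .
  show "t m \<in> E" if "m \<in> F" for m
    using 3 that
  proof (rule spo_cases)
    show "t m \<in> E" if "n \<in> K" "m = p3 n" for n using spo_L[OF 2 spo_K[OF 1 that(1)]] that t by simp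
    show "t m \<in> E" if "n \<in> M" "m = q3 n" for n using spo_K[OF 2 that(1)] that t by simp
  qed
  show "E \<subseteq> (\<lambda>n. p' (p n)) ` L \<union> t ` F"
  proof
    fix x assume "x \<in> E"
    with 2 show "x \<in> (\<lambda>n. p' (p n)) ` L \<union> t ` F"
    proof (rule spo_cases)
      fix y assume y: "y \<in> M" "x = q' y"
      then have "x = t (q3 y)" "q3 y \<in> F" using t spo_K[OF 3] by auto
      then show ?thesis by blast
    next
      fix z assume z: "z \<in> D" "x = p' z"
      from 1 z(1) show ?thesis
      proof (rule spo_cases)
        fix m assume m: "m \<in> K" "z = q m"
        then have "x = t (p3 m)" "p3 m \<in> F" using z t spo_L[OF 3] by auto
        then show ?thesis by blast
      qed (use z in blast)
    qed
  qed
  show "p' (p (j i)) = t (p3 (k i))" if "i \<in> J" for i using spo_comm[OF 1 that] t k that by simp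
  fix \<alpha> \<beta> :: "nat \<Rightarrow> nat" assume ab: "\<forall>i\<in>J. \<alpha> (j i) = \<beta> (p3 (k i))"
  obtain \<gamma> where g: "\<And>n. n \<in> L \<Longrightarrow> \<gamma> (p n) = \<alpha> n" "\<And>m. m \<in> K \<Longrightarrow> \<gamma> (q m) = \<beta> (p3 m)"
    using spo_mapE[OF 1, of \<alpha> "\<lambda>m. \<beta> (p3 m)"] ab by metis
  have "\<forall>i\<in>J'. \<gamma> (q (j' i)) = \<beta> (q3 (k' i))" using g j' spo_comm[OF 3] by metis
  then obtain \<delta> where d: "\<And>n. n \<in> D \<Longrightarrow> \<delta> (p' n) = \<gamma> n" "\<And>m. m \<in> M \<Longrightarrow> \<delta> (q' m) = \<beta> (q3 m)"
    using spo_mapE[OF 2, of \<gamma> "\<lambda>m. \<beta> (q3 m)"] by metis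
  have "\<delta> (p' (p n)) = \<alpha> n" if "n \<in> L" for n using that d g spo_L[OF 1] by simp
  moreover have "\<delta> (t m) = \<beta> m" if "m \<in> F" for m
    using 3 that
  proof (rule spo_cases)
    show "\<delta> (t m) = \<beta> m" if "x \<in> K" "m = p3 x" for x using that t d g spo_K[OF 1] by simp
    show "\<delta> (t m) = \<beta> m" if "x \<in> M" "m = q3 x" for x using that t d by simp
  qed
  ultimately show "\<exists>\<gamma>. (\<forall>n\<in>L. \<gamma> (p' (p n)) = \<alpha> n) \<and> (\<forall>m\<in>F. \<gamma> (t m) = \<beta> m)"
    by (intro exI[of _ \<delta>]) simp
qed

lemma spo_iso:
  assumes s: "spo J L K D j k p q"
    and f: "bij_betw f L L'" and g: "bij_betw g K K'" and h: "bij_betw h D D'"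
    and jk: "\<And>i. i \<in> J \<Longrightarrow> j i \<in> L \<and> j' i = f (j i) \<and> k i \<in> K \<and> k' i = g (k i)"
    and p: "\<And>n. n \<in> L \<Longrightarrow> p' (f n) = h (p n)" and q: "\<And>m. m \<in> K \<Longrightarrow> q' (g m) = h (q m)"
  shows "spo J L' K' D' j' k' p' q'"
proof (rule spoI)
  have im: "f ` L = L'" "g ` K = K'" "h ` D = D'" using f g h by (auto simp: bij_betw_def)
  show "p' n \<in> D'" if n: "n \<in> L'" for n
  proof -
    obtain x where "x \<in> L" "n = f x" using n im by blast
    then show ?thesis using p spo_L[OF s] im by auto
  qed
  show "q' n \<in> D'" if n: "n \<in> K'" for n
  proof -
    obtain x where "x \<in> K" "n = g x" using n im by blast
    then show ?thesis using q spo_K[OF s] im by auto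
  qed
  show "D' \<subseteq> p' ` L' \<union> q' ` K'"
  proof
    fix x assume "x \<in> D'"
    then obtain y where y: "y \<in> D" "x = h y" using im by blast
    from s y(1) show "x \<in> p' ` L' \<union> q' ` K'"
    proof (rule spo_cases)
      fix n assume n: "n \<in> L" "y = p n"
      then have "x = p' (f n)" "f n \<in> L'" using y(2) p im(1) by auto
      then show ?thesis by blast
    next
      fix n assume n: "n \<in> K" "y = q n"
      then have "x = q' (g n)" "g n \<in> K'" using y(2) q im(2) by auto
      then show ?thesis by blast
    qed
  qed
  show "p' (j' i) = q' (k' i)" if "i \<in> J" for i using jk[OF that] p q spo_comm[OF s that] by simp
  fix \<alpha> \<beta> :: "nat \<Rightarrow> nat" assume "\<forall>i\<in>J. \<alpha> (j' i) = \<beta> (k' i)"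
  then have "\<forall>i\<in>J. \<alpha> (f (j i)) = \<beta> (g (k i))" using jk by metis
  then obtain \<gamma> where c: "\<And>n. n \<in> L \<Longrightarrow> \<gamma> (p n) = \<alpha> (f n)" "\<And>m. m \<in> K \<Longrightarrow> \<gamma> (q m) = \<beta> (g m)"
    using spo_mapE[OF s, of "\<lambda>n. \<alpha> (f n)" "\<lambda>n. \<beta> (g n)"] by metis
  let ?c = "\<lambda>x. \<gamma> (inv_into D h x)"
  have i: "inv_into D h (h x) = x" if "x \<in> D" for x using h that by (simp add: bij_betw_def)
  have "?c (p' n) = \<alpha> n" if n: "n \<in> L'" for n
  proof -
    obtain x where x: "x \<in> L" "n = f x" using n im by blast
    moreover have "p x \<in> D" using spo_L[OF s] x by blast
    ultimately show ?thesis using p c i by simp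
  qed
  moreover have "?c (q' n) = \<beta> n" if n: "n \<in> K'" for n
  proof -
    obtain x where x: "x \<in> K" "n = g x" using n im by blast
    moreover have "q x \<in> D" using spo_K[OF s] x by blast
    ultimately show ?thesis using q c i by simp
  qed
  ultimately show "\<exists>\<gamma>. (\<forall>n\<in>L'. \<gamma> (p' n) = \<alpha> n) \<and> (\<forall>m\<in>K'. \<gamma> (q' m) = \<beta> m)"
    by (intro exI[of _ ?c]) simp
qed

lemma spo_cong:
  assumes "spo J L K D j k p q" "\<And>i. i \<in> J \<Longrightarrow> j i \<in> L \<and> j' i = j i \<and> k i \<in> K \<and> k' i = k i"
    "\<And>n. n \<in> L \<Longrightarrow> p' n = p n" "\<And>m. m \<in> K \<Longrightarrow> q' m = q m"
  shows "spo J L K D j' k' p' q'"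
  using spo_iso[OF assms(1) bij_betw_id bij_betw_id bij_betw_id, of j' k' p' q'] assms(2-) by simp

section \<open>Gluing sets of natural numbers along a span\<close>

abbreviation inl :: "nat \<Rightarrow> nat" where "inl n \<equiv> sum_encode (Inl n)"
abbreviation inr :: "nat \<Rightarrow> nat" where "inr n \<equiv> sum_encode (Inr n)"

lemma sum_image: "sum_encode ` (L <+> K) = inl ` L \<union> inr ` K"
  by auto

text \<open>Each identification is listed in both directions, so the reflexive transitive closure is
  an equivalence relation.\<close>

definition glue :: "nat set \<Rightarrow> (nat \<Rightarrow> nat) \<Rightarrow> (nat \<Rightarrow> nat) \<Rightarrow> (nat \<times> nat) set" where
  "glue J j k = (\<Union>i\<in>J. {(inl (j i), inr (k i)), (inr (k i), inl (j i))})\<^sup>*"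

text \<open>Least representatives realise the quotient as a set of natural numbers again, as the
  type of nodes demands.\<close>

definition gluer :: "nat set \<Rightarrow> (nat \<Rightarrow> nat) \<Rightarrow> (nat \<Rightarrow> nat) \<Rightarrow> nat \<Rightarrow> nat" where
  "gluer J j k x = (LEAST y. (x, y) \<in> glue J j k)"

lemma glue_invariant:
  assumes "(x, y) \<in> glue J j k" "\<And>i. i \<in> J \<Longrightarrow> f (inl (j i)) = f (inr (k i))"
  shows "f x = f y"
  using assms(1) unfolding glue_def by (induction rule: rtrancl_induct) (use assms(2) in auto)

lemma gluer_glue: "(x, gluer J j k x) \<in> glue J j k"
  unfolding gluer_def by (rule LeastI[of _ x]) (simp add: glue_def)

lemma gluer_invariant:
  assumes "\<And>i. i \<in> J \<Longrightarrow> f (inl (j i)) = f (inr (k i))"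
  shows "f (gluer J j k x) = f x"
proof -
  have "f x = f (gluer J j k x)" by (rule glue_invariant[OF gluer_glue]) (rule assms)
  then show ?thesis by (rule sym)
qed

lemma glue_trans: "(x, y) \<in> glue J j k \<Longrightarrow> (y, z) \<in> glue J j k \<Longrightarrow> (x, z) \<in> glue J j k"
  unfolding glue_def by (rule rtrancl_trans)

lemma gluer_eq: assumes "i \<in> J" shows "gluer J j k (inl (j i)) = gluer J j k (inr (k i))"
proof -
  have a: "(inl (j i), inr (k i)) \<in> glue J j k" "(inr (k i), inl (j i)) \<in> glue J j k"
    using assms unfolding glue_def by (auto intro!: r_into_rtrancl)
  have "(inl (j i), y) \<in> glue J j k \<longleftrightarrow> (inr (k i), y) \<in> glue J j k" for y
    using glue_trans[OF a(1)] glue_trans[OF a(2)] by blast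
  then show ?thesis by (simp add: gluer_def)
qed

lemma spo_gluer:
  "spo J L K (gluer J j k ` (inl ` L \<union> inr ` K)) j k (\<lambda>n. gluer J j k (inl n)) (\<lambda>m. gluer J j k (inr m))"
proof (rule spoI)
  fix \<alpha> \<beta> :: "nat \<Rightarrow> nat" assume ab: "\<forall>i\<in>J. \<alpha> (j i) = \<beta> (k i)"
  \<comment> \<open>The copairing is constant on the classes, so it already serves as the induced
    function on representatives.\<close>
  let ?g = "case_sum \<alpha> \<beta> \<circ> sum_decode"
  have "?g (gluer J j k x) = ?g x" for x by (rule gluer_invariant) (use ab in simp)
  then have "(\<forall>n\<in>L. ?g (gluer J j k (inl n)) = \<alpha> n) \<and> (\<forall>m\<in>K. ?g (gluer J j k (inr m)) = \<beta> m)" by simp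
  then show "\<exists>\<gamma>. (\<forall>n\<in>L. \<gamma> (gluer J j k (inl n)) = \<alpha> n) \<and> (\<forall>m\<in>K. \<gamma> (gluer J j k (inr m)) = \<beta> m)"
    by (intro exI[of _ ?g]) simp
next
  show "gluer J j k (inl (j i)) = gluer J j k (inr (k i))" if "i \<in> J" for i
    using that by (rule gluer_eq)
qed (unfold image_Un image_image, blast+)

section \<open>Hypergraphs, homomorphisms and pushouts over discrete interfaces\<close>

lemma hsum_simps [simp]:
  "nodes (hsum G H) = (inl ` nodes G \<union> inr ` nodes H)"
  "edges (hsum G H) = (inl ` edges G \<union> inr ` edges H)"
  "nlabel (hsum G H) (inl n) = nlabel G n" "nlabel (hsum G H) (inr n) = nlabel H n"
  "elabel (hsum G H) (inl n) = elabel G n" "elabel (hsum G H) (inr n) = elabel H n"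
  "sources (hsum G H) (inl n) = map inl (sources G n)" "sources (hsum G H) (inr n) = map inr (sources H n)"
  "targets (hsum G H) (inl n) = map inl (targets G n)" "targets (hsum G H) (inr n) = map inr (targets H n)"
  by (simp_all add: hsum_def sum_image)

lemma discrete_simps [simp]:
  "nodes (discrete w) = {..<length w}" "edges (discrete w) = {}" "nlabel (discrete w) = (!) w"
  by (simp_all add: discrete_def)

lemma hcomp_simps [simp]: "nmap (hcomp f g) n = nmap g (nmap f n)" "emap (hcomp f g) n = emap g (emap f n)"
  by (simp_all add: hcomp_def)

lemma hid_simps [simp]: "nmap hid n = n" "emap hid n = n"
  by (simp_all add: hid_def)

lemma homI:
  assumes "\<And>n. n \<in> nodes G \<Longrightarrow> nmap f n \<in> nodes H \<and> nlabel H (nmap f n) = nlabel G n"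
    "\<And>e. e \<in> edges G \<Longrightarrow> emap f e \<in> edges H \<and> elabel H (emap f e) = elabel G e \<and>
        sources H (emap f e) = map (nmap f) (sources G e) \<and> targets H (emap f e) = map (nmap f) (targets G e)"
  shows "f \<in> hyp_hom G H"
  using assms by (auto simp: hyp_hom_def)

lemma hom_node: "f \<in> hyp_hom G H \<Longrightarrow> n \<in> nodes G \<Longrightarrow> nmap f n \<in> nodes H"
  and hom_nlabel: "f \<in> hyp_hom G H \<Longrightarrow> n \<in> nodes G \<Longrightarrow> nlabel H (nmap f n) = nlabel G n"
  and hom_edge: "f \<in> hyp_hom G H \<Longrightarrow> e \<in> edges G \<Longrightarrow> emap f e \<in> edges H"
  and hom_elabel: "f \<in> hyp_hom G H \<Longrightarrow> e \<in> edges G \<Longrightarrow> elabel H (emap f e) = elabel G e"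
  and hom_sources: "f \<in> hyp_hom G H \<Longrightarrow> e \<in> edges G \<Longrightarrow> sources H (emap f e) = map (nmap f) (sources G e)"
  and hom_targets: "f \<in> hyp_hom G H \<Longrightarrow> e \<in> edges G \<Longrightarrow> targets H (emap f e) = map (nmap f) (targets G e)"
  by (auto simp: hyp_hom_def)

lemma Hyp_attached:
  assumes "G \<in> Hyp T" "e \<in> edges G"
  shows "set (sources G e) \<subseteq> nodes G" "set (targets G e) \<subseteq> nodes G"
    "map (nlabel G) (sources G e) = arity T (elabel G e)"
    "map (nlabel G) (targets G e) = coarity T (elabel G e)" "elabel G e \<in> ops T"
  using assms by (simp_all add: Hyp_def)

lemma Hyp_node: "G \<in> Hyp T \<Longrightarrow> n \<in> nodes G \<Longrightarrow> nlabel G n \<in> colours T"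
  and Hyp_finite: "G \<in> Hyp T \<Longrightarrow> finite (nodes G)" "G \<in> Hyp T \<Longrightarrow> finite (edges G)"
  by (auto simp: Hyp_def)

lemma HypI:
  assumes "finite (nodes G)" "finite (edges G)" "\<And>n. n \<in> nodes G \<Longrightarrow> nlabel G n \<in> colours T"
    and "\<And>e. e \<in> edges G \<Longrightarrow> elabel G e \<in> ops T \<and>
        set (sources G e) \<subseteq> nodes G \<and> set (targets G e) \<subseteq> nodes G \<and>
        map (nlabel G) (sources G e) = arity T (elabel G e) \<and>
        map (nlabel G) (targets G e) = coarity T (elabel G e)"
  shows "G \<in> Hyp T"
  using assms by (simp add: Hyp_def)

lemma hcomp_hom: "f \<in> hyp_hom G H \<Longrightarrow> g \<in> hyp_hom H K \<Longrightarrow> hcomp f g \<in> hyp_hom G K"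
  by (rule homI) (auto simp: hom_node hom_nlabel hom_edge hom_elabel hom_sources hom_targets)

lemma hid_hom: "hid \<in> hyp_hom G G"
  by (rule homI) (simp_all add: hid_def)

text \<open>Used in two ways: \<open>c\<close> picks representatives in the construction of
  pushouts, and it sends one node to another when a comultiplication glues them. Hyperedges keep
  their names, as gluing along nodes never identifies them.\<close>

definition hquot :: "('c, 'o) hypergraph \<Rightarrow> (nat \<Rightarrow> nat) \<Rightarrow> ('c, 'o) hypergraph" where
  "hquot G c = G \<lparr> nodes := c ` nodes G, sources := map c \<circ> sources G, targets := map c \<circ> targets G \<rparr>"

lemma hquot_simps [simp]:
  "nodes (hquot G c) = c ` nodes G" "edges (hquot G c) = edges G" "nlabel (hquot G c) = nlabel G"
  "elabel (hquot G c) = elabel G" "sources (hquot G c) e = map c (sources G e)" "targets (hquot G c) e = map c (targets G e)"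
  by (simp_all add: hquot_def)

lemma hquot_Hyp:
  assumes "G \<in> Hyp T" "\<And>n. n \<in> nodes G \<Longrightarrow> nlabel G (c n) = nlabel G n"
  shows "hquot G c \<in> Hyp T"
proof (rule HypI)
  fix e assume "e \<in> edges (hquot G c)"
  then have e: "e \<in> edges G" by simp
  have "map (nlabel G) (map c (sources G e)) = map (nlabel G) (sources G e)"
    "map (nlabel G) (map c (targets G e)) = map (nlabel G) (targets G e)"
    using assms(2) Hyp_attached(1,2)[OF assms(1) e] by auto
  then show "elabel (hquot G c) e \<in> ops T \<and>
        set (sources (hquot G c) e) \<subseteq> nodes (hquot G c) \<and> set (targets (hquot G c) e) \<subseteq> nodes (hquot G c) \<and>
        map (nlabel (hquot G c)) (sources (hquot G c) e) = arity T (elabel (hquot G c) e) \<and>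
        map (nlabel (hquot G c)) (targets (hquot G c) e) = coarity T (elabel (hquot G c) e)"
    using Hyp_attached[OF assms(1) e] by (auto simp del: map_map)
qed (use assms Hyp_finite[OF assms(1)] Hyp_node[OF assms(1)] in auto)

lemma hsum_Hyp:
  assumes "G \<in> Hyp T" "H \<in> Hyp T" shows "hsum G H \<in> Hyp T"
proof (rule HypI)
  fix e assume "e \<in> edges (hsum G H)"
  then consider d where "d \<in> edges G" "e = inl d" | d where "d \<in> edges H" "e = inr d" by auto
  then show "elabel (hsum G H) e \<in> ops T \<and>
        set (sources (hsum G H) e) \<subseteq> nodes (hsum G H) \<and> set (targets (hsum G H) e) \<subseteq> nodes (hsum G H) \<and>
        map (nlabel (hsum G H)) (sources (hsum G H) e) = arity T (elabel (hsum G H) e) \<and>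
        map (nlabel (hsum G H)) (targets (hsum G H) e) = coarity T (elabel (hsum G H) e)"
    by cases (use Hyp_attached[OF assms(1)] Hyp_attached[OF assms(2)] in \<open>force simp: comp_def sum_image\<close>)+
qed (use assms in \<open>auto simp: Hyp_finite Hyp_node\<close>)

lemma discrete_Hyp: "w \<in> lists (colours T) \<Longrightarrow> discrete w \<in> Hyp T"
  by (auto simp: Hyp_def)

lemma discrete_hom:
  "f \<in> hyp_hom (discrete w) G \<longleftrightarrow> (\<forall>i<length w. nmap f i \<in> nodes G \<and> nlabel G (nmap f i) = w ! i)"
  by (auto simp: hyp_hom_def)

lemma discrete_heq: "heq (discrete w) f g \<longleftrightarrow> (\<forall>i<length w. nmap f i = nmap g i)"
  by (auto simp: heq_def)

text \<open>Nodes and hyperedges are glued separately. The induced functions fit together to a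
  homomorphism, and are unique, because every node and hyperedge of \<open>G\<close> comes from
  \<open>L\<close> or \<open>K\<close>.\<close>

lemma pushout_intro:
  assumes "J \<in> Hyp T" "L \<in> Hyp T" "K \<in> Hyp T" "G \<in> Hyp T" "j \<in> hyp_hom J L" "k \<in> hyp_hom J K"
    and p: "p \<in> hyp_hom L G" and q: "q \<in> hyp_hom K G"
    and n: "spo (nodes J) (nodes L) (nodes K) (nodes G) (nmap j) (nmap k) (nmap p) (nmap q)"
    and e: "spo (edges J) (edges L) (edges K) (edges G) (emap j) (emap k) (emap p) (emap q)"
  shows "pushout T J L K G j k p q"
  unfolding pushout_def
proof (intro conjI ballI impI)
  show "heq J (hcomp j p) (hcomp k q)" using spo_comm[OF n] spo_comm[OF e] by (auto simp: heq_def)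
  fix X p' q' assume X: "X \<in> Hyp T" and p': "p' \<in> hyp_hom L X" and q': "q' \<in> hyp_hom K X"
    and c: "heq J (hcomp j p') (hcomp k q')"
  obtain \<gamma> where g: "\<And>x. x \<in> nodes L \<Longrightarrow> \<gamma> (nmap p x) = nmap p' x" "\<And>x. x \<in> nodes K \<Longrightarrow> \<gamma> (nmap q x) = nmap q' x"
    using spo_mapE[OF n, of "nmap p'" "nmap q'"] c by (auto simp: heq_def)
  obtain \<epsilon> where h: "\<And>x. x \<in> edges L \<Longrightarrow> \<epsilon> (emap p x) = emap p' x" "\<And>x. x \<in> edges K \<Longrightarrow> \<epsilon> (emap q x) = emap q' x"
    using spo_mapE[OF e, of "emap p'" "emap q'"] c by (auto simp: heq_def)
  let ?h = "\<lparr> nmap = \<gamma>, emap = \<epsilon> \<rparr>"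
  have "?h \<in> hyp_hom G X"
  proof (rule homI)
    show "nmap ?h x \<in> nodes X \<and> nlabel X (nmap ?h x) = nlabel G x" if "x \<in> nodes G" for x
      using n that
      by (rule spo_cases) (use p q p' q' g in \<open>auto simp: hom_node hom_nlabel\<close>)
    have 1: "map (\<lambda>x. \<gamma> (nmap p x)) (sources L x) = map (nmap p') (sources L x)"
       "map (\<lambda>x. \<gamma> (nmap p x)) (targets L x) = map (nmap p') (targets L x)" if "x \<in> edges L" for x
      using Hyp_attached[OF assms(2) that] g by auto
    have 2: "map (\<lambda>x. \<gamma> (nmap q x)) (sources K x) = map (nmap q') (sources K x)"
       "map (\<lambda>x. \<gamma> (nmap q x)) (targets K x) = map (nmap q') (targets K x)" if "x \<in> edges K" for x
      using Hyp_attached[OF assms(3) that] g by auto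
    show "emap ?h x \<in> edges X \<and> elabel X (emap ?h x) = elabel G x \<and>
        sources X (emap ?h x) = map (nmap ?h) (sources G x) \<and> targets X (emap ?h x) = map (nmap ?h) (targets G x)"
      if "x \<in> edges G" for x
      using e that
      by (rule spo_cases)
        (use p q p' q' h 1 2 in \<open>auto simp: hom_edge hom_elabel hom_sources hom_targets comp_def simp del: map_eq_conv\<close>)
  qed
  moreover have "heq L (hcomp p ?h) p'" "heq K (hcomp q ?h) q'" using g h by (auto simp: heq_def)
  moreover have "heq G h' ?h" if "heq L (hcomp p h') p'" "heq K (hcomp q h') q'" for h'
    unfolding heq_def
  proof (intro conjI ballI)
    fix x assume "x \<in> nodes G"
    with n show "nmap h' x = nmap ?h x" by (rule spo_cases) (use that g in \<open>auto simp: heq_def\<close>)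
  next
    fix x assume "x \<in> edges G"
    with e show "emap h' x = emap ?h x" by (rule spo_cases) (use that h in \<open>auto simp: heq_def\<close>)
  qed
  ultimately show "\<exists>h\<in>hyp_hom G X. heq L (hcomp p h) p' \<and> heq K (hcomp q h) q' \<and>
           (\<forall>h'\<in>hyp_hom G X. heq L (hcomp p h') p' \<and> heq K (hcomp q h') q' \<longrightarrow> heq G h' h)" by blast
qed (use assms in auto)

lemma spo_empty: "spo {} L K ((inl ` L \<union> inr ` K)) j k inl inr"
proof (rule spoI)
  fix \<alpha> \<beta> :: "nat \<Rightarrow> nat"
  show "\<exists>\<gamma>. (\<forall>n\<in>L. \<gamma> (inl n) = \<alpha> n) \<and> (\<forall>m\<in>K. \<gamma> (inr m) = \<beta> m)"
    by (rule exI[of _ "case_sum \<alpha> \<beta> \<circ> sum_decode"]) simp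
qed auto

text \<open>The pushout is the disjoint union with nodes identified along \<open>J\<close>. The
  set-level facts are part of the result because \<open>pushout_spo\<close> transfers them to every
  other pushout.\<close>

lemma pushout_ex:
  assumes J: "J \<in> Hyp T" "edges J = {}" and L: "L \<in> Hyp T" and K: "K \<in> Hyp T"
    and j: "j \<in> hyp_hom J L" and k: "k \<in> hyp_hom J K"
  shows "\<exists>G p q. pushout T J L K G j k p q \<and>
    spo (nodes J) (nodes L) (nodes K) (nodes G) (nmap j) (nmap k) (nmap p) (nmap q) \<and>
    spo {} (edges L) (edges K) (edges G) (emap j) (emap k) (emap p) (emap q)"
proof -
  let ?c = "gluer (nodes J) (nmap j) (nmap k)"
  let ?G = "hquot (hsum L K) ?c"
  let ?p = "\<lparr> nmap = \<lambda>n. ?c (inl n), emap = inl \<rparr>" and ?q = "\<lparr> nmap = \<lambda>n. ?c (inr n), emap = inr \<rparr>"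
  have lab: "nlabel (hsum L K) (?c n) = nlabel (hsum L K) n" for n
    by (rule gluer_invariant) (use j k in \<open>simp add: hom_nlabel\<close>)
  have G: "?G \<in> Hyp T" by (rule hquot_Hyp[OF hsum_Hyp[OF L K] lab])
  have p: "?p \<in> hyp_hom L ?G" and q: "?q \<in> hyp_hom K ?G"
    by (auto intro!: homI simp: lab)
  have n: "spo (nodes J) (nodes L) (nodes K) (nodes ?G) (nmap j) (nmap k) (nmap ?p) (nmap ?q)"
    using spo_gluer by simp
  have e: "spo {} (edges L) (edges K) (edges ?G) (emap j) (emap k) (emap ?p) (emap ?q)"
    using spo_empty by simp
  have "pushout T J L K ?G j k ?p ?q"
    by (rule pushout_intro[OF J(1) L K G j k p q n]) (use e J in simp)
  with n e show ?thesis by blast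
qed

lemma hyp_isoI:
  assumes f: "f \<in> hyp_hom G H" and g: "g \<in> hyp_hom H G"
    and "heq G (hcomp f g) hid" "heq H (hcomp g f) hid"
  shows "f \<in> hyp_iso G H"
proof -
  have "bij_betw (nmap f) (nodes G) (nodes H)"
    by (rule bij_betw_byWitness[where f' = "nmap g"]) (use assms in \<open>auto simp: heq_def hom_node\<close>)
  moreover have "bij_betw (emap f) (edges G) (edges H)"
    by (rule bij_betw_byWitness[where f' = "emap g"]) (use assms in \<open>auto simp: heq_def hom_edge\<close>)
  ultimately show ?thesis using f by (simp add: hyp_iso_def)
qed

lemma heq_refl: "heq G f f" and heq_sym: "heq G f g \<Longrightarrow> heq G g f"
  and heq_trans: "heq G f g \<Longrightarrow> heq G g h \<Longrightarrow> heq G f h"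
  by (auto simp: heq_def)

lemma pushout_endo:
  assumes P: "pushout T J L K G j k p q" and f: "f \<in> hyp_hom G G"
    and "heq L (hcomp p f) p" "heq K (hcomp q f) q"
  shows "heq G f hid"
proof -
  have "G \<in> Hyp T" "p \<in> hyp_hom L G" "q \<in> hyp_hom K G" "heq J (hcomp j p) (hcomp k q)"
    using P by (auto simp: pushout_def)
  then obtain h where "\<forall>h'\<in>hyp_hom G G. heq L (hcomp p h') p \<and> heq K (hcomp q h') q \<longrightarrow> heq G h' h"
    using P unfolding pushout_def by blast
  moreover have "heq L (hcomp p hid) p" "heq K (hcomp q hid) q" by (auto simp: heq_def)
  ultimately show ?thesis using assms hid_hom heq_trans heq_sym by blast
qed

lemma pushout_unique:
  assumes P: "pushout T J L K G j k p q" and Q: "pushout T J L K H j k p' q'"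
  obtains f where "f \<in> hyp_iso G H" "heq L (hcomp p f) p'" "heq K (hcomp q f) q'"
proof -
  obtain f where f: "f \<in> hyp_hom G H" "heq L (hcomp p f) p'" "heq K (hcomp q f) q'"
    using P Q unfolding pushout_def by blast
  obtain g where g: "g \<in> hyp_hom H G" "heq L (hcomp p' g) p" "heq K (hcomp q' g) q"
    using P Q unfolding pushout_def by blast
  have "p \<in> hyp_hom L G" "q \<in> hyp_hom K G" "p' \<in> hyp_hom L H" "q' \<in> hyp_hom K H"
    using P Q by (auto simp: pushout_def)
  then have "heq G (hcomp f g) hid"
    using f g by (intro pushout_endo[OF P] hcomp_hom) (auto simp: heq_def)
  moreover have "heq H (hcomp g f) hid"
    using f g by (intro pushout_endo[OF Q] hcomp_hom) (auto simp: heq_def)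
  ultimately show thesis using that f g hyp_isoI by blast
qed

text \<open>The universal property speaks of label-preserving homomorphisms, so it cannot be tested
  directly on arbitrary functions. Instead the concrete pushout, whose set-level property is known,
  is compared with \<open>G\<close> through an isomorphism.\<close>

lemma pushout_spo:
  assumes P: "pushout T J L K G j k p q" and J: "edges J = {}"
  shows "spo (nodes J) (nodes L) (nodes K) (nodes G) (nmap j) (nmap k) (nmap p) (nmap q)"
    and "spo {} (edges L) (edges K) (edges G) (emap j) (emap k) (emap p) (emap q)"
proof -
  have hyp: "J \<in> Hyp T" "L \<in> Hyp T" "K \<in> Hyp T" "j \<in> hyp_hom J L" "k \<in> hyp_hom J K"
    using P by (auto simp: pushout_def)
  obtain H p' q' where H: "pushout T J L K H j k p' q'"
    and n: "spo (nodes J) (nodes L) (nodes K) (nodes H) (nmap j) (nmap k) (nmap p') (nmap q')"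
    and e: "spo {} (edges L) (edges K) (edges H) (emap j) (emap k) (emap p') (emap q')"
    using pushout_ex[OF hyp(1) J hyp(2-5)] by blast
  obtain f where f: "f \<in> hyp_iso H G" "heq L (hcomp p' f) p" "heq K (hcomp q' f) q"
    using pushout_unique[OF H P] by blast
  show "spo (nodes J) (nodes L) (nodes K) (nodes G) (nmap j) (nmap k) (nmap p) (nmap q)"
    by (rule spo_iso[OF n bij_betw_id bij_betw_id, where h = "nmap f"])
      (use f hyp in \<open>auto simp: hyp_iso_def heq_def hom_node\<close>)
  show "spo {} (edges L) (edges K) (edges G) (emap j) (emap k) (emap p) (emap q)"
    by (rule spo_iso[OF e bij_betw_id bij_betw_id, where h = "emap f"])
      (use f hyp in \<open>auto simp: hyp_iso_def heq_def hom_node\<close>)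
qed

section \<open>The prop of cospans\<close>

lemma hyp_iso_hom: "f \<in> hyp_iso G H \<Longrightarrow> f \<in> hyp_hom G H"
  by (simp add: hyp_iso_def)

lemma hyp_iso_inverse:
  assumes f: "f \<in> hyp_iso G H" and G: "G \<in> Hyp T"
  obtains g where "g \<in> hyp_iso H G" "heq G (hcomp f g) hid" "heq H (hcomp g f) hid"
proof -
  have fh: "f \<in> hyp_hom G H" and bn: "bij_betw (nmap f) (nodes G) (nodes H)"
    and be: "bij_betw (emap f) (edges G) (edges H)"
    using f by (auto simp: hyp_iso_def)
  let ?g = "\<lparr> nmap = inv_into (nodes G) (nmap f), emap = inv_into (edges G) (emap f) \<rparr>"
  have gn: "nmap ?g (nmap f n) = n" if "n \<in> nodes G" for n using bij_betw_inv_into_left[OF bn that] by simp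
  have ge: "emap ?g (emap f n) = n" if "n \<in> edges G" for n using bij_betw_inv_into_left[OF be that] by simp
  have Hn: "\<exists>m\<in>nodes G. n = nmap f m" if "n \<in> nodes H" for n using bn that by (auto simp: bij_betw_def)
  have He: "\<exists>m\<in>edges G. n = emap f m" if "n \<in> edges H" for n using be that by (auto simp: bij_betw_def)
  have "?g \<in> hyp_hom H G"
  proof (rule homI)
    show "nmap ?g n \<in> nodes G \<and> nlabel G (nmap ?g n) = nlabel H n" if n: "n \<in> nodes H" for n
      using Hn[OF n] gn hom_nlabel[OF fh] by auto
    show "emap ?g e \<in> edges G \<and> elabel G (emap ?g e) = elabel H e \<and>
        sources G (emap ?g e) = map (nmap ?g) (sources H e) \<and> targets G (emap ?g e) = map (nmap ?g) (targets H e)"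
      if "e \<in> edges H" for e
    proof -
      obtain d where d: "d \<in> edges G" "e = emap f d" using He[OF \<open>e \<in> edges H\<close>] by blast
      have "map (nmap ?g) (map (nmap f) (sources G d)) = sources G d"
        "map (nmap ?g) (map (nmap f) (targets G d)) = targets G d"
        using gn Hyp_attached(1,2)[OF G d(1)] by (auto intro!: map_idI simp del: select_convs)
      then show ?thesis
        using d ge hom_elabel[OF fh d(1)] hom_sources[OF fh d(1)] hom_targets[OF fh d(1)] by simp
    qed
  qed
  moreover have "heq G (hcomp f ?g) hid" using gn ge by (simp add: heq_def)
  moreover have "heq H (hcomp ?g f) hid"
    using bij_betw_inv_into_right[OF bn] bij_betw_inv_into_right[OF be] by (simp add: heq_def)
  ultimately show thesis using that hyp_isoI[OF _ fh] by blast
qed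

lemma hyp_iso_comp: "f \<in> hyp_iso G H \<Longrightarrow> g \<in> hyp_iso H K \<Longrightarrow> hcomp f g \<in> hyp_iso G K"
  unfolding hyp_iso_def by (auto simp: hcomp_hom) (auto simp: hcomp_def intro: bij_betw_trans)

lemma CospanD:
  assumes "c \<in> Cospan T"
  shows "csrc c \<in> lists (colours T)" "ctgt c \<in> lists (colours T)" "apex c \<in> Hyp T"
    "lleg c \<in> hyp_hom (discrete (csrc c)) (apex c)" "rleg c \<in> hyp_hom (discrete (ctgt c)) (apex c)"
    "\<And>i. i < length (csrc c) \<Longrightarrow> nmap (lleg c) i \<in> nodes (apex c)"
    "\<And>i. i < length (csrc c) \<Longrightarrow> nlabel (apex c) (nmap (lleg c) i) = csrc c ! i"
    "\<And>i. i < length (ctgt c) \<Longrightarrow> nmap (rleg c) i \<in> nodes (apex c)"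
    "\<And>i. i < length (ctgt c) \<Longrightarrow> nlabel (apex c) (nmap (rleg c) i) = ctgt c ! i"
  using assms by (auto simp: Cospan_def discrete_hom)

lemma CospanI:
  assumes "csrc c \<in> lists (colours T)" "ctgt c \<in> lists (colours T)" "apex c \<in> Hyp T"
    "\<And>i. i < length (csrc c) \<Longrightarrow> nmap (lleg c) i \<in> nodes (apex c) \<and> nlabel (apex c) (nmap (lleg c) i) = csrc c ! i"
    "\<And>i. i < length (ctgt c) \<Longrightarrow> nmap (rleg c) i \<in> nodes (apex c) \<and> nlabel (apex c) (nmap (rleg c) i) = ctgt c ! i"
  shows "c \<in> Cospan T"
  using assms by (auto simp: Cospan_def discrete_hom)

lemma cospan_isoI:
  assumes "csrc c = csrc d" "ctgt c = ctgt d" "f \<in> hyp_iso (apex c) (apex d)"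
    "\<And>i. i < length (csrc c) \<Longrightarrow> nmap f (nmap (lleg c) i) = nmap (lleg d) i"
    "\<And>i. i < length (ctgt c) \<Longrightarrow> nmap f (nmap (rleg c) i) = nmap (rleg d) i"
  shows "cospan_iso c d"
  using assms by (auto simp: cospan_iso_def discrete_heq)

lemma cospan_isoE:
  assumes "cospan_iso c d"
  obtains f where "csrc c = csrc d" "ctgt c = ctgt d" "f \<in> hyp_iso (apex c) (apex d)"
    "\<forall>i<length (csrc c). nmap f (nmap (lleg c) i) = nmap (lleg d) i"
    "\<forall>i<length (ctgt c). nmap f (nmap (rleg c) i) = nmap (rleg d) i"
  using assms by (auto simp: cospan_iso_def discrete_heq)

lemma cospan_iso_refl: "cospan_iso c c"
  by (rule cospan_isoI[where f = hid]) (auto simp: hyp_iso_def hid_hom, auto simp: hid_def bij_betw_def)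

lemma cospan_iso_sym: assumes "cospan_iso c d" "c \<in> Cospan T" shows "cospan_iso d c"
  using assms(1)
proof (rule cospan_isoE)
  fix f assume f: "csrc c = csrc d" "ctgt c = ctgt d" "f \<in> hyp_iso (apex c) (apex d)"
    "\<forall>i<length (csrc c). nmap f (nmap (lleg c) i) = nmap (lleg d) i"
    "\<forall>i<length (ctgt c). nmap f (nmap (rleg c) i) = nmap (rleg d) i"
  obtain g where g: "g \<in> hyp_iso (apex d) (apex c)" "heq (apex c) (hcomp f g) hid"
    using hyp_iso_inverse[OF f(3)] CospanD(3)[OF assms(2)] by blast
  have "nmap g (nmap f n) = n" if "n \<in> nodes (apex c)" for n using g(2) that by (simp add: heq_def)
  then show ?thesis
    using f CospanD(6,8)[OF assms(2)] by (intro cospan_isoI[OF _ _ g(1)]) (metis | simp)+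
qed

lemma cospan_iso_trans: assumes "cospan_iso c d" "cospan_iso d e" shows "cospan_iso c e"
  using assms(1)
proof (rule cospan_isoE)
  fix f assume f: "csrc c = csrc d" "ctgt c = ctgt d" "f \<in> hyp_iso (apex c) (apex d)"
    "\<forall>i<length (csrc c). nmap f (nmap (lleg c) i) = nmap (lleg d) i"
    "\<forall>i<length (ctgt c). nmap f (nmap (rleg c) i) = nmap (rleg d) i"
  from assms(2) show ?thesis
  proof (rule cospan_isoE)
    fix g assume g: "csrc d = csrc e" "ctgt d = ctgt e" "g \<in> hyp_iso (apex d) (apex e)"
      "\<forall>i<length (csrc d). nmap g (nmap (lleg d) i) = nmap (lleg e) i"
      "\<forall>i<length (ctgt d). nmap g (nmap (rleg d) i) = nmap (rleg e) i"
    show ?thesis using f g by (intro cospan_isoI[OF _ _ hyp_iso_comp[OF f(3) g(3)]]) simp_all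
  qed
qed

lemma is_compositeI:
  assumes c: "c \<in> Cospan T" and d: "d \<in> Cospan T" and e: "e \<in> Cospan T"
    and "ctgt c = csrc d" "csrc e = csrc c" "ctgt e = ctgt d"
    and p: "p \<in> hyp_hom (apex c) (apex e)" and q: "q \<in> hyp_hom (apex d) (apex e)"
    and n: "spo {..<length (ctgt c)} (nodes (apex c)) (nodes (apex d)) (nodes (apex e)) (nmap (rleg c)) (nmap (lleg d)) (nmap p) (nmap q)"
    and m: "spo {} (edges (apex c)) (edges (apex d)) (edges (apex e)) (emap (rleg c)) (emap (lleg d)) (emap p) (emap q)"
    and "\<And>i. i < length (csrc c) \<Longrightarrow> nmap (lleg e) i = nmap p (nmap (lleg c) i)"
    and "\<And>i. i < length (ctgt d) \<Longrightarrow> nmap (rleg e) i = nmap q (nmap (rleg d) i)"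
  shows "is_composite T c d e"
proof -
  have "pushout T (discrete (ctgt c)) (apex c) (apex d) (apex e) (rleg c) (lleg d) p q"
    using CospanD[OF c] CospanD[OF d] CospanD[OF e] assms(4) n m
    by (intro pushout_intro discrete_Hyp p q) simp_all
  then show ?thesis unfolding is_composite_def using assms(4-6,11,12)
    by (intro conjI exI[of _ p] exI[of _ q]) (simp_all add: discrete_heq)
qed

lemma pushoutD:
  assumes "pushout T J L K G j k p q"
  shows "p \<in> hyp_hom L G" "q \<in> hyp_hom K G" "G \<in> Hyp T"
  subgoal using assms unfolding pushout_def by (elim conjE) assumption
  subgoal using assms unfolding pushout_def by (elim conjE) assumption
  subgoal using assms unfolding pushout_def by (elim conjE) assumption
  done

lemma is_compositeE:
  assumes "is_composite T c d e"
  obtains p q where "ctgt c = csrc d" "csrc e = csrc c" "ctgt e = ctgt d"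
    "p \<in> hyp_hom (apex c) (apex e)" "q \<in> hyp_hom (apex d) (apex e)"
    "spo {..<length (ctgt c)} (nodes (apex c)) (nodes (apex d)) (nodes (apex e)) (nmap (rleg c)) (nmap (lleg d)) (nmap p) (nmap q)"
    "spo {} (edges (apex c)) (edges (apex d)) (edges (apex e)) (emap (rleg c)) (emap (lleg d)) (emap p) (emap q)"
    "\<forall>i<length (csrc c). nmap (lleg e) i = nmap p (nmap (lleg c) i)"
    "\<forall>i<length (ctgt d). nmap (rleg e) i = nmap q (nmap (rleg d) i)"
    "pushout T (discrete (ctgt c)) (apex c) (apex d) (apex e) (rleg c) (lleg d) p q"
proof -
  have eq: "ctgt c = csrc d" "csrc e = csrc c" "ctgt e = ctgt d"
    using assms by (simp_all add: is_composite_def)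
  have ex: "\<exists>p q. pushout T (discrete (ctgt c)) (apex c) (apex d) (apex e) (rleg c) (lleg d) p q \<and>
      heq (discrete (csrc c) :: ('a, 'b) hypergraph) (lleg e) (hcomp (lleg c) p) \<and>
      heq (discrete (ctgt d) :: ('a, 'b) hypergraph) (rleg e) (hcomp (rleg d) q)"
    using assms unfolding is_composite_def by (elim conjE) assumption
  from ex obtain p q where po: "pushout T (discrete (ctgt c)) (apex c) (apex d) (apex e) (rleg c) (lleg d) p q"
    and leg: "heq (discrete (csrc c) :: ('a, 'b) hypergraph) (lleg e) (hcomp (lleg c) p)"
      "heq (discrete (ctgt d) :: ('a, 'b) hypergraph) (rleg e) (hcomp (rleg d) q)"
    by (elim exE conjE)
  have "\<forall>i<length (csrc c). nmap (lleg e) i = nmap p (nmap (lleg c) i)"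
    "\<forall>i<length (ctgt d). nmap (rleg e) i = nmap q (nmap (rleg d) i)"
    using leg by (simp_all add: discrete_heq)
  moreover have "spo {..<length (ctgt c)} (nodes (apex c)) (nodes (apex d)) (nodes (apex e)) (nmap (rleg c)) (nmap (lleg d)) (nmap p) (nmap q)"
    using pushout_spo(1)[OF po] by simp
  moreover have "spo {} (edges (apex c)) (edges (apex d)) (edges (apex e)) (emap (rleg c)) (emap (lleg d)) (emap p) (emap q)"
    using pushout_spo(2)[OF po] by simp
  ultimately show thesis by (intro that[OF eq(1-3) pushoutD(1,2)[OF po] _ _ _ _ po])
qed

lemma composite_ex:
  assumes c: "c \<in> Cospan T" and d: "d \<in> Cospan T" and "ctgt c = csrc d"
  shows "\<exists>e\<in>Cospan T. is_composite T c d e"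
proof -
  obtain G p q where G: "pushout T (discrete (ctgt c)) (apex c) (apex d) G (rleg c) (lleg d) p q"
    using pushout_ex[OF discrete_Hyp[OF CospanD(2)[OF c]] discrete_simps(2) CospanD(3)[OF c] CospanD(3)[OF d]
      CospanD(5)[OF c] CospanD(4)[OF d, folded assms(3)]] by (elim exE conjE)
  let ?e = "\<lparr> csrc = csrc c, ctgt = ctgt d, apex = G, lleg = hcomp (lleg c) p, rleg = hcomp (rleg d) q \<rparr>"
  have pq: "p \<in> hyp_hom (apex c) G" "q \<in> hyp_hom (apex d) G" "G \<in> Hyp T" using pushoutD[OF G] by auto
  then have "?e \<in> Cospan T"
    using CospanD[OF c] CospanD[OF d] unfolding Cospan_def by (simp add: hcomp_hom)
  moreover have "is_composite T c d ?e"
    unfolding is_composite_def using G assms(3) by (intro conjI exI[of _ p] exI[of _ q]) (simp_all add: heq_refl)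
  ultimately show ?thesis by blast
qed

lemma composite_unique:
  assumes "is_composite T c d e" "is_composite T c d e'" "c \<in> Cospan T" "d \<in> Cospan T"
  shows "cospan_iso e e'"
  using assms(1)
proof (rule is_compositeE)
  fix p q assume 1: "ctgt c = csrc d" "csrc e = csrc c" "ctgt e = ctgt d"
    "\<forall>i<length (csrc c). nmap (lleg e) i = nmap p (nmap (lleg c) i)"
    "\<forall>i<length (ctgt d). nmap (rleg e) i = nmap q (nmap (rleg d) i)"
    "pushout T (discrete (ctgt c)) (apex c) (apex d) (apex e) (rleg c) (lleg d) p q"
  from assms(2) show ?thesis
  proof (rule is_compositeE)
    fix p' q' assume 2: "ctgt c = csrc d" "csrc e' = csrc c" "ctgt e' = ctgt d"
      "\<forall>i<length (csrc c). nmap (lleg e') i = nmap p' (nmap (lleg c) i)"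
      "\<forall>i<length (ctgt d). nmap (rleg e') i = nmap q' (nmap (rleg d) i)"
      "pushout T (discrete (ctgt c)) (apex c) (apex d) (apex e') (rleg c) (lleg d) p' q'"
    obtain f where f: "f \<in> hyp_iso (apex e) (apex e')" "heq (apex c) (hcomp p f) p'" "heq (apex d) (hcomp q f) q'"
      using pushout_unique[OF 1(6) 2(6)] by blast
    show ?thesis
      using 1 2 f CospanD(6)[OF assms(3)] CospanD(8)[OF assms(4)]
      by (intro cospan_isoI[OF _ _ f(1)]) (simp_all add: heq_def)
  qed
qed

text \<open>Composition in \<open>FTerm\<close> goes through chosen representatives, and this is its
  independence of the choice: the set-level gluings are transported along the three
  isomorphisms.\<close>

lemma composite_iso:
  assumes comp: "is_composite T c d e" and iso: "cospan_iso c c'" "cospan_iso d d'" "cospan_iso e e'"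
    and C: "c \<in> Cospan T" "d \<in> Cospan T" "e \<in> Cospan T" "c' \<in> Cospan T" "d' \<in> Cospan T" "e' \<in> Cospan T"
  shows "is_composite T c' d' e'"
proof -
  obtain f where f: "csrc c = csrc c'" "ctgt c = ctgt c'" "f \<in> hyp_iso (apex c) (apex c')"
    "\<forall>i<length (csrc c). nmap f (nmap (lleg c) i) = nmap (lleg c') i"
    "\<forall>i<length (ctgt c). nmap f (nmap (rleg c) i) = nmap (rleg c') i"
    using iso(1) by (elim cospan_isoE)
  obtain g where g: "csrc d = csrc d'" "ctgt d = ctgt d'" "g \<in> hyp_iso (apex d) (apex d')"
    "\<forall>i<length (csrc d). nmap g (nmap (lleg d) i) = nmap (lleg d') i"
    "\<forall>i<length (ctgt d). nmap g (nmap (rleg d) i) = nmap (rleg d') i"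
    using iso(2) by (elim cospan_isoE)
  obtain h where h: "csrc e = csrc e'" "ctgt e = ctgt e'" "h \<in> hyp_iso (apex e) (apex e')"
    "\<forall>i<length (csrc e). nmap h (nmap (lleg e) i) = nmap (lleg e') i"
    "\<forall>i<length (ctgt e). nmap h (nmap (rleg e) i) = nmap (rleg e') i"
    using iso(3) by (elim cospan_isoE)
  obtain p q where pq: "ctgt c = csrc d" "csrc e = csrc c" "ctgt e = ctgt d"
    "p \<in> hyp_hom (apex c) (apex e)" "q \<in> hyp_hom (apex d) (apex e)"
    "spo {..<length (ctgt c)} (nodes (apex c)) (nodes (apex d)) (nodes (apex e)) (nmap (rleg c)) (nmap (lleg d)) (nmap p) (nmap q)"
    "spo {} (edges (apex c)) (edges (apex d)) (edges (apex e)) (emap (rleg c)) (emap (lleg d)) (emap p) (emap q)"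
    "\<forall>i<length (csrc c). nmap (lleg e) i = nmap p (nmap (lleg c) i)"
    "\<forall>i<length (ctgt d). nmap (rleg e) i = nmap q (nmap (rleg d) i)"
    using comp by (elim is_compositeE)
  obtain f' where f': "f' \<in> hyp_iso (apex c') (apex c)" "heq (apex c) (hcomp f f') hid"
    using hyp_iso_inverse[OF f(3) CospanD(3)[OF C(1)]] by blast
  obtain g' where g': "g' \<in> hyp_iso (apex d') (apex d)" "heq (apex d) (hcomp g g') hid"
    using hyp_iso_inverse[OF g(3) CospanD(3)[OF C(2)]] by blast
  note Cc = CospanD[OF C(1)] and Cd = CospanD[OF C(2)]
  let ?p = "hcomp f' (hcomp p h)" and ?q = "hcomp g' (hcomp q h)"
  have hom: "?p \<in> hyp_hom (apex c') (apex e')" "?q \<in> hyp_hom (apex d') (apex e')"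
    using hyp_iso_hom[OF f'(1)] hyp_iso_hom[OF g'(1)] hyp_iso_hom[OF h(3)] pq(4,5) by (auto intro: hcomp_hom)
  have n: "spo {..<length (ctgt c')} (nodes (apex c')) (nodes (apex d')) (nodes (apex e')) (nmap (rleg c')) (nmap (lleg d')) (nmap ?p) (nmap ?q)"
    by (rule spo_iso[where f = "nmap f" and g = "nmap g" and h = "nmap h", OF pq(6)[unfolded f(2)]])
      (use f g h f' g' pq(1) Cc Cd in \<open>auto simp: hyp_iso_def heq_def\<close>)
  have e: "spo {} (edges (apex c')) (edges (apex d')) (edges (apex e')) (emap (rleg c')) (emap (lleg d')) (emap ?p) (emap ?q)"
    by (rule spo_iso[where f = "emap f" and g = "emap g" and h = "emap h", OF pq(7)])
      (use f g h f' g' in \<open>auto simp: hyp_iso_def heq_def\<close>)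
  have l: "nmap (lleg e') i = nmap ?p (nmap (lleg c') i)" if "i < length (csrc c')" for i
    using that f h pq f'(2) Cc(6) by (metis hcomp_simps(1) heq_def hid_simps(1))
  have r: "nmap (rleg e') i = nmap ?q (nmap (rleg d') i)" if "i < length (ctgt d')" for i
    using that g h pq g'(2) Cd(8) by (metis hcomp_simps(1) heq_def hid_simps(1))
  show ?thesis
    by (rule is_compositeI[OF C(4-6) _ _ _ hom n e l r]) (use f g h pq in simp_all)
qed

text \<open>If the right leg of \<open>c\<close> covers all nodes of an edge-free apex, gluing adds
  nothing to \<open>d\<close>: its apex is kept and only the left leg changes. This computes
  composites with identities, symmetries and several Frobenius generators.\<close>

lemma composite_left:
  assumes c: "c \<in> Cospan T" and d: "d \<in> Cospan T" and w: "ctgt c = csrc d"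
    and "edges (apex c) = {}" "nodes (apex c) \<subseteq> nmap (rleg c) ` {..<length (ctgt c)}"
    and p: "p \<in> hyp_hom (apex c) (apex d)"
    and pl: "\<And>i. i < length (ctgt c) \<Longrightarrow> nmap p (nmap (rleg c) i) = nmap (lleg d) i"
    and e: "e \<in> Cospan T" "csrc e = csrc c" "ctgt e = ctgt d" "apex e = apex d"
      "\<And>i. i < length (csrc c) \<Longrightarrow> nmap (lleg e) i = nmap p (nmap (lleg c) i)"
      "\<And>i. i < length (ctgt d) \<Longrightarrow> nmap (rleg e) i = nmap (rleg d) i"
  shows "is_composite T c d e"
proof (rule is_compositeI[where p = p and q = hid])
  show "spo {..<length (ctgt c)} (nodes (apex c)) (nodes (apex d)) (nodes (apex e)) (nmap (rleg c)) (nmap (lleg d)) (nmap p) (nmap hid)"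
  proof (rule spoI)
    fix \<alpha> \<beta> :: "nat \<Rightarrow> nat" assume *: "\<forall>i\<in>{..<length (ctgt c)}. \<alpha> (nmap (rleg c) i) = \<beta> (nmap (lleg d) i)"
    have "\<beta> (nmap p n) = \<alpha> n" if n: "n \<in> nodes (apex c)" for n
    proof -
      obtain i where "i < length (ctgt c)" "n = nmap (rleg c) i" using n assms(5) by auto
      then show ?thesis using * pl by simp
    qed
    then show "\<exists>\<gamma>. (\<forall>n\<in>nodes (apex c). \<gamma> (nmap p n) = \<alpha> n) \<and> (\<forall>m\<in>nodes (apex d). \<gamma> (nmap hid m) = \<beta> m)"
      by (intro exI[of _ \<beta>]) simp
  qed (use pl e p hom_node[OF p] in auto)
  show "spo {} (edges (apex c)) (edges (apex d)) (edges (apex e)) (emap (rleg c)) (emap (lleg d)) (emap p) (emap hid)"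
  proof (rule spoI)
    fix \<alpha> \<beta> :: "nat \<Rightarrow> nat"
    show "\<exists>\<gamma>. (\<forall>n\<in>edges (apex c). \<gamma> (emap p n) = \<alpha> n) \<and> (\<forall>m\<in>edges (apex d). \<gamma> (emap hid m) = \<beta> m)"
      using assms(4) by (intro exI[of _ \<beta>]) simp
  qed (use assms(4) e in auto)
qed (use assms hid_hom in simp_all)

lemma composite_right:
  assumes c: "c \<in> Cospan T" and d: "d \<in> Cospan T" and w: "ctgt c = csrc d"
    and "edges (apex d) = {}" "nodes (apex d) \<subseteq> nmap (lleg d) ` {..<length (ctgt c)}"
    and q: "q \<in> hyp_hom (apex d) (apex c)"
    and ql: "\<And>i. i < length (ctgt c) \<Longrightarrow> nmap q (nmap (lleg d) i) = nmap (rleg c) i"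
    and e: "e \<in> Cospan T" "csrc e = csrc c" "ctgt e = ctgt d" "apex e = apex c"
      "\<And>i. i < length (csrc c) \<Longrightarrow> nmap (lleg e) i = nmap (lleg c) i"
      "\<And>i. i < length (ctgt d) \<Longrightarrow> nmap (rleg e) i = nmap q (nmap (rleg d) i)"
  shows "is_composite T c d e"
proof (rule is_compositeI[where p = hid and q = q])
  show "spo {..<length (ctgt c)} (nodes (apex c)) (nodes (apex d)) (nodes (apex e)) (nmap (rleg c)) (nmap (lleg d)) (nmap hid) (nmap q)"
  proof (rule spoI)
    fix \<alpha> \<beta> :: "nat \<Rightarrow> nat" assume *: "\<forall>i\<in>{..<length (ctgt c)}. \<alpha> (nmap (rleg c) i) = \<beta> (nmap (lleg d) i)"
    have "\<alpha> (nmap q n) = \<beta> n" if n: "n \<in> nodes (apex d)" for n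
    proof -
      obtain i where "i < length (ctgt c)" "n = nmap (lleg d) i" using n assms(5) by auto
      then show ?thesis using * ql by simp
    qed
    then show "\<exists>\<gamma>. (\<forall>n\<in>nodes (apex c). \<gamma> (nmap hid n) = \<alpha> n) \<and> (\<forall>m\<in>nodes (apex d). \<gamma> (nmap q m) = \<beta> m)"
      by (intro exI[of _ \<alpha>]) simp
  qed (use ql e q hom_node[OF q] in auto)
  show "spo {} (edges (apex c)) (edges (apex d)) (edges (apex e)) (emap (rleg c)) (emap (lleg d)) (emap hid) (emap q)"
  proof (rule spoI)
    fix \<alpha> \<beta> :: "nat \<Rightarrow> nat"
    show "\<exists>\<gamma>. (\<forall>n\<in>edges (apex c). \<gamma> (emap hid n) = \<alpha> n) \<and> (\<forall>m\<in>edges (apex d). \<gamma> (emap q m) = \<beta> m)"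
      using assms(4) by (intro exI[of _ \<alpha>]) simp
  qed (use assms(4) e in auto)
qed (use assms hid_hom in simp_all)

lemma composite_assoc:
  assumes 1: "is_composite T c d e1" and 2: "is_composite T e1 f e2" and 3: "is_composite T d f g"
    and C: "c \<in> Cospan T" "d \<in> Cospan T" "f \<in> Cospan T" "e1 \<in> Cospan T" "e2 \<in> Cospan T" "g \<in> Cospan T"
  shows "is_composite T c g e2"
proof -
  note Cc = CospanD[OF C(1)] and Cd = CospanD[OF C(2)] and Cf = CospanD[OF C(3)]
  obtain p q where 1: "ctgt c = csrc d" "csrc e1 = csrc c" "ctgt e1 = ctgt d"
    "p \<in> hyp_hom (apex c) (apex e1)" "q \<in> hyp_hom (apex d) (apex e1)"
    "spo {..<length (ctgt c)} (nodes (apex c)) (nodes (apex d)) (nodes (apex e1)) (nmap (rleg c)) (nmap (lleg d)) (nmap p) (nmap q)"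
    "spo {} (edges (apex c)) (edges (apex d)) (edges (apex e1)) (emap (rleg c)) (emap (lleg d)) (emap p) (emap q)"
    "\<forall>i<length (csrc c). nmap (lleg e1) i = nmap p (nmap (lleg c) i)"
    "\<forall>i<length (ctgt d). nmap (rleg e1) i = nmap q (nmap (rleg d) i)"
    using 1 by (elim is_compositeE)
  obtain p' q' where 2: "ctgt e1 = csrc f" "csrc e2 = csrc e1" "ctgt e2 = ctgt f"
    "p' \<in> hyp_hom (apex e1) (apex e2)" "q' \<in> hyp_hom (apex f) (apex e2)"
    "spo {..<length (ctgt e1)} (nodes (apex e1)) (nodes (apex f)) (nodes (apex e2)) (nmap (rleg e1)) (nmap (lleg f)) (nmap p') (nmap q')"
    "spo {} (edges (apex e1)) (edges (apex f)) (edges (apex e2)) (emap (rleg e1)) (emap (lleg f)) (emap p') (emap q')"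
    "\<forall>i<length (csrc e1). nmap (lleg e2) i = nmap p' (nmap (lleg e1) i)"
    "\<forall>i<length (ctgt f). nmap (rleg e2) i = nmap q' (nmap (rleg f) i)"
    using 2 by (elim is_compositeE)
  obtain r s where 3: "ctgt d = csrc f" "csrc g = csrc d" "ctgt g = ctgt f"
    "r \<in> hyp_hom (apex d) (apex g)" "s \<in> hyp_hom (apex f) (apex g)"
    "spo {..<length (ctgt d)} (nodes (apex d)) (nodes (apex f)) (nodes (apex g)) (nmap (rleg d)) (nmap (lleg f)) (nmap r) (nmap s)"
    "spo {} (edges (apex d)) (edges (apex f)) (edges (apex g)) (emap (rleg d)) (emap (lleg f)) (emap r) (emap s)"
    "\<forall>i<length (csrc d). nmap (lleg g) i = nmap r (nmap (lleg d) i)"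
    "\<forall>i<length (ctgt f). nmap (rleg g) i = nmap s (nmap (rleg f) i)"
    "pushout T (discrete (ctgt d)) (apex d) (apex f) (apex g) (rleg d) (lleg f) r s"
    using 3 by (elim is_compositeE)
  have "heq (discrete (ctgt d)) (hcomp (rleg d) (hcomp q p')) (hcomp (lleg f) q')"
    using spo_comm[OF 2(6)] 1(3,9) by (simp add: discrete_heq)
  moreover have "hcomp q p' \<in> hyp_hom (apex d) (apex e2)" using 1(5) 2(4) by (rule hcomp_hom)
  \<comment> \<open>The comparison map out of the apex of \<open>g\<close> comes from its universal
    property; the set-level squares are then pasted along it.\<close>
  ultimately obtain t where t: "t \<in> hyp_hom (apex g) (apex e2)" "heq (apex d) (hcomp r t) (hcomp q p')" "heq (apex f) (hcomp s t) q'"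
    using 3(10) 2(5) CospanD(3)[OF C(5)] unfolding pushout_def by blast
  have n: "spo {..<length (ctgt c)} (nodes (apex c)) (nodes (apex g)) (nodes (apex e2)) (nmap (rleg c)) (nmap (lleg g)) (nmap (hcomp p p')) (nmap t)"
  proof -
    have s2: "spo {..<length (ctgt d)} (nodes (apex e1)) (nodes (apex f)) (nodes (apex e2)) (\<lambda>i. nmap q (nmap (rleg d) i)) (nmap (lleg f)) (nmap p') (nmap q')"
      by (rule spo_cong[OF 2(6)[unfolded 1(3)]]) (use 1 2 3 Cd Cf CospanD[OF C(4)] in auto)
    show ?thesis
      by (rule spo_cong[OF spo_paste[OF 1(6) s2 3(6), of "nmap t"]])
        (use 1 2 3 t Cc Cd Cf hom_node[OF 3(4)] in \<open>auto simp: heq_def\<close>)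
  qed
  have e: "spo {} (edges (apex c)) (edges (apex g)) (edges (apex e2)) (emap (rleg c)) (emap (lleg g)) (emap (hcomp p p')) (emap t)"
  proof -
    have s2: "spo {} (edges (apex e1)) (edges (apex f)) (edges (apex e2)) (\<lambda>i. emap q (emap (rleg d) i)) (emap (lleg f)) (emap p') (emap q')"
      by (rule spo_cong[OF 2(7)]) auto
    show ?thesis
      by (rule spo_cong[OF spo_paste[OF 1(7) s2 3(7), of "emap t"]]) (use t in \<open>auto simp: heq_def\<close>)
  qed
  show ?thesis
    by (rule is_compositeI[OF C(1,6,5) _ _ _ hcomp_hom[OF 1(4) 2(4)] t(1) n e])
      (use 1 2 3 t Cf in \<open>auto simp: heq_def\<close>)
qed

section \<open>Isomorphism classes of cospans as arrows\<close>

lemma ccls_self: "c \<in> Cospan T \<Longrightarrow> c \<in> ccls T c"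
  by (simp add: ccls_def cospan_iso_refl)

lemma ccls_eqI:
  assumes "c \<in> Cospan T" "d \<in> Cospan T" "cospan_iso c d"
  shows "ccls T c = ccls T d"
  unfolding ccls_def using assms cospan_iso_sym cospan_iso_trans by blast

lemma rep_ccls:
  assumes "c \<in> Cospan T"
  shows "rep (ccls T c) \<in> Cospan T" "cospan_iso c (rep (ccls T c))"
proof -
  have "rep (ccls T c) \<in> ccls T c" unfolding rep_def using ccls_self[OF assms] by (rule someI)
  then show "rep (ccls T c) \<in> Cospan T" "cospan_iso c (rep (ccls T c))" by (auto simp: ccls_def)
qed

lemma rep_ccls_words:
  assumes "c \<in> Cospan T"
  shows "csrc (rep (ccls T c)) = csrc c" "ctgt (rep (ccls T c)) = ctgt c"
  using rep_ccls(2)[OF assms] by (auto elim: cospan_isoE)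

lemma FTerm_Arr: "X \<in> Arr (FTerm T) w v \<longleftrightarrow> (\<exists>c\<in>Cospan T. csrc c = w \<and> ctgt c = v \<and> X = ccls T c)"
  unfolding Arr_def FTerm_def using rep_ccls_words by fastforce

lemma FTerm_ArrE:
  assumes "X \<in> Arr (FTerm T) w v"
  obtains c where "c \<in> Cospan T" "csrc c = w" "ctgt c = v" "X = ccls T c"
  using assms FTerm_Arr by blast

lemma FTerm_mem:
  assumes "X \<in> Arr (FTerm T) w v" "c \<in> X"
  shows "c \<in> Cospan T" "X = ccls T c" "csrc c = w" "ctgt c = v"
proof -
  obtain d where d: "d \<in> Cospan T" "csrc d = w" "ctgt d = v" "X = ccls T d" using assms(1) by (rule FTerm_ArrE)
  then have "c \<in> Cospan T" "cospan_iso d c" using assms(2) by (auto simp: ccls_def)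
  then show "c \<in> Cospan T" "X = ccls T c" "csrc c = w" "ctgt c = v"
    using d ccls_eqI by (auto elim: cospan_isoE)
qed

text \<open>A composite is defined as the set of all composite cospans of the representatives.
  Uniqueness up to isomorphism, and closure under isomorphism, make this set the class of
  \<open>e\<close>.\<close>

lemma FTerm_comp:
  assumes "c \<in> Cospan T" "d \<in> Cospan T" "e \<in> Cospan T" "is_composite T c d e"
  shows "pcomp (FTerm T) (ccls T c) (ccls T d) = ccls T e"
proof -
  let ?c = "rep (ccls T c)" and ?d = "rep (ccls T d)"
  note c = rep_ccls[OF assms(1)] and d = rep_ccls[OF assms(2)]
  have comp: "is_composite T ?c ?d e"
    by (rule composite_iso[OF assms(4) c(2) d(2) cospan_iso_refl assms(1-3) c(1) d(1) assms(3)])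
  have "is_composite T ?c ?d x \<longleftrightarrow> cospan_iso e x" if "x \<in> Cospan T" for x
    using composite_unique[OF comp _ c(1) d(1)]
      composite_iso[OF comp cospan_iso_refl cospan_iso_refl _ c(1) d(1) assms(3) c(1) d(1) that] by blast
  then show ?thesis by (auto simp: FTerm_def ccls_def)
qed

section \<open>Disjoint unions of hypergraphs and cospans\<close>

definition hcase :: "hmap \<Rightarrow> hmap \<Rightarrow> hmap" where
  "hcase f g = \<lparr> nmap = case_sum (nmap f) (nmap g) \<circ> sum_decode, emap = case_sum (emap f) (emap g) \<circ> sum_decode \<rparr>"

definition hinl :: hmap where "hinl = \<lparr> nmap = inl, emap = inl \<rparr>"
definition hinr :: hmap where "hinr = \<lparr> nmap = inr, emap = inr \<rparr>"

lemma hcase_simps [simp]: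
  "nmap (hcase f g) (inl n) = nmap f n" "nmap (hcase f g) (inr n) = nmap g n"
  "emap (hcase f g) (inl n) = emap f n" "emap (hcase f g) (inr n) = emap g n"
  by (simp_all add: hcase_def)

lemma hin_simps [simp]: "nmap hinl n = inl n" "emap hinl n = inl n" "nmap hinr n = inr n" "emap hinr n = inr n"
  by (simp_all add: hinl_def hinr_def)

lemma hcase_hom: "f \<in> hyp_hom G K \<Longrightarrow> g \<in> hyp_hom H K \<Longrightarrow> hcase f g \<in> hyp_hom (hsum G H) K"
  by (rule homI) (auto simp: hom_node hom_nlabel hom_edge hom_elabel hom_sources hom_targets)

lemma hinl_hom: "hinl \<in> hyp_hom G (hsum G H)" and hinr_hom: "hinr \<in> hyp_hom H (hsum G H)"
  by (rule homI; auto)+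

lemma leg_sum_simps [simp]:
  "nmap (leg_sum k f g) i = (if i < k then inl (nmap f i) else inr (nmap g (i - k)))"
  by (simp add: leg_sum_def)

lemma cospan_sum_simps [simp]:
  "csrc (cospan_sum c d) = csrc c @ csrc d" "ctgt (cospan_sum c d) = ctgt c @ ctgt d"
  "apex (cospan_sum c d) = hsum (apex c) (apex d)"
  "lleg (cospan_sum c d) = leg_sum (length (csrc c)) (lleg c) (lleg d)"
  "rleg (cospan_sum c d) = leg_sum (length (ctgt c)) (rleg c) (rleg d)"
  by (simp_all add: cospan_sum_def)

lemma cospan_sum_Cospan:
  assumes c: "c \<in> Cospan T" and d: "d \<in> Cospan T" shows "cospan_sum c d \<in> Cospan T"
  by (rule CospanI) (use CospanD[OF c] CospanD[OF d] hsum_Hyp in \<open>auto simp: nth_append\<close>)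

lemma cospan_sum_iso:
  assumes "cospan_iso c c'" "cospan_iso d d'" and C: "c \<in> Cospan T" "d \<in> Cospan T"
  shows "cospan_iso (cospan_sum c d) (cospan_sum c' d')"
proof -
  obtain f where f: "csrc c = csrc c'" "ctgt c = ctgt c'" "f \<in> hyp_iso (apex c) (apex c')"
    "\<forall>i<length (csrc c). nmap f (nmap (lleg c) i) = nmap (lleg c') i"
    "\<forall>i<length (ctgt c). nmap f (nmap (rleg c) i) = nmap (rleg c') i"
    using assms(1) by (elim cospan_isoE)
  obtain g where g: "csrc d = csrc d'" "ctgt d = ctgt d'" "g \<in> hyp_iso (apex d) (apex d')"
    "\<forall>i<length (csrc d). nmap g (nmap (lleg d) i) = nmap (lleg d') i"
    "\<forall>i<length (ctgt d). nmap g (nmap (rleg d) i) = nmap (rleg d') i"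
    using assms(2) by (elim cospan_isoE)
  obtain f' where f': "f' \<in> hyp_iso (apex c') (apex c)" "heq (apex c) (hcomp f f') hid" "heq (apex c') (hcomp f' f) hid"
    using hyp_iso_inverse[OF f(3) CospanD(3)[OF C(1)]] by blast
  obtain g' where g': "g' \<in> hyp_iso (apex d') (apex d)" "heq (apex d) (hcomp g g') hid" "heq (apex d') (hcomp g' g) hid"
    using hyp_iso_inverse[OF g(3) CospanD(3)[OF C(2)]] by blast
  have "hcase (hcomp f hinl) (hcomp g hinr) \<in> hyp_iso (hsum (apex c) (apex d)) (hsum (apex c') (apex d'))"
  proof (rule hyp_isoI)
    show "hcase (hcomp f hinl) (hcomp g hinr) \<in> hyp_hom (hsum (apex c) (apex d)) (hsum (apex c') (apex d'))"
      using f g by (intro hcase_hom hcomp_hom[OF hyp_iso_hom hinl_hom] hcomp_hom[OF hyp_iso_hom hinr_hom])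
    show "hcase (hcomp f' hinl) (hcomp g' hinr) \<in> hyp_hom (hsum (apex c') (apex d')) (hsum (apex c) (apex d))"
      using f' g' by (intro hcase_hom hcomp_hom[OF hyp_iso_hom hinl_hom] hcomp_hom[OF hyp_iso_hom hinr_hom])
  qed (use f' g' in \<open>auto simp: heq_def\<close>)
  then show ?thesis
    using f g by (intro cospan_isoI[where f = "hcase (hcomp f hinl) (hcomp g hinr)"]) auto
qed

lemma FTerm_tensor:
  assumes "c \<in> Cospan T" "d \<in> Cospan T"
  shows "ptensor (FTerm T) (ccls T c) (ccls T d) = ccls T (cospan_sum c d)"
proof -
  note c = rep_ccls[OF assms(1)] and d = rep_ccls[OF assms(2)]
  have "ccls T (cospan_sum c d) = ccls T (cospan_sum (rep (ccls T c)) (rep (ccls T d)))"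
    by (intro ccls_eqI cospan_sum_Cospan cospan_sum_iso[OF c(2) d(2) assms] assms c(1) d(1))
  then show ?thesis by (simp add: FTerm_def)
qed

lemma FTerm_simps: "pcolours (FTerm T) = colours T" "pid (FTerm T) w = ccls T (id_cospan w)"
  "psym (FTerm T) w v = ccls T (sym_cospan w v)"
  by (simp_all add: FTerm_def)

lemma spo_sum:
  assumes "spo {..<m} L K D j k p q" "spo {..<n} L' K' D' j' k' p' q'"
  shows "spo {..<m + n} (inl ` L \<union> inr ` L') (inl ` K \<union> inr ` K') (inl ` D \<union> inr ` D')
    (\<lambda>i. if i < m then inl (j i) else inr (j' (i - m))) (\<lambda>i. if i < m then inl (k i) else inr (k' (i - m)))
    (case_sum (\<lambda>x. inl (p x)) (\<lambda>x. inr (p' x)) \<circ> sum_decode) (case_sum (\<lambda>x. inl (q x)) (\<lambda>x. inr (q' x)) \<circ> sum_decode)"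
proof (rule spoI)
  fix \<alpha> \<beta> :: "nat \<Rightarrow> nat"
  assume *: "\<forall>i\<in>{..<m + n}. \<alpha> (if i < m then inl (j i) else inr (j' (i - m))) = \<beta> (if i < m then inl (k i) else inr (k' (i - m)))"
  have "\<forall>i\<in>{..<m}. \<alpha> (inl (j i)) = \<beta> (inl (k i))"
  proof
    fix i assume "i \<in> {..<m}"
    then show "\<alpha> (inl (j i)) = \<beta> (inl (k i))" using bspec[OF *, of i] by simp
  qed
  then obtain \<gamma> where g: "\<And>x. x \<in> L \<Longrightarrow> \<gamma> (p x) = \<alpha> (inl x)" "\<And>x. x \<in> K \<Longrightarrow> \<gamma> (q x) = \<beta> (inl x)"
    using spo_mapE[OF assms(1), of "\<lambda>x. \<alpha> (inl x)" "\<lambda>x. \<beta> (inl x)"] by metis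
  have "\<forall>i\<in>{..<n}. \<alpha> (inr (j' i)) = \<beta> (inr (k' i))"
  proof
    fix i assume "i \<in> {..<n}"
    then show "\<alpha> (inr (j' i)) = \<beta> (inr (k' i))" using bspec[OF *, of "m + i"] by simp
  qed
  then obtain \<delta> where d: "\<And>x. x \<in> L' \<Longrightarrow> \<delta> (p' x) = \<alpha> (inr x)" "\<And>x. x \<in> K' \<Longrightarrow> \<delta> (q' x) = \<beta> (inr x)"
    using spo_mapE[OF assms(2), of "\<lambda>x. \<alpha> (inr x)" "\<lambda>x. \<beta> (inr x)"] by metis
  show "\<exists>c. (\<forall>x\<in>inl ` L \<union> inr ` L'. c ((case_sum (\<lambda>x. inl (p x)) (\<lambda>x. inr (p' x)) \<circ> sum_decode) x) = \<alpha> x) \<and>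
    (\<forall>x\<in>inl ` K \<union> inr ` K'. c ((case_sum (\<lambda>x. inl (q x)) (\<lambda>x. inr (q' x)) \<circ> sum_decode) x) = \<beta> x)"
    by (rule exI[of _ "case_sum \<gamma> \<delta> \<circ> sum_decode"]) (use g d in auto)
next
  show "inl ` D \<union> inr ` D' \<subseteq> (case_sum (\<lambda>x. inl (p x)) (\<lambda>x. inr (p' x)) \<circ> sum_decode) ` (inl ` L \<union> inr ` L') \<union>
    (case_sum (\<lambda>x. inl (q x)) (\<lambda>x. inr (q' x)) \<circ> sum_decode) ` (inl ` K \<union> inr ` K')"
    using spo_set(3)[OF assms(1)] spo_set(3)[OF assms(2)] by (simp add: image_Un image_image) blast
qed (use spo_L[OF assms(1)] spo_L[OF assms(2)] spo_K[OF assms(1)] spo_K[OF assms(2)] spo_comm[OF assms(1)] spo_comm[OF assms(2)] in auto)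

lemma composite_sum:
  assumes 1: "is_composite T c d e" and 2: "is_composite T c' d' e'"
    and C: "c \<in> Cospan T" "d \<in> Cospan T" "e \<in> Cospan T" "c' \<in> Cospan T" "d' \<in> Cospan T" "e' \<in> Cospan T"
  shows "is_composite T (cospan_sum c c') (cospan_sum d d') (cospan_sum e e')"
proof -
  obtain p q where p: "ctgt c = csrc d" "csrc e = csrc c" "ctgt e = ctgt d"
    "p \<in> hyp_hom (apex c) (apex e)" "q \<in> hyp_hom (apex d) (apex e)"
    "spo {..<length (ctgt c)} (nodes (apex c)) (nodes (apex d)) (nodes (apex e)) (nmap (rleg c)) (nmap (lleg d)) (nmap p) (nmap q)"
    "spo {} (edges (apex c)) (edges (apex d)) (edges (apex e)) (emap (rleg c)) (emap (lleg d)) (emap p) (emap q)"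
    "\<forall>i<length (csrc c). nmap (lleg e) i = nmap p (nmap (lleg c) i)"
    "\<forall>i<length (ctgt d). nmap (rleg e) i = nmap q (nmap (rleg d) i)"
    using 1 by (elim is_compositeE)
  obtain p' q' where p': "ctgt c' = csrc d'" "csrc e' = csrc c'" "ctgt e' = ctgt d'"
    "p' \<in> hyp_hom (apex c') (apex e')" "q' \<in> hyp_hom (apex d') (apex e')"
    "spo {..<length (ctgt c')} (nodes (apex c')) (nodes (apex d')) (nodes (apex e')) (nmap (rleg c')) (nmap (lleg d')) (nmap p') (nmap q')"
    "spo {} (edges (apex c')) (edges (apex d')) (edges (apex e')) (emap (rleg c')) (emap (lleg d')) (emap p') (emap q')"
    "\<forall>i<length (csrc c'). nmap (lleg e') i = nmap p' (nmap (lleg c') i)"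
    "\<forall>i<length (ctgt d'). nmap (rleg e') i = nmap q' (nmap (rleg d') i)"
    using 2 by (elim is_compositeE)
  let ?p = "hcase (hcomp p hinl) (hcomp p' hinr)" and ?q = "hcase (hcomp q hinl) (hcomp q' hinr)"
  have pq: "?p \<in> hyp_hom (apex (cospan_sum c c')) (apex (cospan_sum e e'))"
    "?q \<in> hyp_hom (apex (cospan_sum d d')) (apex (cospan_sum e e'))"
    using p p' by (auto intro!: hcase_hom intro: hcomp_hom hinl_hom hinr_hom)
  have np: "nmap (hcase (hcomp f hinl) (hcomp g hinr)) = case_sum (\<lambda>x. inl (nmap f x)) (\<lambda>x. inr (nmap g x)) \<circ> sum_decode"
    "emap (hcase (hcomp f hinl) (hcomp g hinr)) = case_sum (\<lambda>x. inl (emap f x)) (\<lambda>x. inr (emap g x)) \<circ> sum_decode" for f g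
    by (auto simp: hcase_def hcomp_def fun_eq_iff split: sum.split)
  have n: "spo {..<length (ctgt (cospan_sum c c'))} (nodes (apex (cospan_sum c c'))) (nodes (apex (cospan_sum d d')))
      (nodes (apex (cospan_sum e e'))) (nmap (rleg (cospan_sum c c'))) (nmap (lleg (cospan_sum d d'))) (nmap ?p) (nmap ?q)"
    unfolding np using spo_sum[OF p(6) p'(6)] by (simp add: leg_sum_def p(1)[symmetric] cong: if_cong)
  \<comment> \<open>\<open>spo_sum\<close> is stated for intervals as interfaces, so the empty
    interface of the hyperedges enters as \<open>{..<0 + 0}\<close>.\<close>
  have e0: "spo {..<0 + 0} (inl ` edges (apex c) \<union> inr ` edges (apex c')) (inl ` edges (apex d) \<union> inr ` edges (apex d'))
      (inl ` edges (apex e) \<union> inr ` edges (apex e'))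
      (\<lambda>i. if i < 0 then inl (emap (rleg c) i) else inr (emap (rleg c') (i - 0)))
      (\<lambda>i. if i < 0 then inl (emap (lleg d) i) else inr (emap (lleg d') (i - 0))) (emap ?p) (emap ?q)"
    unfolding np by (rule spo_sum) (use p(7) p'(7) in simp_all)
  have e: "spo {} (edges (apex (cospan_sum c c'))) (edges (apex (cospan_sum d d')))
      (edges (apex (cospan_sum e e'))) (emap (rleg (cospan_sum c c'))) (emap (lleg (cospan_sum d d'))) (emap ?p) (emap ?q)"
    using spo_cong[OF e0] by simp
  show ?thesis
    by (rule is_compositeI[OF _ _ _ _ _ _ pq n e]) (use C p p' CospanD[OF C(1)] CospanD[OF C(2)] in \<open>auto simp: cospan_sum_Cospan\<close>)
qed

text \<open>The contravariant embedding of functions between words; composites of symmetries and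
  comultiplications are interpreted in its image.\<close>

definition cofun :: "'c list \<Rightarrow> nat list \<Rightarrow> ('c, 'o) cospan" where
  "cofun w xs = \<lparr> csrc = w, ctgt = map ((!) w) xs, apex = discrete w, lleg = hid, rleg = \<lparr> nmap = (!) xs, emap = id \<rparr> \<rparr>"

lemma cofun_simps [simp]: "csrc (cofun w xs) = w" "ctgt (cofun w xs) = map ((!) w) xs" "apex (cofun w xs) = discrete w"
  "nmap (lleg (cofun w xs)) i = i" "nmap (rleg (cofun w xs)) i = xs ! i"
  by (simp_all add: cofun_def)

lemma cofun_Cospan: "w \<in> lists (colours T) \<Longrightarrow> set xs \<subseteq> {..<length w} \<Longrightarrow> cofun w xs \<in> Cospan T"
  by (rule CospanI) (auto simp: discrete_Hyp subset_iff)

lemma id_cospan_simps [simp]: "csrc (id_cospan w) = w" "ctgt (id_cospan w) = w" "apex (id_cospan w) = discrete w"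
  "nmap (lleg (id_cospan w)) i = i" "nmap (rleg (id_cospan w)) i = i"
  by (simp_all add: id_cospan_def)

lemma sym_cospan_simps [simp]: "csrc (sym_cospan w v) = w @ v" "ctgt (sym_cospan w v) = v @ w"
  "apex (sym_cospan w v) = discrete (w @ v)" "nmap (lleg (sym_cospan w v)) i = i"
  "nmap (rleg (sym_cospan w v)) i = (if i < length v then length w + i else i - length v)"
  by (simp_all add: sym_cospan_def)

lemma id_cospan_Cospan: "w \<in> lists (colours T) \<Longrightarrow> id_cospan w \<in> Cospan T"
  by (rule CospanI) (auto simp: discrete_Hyp)

lemma sym_cospan_Cospan: "w \<in> lists (colours T) \<Longrightarrow> v \<in> lists (colours T) \<Longrightarrow> sym_cospan w v \<in> Cospan T"
  by (rule CospanI) (auto simp: discrete_Hyp nth_append)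

lemma hid_iso: "hid \<in> hyp_iso G G"
  by (rule hyp_isoI[OF hid_hom hid_hom]) (auto simp: heq_def)

lemma id_cofun: "cospan_iso (id_cospan w) (cofun w [0..<length w])"
  by (rule cospan_isoI[where f = hid]) (auto simp: hid_iso intro: nth_equalityI)

lemma sym_cofun: "cospan_iso (sym_cospan w v) (cofun (w @ v) ([length w..<length w + length v] @ [0..<length w]))"
  by (rule cospan_isoI[where f = hid]) (auto simp: hid_iso nth_append intro: nth_equalityI)

lemma sum_cofun:
  "cospan_iso (cospan_sum (cofun w xs) (cofun v ys)) (cofun (w @ v) (xs @ map ((+) (length w)) ys))"
  if "set xs \<subseteq> {..<length w}"
proof (rule cospan_isoI)
  let ?f = "hcase hid \<lparr> nmap = (+) (length w), emap = id \<rparr>"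
  let ?g = "\<lparr> nmap = \<lambda>i. if i < length w then inl i else inr (i - length w), emap = id \<rparr>"
  show "?f \<in> hyp_iso (apex (cospan_sum (cofun w xs) (cofun v ys))) (apex (cofun (w @ v) (xs @ map ((+) (length w)) ys)))"
  proof (rule hyp_isoI[where g = ?g])
    show "?f \<in> hyp_hom (apex (cospan_sum (cofun w xs) (cofun v ys))) (apex (cofun (w @ v) (xs @ map ((+) (length w)) ys)))"
      by (rule homI) (auto simp: nth_append)
    show "?g \<in> hyp_hom (apex (cofun (w @ v) (xs @ map ((+) (length w)) ys))) (apex (cospan_sum (cofun w xs) (cofun v ys)))"
      by (rule homI) (auto simp: nth_append)
  qed (auto simp: heq_def)
qed (use that in \<open>auto simp: nth_append subset_iff\<close>)

text \<open>Composition becomes lookup in lists of indices, so prop laws that involve only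
  identities and symmetries reduce to equations between such lists.\<close>

lemma comp_cofun:
  assumes "w \<in> lists (colours T)" "set xs \<subseteq> {..<length w}" "set ys \<subseteq> {..<length xs}"
  shows "is_composite T (cofun w xs) (cofun (map ((!) w) xs) ys) (cofun w (map ((!) xs) ys))"
proof -
  have y: "ys ! i < length xs" if "i < length ys" for i using subsetD[OF assms(3) nth_mem[OF that]] by simp
  have x: "xs ! i < length w" if "i < length xs" for i using subsetD[OF assms(2) nth_mem[OF that]] by simp
  have C: "cofun w xs \<in> Cospan T" "cofun (map ((!) w) xs) ys \<in> Cospan T" "cofun w (map ((!) xs) ys) \<in> Cospan T"
  proof -
    have "map ((!) w) xs \<in> lists (colours T)" using assms(1) assms(2) by (auto simp: subset_iff)
    then show "cofun w xs \<in> Cospan T" "cofun (map ((!) w) xs) ys \<in> Cospan T" "cofun w (map ((!) xs) ys) \<in> Cospan T"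
      using assms y x by (auto intro!: cofun_Cospan simp: set_conv_nth[of ys])
  qed
  show ?thesis
    by (rule composite_right[OF C(1,2) _ _ _ _ _ C(3), where q = "\<lparr> nmap = (!) xs, emap = id \<rparr>"])
      (use x y assms(3) in \<open>auto simp: discrete_hom subset_iff\<close>)
qed

definition ccofun where "ccofun T w xs = ccls T (cofun w xs)"

lemma FTerm_id_cofun: "w \<in> lists (colours T) \<Longrightarrow> pid (FTerm T) w = ccofun T w [0..<length w]"
  unfolding FTerm_simps ccofun_def by (rule ccls_eqI[OF id_cospan_Cospan cofun_Cospan id_cofun]) auto

lemma FTerm_sym_cofun:
  "w \<in> lists (colours T) \<Longrightarrow> v \<in> lists (colours T) \<Longrightarrow>
    psym (FTerm T) w v = ccofun T (w @ v) ([length w..<length w + length v] @ [0..<length w])"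
  unfolding FTerm_simps ccofun_def by (rule ccls_eqI[OF sym_cospan_Cospan cofun_Cospan sym_cofun]) auto

lemma FTerm_tensor_cofun:
  assumes "w \<in> lists (colours T)" "v \<in> lists (colours T)" "set xs \<subseteq> {..<length w}" "set ys \<subseteq> {..<length v}"
  shows "ptensor (FTerm T) (ccofun T w xs) (ccofun T v ys) = ccofun T (w @ v) (xs @ map ((+) (length w)) ys)"
proof -
  have "set (xs @ map ((+) (length w)) ys) \<subseteq> {..<length (w @ v)}" using assms by (auto simp: subset_iff)
  then have "ccls T (cospan_sum (cofun w xs) (cofun v ys)) = ccls T (cofun (w @ v) (xs @ map ((+) (length w)) ys))"
    using assms by (intro ccls_eqI sum_cofun cospan_sum_Cospan cofun_Cospan) simp_all
  then show ?thesis using assms by (simp add: ccofun_def FTerm_tensor cofun_Cospan)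
qed

lemma FTerm_comp_cofun:
  assumes "w \<in> lists (colours T)" "set xs \<subseteq> {..<length w}" "set ys \<subseteq> {..<length xs}" "v = map ((!) w) xs"
  shows "pcomp (FTerm T) (ccofun T w xs) (ccofun T v ys) = ccofun T w (map ((!) xs) ys)"
proof -
  have x: "xs ! i < length w" if "i < length xs" for i using subsetD[OF assms(2) nth_mem[OF that]] by simp
  have "map ((!) w) xs \<in> lists (colours T)" using assms(1) assms(2) by (auto simp: subset_iff)
  moreover have "set (map ((!) xs) ys) \<subseteq> {..<length w}" using assms(3) x by auto
  ultimately show ?thesis unfolding ccofun_def assms(4)
    using assms(1-3) by (intro FTerm_comp comp_cofun cofun_Cospan) auto
qed

lemma tensor_assoc_iso: "cospan_iso (cospan_sum (cospan_sum c d) e) (cospan_sum c (cospan_sum d e))"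
proof (rule cospan_isoI)
  let ?f = "hcase (hcase hinl (hcomp hinl hinr)) (hcomp hinr hinr)"
  let ?g = "hcase (hcomp hinl hinl) (hcase (hcomp hinr hinl) hinr)"
  show "?f \<in> hyp_iso (apex (cospan_sum (cospan_sum c d) e)) (apex (cospan_sum c (cospan_sum d e)))"
    by (rule hyp_isoI[where g = ?g])
      (auto intro!: hcase_hom intro: hcomp_hom hinl_hom hinr_hom simp: heq_def)
qed auto

lemma unit_tensor_iso: "cospan_iso (cospan_sum (id_cospan []) c) c"
proof (rule cospan_isoI)
  have "hid \<in> hyp_hom (discrete []) (apex c)" by (rule homI) auto
  then show "hcase hid hid \<in> hyp_iso (apex (cospan_sum (id_cospan []) c)) (apex c)"
    by (intro hyp_isoI[where g = hinr]) (auto intro!: hcase_hom hid_hom hinr_hom simp: heq_def)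
qed auto

lemma tensor_unit_iso: "cospan_iso (cospan_sum c (id_cospan [])) c"
proof (rule cospan_isoI)
  have "hid \<in> hyp_hom (discrete []) (apex c)" by (rule homI) auto
  then show "hcase hid hid \<in> hyp_iso (apex (cospan_sum c (id_cospan []))) (apex c)"
    by (intro hyp_isoI[where g = hinl]) (auto intro!: hcase_hom hid_hom hinl_hom simp: heq_def)
qed auto

lemma swap_iso: "hcase hinr hinl \<in> hyp_iso (hsum G H) (hsum H G)"
  by (rule hyp_isoI[where g = "hcase hinr hinl"]) (auto intro!: hcase_hom hinl_hom hinr_hom simp: heq_def)

text \<open>A symmetry merely renumbers an interface, so both composites can be written down; they
  differ by exchanging the summands of the apex.\<close>

lemma FTerm_sym_natural:
  assumes c: "c \<in> Cospan T" and d: "d \<in> Cospan T"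
  shows "pcomp (FTerm T) (ccls T (cospan_sum c d)) (ccls T (sym_cospan (ctgt c) (ctgt d)))
    = pcomp (FTerm T) (ccls T (sym_cospan (csrc c) (csrc d))) (ccls T (cospan_sum d c))"
proof -
  note Cc = CospanD[OF c] and Cd = CospanD[OF d]
  let ?c = "cospan_sum c d" and ?d = "cospan_sum d c"
  let ?e = "\<lparr> csrc = csrc c @ csrc d, ctgt = ctgt d @ ctgt c, apex = hsum (apex c) (apex d), lleg = lleg ?c,
     rleg = \<lparr> nmap = \<lambda>i. if i < length (ctgt d) then inr (nmap (rleg d) i) else inl (nmap (rleg c) (i - length (ctgt d))), emap = id \<rparr> \<rparr>"
  let ?f = "\<lparr> csrc = csrc c @ csrc d, ctgt = ctgt d @ ctgt c, apex = hsum (apex d) (apex c),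
     lleg = \<lparr> nmap = \<lambda>i. if i < length (csrc c) then inr (nmap (lleg c) i) else inl (nmap (lleg d) (i - length (csrc c))), emap = id \<rparr>,
     rleg = rleg ?d \<rparr>"
  have C: "?c \<in> Cospan T" "?d \<in> Cospan T" "sym_cospan (ctgt c) (ctgt d) \<in> Cospan T" "sym_cospan (csrc c) (csrc d) \<in> Cospan T"
    using c d Cc Cd by (auto intro: cospan_sum_Cospan sym_cospan_Cospan)
  have e: "?e \<in> Cospan T" by (rule CospanI) (use Cc Cd hsum_Hyp in \<open>auto simp: nth_append\<close>)
  have f: "?f \<in> Cospan T" by (rule CospanI) (use Cc Cd hsum_Hyp in \<open>auto simp: nth_append\<close>)
  \<comment> \<open>The renumbering of the symmetry reaches every node, as
    \<open>composite_left\<close> requires of its right leg.\<close>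
  have bij: "{..<m + n} \<subseteq> (\<lambda>i. if i < n then m + i else i - n) ` {..<n + m}" for m n :: nat
  proof
    fix x assume "x \<in> {..<m + n}"
    then show "x \<in> (\<lambda>i. if i < n then m + i else i - n) ` {..<n + m}"
      by (intro image_eqI[of _ _ "if x < m then n + x else x - m"]) auto
  qed
  have 1: "is_composite T ?c (sym_cospan (ctgt c) (ctgt d)) ?e"
    by (rule composite_right[OF C(1) C(3) _ _ _ _ _ e, where q = "rleg ?c"])
      (use CospanD(5)[OF C(1)] in \<open>auto\<close>)
  have 2: "is_composite T (sym_cospan (csrc c) (csrc d)) ?d ?f"
    by (rule composite_left[OF C(4) C(2) _ _ _ _ _ f, where p = "\<lparr> nmap = nmap (lleg ?f), emap = id \<rparr>"])
      (use CospanD(4)[OF f] bij in \<open>auto simp: discrete_hom\<close>)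
  have "cospan_iso ?e ?f"
    by (rule cospan_isoI[where f = "hcase hinr hinl"]) (auto simp: swap_iso)
  then show ?thesis
    using FTerm_comp[OF C(1,3) e 1] FTerm_comp[OF C(4,2) f 2] ccls_eqI[OF e f] by simp
qed

lemma coloured_prop_FTerm: "coloured_prop (FTerm T)"
proof
  note [simp] = FTerm_simps
  have W: "w \<in> lists (colours T) \<and> v \<in> lists (colours T)" if "f \<in> Arr (FTerm T) w v" for f w v
    using FTerm_ArrE[OF that] CospanD(1,2) by metis
  then show "w \<in> lists (pcolours (FTerm T)) \<and> v \<in> lists (pcolours (FTerm T))" if "f \<in> Arr (FTerm T) w v" for f w v
    using that by simp
  show "pid (FTerm T) w \<in> Arr (FTerm T) w w" if "w \<in> lists (pcolours (FTerm T))" for w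
    using that id_cospan_Cospan[of w T] unfolding FTerm_Arr by (intro bexI[of _ "id_cospan w"]) auto
  show "psym (FTerm T) w v \<in> Arr (FTerm T) (w @ v) (v @ w)"
    if "w \<in> lists (pcolours (FTerm T))" "v \<in> lists (pcolours (FTerm T))" for w v
    using that sym_cospan_Cospan[of w T v] unfolding FTerm_Arr by (intro bexI[of _ "sym_cospan w v"]) auto
  show comp: "pcomp (FTerm T) f g \<in> Arr (FTerm T) u w" if fg: "f \<in> Arr (FTerm T) u v" "g \<in> Arr (FTerm T) v w" for f g u v w
  proof -
    obtain c where c: "c \<in> Cospan T" "csrc c = u" "ctgt c = v" "f = ccls T c" using fg(1) by (rule FTerm_ArrE)
    obtain d where d: "d \<in> Cospan T" "csrc d = v" "ctgt d = w" "g = ccls T d" using fg(2) by (rule FTerm_ArrE)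
    obtain e where e: "e \<in> Cospan T" "is_composite T c d e" using composite_ex[OF c(1) d(1)] c d by auto
    then have "csrc e = u" "ctgt e = w" using c d by (auto simp: is_composite_def)
    then show ?thesis using FTerm_comp[OF c(1) d(1) e] c d e unfolding FTerm_Arr by auto
  qed
  show "ptensor (FTerm T) f g \<in> Arr (FTerm T) (u @ u') (v @ v')"
    if fg: "f \<in> Arr (FTerm T) u v" "g \<in> Arr (FTerm T) u' v'" for f g u v u' v'
  proof -
    obtain c where c: "c \<in> Cospan T" "csrc c = u" "ctgt c = v" "f = ccls T c" using fg(1) by (rule FTerm_ArrE)
    obtain d where d: "d \<in> Cospan T" "csrc d = u'" "ctgt d = v'" "g = ccls T d" using fg(2) by (rule FTerm_ArrE)
    show ?thesis using FTerm_tensor[OF c(1) d(1)] cospan_sum_Cospan[OF c(1) d(1)] c d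
      unfolding FTerm_Arr by (intro bexI[of _ "cospan_sum c d"]) simp_all
  qed
  show "pcomp (FTerm T) (pid (FTerm T) u) f = f" if f: "f \<in> Arr (FTerm T) u v" for f u v
  proof -
    obtain c where c: "c \<in> Cospan T" "csrc c = u" "ctgt c = v" "f = ccls T c" using f by (rule FTerm_ArrE)
    note i = id_cospan_Cospan[OF CospanD(1)[OF c(1)]]
    have "is_composite T (id_cospan (csrc c)) c c"
      by (rule composite_left[OF i c(1) _ _ _ _ _ c(1), where p = "lleg c"]) (use CospanD(4)[OF c(1)] in auto)
    then show ?thesis using FTerm_comp[OF i c(1) c(1)] c by simp
  qed
  show "pcomp (FTerm T) f (pid (FTerm T) v) = f" if f: "f \<in> Arr (FTerm T) u v" for f u v
  proof -
    obtain c where c: "c \<in> Cospan T" "csrc c = u" "ctgt c = v" "f = ccls T c" using f by (rule FTerm_ArrE)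
    note i = id_cospan_Cospan[OF CospanD(2)[OF c(1)]]
    have "is_composite T c (id_cospan (ctgt c)) c"
      by (rule composite_right[OF c(1) i _ _ _ _ _ c(1), where q = "rleg c"]) (use CospanD(5)[OF c(1)] in auto)
    then show ?thesis using FTerm_comp[OF c(1) i c(1)] c by simp
  qed
  show "pcomp (FTerm T) (pcomp (FTerm T) f g) h = pcomp (FTerm T) f (pcomp (FTerm T) g h)"
    if fgh: "f \<in> Arr (FTerm T) u v" "g \<in> Arr (FTerm T) v w" "h \<in> Arr (FTerm T) w x" for f g h u v w x
  proof -
    obtain c where c: "c \<in> Cospan T" "csrc c = u" "ctgt c = v" "f = ccls T c" using fgh(1) by (rule FTerm_ArrE)
    obtain d where d: "d \<in> Cospan T" "csrc d = v" "ctgt d = w" "g = ccls T d" using fgh(2) by (rule FTerm_ArrE)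
    obtain k where k: "k \<in> Cospan T" "csrc k = w" "ctgt k = x" "h = ccls T k" using fgh(3) by (rule FTerm_ArrE)
    obtain e where e: "e \<in> Cospan T" "is_composite T c d e" using composite_ex[OF c(1) d(1)] c d by auto
    have e': "ctgt e = w" using e d by (auto simp: is_composite_def)
    obtain m where m: "m \<in> Cospan T" "is_composite T e k m" using composite_ex[OF e(1) k(1)] e' k by auto
    obtain n where n: "n \<in> Cospan T" "is_composite T d k n" using composite_ex[OF d(1) k(1)] d k by auto
    have "is_composite T c n m" by (rule composite_assoc[OF e(2) m(2) n(2) c(1) d(1) k(1) e(1) m(1) n(1)])
    then show ?thesis
      using FTerm_comp[OF c(1) d(1) e] FTerm_comp[OF e(1) k(1) m] FTerm_comp[OF d(1) k(1) n] FTerm_comp[OF c(1) n(1) m(1)] c d k by simp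
  qed
  show "ptensor (FTerm T) (pid (FTerm T) []) f = f" if f: "f \<in> Arr (FTerm T) u v" for f u v
  proof -
    obtain c where c: "c \<in> Cospan T" "csrc c = u" "ctgt c = v" "f = ccls T c" using f by (rule FTerm_ArrE)
    have i: "id_cospan [] \<in> Cospan T" by (simp add: id_cospan_Cospan)
    show ?thesis using FTerm_tensor[OF i c(1)] ccls_eqI[OF cospan_sum_Cospan[OF i c(1)] c(1) unit_tensor_iso] c by simp
  qed
  show "ptensor (FTerm T) f (pid (FTerm T) []) = f" if f: "f \<in> Arr (FTerm T) u v" for f u v
  proof -
    obtain c where c: "c \<in> Cospan T" "csrc c = u" "ctgt c = v" "f = ccls T c" using f by (rule FTerm_ArrE)
    have i: "id_cospan [] \<in> Cospan T" by (simp add: id_cospan_Cospan)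
    show ?thesis using FTerm_tensor[OF c(1) i] ccls_eqI[OF cospan_sum_Cospan[OF c(1) i] c(1) tensor_unit_iso] c by simp
  qed
  show "ptensor (FTerm T) (ptensor (FTerm T) f g) h = ptensor (FTerm T) f (ptensor (FTerm T) g h)"
    if fgh: "f \<in> Arr (FTerm T) u v" "g \<in> Arr (FTerm T) u' v'" "h \<in> Arr (FTerm T) u'' v''" for f g h u v u' v' u'' v''
  proof -
    obtain c where c: "c \<in> Cospan T" "f = ccls T c" using fgh(1) by (rule FTerm_ArrE)
    obtain d where d: "d \<in> Cospan T" "g = ccls T d" using fgh(2) by (rule FTerm_ArrE)
    obtain k where k: "k \<in> Cospan T" "h = ccls T k" using fgh(3) by (rule FTerm_ArrE)
    show ?thesis
      using c d k ccls_eqI[OF _ _ tensor_assoc_iso, of c d k T] by (simp add: FTerm_tensor cospan_sum_Cospan)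
  qed
  show "ptensor (FTerm T) (pid (FTerm T) w) (pid (FTerm T) v) = pid (FTerm T) (w @ v)"
    if "w \<in> lists (pcolours (FTerm T))" "v \<in> lists (pcolours (FTerm T))" for w v
  proof -
    have "[0..<length w] @ map ((+) (length w)) [0..<length v] = [0..<length (w @ v)]"
      by (auto intro: nth_equalityI simp: nth_append)
    then show ?thesis using that FTerm_tensor_cofun[of w T v "[0..<length w]" "[0..<length v]"]
      by (auto simp: FTerm_id_cofun atLeast0LessThan simp del: FTerm_simps(2))
  qed
  show "ptensor (FTerm T) (pcomp (FTerm T) f g) (pcomp (FTerm T) f' g') =
      pcomp (FTerm T) (ptensor (FTerm T) f f') (ptensor (FTerm T) g g')"
    if fg: "f \<in> Arr (FTerm T) u v" "g \<in> Arr (FTerm T) v w" "f' \<in> Arr (FTerm T) u' v'" "g' \<in> Arr (FTerm T) v' w'"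
    for f g f' g' u v w u' v' w'
  proof -
    obtain c where c: "c \<in> Cospan T" "csrc c = u" "ctgt c = v" "f = ccls T c" using fg(1) by (rule FTerm_ArrE)
    obtain d where d: "d \<in> Cospan T" "csrc d = v" "ctgt d = w" "g = ccls T d" using fg(2) by (rule FTerm_ArrE)
    obtain e where e: "e \<in> Cospan T" "is_composite T c d e" using composite_ex[OF c(1) d(1)] c d by auto
    obtain c' where c': "c' \<in> Cospan T" "csrc c' = u'" "ctgt c' = v'" "f' = ccls T c'" using fg(3) by (rule FTerm_ArrE)
    obtain d' where d': "d' \<in> Cospan T" "csrc d' = v'" "ctgt d' = w'" "g' = ccls T d'" using fg(4) by (rule FTerm_ArrE)
    obtain e' where e': "e' \<in> Cospan T" "is_composite T c' d' e'" using composite_ex[OF c'(1) d'(1)] c' d' by auto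
    note s = composite_sum[OF e(2) e'(2) c(1) d(1) e(1) c'(1) d'(1) e'(1)]
    show ?thesis
      using FTerm_comp[OF c(1) d(1) e] FTerm_comp[OF c'(1) d'(1) e'] c d e c' d' e'
        FTerm_comp[OF _ _ _ s] by (simp add: FTerm_tensor cospan_sum_Cospan)
  qed
  show "pcomp (FTerm T) (ptensor (FTerm T) f g) (psym (FTerm T) v v') = pcomp (FTerm T) (psym (FTerm T) u u') (ptensor (FTerm T) g f)"
    if fg: "f \<in> Arr (FTerm T) u v" "g \<in> Arr (FTerm T) u' v'" for f g u v u' v'
  proof -
    obtain c where c: "c \<in> Cospan T" "csrc c = u" "ctgt c = v" "f = ccls T c" using fg(1) by (rule FTerm_ArrE)
    obtain d where d: "d \<in> Cospan T" "csrc d = u'" "ctgt d = v'" "g = ccls T d" using fg(2) by (rule FTerm_ArrE)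
    show ?thesis using FTerm_sym_natural[OF c(1) d(1)] c d by (simp add: FTerm_tensor)
  qed
  show "pcomp (FTerm T) (psym (FTerm T) w v) (psym (FTerm T) v w) = pid (FTerm T) (w @ v)"
    if "w \<in> lists (pcolours (FTerm T))" "v \<in> lists (pcolours (FTerm T))" for w v
  proof -
    let ?p = "[length w..<length w + length v] @ [0..<length w]" and ?q = "[length v..<length v + length w] @ [0..<length v]"
    have "map ((!) ?p) ?q = [0..<length (w @ v)]"
      by (rule nth_equalityI) (auto simp: nth_append)
    moreover have "v @ w = map ((!) (w @ v)) ?p"
      by (rule nth_equalityI) (auto simp: nth_append)
    moreover have "pcomp (FTerm T) (ccofun T (w @ v) ?p) (ccofun T (v @ w) ?q) = ccofun T (w @ v) (map ((!) ?p) ?q)"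
      using that calculation(2) by (intro FTerm_comp_cofun) auto
    ultimately show ?thesis using that
      by (simp only: FTerm_sym_cofun[of w T v] FTerm_sym_cofun[of v T w] FTerm_id_cofun[of "w @ v" T] append_in_lists_conv FTerm_simps(1) simp_thms)
  qed
  show "psym (FTerm T) u (v @ w) = pcomp (FTerm T) (ptensor (FTerm T) (psym (FTerm T) u v) (pid (FTerm T) w))
      (ptensor (FTerm T) (pid (FTerm T) v) (psym (FTerm T) u w))"
    if "u \<in> lists (pcolours (FTerm T))" "v \<in> lists (pcolours (FTerm T))" "w \<in> lists (pcolours (FTerm T))" for u v w
  proof -
    let ?p = "([length u..<length u + length v] @ [0..<length u]) @ map ((+) (length (u @ v))) [0..<length w]"
    let ?q = "[0..<length v] @ map ((+) (length v)) ([length u..<length u + length w] @ [0..<length u])"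
    have "map ((!) ?p) ?q = [length u..<length u + length (v @ w)] @ [0..<length u]"
      by (rule nth_equalityI) (auto simp: nth_append)
    moreover have "v @ u @ w = map ((!) (u @ v @ w)) ?p"
      by (rule nth_equalityI) (auto simp: nth_append intro: arg_cong[of _ _ "(!) w"])
    moreover have "pcomp (FTerm T) (ccofun T (u @ v @ w) ?p) (ccofun T (v @ u @ w) ?q) = ccofun T (u @ v @ w) (map ((!) ?p) ?q)"
      using that calculation(2) by (intro FTerm_comp_cofun) auto
    moreover have "ptensor (FTerm T) (psym (FTerm T) u v) (pid (FTerm T) w) = ccofun T (u @ v @ w) ?p"
      using that FTerm_tensor_cofun[of "u @ v" T w "[length u..<length u + length v] @ [0..<length u]" "[0..<length w]"]
      by (simp add: FTerm_sym_cofun FTerm_id_cofun subset_iff del: FTerm_simps(2,3))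
    moreover have "ptensor (FTerm T) (pid (FTerm T) v) (psym (FTerm T) u w) = ccofun T (v @ u @ w) ?q"
      using that FTerm_tensor_cofun[of v T "u @ w" "[0..<length v]" "[length u..<length u + length w] @ [0..<length u]"]
      by (simp add: FTerm_sym_cofun FTerm_id_cofun subset_iff del: FTerm_simps(2,3))
    ultimately show ?thesis
      using that by (simp only: FTerm_sym_cofun[of u T "v @ w"] append_in_lists_conv FTerm_simps(1) simp_thms)
  qed
qed

section \<open>The interpretation of string diagrams\<close>

text \<open>A morphism is determined by its values on generators. Applied to the identity morphism,
  this decomposes an arrow of a presented prop into generators.\<close>

lemma morphism_teval:
  assumes S: "wf_signature S" and F: "prop_morphism (presented_prop S E) R F" and "wt S t"
  shows "F (pcls S E t) = teval R (\<lambda>g. F (pcls S E (TGen g))) t"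
  using assms(3)
proof (induction t)
  case (TSeq s t)
  then have "F (pcomp (presented_prop S E) (pcls S E s) (pcls S E t)) = pcomp R (F (pcls S E s)) (F (pcls S E t))"
    using F pcls_wt[OF S, of s E] pcls_wt[OF S, of t E] unfolding prop_morphism_def by auto
  with TSeq pcls_comp[OF S, of s t E] show ?case by simp
next
  case (TPar s t)
  then have "F (ptensor (presented_prop S E) (pcls S E s) (pcls S E t)) = ptensor R (F (pcls S E s)) (F (pcls S E t))"
    using F pcls_wt[OF S, of s E] pcls_wt[OF S, of t E] unfolding prop_morphism_def by (auto simp: Arr_def)
  with TPar pcls_tensor[OF S, of s t E] show ?case by simp
qed (use F in \<open>auto simp: prop_morphism_def pcolours_presented pcls_id pcls_sym\<close>)

lemma morphism_equation:
  assumes S: "wf_signature S" and F: "prop_morphism (presented_prop S E) R F" and "(s, t) \<in> E"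
    and wt: "wt S s" "wt S t" "tdom S s = tdom S t" "tcod S s = tcod S t"
  shows "teval R (\<lambda>g. F (pcls S E (TGen g))) s = teval R (\<lambda>g. F (pcls S E (TGen g))) t"
  using pcls_eqI[OF S peq.equation[OF assms(3) wt]] morphism_teval[OF S F wt(1)] morphism_teval[OF S F wt(2)] by simp

lemma wf_frob_sig: "wf_signature (frob_sig C)"
  by (auto simp: wf_signature_def frob_sig_def)

lemma spider_simps [simp]: "csrc (spider w v a) = w" "ctgt (spider w v a) = v" "apex (spider w v a) = discrete [a]"
  "nmap (lleg (spider w v a)) i = 0" "nmap (rleg (spider w v a)) i = 0"
  by (simp_all add: spider_def)

lemma spider_Cospan:
  assumes "a \<in> colours T" "set w \<subseteq> {a}" "set v \<subseteq> {a}" shows "spider w v a \<in> Cospan T"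
proof (rule CospanI)
  have "w ! i = a" if "i < length w" for i using assms(2) nth_mem[OF that] by auto
  then show "\<And>i. i < length (csrc (spider w v a)) \<Longrightarrow> nmap (lleg (spider w v a)) i \<in> nodes (apex (spider w v a)) \<and>
     nlabel (apex (spider w v a)) (nmap (lleg (spider w v a)) i) = csrc (spider w v a) ! i" by simp
  have "v ! i = a" if "i < length v" for i using assms(3) nth_mem[OF that] by auto
  then show "\<And>i. i < length (ctgt (spider w v a)) \<Longrightarrow> nmap (rleg (spider w v a)) i \<in> nodes (apex (spider w v a)) \<and>
     nlabel (apex (spider w v a)) (nmap (rleg (spider w v a)) i) = ctgt (spider w v a) ! i" by simp
qed (use assms in \<open>auto intro: discrete_Hyp\<close>)

text \<open>Spider fusion: a connected gluing of edge-free cospans in one colour collapses to a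
  single node. Connectedness is expressed by \<open>conn\<close>, which says that compatible test
  functions are constant; \<open>ne\<close> provides a preimage of the node.\<close>

lemma composite_spider:
  assumes c: "c \<in> Cospan T" and d: "d \<in> Cospan T" and a: "a \<in> colours T" and w: "ctgt c = csrc d"
    and set: "set (csrc c) \<subseteq> {a}" "set (ctgt d) \<subseteq> {a}"
    and edges: "edges (apex c) = {}" "edges (apex d) = {}"
    and lab: "\<And>n. n \<in> nodes (apex c) \<Longrightarrow> nlabel (apex c) n = a" "\<And>n. n \<in> nodes (apex d) \<Longrightarrow> nlabel (apex d) n = a"
    and ne: "nodes (apex c) \<noteq> {}"
    and conn: "\<And>\<alpha> \<beta> :: nat \<Rightarrow> nat. \<forall>i<length (ctgt c). \<alpha> (nmap (rleg c) i) = \<beta> (nmap (lleg d) i) \<Longrightarrow>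
      \<exists>k. (\<forall>x\<in>nodes (apex c). \<alpha> x = k) \<and> (\<forall>y\<in>nodes (apex d). \<beta> y = k)"
  shows "pcomp (FTerm T) (ccls T c) (ccls T d) = ccls T (spider (csrc c) (ctgt d) a)"
proof -
  let ?e = "spider (csrc c) (ctgt d) a" and ?z = "\<lparr> nmap = \<lambda>_. 0, emap = \<lambda>_. 0 \<rparr>"
  have e: "?e \<in> Cospan T" using spider_Cospan[OF a set] .
  have "is_composite T c d ?e"
  proof (rule is_compositeI[OF c d e w, where p = ?z and q = ?z])
    show "spo {..<length (ctgt c)} (nodes (apex c)) (nodes (apex d)) (nodes (apex ?e)) (nmap (rleg c)) (nmap (lleg d)) (nmap ?z) (nmap ?z)"
    proof (rule spoI)
      fix \<alpha> \<beta> :: "nat \<Rightarrow> nat" assume "\<forall>i\<in>{..<length (ctgt c)}. \<alpha> (nmap (rleg c) i) = \<beta> (nmap (lleg d) i)"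
      then obtain k where "(\<forall>x\<in>nodes (apex c). \<alpha> x = k) \<and> (\<forall>y\<in>nodes (apex d). \<beta> y = k)" using conn[of \<alpha> \<beta>] by auto
      then show "\<exists>\<gamma>. (\<forall>n\<in>nodes (apex c). \<gamma> (nmap ?z n) = \<alpha> n) \<and> (\<forall>m\<in>nodes (apex d). \<gamma> (nmap ?z m) = \<beta> m)"
        by (intro exI[of _ "\<lambda>_. k"]) simp
    next
      show "nodes (apex ?e) \<subseteq> nmap ?z ` nodes (apex c) \<union> nmap ?z ` nodes (apex d)" using ne by auto
    qed simp_all
    show "spo {} (edges (apex c)) (edges (apex d)) (edges (apex ?e)) (emap (rleg c)) (emap (lleg d)) (emap ?z) (emap ?z)"
      unfolding edges by (rule spoI) simp_all
    show "?z \<in> hyp_hom (apex c) (apex ?e)" "?z \<in> hyp_hom (apex d) (apex ?e)"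
      using edges lab by (auto intro!: homI)
  qed simp_all
  then show ?thesis using FTerm_comp[OF c d e] by simp
qed

lemma id_spider: "a \<in> colours T \<Longrightarrow> ccls T (id_cospan [a]) = ccls T (spider [a] [a] a)"
  by (intro ccls_eqI id_cospan_Cospan spider_Cospan cospan_isoI[where f = hid]) (auto simp: hid_iso)

text \<open>In every equation both sides fuse to the same spider; the identity on a letter is a
  spider as well.\<close>

lemma frob_interpretation:
  "interpretation_of (frob_sig (colours T)) (frob_eqs (colours T)) (FTerm T) (\<lambda>g. ccls T (frob_cospan g))"
proof -
  have "ccls T (frob_cospan g) \<in> Arr (FTerm T) (arity (frob_sig (colours T)) g) (coarity (frob_sig (colours T)) g)"
    if "g \<in> ops (frob_sig (colours T))" for g
    unfolding FTerm_Arr using that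
    by (intro bexI[of _ "frob_cospan g"]) (auto simp: frob_sig_def frob_cospan_def intro!: spider_Cospan)
  moreover have "teval (FTerm T) (\<lambda>g. ccls T (frob_cospan g)) s = teval (FTerm T) (\<lambda>g. ccls T (frob_cospan g)) t"
    if st: "(s, t) \<in> frob_eqs (colours T)" for s t
  proof -
    obtain a where a: "a \<in> colours T" and st: "(s, t) \<in>
       {(TSeq (TPar (TGen (Mu a)) (TId [a])) (TGen (Mu a)), TSeq (TPar (TId [a]) (TGen (Mu a))) (TGen (Mu a))),
         (TSeq (TPar (TGen (Eta a)) (TId [a])) (TGen (Mu a)), (TId [a])),
         (TSeq (TPar (TId [a]) (TGen (Eta a))) (TGen (Mu a)), (TId [a])),
         (TSeq (TSym [a] [a]) (TGen (Mu a)), (TGen (Mu a))),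
         (TSeq (TGen (Delta a)) (TPar (TGen (Delta a)) (TId [a])), TSeq (TGen (Delta a)) (TPar (TId [a]) (TGen (Delta a)))),
         (TSeq (TGen (Delta a)) (TPar (TGen (Eps a)) (TId [a])), (TId [a])),
         (TSeq (TGen (Delta a)) (TPar (TId [a]) (TGen (Eps a))), (TId [a])),
         (TSeq (TGen (Delta a)) (TSym [a] [a]), (TGen (Delta a))),
         (TSeq (TPar (TGen (Delta a)) (TId [a])) (TPar (TId [a]) (TGen (Mu a))), TSeq (TGen (Mu a)) (TGen (Delta a))),
         (TSeq (TPar (TId [a]) (TGen (Delta a))) (TPar (TGen (Mu a)) (TId [a])), TSeq (TGen (Mu a)) (TGen (Delta a))),
         (TSeq (TGen (Delta a)) (TGen (Mu a)), (TId [a]))}"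
      using st unfolding frob_eqs_def Let_def by (elim UN_E)
    have [simp]: "spider w v a \<in> Cospan T" if "set w \<subseteq> {a}" "set v \<subseteq> {a}" for w v using spider_Cospan[OF a that] .
    have [simp]: "sym_cospan [a] [a] \<in> Cospan T" "id_cospan [a] \<in> Cospan T" using a by (simp_all add: sym_cospan_Cospan id_cospan_Cospan)
    note [simp] = cospan_sum_Cospan All_less_Suc lessThan_Suc
    have spiders:
      "pcomp (FTerm T) (ccls T (cospan_sum (spider [a, a] [a] a) (spider [a] [a] a))) (ccls T (spider [a, a] [a] a)) = ccls T (spider [a, a, a] [a] a)"
      "pcomp (FTerm T) (ccls T (cospan_sum (spider [a] [a] a) (spider [a, a] [a] a))) (ccls T (spider [a, a] [a] a)) = ccls T (spider [a, a, a] [a] a)"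
      "pcomp (FTerm T) (ccls T (cospan_sum (spider [] [a] a) (spider [a] [a] a))) (ccls T (spider [a, a] [a] a)) = ccls T (spider [a] [a] a)"
      "pcomp (FTerm T) (ccls T (cospan_sum (spider [a] [a] a) (spider [] [a] a))) (ccls T (spider [a, a] [a] a)) = ccls T (spider [a] [a] a)"
      "pcomp (FTerm T) (ccls T (sym_cospan [a] [a])) (ccls T (spider [a, a] [a] a)) = ccls T (spider [a, a] [a] a)"
      "pcomp (FTerm T) (ccls T (spider [a] [a, a] a)) (ccls T (cospan_sum (spider [a] [a, a] a) (spider [a] [a] a))) = ccls T (spider [a] [a, a, a] a)"
      "pcomp (FTerm T) (ccls T (spider [a] [a, a] a)) (ccls T (cospan_sum (spider [a] [a] a) (spider [a] [a, a] a))) = ccls T (spider [a] [a, a, a] a)"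
      "pcomp (FTerm T) (ccls T (spider [a] [a, a] a)) (ccls T (cospan_sum (spider [a] [] a) (spider [a] [a] a))) = ccls T (spider [a] [a] a)"
      "pcomp (FTerm T) (ccls T (spider [a] [a, a] a)) (ccls T (cospan_sum (spider [a] [a] a) (spider [a] [] a))) = ccls T (spider [a] [a] a)"
      "pcomp (FTerm T) (ccls T (spider [a] [a, a] a)) (ccls T (sym_cospan [a] [a])) = ccls T (spider [a] [a, a] a)"
      "pcomp (FTerm T) (ccls T (cospan_sum (spider [a] [a, a] a) (spider [a] [a] a))) (ccls T (cospan_sum (spider [a] [a] a) (spider [a, a] [a] a))) = ccls T (spider [a, a] [a, a] a)"
      "pcomp (FTerm T) (ccls T (cospan_sum (spider [a] [a] a) (spider [a] [a, a] a))) (ccls T (cospan_sum (spider [a, a] [a] a) (spider [a] [a] a))) = ccls T (spider [a, a] [a, a] a)"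
      "pcomp (FTerm T) (ccls T (spider [a, a] [a] a)) (ccls T (spider [a] [a, a] a)) = ccls T (spider [a, a] [a, a] a)"
      "pcomp (FTerm T) (ccls T (spider [a] [a, a] a)) (ccls T (spider [a, a] [a] a)) = ccls T (spider [a] [a] a)"
      by (subst composite_spider[OF _ _ a]; auto)+
    show ?thesis
      using st by (elim insertE emptyE) (simp_all add: FTerm_tensor FTerm_simps frob_cospan_def spiders id_spider[OF a])
  qed
  ultimately show ?thesis unfolding interpretation_of_def by (auto simp: frob_sig_def FTerm_simps(1))
qed

lemma op_cospan_Cospan:
  assumes S: "wf_signature T" and o: "f \<in> ops T"
  shows "op_cospan T f \<in> Cospan T" "csrc (op_cospan T f) = arity T f" "ctgt (op_cospan T f) = coarity T f"
proof -
  have w: "arity T f \<in> lists (colours T)" "coarity T f \<in> lists (colours T)"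
    using assms by (auto simp: wf_signature_def)
  have "apex (op_cospan T f) \<in> Hyp T"
  proof (rule HypI)
    show "elabel (apex (op_cospan T f)) e \<in> ops T \<and>
        set (sources (apex (op_cospan T f)) e) \<subseteq> nodes (apex (op_cospan T f)) \<and>
        set (targets (apex (op_cospan T f)) e) \<subseteq> nodes (apex (op_cospan T f)) \<and>
        map (nlabel (apex (op_cospan T f))) (sources (apex (op_cospan T f)) e) = arity T (elabel (apex (op_cospan T f)) e) \<and>
        map (nlabel (apex (op_cospan T f))) (targets (apex (op_cospan T f)) e) = coarity T (elabel (apex (op_cospan T f)) e)" for e
      using o by (auto simp: op_cospan_def Let_def nth_append intro: nth_equalityI)
  qed (use w in \<open>auto simp: op_cospan_def Let_def nth_append\<close>)
  then show "op_cospan T f \<in> Cospan T"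
    using w by (intro CospanI) (auto simp: op_cospan_def Let_def nth_append)
  show "csrc (op_cospan T f) = arity T f" "ctgt (op_cospan T f) = coarity T f"
    by (simp_all add: op_cospan_def Let_def)
qed

lemma teval_closed:
  assumes R: "coloured_prop R" and C: "colours S = pcolours R"
    and h: "\<And>g. g \<in> ops S \<Longrightarrow> h g \<in> Arr R (arity S g) (coarity S g) \<and> Q (h g)"
    and id: "\<And>w. w \<in> lists (pcolours R) \<Longrightarrow> Q (pid R w)"
    and sym: "\<And>w v. w \<in> lists (pcolours R) \<Longrightarrow> v \<in> lists (pcolours R) \<Longrightarrow> Q (psym R w v)"
    and comp: "\<And>f g u v w. f \<in> Arr R u v \<Longrightarrow> g \<in> Arr R v w \<Longrightarrow> Q f \<Longrightarrow> Q g \<Longrightarrow> Q (pcomp R f g)"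
    and tensor: "\<And>f g u v u' v'. f \<in> Arr R u v \<Longrightarrow> g \<in> Arr R u' v' \<Longrightarrow> Q f \<Longrightarrow> Q g \<Longrightarrow> Q (ptensor R f g)"
    and "wt S t"
  shows "Q (teval R h t)"
proof -
  have "interpretation_of S {} R h" using C h by (simp add: interpretation_of_def)
  note A = teval_arr[OF R this]
  show ?thesis using \<open>wt S t\<close>
  proof (induction t)
    case (TSeq s t)
    then show ?case using comp[OF A[of s] _] A[of t] by simp
  next
    case (TPar s t)
    then show ?case using tensor[OF A[of s] A[of t]] by simp
  qed (use h id sym C in auto)
qed

section \<open>Generators of the coproduct prop and induction over its arrows\<close>

lemma prop_morphism_id: "prop_morphism P P (\<lambda>x. x)"
  by (simp add: prop_morphism_def)

definition op_arrow :: "('c, 'o) signature \<Rightarrow> 'o \<Rightarrow> ('c, 'o) SFrob_arrow" where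
  "op_arrow T f = coprod_inl (free_prop T) (Frob (colours T)) (pcls T {} (TGen f))"

context
  fixes T :: "('c, 'o) signature"
  assumes mt: "monoidal_theory T"
begin

lemma wf_T: "wf_signature T"
  using mt by (simp add: monoidal_theory_def)

lemma coloured_prop_parts:
  "coloured_prop (free_prop T)" "coloured_prop (Frob (colours T))" "pcolours (free_prop T) = pcolours (Frob (colours T))"
  "pcolours (Frob (colours T)) = colours T"
  unfolding free_prop_def Frob_def
  using presented_coloured_prop[OF wf_T] presented_coloured_prop[OF wf_frob_sig]
  by (simp_all add: pcolours_presented frob_sig_def)

lemma op_interpretation: "interpretation_of T {} (FTerm T) (\<lambda>f. ccls T (op_cospan T f))"
  unfolding interpretation_of_def FTerm_Arr using op_cospan_Cospan[OF wf_T] by (auto simp: FTerm_simps)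

lemma part_morphisms:
  "prop_morphism (free_prop T) (FTerm T) (presented_ext (FTerm T) (\<lambda>f. ccls T (op_cospan T f)))"
  "prop_morphism (Frob (colours T)) (FTerm T) (presented_ext (FTerm T) (\<lambda>g. ccls T (frob_cospan g)))"
  unfolding free_prop_def Frob_def
  using presented_ext_morphism[OF coloured_prop_FTerm wf_T op_interpretation]
    presented_ext_morphism[OF coloured_prop_FTerm wf_frob_sig frob_interpretation] by simp_all

lemmas SFrob_universal = coprod_universal[OF coloured_prop_parts(1,2) coloured_prop_FTerm part_morphisms]

lemma coloured_prop_SFrob: "coloured_prop (SFrob T)"
  unfolding SFrob_def by (rule SFrob_universal(1))

lemma pcolours_SFrob: "pcolours (SFrob T) = colours T"
  using SFrob_universal(4) by (simp add: SFrob_def prop_morphism_def FTerm_simps)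

lemma sem_morphism: "prop_morphism (SFrob T) (FTerm T) (sem T)"
  unfolding SFrob_def sem_def by (rule SFrob_universal(4))

lemma gen_arrows:
  "f \<in> ops T \<Longrightarrow> pcls T {} (TGen f) \<in> Arr (free_prop T) (arity T f) (coarity T f)"
  "g \<in> ops (frob_sig (colours T)) \<Longrightarrow> pcls (frob_sig (colours T)) (frob_eqs (colours T)) (TGen g)
    \<in> Arr (Frob (colours T)) (arity (frob_sig (colours T)) g) (coarity (frob_sig (colours T)) g)"
  using pcls_wt[OF wf_T, of "TGen f" "{}"] pcls_wt[OF wf_frob_sig, of "colours T" "TGen g" "frob_eqs (colours T)"]
  by (simp_all add: free_prop_def Frob_def)

lemma op_arrow_Arr: "f \<in> ops T \<Longrightarrow> op_arrow T f \<in> Arr (SFrob T) (arity T f) (coarity T f)"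
  using SFrob_universal(2) gen_arrows(1) unfolding prop_morphism_def op_arrow_def SFrob_def by blast

lemma frob_arrow_Arr: "g \<in> ops (frob_sig (colours T)) \<Longrightarrow>
    frob_arrow T g \<in> Arr (SFrob T) (arity (frob_sig (colours T)) g) (coarity (frob_sig (colours T)) g)"
  using SFrob_universal(3) gen_arrows(2) unfolding prop_morphism_def frob_arrow_def SFrob_def by blast

lemma sem_op: "f \<in> ops T \<Longrightarrow> sem T (op_arrow T f) = ccls T (op_cospan T f)"
  using SFrob_universal(5)[of "pcls T {} (TGen f)"] gen_arrows(1)[of f]
    presented_ext_pcls[OF coloured_prop_FTerm wf_T op_interpretation, of "TGen f"]
  by (simp add: sem_def op_arrow_def Arr_def)

lemma sem_frob: "g \<in> ops (frob_sig (colours T)) \<Longrightarrow> sem T (frob_arrow T g) = ccls T (frob_cospan g)"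
  using SFrob_universal(6)[of "pcls (frob_sig (colours T)) (frob_eqs (colours T)) (TGen g)"] gen_arrows(2)[of g]
    presented_ext_pcls[OF coloured_prop_FTerm wf_frob_sig frob_interpretation[of T], where t = "TGen g"]
  by (simp add: sem_def frob_arrow_def Arr_def)

lemma frob_equation:
  assumes "(s, t) \<in> frob_eqs (colours T)"
    and wt: "wt (frob_sig (colours T)) s" "wt (frob_sig (colours T)) t" "tdom (frob_sig (colours T)) s = tdom (frob_sig (colours T)) t"
      "tcod (frob_sig (colours T)) s = tcod (frob_sig (colours T)) t"
  shows "teval (SFrob T) (frob_arrow T) s = teval (SFrob T) (frob_arrow T) t"
  using morphism_equation[OF wf_frob_sig SFrob_universal(3)[unfolded Frob_def] assms]
  unfolding frob_arrow_def[abs_def] SFrob_def Frob_def by simp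

lemma frob_prop_SFrob:
  "frob_prop (SFrob T) (\<lambda>c. frob_arrow T (Mu c)) (\<lambda>c. frob_arrow T (Eta c)) (\<lambda>c. frob_arrow T (Delta c)) (\<lambda>c. frob_arrow T (Eps c))"
proof -
  interpret coloured_prop "SFrob T" by (rule coloured_prop_SFrob)
  have eqs: "teval (SFrob T) (frob_arrow T) s = teval (SFrob T) (frob_arrow T) t"
    if "c \<in> colours T" "(s, t) \<in> frob_eqs {c}" for c s t
  proof (rule frob_equation)
    show "(s, t) \<in> frob_eqs (colours T)" using that unfolding frob_eqs_def by blast
  qed (use that in \<open>auto simp: frob_eqs_def Let_def frob_sig_def\<close>)
  have arr: "frob_arrow T (Mu c) \<in> Arr (SFrob T) [c, c] [c]" "frob_arrow T (Eta c) \<in> Arr (SFrob T) [] [c]"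
    "frob_arrow T (Delta c) \<in> Arr (SFrob T) [c] [c, c]" "frob_arrow T (Eps c) \<in> Arr (SFrob T) [c] []"
    if "c \<in> colours T" for c
    using frob_arrow_Arr[of "Mu c"] frob_arrow_Arr[of "Eta c"] frob_arrow_Arr[of "Delta c"] frob_arrow_Arr[of "Eps c"] that
    by (simp_all add: frob_sig_def)
  have laws:
    "teval (SFrob T) (frob_arrow T) (TSeq (TPar (TGen (Mu c)) (TId [c])) (TGen (Mu c))) = teval (SFrob T) (frob_arrow T) (TSeq (TPar (TId [c]) (TGen (Mu c))) (TGen (Mu c)))"
    "teval (SFrob T) (frob_arrow T) (TSeq (TPar (TGen (Eta c)) (TId [c])) (TGen (Mu c))) = teval (SFrob T) (frob_arrow T) ((TId [c]))"
    "teval (SFrob T) (frob_arrow T) (TSeq (TSym [c] [c]) (TGen (Mu c))) = teval (SFrob T) (frob_arrow T) ((TGen (Mu c)))"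
    "teval (SFrob T) (frob_arrow T) (TSeq (TGen (Delta c)) (TPar (TGen (Eps c)) (TId [c]))) = teval (SFrob T) (frob_arrow T) ((TId [c]))"
    "teval (SFrob T) (frob_arrow T) (TSeq (TGen (Delta c)) (TPar (TId [c]) (TGen (Eps c)))) = teval (SFrob T) (frob_arrow T) ((TId [c]))"
    "teval (SFrob T) (frob_arrow T) (TSeq (TPar (TGen (Delta c)) (TId [c])) (TPar (TId [c]) (TGen (Mu c)))) = teval (SFrob T) (frob_arrow T) (TSeq (TGen (Mu c)) (TGen (Delta c)))"
    "teval (SFrob T) (frob_arrow T) (TSeq (TPar (TId [c]) (TGen (Delta c))) (TPar (TGen (Mu c)) (TId [c]))) = teval (SFrob T) (frob_arrow T) (TSeq (TGen (Mu c)) (TGen (Delta c)))"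
    "teval (SFrob T) (frob_arrow T) (TSeq (TGen (Delta c)) (TGen (Mu c))) = teval (SFrob T) (frob_arrow T) ((TId [c]))"
    if "c \<in> colours T" for c
    by (rule eqs[OF that]; simp add: frob_eqs_def Let_def)+
  show ?thesis
    by unfold_locales (use arr laws in \<open>simp_all add: pcolours_SFrob\<close>)
qed

text \<open>The generators of the coproduct are whole arrows of the two summands. Each of these is
  in turn the class of a term over its own signature, so closure under evaluation of terms is used
  at both levels.\<close>

lemma SFrob_induct:
  assumes X: "X \<in> arrows (SFrob T)"
    and op: "\<And>f. f \<in> ops T \<Longrightarrow> Q (op_arrow T f)"
    and frob: "\<And>c. c \<in> colours T \<Longrightarrow>
      Q (frob_arrow T (Mu c)) \<and> Q (frob_arrow T (Eta c)) \<and> Q (frob_arrow T (Delta c)) \<and> Q (frob_arrow T (Eps c))"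
    and id: "\<And>w. w \<in> lists (colours T) \<Longrightarrow> Q (pid (SFrob T) w)"
    and sym: "\<And>w v. w \<in> lists (colours T) \<Longrightarrow> v \<in> lists (colours T) \<Longrightarrow> Q (psym (SFrob T) w v)"
    and comp: "\<And>f g u v w. f \<in> Arr (SFrob T) u v \<Longrightarrow> g \<in> Arr (SFrob T) v w \<Longrightarrow> Q f \<Longrightarrow> Q g \<Longrightarrow> Q (pcomp (SFrob T) f g)"
    and tensor: "\<And>f g u v u' v'. f \<in> Arr (SFrob T) u v \<Longrightarrow> g \<in> Arr (SFrob T) u' v' \<Longrightarrow> Q f \<Longrightarrow> Q g \<Longrightarrow> Q (ptensor (SFrob T) f g)"
  shows "Q X"
proof -
  let ?S = "coprod_sig (free_prop T) (Frob (colours T))" and ?E = "coprod_eqs (free_prop T) (Frob (colours T))"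
  note S = wf_coprod_sig[OF coloured_prop_parts(1-3)]
  have SF: "SFrob T = presented_prop ?S ?E" by (simp add: SFrob_def coprod_prop_def)
  note closed = teval_closed[OF coloured_prop_SFrob, where Q = Q, unfolded pcolours_SFrob, OF _ _ id sym comp tensor]
  obtain t where t: "wt ?S t" "X = pcls ?S ?E t" using X unfolding SF by (auto simp: presented_prop_def)
  have "X = teval (SFrob T) (\<lambda>g. pcls ?S ?E (TGen g)) t"
    unfolding t(2) using morphism_teval[OF S prop_morphism_id t(1)] unfolding SF .
  moreover have "pcls ?S ?E (TGen g) \<in> Arr (SFrob T) (arity ?S g) (coarity ?S g) \<and> Q (pcls ?S ?E (TGen g))"
    if g: "g \<in> ops ?S" for g
  proof
    show "pcls ?S ?E (TGen g) \<in> Arr (SFrob T) (arity ?S g) (coarity ?S g)"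
      unfolding SF using pcls_wt[OF S, of "TGen g" ?E] g by simp
    consider f where "g = Inl f" "f \<in> arrows (free_prop T)" | f where "g = Inr f" "f \<in> arrows (Frob (colours T))"
      using g by (auto simp: coprod_sig_def)
    then show "Q (pcls ?S ?E (TGen g))"
    proof cases
      case 1
      then obtain s where s: "wt T s" "f = pcls T {} s" by (auto simp: free_prop_def presented_prop_def)
      have "pcls ?S ?E (TGen g) = teval (SFrob T) (op_arrow T) s"
        using morphism_teval[OF wf_T SFrob_universal(2)[unfolded free_prop_def] s(1)] 1 s(2)
        unfolding coprod_inl_def op_arrow_def[abs_def] SFrob_def free_prop_def by simp
      then show ?thesis using closed[where S = T and h = "op_arrow T" and t = s] op op_arrow_Arr s(1) by simp
    next
      case 2
      let ?F = "frob_sig (colours T)"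
      obtain s where s: "wt ?F s" "f = pcls ?F (frob_eqs (colours T)) s"
        using 2 by (auto simp: Frob_def presented_prop_def)
      have "pcls ?S ?E (TGen g) = teval (SFrob T) (frob_arrow T) s"
        using morphism_teval[OF wf_frob_sig SFrob_universal(3)[unfolded Frob_def] s(1)] 2 s(2)
        unfolding coprod_inr_def frob_arrow_def[abs_def] SFrob_def Frob_def by simp
      moreover have "Q (frob_arrow T g)" if "g \<in> ops ?F" for g using that frob by (auto simp: frob_sig_def)
      ultimately show ?thesis
        using closed[where S = ?F and h = "frob_arrow T" and t = s] frob_arrow_Arr s(1) by (simp add: frob_sig_def[of "colours T"])
    qed
  qed
  ultimately show ?thesis using closed[where S = ?S and t = t] t(1) coloured_prop_parts by (simp add: coprod_sig_def)
qed

end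

section \<open>Effects and layers of cospans\<close>

text \<open>The interface is given by the list of nodes that its wires reach, the same datum that
  \<open>net\<close> receives as \<open>zs\<close>; its word is read off from the labels.\<close>

definition eff :: "('c, 'o) hypergraph \<Rightarrow> nat list \<Rightarrow> ('c, 'o) cospan" where
  "eff G zs = \<lparr> csrc = map (nlabel G) zs, ctgt = [], apex = G, lleg = \<lparr> nmap = (!) zs, emap = id \<rparr>, rleg = hid \<rparr>"

lemma eff_simps [simp]: "csrc (eff G zs) = map (nlabel G) zs" "ctgt (eff G zs) = []" "apex (eff G zs) = G"
  "nmap (lleg (eff G zs)) i = zs ! i"
  by (simp_all add: eff_def)

lemma Hyp_word: "G \<in> Hyp T \<Longrightarrow> set zs \<subseteq> nodes G \<Longrightarrow> map (nlabel G) zs \<in> lists (colours T)"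
  by (auto simp: Hyp_def subset_iff)

lemma eff_Cospan:
  assumes "G \<in> Hyp T" "set zs \<subseteq> nodes G" shows "eff G zs \<in> Cospan T"
proof (rule CospanI)
  have "zs ! i \<in> nodes G" if "i < length zs" for i using assms(2) nth_mem[OF that] by blast
  then show "\<And>i. i < length (csrc (eff G zs)) \<Longrightarrow> nmap (lleg (eff G zs)) i \<in> nodes (apex (eff G zs)) \<and>
    nlabel (apex (eff G zs)) (nmap (lleg (eff G zs)) i) = csrc (eff G zs) ! i" by simp
qed (use assms Hyp_word[OF assms] in \<open>simp_all del: in_lists_conv_set\<close>)

lemma eff_of_cospan:
  assumes c: "c \<in> Cospan T" and "ctgt c = []"
  defines "zs \<equiv> map (nmap (lleg c)) [0..<length (csrc c)]"
  shows "set zs \<subseteq> nodes (apex c)" "ccls T c = ccls T (eff (apex c) zs)" "csrc c = map (nlabel (apex c)) zs"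
proof -
  note C = CospanD[OF c]
  show sub: "set zs \<subseteq> nodes (apex c)" using C(6) by (auto simp: zs_def)
  show lab: "csrc c = map (nlabel (apex c)) zs" using C(7) by (auto simp: zs_def intro: nth_equalityI)
  have zi: "\<forall>i<length (csrc c). zs ! i = nmap (lleg c) i" by (simp add: zs_def)
  have "cospan_iso c (eff (apex c) zs)"
    by (rule cospan_isoI[where f = hid]) (use assms(2) lab[symmetric] zi in \<open>simp_all add: hid_iso\<close>)
  then show "ccls T c = ccls T (eff (apex c) zs)"
    using ccls_eqI[OF c eff_Cospan[OF C(3) sub]] by blast
qed

lemma nodes_hom:
  assumes "set zs \<subseteq> nodes G" "w = map (nlabel G) zs"
  shows "\<lparr> nmap = (!) zs, emap = id \<rparr> \<in> hyp_hom (discrete w) G"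
proof -
  have "zs ! i \<in> nodes G" if "i < length zs" for i using assms(1) nth_mem[OF that] by blast
  then show ?thesis using assms(2) by (simp add: discrete_hom)
qed

text \<open>The form of \<open>composite_left\<close> for a generator on the front wires: when its
  right leg covers its nodes, \<open>G\<close> stays the same and only the list of reached nodes
  changes.\<close>

lemma layer_left:
  assumes c: "c \<in> Cospan T" and G: "G \<in> Hyp T" and zs: "set zs \<subseteq> nodes G"
    and as: "set as \<subseteq> nodes G" "csrc c = map (nlabel G) as" and as': "set as' \<subseteq> nodes G" "ctgt c = map (nlabel G) as'"
    and edges: "edges (apex c) = {}" and onto: "nodes (apex c) \<subseteq> nmap (rleg c) ` {..<length (ctgt c)}"
    and p: "p \<in> hyp_hom (apex c) G" "\<And>i. i < length as' \<Longrightarrow> nmap p (nmap (rleg c) i) = as' ! i"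
      "\<And>i. i < length as \<Longrightarrow> nmap p (nmap (lleg c) i) = as ! i"
  shows "is_composite T (cospan_sum c (id_cospan (map (nlabel G) zs))) (eff G (as' @ zs)) (eff G (as @ zs))"
proof (rule composite_left)
  let ?b = "map (nlabel G) zs" and ?q = "\<lparr> nmap = (!) zs, emap = id \<rparr>"
  have b: "?b \<in> lists (colours T)" using Hyp_word[OF G zs] .
  show "cospan_sum c (id_cospan ?b) \<in> Cospan T" by (intro cospan_sum_Cospan c id_cospan_Cospan b)
  show "eff G (as' @ zs) \<in> Cospan T" "eff G (as @ zs) \<in> Cospan T" using as(1) as'(1) zs by (simp_all add: eff_Cospan[OF G])
  show "hcase p ?q \<in> hyp_hom (apex (cospan_sum c (id_cospan ?b))) (apex (eff G (as' @ zs)))"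
    using hcase_hom[OF p(1) nodes_hom[OF zs HOL.refl]] by simp
  show "nodes (apex (cospan_sum c (id_cospan ?b))) \<subseteq> nmap (rleg (cospan_sum c (id_cospan ?b))) ` {..<length (ctgt (cospan_sum c (id_cospan ?b)))}"
  proof
    fix x assume "x \<in> nodes (apex (cospan_sum c (id_cospan ?b)))"
    then consider n where "n \<in> nodes (apex c)" "x = inl n" | k where "k < length zs" "x = inr k" by auto
    then show "x \<in> nmap (rleg (cospan_sum c (id_cospan ?b))) ` {..<length (ctgt (cospan_sum c (id_cospan ?b)))}"
    proof cases
      case 1
      then obtain i where "i < length (ctgt c)" "n = nmap (rleg c) i" using onto by auto
      then show ?thesis using 1 by (intro image_eqI[of _ _ i]) auto
    next
      case 2
      then show ?thesis by (intro image_eqI[of _ _ "length (ctgt c) + k"]) auto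
    qed
  qed
qed (use edges p as as' in \<open>auto simp: nth_append\<close>)

lemma layer_mu:
  assumes G: "G \<in> Hyp T" and zs: "set zs \<subseteq> nodes G" and x: "x \<in> nodes G"
  shows "is_composite T (cospan_sum (spider [nlabel G x, nlabel G x] [nlabel G x] (nlabel G x)) (id_cospan (map (nlabel G) zs)))
    (eff G ([x] @ zs)) (eff G ([x, x] @ zs))"
  by (rule layer_left[where p = "\<lparr> nmap = \<lambda>_. x, emap = id \<rparr>"])
    (use assms Hyp_node[OF G x] in \<open>auto intro!: spider_Cospan simp: discrete_hom nth_Cons'\<close>)

lemma layer_eta:
  assumes G: "G \<in> Hyp T" and zs: "set zs \<subseteq> nodes G" and x: "x \<in> nodes G"
  shows "is_composite T (cospan_sum (spider [] [nlabel G x] (nlabel G x)) (id_cospan (map (nlabel G) zs)))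
    (eff G ([x] @ zs)) (eff G ([] @ zs))"
  by (rule layer_left[where p = "\<lparr> nmap = \<lambda>_. x, emap = id \<rparr>"])
    (use assms Hyp_node[OF G x] in \<open>auto intro!: spider_Cospan simp: discrete_hom\<close>)

lemma layer_delta_same:
  assumes G: "G \<in> Hyp T" and zs: "set zs \<subseteq> nodes G" and x: "x \<in> nodes G"
  shows "is_composite T (cospan_sum (spider [nlabel G x] [nlabel G x, nlabel G x] (nlabel G x)) (id_cospan (map (nlabel G) zs)))
    (eff G ([x, x] @ zs)) (eff G ([x] @ zs))"
  by (rule layer_left[where p = "\<lparr> nmap = \<lambda>_. x, emap = id \<rparr>"])
    (use assms Hyp_node[OF G x] in \<open>auto intro!: spider_Cospan simp: discrete_hom nth_Cons'\<close>)

lemma layer_sym: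
  assumes G: "G \<in> Hyp T" and sub: "set zs \<subseteq> nodes G" "set as \<subseteq> nodes G" "set bs \<subseteq> nodes G"
  shows "is_composite T (cospan_sum (sym_cospan (map (nlabel G) as) (map (nlabel G) bs)) (id_cospan (map (nlabel G) zs)))
    (eff G ((bs @ as) @ zs)) (eff G ((as @ bs) @ zs))"
proof (rule layer_left[where p = "\<lparr> nmap = (!) (as @ bs), emap = id \<rparr>"])
  let ?c = "sym_cospan (map (nlabel G) as) (map (nlabel G) bs)"
  show "?c \<in> Cospan T" using sub by (intro sym_cospan_Cospan Hyp_word[OF G])
  show "nodes (apex ?c) \<subseteq> nmap (rleg ?c) ` {..<length (ctgt ?c)}"
  proof
    fix x assume "x \<in> nodes (apex ?c)"
    then show "x \<in> nmap (rleg ?c) ` {..<length (ctgt ?c)}"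
      by (intro image_eqI[of _ _ "if x < length as then length bs + x else x - length as"]) auto
  qed
  show "\<lparr> nmap = (!) (as @ bs), emap = id \<rparr> \<in> hyp_hom (apex ?c) G"
    using nodes_hom[of "as @ bs" G] sub by simp
qed (use assms in \<open>auto simp: nth_append\<close>)

text \<open>The right leg of a counit misses its node, so the result is a disjoint union. The
  isomorphism \<open>f\<close> is left open because the node is either added to a given
  \<open>G\<close> or split off from a given \<open>H\<close>.\<close>

lemma layer_eps:
  assumes G: "G \<in> Hyp T" and H: "H \<in> Hyp T" and a: "a \<in> colours T"
    and f: "f \<in> hyp_iso (hsum (discrete [a]) G) H" "nmap f (inl 0) = x" "map (nmap f) (map inr zs) = ys"
    and zs: "set zs \<subseteq> nodes G"
  shows "ccls T (cospan_sum (spider [a] [] a) (eff G zs)) = ccls T (eff H (x # ys))"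
proof -
  have fh: "f \<in> hyp_hom (hsum (discrete [a]) G) H" using f(1) by (rule hyp_iso_hom)
  have x: "x \<in> nodes H" "nlabel H x = a" using hom_node[OF fh, of "inl 0"] hom_nlabel[OF fh, of "inl 0"] f(2) by auto
  have ys: "set ys \<subseteq> nodes H" "map (nlabel H) ys = map (nlabel G) zs"
    unfolding f(3)[symmetric] using zs hom_node[OF fh] hom_nlabel[OF fh] by auto
  have "cospan_iso (cospan_sum (spider [a] [] a) (eff G zs)) (eff H (x # ys))"
  proof (rule cospan_isoI[where f = f])
    show "nmap f (nmap (lleg (cospan_sum (spider [a] [] a) (eff G zs))) i) = nmap (lleg (eff H (x # ys))) i"
      if "i < length (csrc (cospan_sum (spider [a] [] a) (eff G zs)))" for i
      using that f(2) unfolding f(3)[symmetric] by (cases i) auto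
  qed (use f x ys in simp_all)
  moreover have "cospan_sum (spider [a] [] a) (eff G zs) \<in> Cospan T"
    using a G zs by (intro cospan_sum_Cospan spider_Cospan eff_Cospan) auto
  moreover have "eff H (x # ys) \<in> Cospan T" using H x ys by (intro eff_Cospan) auto
  ultimately show ?thesis using ccls_eqI by blast
qed

text \<open>The single node of the comultiplication is glued to \<open>x\<close> and to
  \<open>y\<close>, which forces these together; the quotient keeps the name
  \<open>x\<close>.\<close>

lemma layer_delta:
  assumes G: "G \<in> Hyp T" and zs: "set zs \<subseteq> nodes G" and x: "x \<in> nodes G" and y: "y \<in> nodes G"
    and xy: "nlabel G y = nlabel G x"
  defines "r \<equiv> \<lambda>z. if z = y then x else z"
  shows "is_composite T (cospan_sum (spider [nlabel G x] [nlabel G x, nlabel G x] (nlabel G x)) (id_cospan (map (nlabel G) zs)))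
    (eff G ([x, y] @ zs)) (eff (hquot G r) (x # map r zs))"
proof -
  let ?a = "nlabel G x" and ?H = "hquot G r"
  let ?c = "cospan_sum (spider [?a] [?a, ?a] ?a) (id_cospan (map (nlabel G) zs))"
  let ?p = "hcase \<lparr> nmap = \<lambda>_. x, emap = id \<rparr> \<lparr> nmap = (!) (map r zs), emap = id \<rparr>" and ?q = "\<lparr> nmap = r, emap = id \<rparr>"
  have a: "?a \<in> colours T" using Hyp_node[OF G x] .
  have rl: "nlabel G (r n) = nlabel G n" for n using xy by (simp add: r_def)
  have H: "?H \<in> Hyp T" using hquot_Hyp[OF G] rl by blast
  have rx: "r x = x" "r y = x" by (simp_all add: r_def)
  have rzs: "set (map r zs) \<subseteq> nodes ?H" "map (nlabel G) zs = map (nlabel ?H) (map r zs)" using zs rl by auto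
  have xH: "x \<in> nodes ?H" using imageI[OF x, of r] rx by simp
  have c: "?c \<in> Cospan T"
    using a Hyp_word[OF G zs] by (intro cospan_sum_Cospan spider_Cospan id_cospan_Cospan) simp_all
  have d: "eff G ([x, y] @ zs) \<in> Cospan T" using G x y zs by (intro eff_Cospan) auto
  have e: "eff ?H (x # map r zs) \<in> Cospan T" using H xH rzs(1) by (intro eff_Cospan) auto
  have z: "zs ! i \<in> nodes G" if "i < length zs" for i using zs nth_mem[OF that] by blast
  show ?thesis
  proof (rule is_compositeI[OF c d e, where p = ?p and q = ?q])
    have "\<lparr> nmap = \<lambda>_. x, emap = id \<rparr> \<in> hyp_hom (discrete [?a]) ?H" using xH by (simp add: discrete_hom)
    from hcase_hom[OF this nodes_hom[OF rzs]]
    show "?p \<in> hyp_hom (apex ?c) (apex (eff ?H (x # map r zs)))" by simp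
    show "?q \<in> hyp_hom (apex (eff G ([x, y] @ zs))) (apex (eff ?H (x # map r zs)))"
      by (rule homI) (auto simp: rl)
    show "spo {..<length (ctgt ?c)} (nodes (apex ?c)) (nodes (apex (eff G ([x, y] @ zs)))) (nodes (apex (eff ?H (x # map r zs))))
      (nmap (rleg ?c)) (nmap (lleg (eff G ([x, y] @ zs)))) (nmap ?p) (nmap ?q)"
    proof (rule spoI)
      show "nmap ?p n \<in> nodes (apex (eff ?H (x # map r zs)))" if "n \<in> nodes (apex ?c)" for n
        using that xH z by auto
      show "nmap ?p (nmap (rleg ?c) i) = nmap ?q (nmap (lleg (eff G ([x, y] @ zs))) i)" if "i \<in> {..<length (ctgt ?c)}" for i
        using that rx by (auto simp: nth_append nth_Cons')
      fix \<alpha> \<beta> :: "nat \<Rightarrow> nat"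
      assume *: "\<forall>i\<in>{..<length (ctgt ?c)}. \<alpha> (nmap (rleg ?c) i) = \<beta> (nmap (lleg (eff G ([x, y] @ zs))) i)"
      have 0: "\<alpha> (inl 0) = \<beta> x" "\<alpha> (inl 0) = \<beta> y" using bspec[OF *, of 0] bspec[OF *, of 1] by simp_all
      have 1: "\<alpha> (inr i) = \<beta> (zs ! i)" if "i < length zs" for i using bspec[OF *, of "2 + i"] that by simp
      \<comment> \<open>Compatibility on the two outputs of the comultiplication gives
        \<open>\<beta>\<close> equal values at \<open>x\<close> and \<open>y\<close>, so
        \<open>\<beta>\<close> itself can serve as the induced function.\<close>
      have r: "\<beta> (r n) = \<beta> n" for n using 0 by (simp add: r_def)
      show "\<exists>\<gamma>. (\<forall>n\<in>nodes (apex ?c). \<gamma> (nmap ?p n) = \<alpha> n) \<and> (\<forall>m\<in>nodes (apex (eff G ([x, y] @ zs))). \<gamma> (nmap ?q m) = \<beta> m)"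
        by (rule exI[of _ \<beta>]) (use 0 1 r in auto)
    qed simp_all
    show "spo {} (edges (apex ?c)) (edges (apex (eff G ([x, y] @ zs)))) (edges (apex (eff ?H (x # map r zs))))
      (emap (rleg ?c)) (emap (lleg (eff G ([x, y] @ zs)))) (emap ?p) (emap ?q)"
    proof (rule spoI)
      fix \<alpha> \<beta> :: "nat \<Rightarrow> nat"
      show "\<exists>\<gamma>. (\<forall>n\<in>edges (apex ?c). \<gamma> (emap ?p n) = \<alpha> n) \<and> (\<forall>m\<in>edges (apex (eff G ([x, y] @ zs))). \<gamma> (emap ?q m) = \<beta> m)"
        by (rule exI[of _ \<beta>]) simp
    qed simp_all
    show "nmap (lleg (eff ?H (x # map r zs))) i = nmap ?p (nmap (lleg ?c) i)" if "i < length (csrc ?c)" for i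
      using that by (cases i) auto
  qed (use xy rl in \<open>auto simp: comp_def\<close>)
qed

text \<open>The state \<open>\<epsilon> \<rightarrow> u v\<close> obtained by folding an operation \<open>u \<rightarrow> v\<close>.\<close>

definition op_state :: "('c, 'o) signature \<Rightarrow> 'o \<Rightarrow> ('c, 'o) cospan" where
  "op_state T f = \<lparr> csrc = [], ctgt = arity T f @ coarity T f, apex = apex (op_cospan T f), lleg = hid, rleg = hid \<rparr>"

definition hdel :: "('c, 'o) hypergraph \<Rightarrow> nat \<Rightarrow> ('c, 'o) hypergraph" where
  "hdel G e = G \<lparr> edges := edges G - {e} \<rparr>"

lemma hdel_simps [simp]: "nodes (hdel G e) = nodes G" "edges (hdel G e) = edges G - {e}" "nlabel (hdel G e) = nlabel G"
  "elabel (hdel G e) = elabel G" "sources (hdel G e) = sources G" "targets (hdel G e) = targets G"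
  by (simp_all add: hdel_def)

lemma hdel_Hyp: "G \<in> Hyp T \<Longrightarrow> hdel G e \<in> Hyp T"
  by (simp add: Hyp_def)

lemma op_apex_simps [simp]:
  "nodes (apex (op_cospan T f)) = {..<length (arity T f) + length (coarity T f)}" "edges (apex (op_cospan T f)) = {0}"
  "nlabel (apex (op_cospan T f)) = (!) (arity T f @ coarity T f)" "elabel (apex (op_cospan T f)) e = f"
  "sources (apex (op_cospan T f)) e = [0..<length (arity T f)]"
  "targets (apex (op_cospan T f)) e = [length (arity T f)..<length (arity T f) + length (coarity T f)]"
  by (simp_all add: op_cospan_def Let_def)

lemma op_state_simps [simp]: "csrc (op_state T f) = []" "ctgt (op_state T f) = arity T f @ coarity T f"
  "apex (op_state T f) = apex (op_cospan T f)" "nmap (rleg (op_state T f)) i = i"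
  by (simp_all add: op_state_def)

lemma op_state_Cospan: "wf_signature T \<Longrightarrow> f \<in> ops T \<Longrightarrow> op_state T f \<in> Cospan T"
  using CospanD[OF op_cospan_Cospan(1), of T f] op_cospan_Cospan[of T f]
  by (intro CospanI) auto

text \<open>Gluing the state of the operation to \<open>G\<close> without \<open>e\<close>, at the
  nodes formerly attached to \<open>e\<close>, puts the hyperedge back.\<close>

lemma layer_op:
  assumes T: "wf_signature T" and G: "G \<in> Hyp T" and zs: "set zs \<subseteq> nodes G" and e: "e \<in> edges G"
  defines "as \<equiv> sources G e @ targets G e"
  shows "is_composite T (cospan_sum (op_state T (elabel G e)) (id_cospan (map (nlabel G) zs)))
    (eff (hdel G e) (as @ zs)) (eff G zs)"
proof -
  let ?f = "elabel G e" and ?D = "hdel G e"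
  let ?c = "cospan_sum (op_state T ?f) (id_cospan (map (nlabel G) zs))"
  let ?p = "hcase \<lparr> nmap = (!) as, emap = \<lambda>_. e \<rparr> \<lparr> nmap = (!) zs, emap = id \<rparr>"
  note att = Hyp_attached[OF G e]
  have as: "set as \<subseteq> nodes G" "map (nlabel G) as = arity T ?f @ coarity T ?f" using att by (auto simp: as_def)
  have len: "length (sources G e) = length (arity T ?f)" "length (targets G e) = length (coarity T ?f)"
    using att(3,4) by (metis length_map)+
  have las: "length as = length (arity T ?f) + length (coarity T ?f)" using len by (simp add: as_def)
  have asn: "as ! i \<in> nodes G" if "i < length as" for i using as(1) nth_mem[OF that] by blast
  have zsn: "zs ! i \<in> nodes G" if "i < length zs" for i using zs nth_mem[OF that] by blast
  have lab: "nlabel G (as ! i) = (arity T ?f @ coarity T ?f) ! i" if "i < length as" for i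
    using as(2) that by (metis nth_map)
  have c: "?c \<in> Cospan T"
    using op_state_Cospan[OF T att(5)] Hyp_word[OF G zs] by (intro cospan_sum_Cospan id_cospan_Cospan)
  have d: "eff ?D (as @ zs) \<in> Cospan T" using hdel_Hyp[OF G] as zs by (intro eff_Cospan) auto
  have g: "eff G zs \<in> Cospan T" using G zs by (intro eff_Cospan) auto
  show ?thesis
  proof (rule is_compositeI[OF c d g, where p = ?p and q = hid])
    have "\<lparr> nmap = (!) as, emap = \<lambda>_. e \<rparr> \<in> hyp_hom (apex (op_cospan T ?f)) G"
    proof (rule homI)
      have "map ((!) as) [0..<length (arity T ?f)] = sources G e"
        "map ((!) as) [length (arity T ?f)..<length (arity T ?f) + length (coarity T ?f)] = targets G e"
        unfolding len[symmetric] by (auto simp: as_def nth_append intro: nth_equalityI)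
      then show "emap \<lparr> nmap = (!) as, emap = \<lambda>_. e \<rparr> x \<in> edges G \<and> elabel G (emap \<lparr> nmap = (!) as, emap = \<lambda>_. e \<rparr> x) = elabel (apex (op_cospan T ?f)) x \<and>
        sources G (emap \<lparr> nmap = (!) as, emap = \<lambda>_. e \<rparr> x) = map (nmap \<lparr> nmap = (!) as, emap = \<lambda>_. e \<rparr>) (sources (apex (op_cospan T ?f)) x) \<and>
        targets G (emap \<lparr> nmap = (!) as, emap = \<lambda>_. e \<rparr> x) = map (nmap \<lparr> nmap = (!) as, emap = \<lambda>_. e \<rparr>) (targets (apex (op_cospan T ?f)) x)" for x
        using e by simp
    qed (use asn lab las in simp)
    from hcase_hom[OF this nodes_hom[OF zs HOL.refl]] show "?p \<in> hyp_hom (apex ?c) (apex (eff G zs))" by simp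
    show "hid \<in> hyp_hom (apex (eff ?D (as @ zs))) (apex (eff G zs))" by (rule homI) (auto simp: hid_def)
    show "spo {..<length (ctgt ?c)} (nodes (apex ?c)) (nodes (apex (eff ?D (as @ zs)))) (nodes (apex (eff G zs)))
      (nmap (rleg ?c)) (nmap (lleg (eff ?D (as @ zs)))) (nmap ?p) (nmap hid)"
    proof (rule spoI)
      show "nmap ?p n \<in> nodes (apex (eff G zs))" if "n \<in> nodes (apex ?c)" for n
        using that asn zsn las by auto
      show "nmap ?p (nmap (rleg ?c) i) = nmap hid (nmap (lleg (eff ?D (as @ zs))) i)" if "i \<in> {..<length (ctgt ?c)}" for i
        using that las by (auto simp: nth_append)
      fix \<alpha> \<beta> :: "nat \<Rightarrow> nat"
      assume *: "\<forall>i\<in>{..<length (ctgt ?c)}. \<alpha> (nmap (rleg ?c) i) = \<beta> (nmap (lleg (eff ?D (as @ zs))) i)"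
      have 0: "\<alpha> (inl i) = \<beta> (as ! i)" if "i < length as" for i using bspec[OF *, of i] that las by (simp add: nth_append)
      have 1: "\<alpha> (inr i) = \<beta> (zs ! i)" if "i < length zs" for i
        using bspec[OF *, of "length as + i"] that las by (simp add: nth_append)
      show "\<exists>\<gamma>. (\<forall>n\<in>nodes (apex ?c). \<gamma> (nmap ?p n) = \<alpha> n) \<and> (\<forall>m\<in>nodes (apex (eff ?D (as @ zs))). \<gamma> (nmap hid m) = \<beta> m)"
        by (rule exI[of _ \<beta>]) (use 0 1 las in auto)
    qed simp_all
    show "spo {} (edges (apex ?c)) (edges (apex (eff ?D (as @ zs)))) (edges (apex (eff G zs)))
      (emap (rleg ?c)) (emap (lleg (eff ?D (as @ zs)))) (emap ?p) (emap hid)"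
    proof (rule spoI)
      fix \<alpha> \<beta> :: "nat \<Rightarrow> nat"
      show "\<exists>\<gamma>. (\<forall>n\<in>edges (apex ?c). \<gamma> (emap ?p n) = \<alpha> n) \<and> (\<forall>m\<in>edges (apex (eff ?D (as @ zs))). \<gamma> (emap hid m) = \<beta> m)"
        \<comment> \<open>The hyperedge \<open>e\<close> is the image of the only hyperedge
          \<open>0\<close> of the state; all others come from \<open>hdel G e\<close>.\<close>
        by (rule exI[of _ "\<lambda>x. if x = e then \<alpha> (inl 0) else \<beta> x"]) simp
    qed (use e in auto)
  qed (use as in auto)
qed

section \<open>The interpretation is full and faithful\<close>

context
  fixes T :: "('c, 'o) signature"
  assumes mt: "monoidal_theory T"
begin

interpretation frob_prop "SFrob T" "\<lambda>c. frob_arrow T (Mu c)" "\<lambda>c. frob_arrow T (Eta c)"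
  "\<lambda>c. frob_arrow T (Delta c)" "\<lambda>c. frob_arrow T (Eps c)"
  by (rule frob_prop_SFrob[OF mt])

abbreviation SFrob_seq (infixr "\<cdot>" 55) where "f \<cdot> g \<equiv> pcomp (SFrob T) f g"
abbreviation SFrob_par (infixr "\<oplus>" 65) where "f \<oplus> g \<equiv> ptensor (SFrob T) f g"

lemma C_colours: "C = colours T"
  by (rule pcolours_SFrob[OF mt])

lemma fold_arrow_name: "fold_arrow T a = name a"
proof -
  have "eta_word T w = etas w" for w by (induction w) simp_all
  moreover have "delta_word T w = deltas w" for w by (induction w) simp_all
  ultimately show ?thesis by (simp add: fold_arrow_def name_def cup_def Let_def)
qed

lemma sem_Arr: "f \<in> A \<Longrightarrow> sem T f \<in> Arr (FTerm T) (dom f) (cod f)"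
  using sem_morphism[OF mt] ArrI unfolding prop_morphism_def by blast

lemma sem_seq: "f \<in> A \<Longrightarrow> g \<in> A \<Longrightarrow> cod f = dom g \<Longrightarrow> sem T (f \<cdot> g) = pcomp (FTerm T) (sem T f) (sem T g)"
  using sem_morphism[OF mt] ArrI[of f] ArrI[of g] unfolding prop_morphism_def by metis

lemma sem_par: "f \<in> A \<Longrightarrow> g \<in> A \<Longrightarrow> sem T (f \<oplus> g) = ptensor (FTerm T) (sem T f) (sem T g)"
  using sem_morphism[OF mt] unfolding prop_morphism_def by blast

lemma sem_I: "w \<in> W \<Longrightarrow> sem T (I w) = pid (FTerm T) w"
  using sem_morphism[OF mt] unfolding prop_morphism_def by blast

lemma sem_S: "w \<in> W \<Longrightarrow> v \<in> W \<Longrightarrow> sem T (S w v) = psym (FTerm T) w v"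
  using sem_morphism[OF mt] unfolding prop_morphism_def by blast

lemma sem_gens:
  assumes "c \<in> C"
  shows "sem T (frob_arrow T (Mu c)) = ccls T (spider [c, c] [c] c)" "sem T (frob_arrow T (Eta c)) = ccls T (spider [] [c] c)"
    "sem T (frob_arrow T (Delta c)) = ccls T (spider [c] [c, c] c)" "sem T (frob_arrow T (Eps c)) = ccls T (spider [c] [] c)"
  using sem_frob[OF mt] assms unfolding C_colours by (simp_all add: frob_sig_def frob_cospan_def)

lemma sem_layer:
  assumes "f \<in> A" "X \<in> A" "dom X = cod f @ b" "b \<in> W" "sem T f = ccls T c" "c \<in> Cospan T" "sem T X = ccls T d" "d \<in> Cospan T"
    "e \<in> Cospan T" "is_composite T (cospan_sum c (id_cospan b)) d e"
  shows "sem T (L [] f b \<cdot> X) = ccls T e"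
proof -
  have i: "id_cospan b \<in> Cospan T" using assms(4) by (simp add: id_cospan_Cospan C_colours)
  have "sem T (L [] f b) = ccls T (cospan_sum c (id_cospan b))"
    using assms i by (simp add: L_def sem_par sem_I FTerm_simps FTerm_tensor)
  then show ?thesis using assms i FTerm_comp[OF cospan_sum_Cospan[OF assms(6) i] assms(8-10)] by (simp add: sem_seq)
qed

lemma ops_typ:
  assumes "f \<in> ops T"
  shows "op_arrow T f \<in> A" "dom (op_arrow T f) = arity T f" "cod (op_arrow T f) = coarity T f"
    "arity T f \<in> W" "coarity T f \<in> W"
  using op_arrow_Arr[OF mt assms] apply (simp_all add: Arr_iff)
  using wf_T[OF mt] assms unfolding C_colours wf_signature_def by auto

subsection \<open>Folded operations\<close>

text \<open>The counterpart of \<open>cofun\<close> with empty left interface, which is the shape of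
  the interpretations of \<open>etas\<close> and \<open>cup\<close>.\<close>

definition rcofun :: "'c list \<Rightarrow> nat list \<Rightarrow> ('c, 'o) cospan" where
  "rcofun w xs = \<lparr> csrc = [], ctgt = map ((!) w) xs, apex = discrete w, lleg = hid, rleg = \<lparr> nmap = (!) xs, emap = id \<rparr> \<rparr>"

lemma rcofun_simps [simp]: "csrc (rcofun w xs) = []" "ctgt (rcofun w xs) = map ((!) w) xs" "apex (rcofun w xs) = discrete w"
  "nmap (rleg (rcofun w xs)) i = xs ! i"
  by (simp_all add: rcofun_def)

lemma rcofun_Cospan: "w \<in> lists (colours T) \<Longrightarrow> set xs \<subseteq> {..<length w} \<Longrightarrow> rcofun w xs \<in> Cospan T"
  by (rule CospanI) (auto simp: discrete_Hyp subset_iff)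

lemma sem_etas: "w \<in> W \<Longrightarrow> sem T (etas w) = ccls T (rcofun w [0..<length w])"
proof (induction w)
  case Nil
  show ?case
    unfolding etas.simps using sem_I[of "[]"]
    by (simp add: FTerm_simps) (intro ccls_eqI id_cospan_Cospan rcofun_Cospan cospan_isoI[where f = hid]; simp add: hid_iso)
next
  case (Cons c w)
  then have c: "c \<in> C" "w \<in> W" by auto
  have 1: "spider [] [c] c \<in> Cospan T" "rcofun w [0..<length w] \<in> Cospan T" "rcofun (c # w) [0..<length (c # w)] \<in> Cospan T"
    using c by (auto intro!: spider_Cospan rcofun_Cospan simp: C_colours simp del: upt_Suc)
  let ?f = "hcase \<lparr> nmap = \<lambda>_. 0, emap = id \<rparr> \<lparr> nmap = Suc, emap = id \<rparr>"
  let ?g = "\<lparr> nmap = \<lambda>i. if i = 0 then inl 0 else inr (i - 1), emap = id \<rparr>"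
  have f: "?f \<in> hyp_iso (hsum (discrete [c]) (discrete w)) (discrete (c # w))"
  proof (rule hyp_isoI[where g = ?g])
    show "?f \<in> hyp_hom (hsum (discrete [c]) (discrete w)) (discrete (c # w))" by (rule homI) auto
    show "?g \<in> hyp_hom (discrete (c # w)) (hsum (discrete [c]) (discrete w))" by (rule homI) (auto simp: nth_Cons')
  qed (auto simp: heq_def)
  have "cospan_iso (cospan_sum (spider [] [c] c) (rcofun w [0..<length w])) (rcofun (c # w) [0..<length (c # w)])"
  proof (rule cospan_isoI[where f = ?f])
    show "ctgt (cospan_sum (spider [] [c] c) (rcofun w [0..<length w])) = ctgt (rcofun (c # w) [0..<length (c # w)])"
      by (simp del: upt_Suc add: upt_conv_Cons map_Suc_upt[symmetric])
  qed (use f in \<open>auto simp del: upt_Suc simp: nth_append\<close>)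
  then have "ccls T (cospan_sum (spider [] [c] c) (rcofun w [0..<length w])) = ccls T (rcofun (c # w) [0..<length (c # w)])"
    using 1 by (intro ccls_eqI cospan_sum_Cospan)
  then show ?case using Cons.IH c 1 by (simp add: sem_par sem_gens FTerm_tensor del: upt_Suc)
qed

text \<open>All factors of the recursion lie in the image of \<open>cofun\<close>, so the claim
  becomes an identity of index lists.\<close>

lemma sem_deltas: "w \<in> W \<Longrightarrow> sem T (deltas w) = ccofun T w ([0..<length w] @ [0..<length w])"
proof (induction w)
  case Nil
  show ?case unfolding deltas.simps using sem_I[of "[]"] by (simp add: FTerm_id_cofun)
next
  case (Cons c w)
  then have c: "c \<in> C" "w \<in> W" and W: "c \<in> colours T" "w \<in> lists (colours T)" by (auto simp: C_colours)
  let ?n = "length w"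
  have d: "sem T (frob_arrow T (Delta c)) = ccofun T [c] [0, 0]"
    unfolding sem_gens(3)[OF c(1)] ccofun_def
    by (intro ccls_eqI spider_Cospan cofun_Cospan cospan_isoI[where f = hid]) (use W in \<open>auto simp: hid_iso nth_Cons'\<close>)
  \<comment> \<open>\<open>?p\<close> lists the wires in the order c c w w, \<open>?q\<close>
    rearranges them into c w c w, and \<open>?s\<close> is the crossing of the second c with the
    first w.\<close>
  let ?p = "[0, 0] @ map ((+) 1) ([0..<?n] @ [0..<?n])"
  let ?r = "[?n + 0] @ [0..<?n]"
  let ?s = "[1..<1 + ?n] @ [0]"
  let ?q = "[0] @ map ((+) 1) (?s @ map ((+) (1 + ?n)) [0..<?n])"
  have 1: "sem T (frob_arrow T (Delta c) \<oplus> deltas w) = ccofun T (c # w) ?p"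
    using c W FTerm_tensor_cofun[of "[c]" T w "[0, 0]" "[0..<?n] @ [0..<?n]"] Cons.IH d by (simp add: sem_par subset_iff)
  have sy: "sem T (S [c] w) = ccofun T (c # w) ?s"
    using c W by (simp add: sem_S FTerm_sym_cofun)
  have "ptensor (FTerm T) (ccofun T (c # w) ?s) (ccofun T w [0..<?n])
      = ccofun T ((c # w) @ w) (?s @ map ((+) (length (c # w))) [0..<?n])"
    by (rule FTerm_tensor_cofun) (use W in auto)
  then have sy1: "sem T (S [c] w \<oplus> I w) = ccofun T (c # w @ w) (?s @ map ((+) (1 + ?n)) [0..<?n])"
    using c W sy by (simp add: sem_par sem_I FTerm_id_cofun del: upt_Suc)
  have "ptensor (FTerm T) (ccofun T [c] [0]) (ccofun T (c # w @ w) (?s @ map ((+) (1 + ?n)) [0..<?n]))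
      = ccofun T ([c] @ c # w @ w) ([0] @ map ((+) (length [c])) (?s @ map ((+) (1 + ?n)) [0..<?n]))"
    by (rule FTerm_tensor_cofun) (use W in auto)
  then have sy2: "sem T (I [c] \<oplus> (S [c] w \<oplus> I w)) = ccofun T (c # c # w @ w) ?q"
    using c W sy1 by (simp add: sem_par sem_I FTerm_id_cofun del: upt_Suc) (simp add: upt_conv_Cons del: upt_Suc)
  have v: "c # c # w @ w = map ((!) (c # w)) ?p" by (rule nth_equalityI) (auto simp: nth_append nth_Cons')
  have "map ((!) ?p) ?q = [0..<length (c # w)] @ [0..<length (c # w)]"
    by (rule nth_equalityI) (auto simp: nth_append nth_Cons' simp del: upt_Suc)
  moreover have "pcomp (FTerm T) (ccofun T (c # w) ?p) (ccofun T (c # c # w @ w) ?q) = ccofun T (c # w) (map ((!) ?p) ?q)"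
    using c W by (intro FTerm_comp_cofun v) (auto simp: subset_iff)
  moreover have "sem T (deltas (c # w)) = pcomp (FTerm T) (ccofun T (c # w) ?p) (ccofun T (c # c # w @ w) ?q)"
    using 1 sy2 c by (simp add: sem_seq)
  ultimately show ?case by simp
qed

lemma sem_cup:
  assumes "w \<in> W" shows "sem T (cup w) = ccls T (rcofun w ([0..<length w] @ [0..<length w]))"
proof -
  have W: "w \<in> lists (colours T)" using assms by (simp add: C_colours)
  let ?n = "length w"
  have C: "rcofun w [0..<?n] \<in> Cospan T" "cofun w ([0..<?n] @ [0..<?n]) \<in> Cospan T" "rcofun w ([0..<?n] @ [0..<?n]) \<in> Cospan T"
    using W by (auto intro!: rcofun_Cospan cofun_Cospan)
  have "is_composite T (rcofun w [0..<?n]) (cofun w ([0..<?n] @ [0..<?n])) (rcofun w ([0..<?n] @ [0..<?n]))"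
    by (rule composite_right[OF C(1,2) _ _ _ _ _ C(3), where q = hid]) (auto simp: hid_hom map_nth)
  then show ?thesis
    using FTerm_comp[OF C] assms by (simp add: cup_def sem_seq sem_etas sem_deltas ccofun_def)
qed

text \<open>The input wires created by the cup are glued to the source nodes of the operation, so
  its hypergraph is unchanged and all its nodes become right interface.\<close>

lemma sem_name_op:
  assumes f: "f \<in> ops T" shows "sem T (name (op_arrow T f)) = ccls T (op_state T f)"
proof -
  note t = ops_typ[OF f]
  note T = wf_T[OF mt]
  let ?u = "arity T f" and ?v = "coarity T f" and ?O = "apex (op_cospan T f)"
  let ?c = "rcofun ?u ([0..<length ?u] @ [0..<length ?u])" and ?d = "cospan_sum (id_cospan ?u) (op_cospan T f)"
  have W: "?u \<in> lists (colours T)" "?v \<in> lists (colours T)" using t by (simp_all add: C_colours)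
  note O = op_cospan_Cospan[OF T f]
  have C: "?c \<in> Cospan T" "id_cospan ?u \<in> Cospan T" "?d \<in> Cospan T" "op_state T f \<in> Cospan T"
    using W O op_state_Cospan[OF T f] by (auto intro!: rcofun_Cospan cospan_sum_Cospan id_cospan_Cospan)
  have hid: "hid \<in> hyp_hom (discrete ?u) ?O" by (auto simp: discrete_hom nth_append)
  have legs: "nmap (lleg (op_cospan T f)) i = i" "nmap (rleg (op_cospan T f)) i = length ?u + i" for i
    by (simp_all add: op_cospan_def Let_def)
  have "is_composite T ?c ?d (op_state T f)"
  proof (rule is_compositeI[OF C(1,3,4), where p = hid and q = "hcase hid hid"])
    show "hcase hid hid \<in> hyp_hom (apex ?d) (apex (op_state T f))"
      using hcase_hom[OF hid hid_hom] by simp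
    show "spo {..<length (ctgt ?c)} (nodes (apex ?c)) (nodes (apex ?d)) (nodes (apex (op_state T f)))
      (nmap (rleg ?c)) (nmap (lleg ?d)) (nmap hid) (nmap (hcase hid hid))"
    proof (rule spoI)
      fix \<alpha> \<beta> :: "nat \<Rightarrow> nat"
      assume *: "\<forall>i\<in>{..<length (ctgt ?c)}. \<alpha> (nmap (rleg ?c) i) = \<beta> (nmap (lleg ?d) i)"
      have "\<alpha> i = \<beta> (inl i)" "\<alpha> i = \<beta> (inr i)" if "i < length ?u" for i
        using bspec[OF *, of i] bspec[OF *, of "length ?u + i"] that legs O by (simp_all add: nth_append)
      then show "\<exists>\<gamma>. (\<forall>n\<in>nodes (apex ?c). \<gamma> (nmap hid n) = \<alpha> n) \<and> (\<forall>m\<in>nodes (apex ?d). \<gamma> (nmap (hcase hid hid) m) = \<beta> m)"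
        by (intro exI[of _ "\<lambda>i. \<beta> (inr i)"]) auto
    next
      show "nodes (apex (op_state T f)) \<subseteq> nmap hid ` nodes (apex ?c) \<union> nmap (hcase hid hid) ` nodes (apex ?d)"
      proof
        fix x assume "x \<in> nodes (apex (op_state T f))"
        then show "x \<in> nmap hid ` nodes (apex ?c) \<union> nmap (hcase hid hid) ` nodes (apex ?d)"
          by (intro UnI2 image_eqI[of _ _ "inr x"]) simp_all
      qed
    qed (use legs O in \<open>auto simp: nth_append\<close>)
    show "spo {} (edges (apex ?c)) (edges (apex ?d)) (edges (apex (op_state T f)))
      (emap (rleg ?c)) (emap (lleg ?d)) (emap hid) (emap (hcase hid hid))"
    proof (rule spoI)
      fix \<alpha> \<beta> :: "nat \<Rightarrow> nat"
      show "\<exists>\<gamma>. (\<forall>n\<in>edges (apex ?c). \<gamma> (emap hid n) = \<alpha> n) \<and> (\<forall>m\<in>edges (apex ?d). \<gamma> (emap (hcase hid hid) m) = \<beta> m)"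
        by (intro exI[of _ "\<lambda>i. \<beta> (inr i)"]) simp
    qed auto
  qed (use hid legs O in \<open>auto simp: nth_append map_nth\<close>)
  moreover have "sem T (I ?u \<oplus> op_arrow T f) = ccls T ?d"
    using t C O sem_op[OF mt f] by (simp add: sem_par sem_I FTerm_simps FTerm_tensor)
  ultimately show ?thesis
    using FTerm_comp[OF C(1,3,4)] t by (simp add: name_def sem_seq sem_cup)
qed

subsection \<open>Faithfulness\<close>

lemmas [simp del] = in_lists_conv_set

lemma inl_inr_eq [simp]: "inl x = inl y \<longleftrightarrow> x = y" "inr x = inr y \<longleftrightarrow> x = y" "inl x \<noteq> inr y" "inr y \<noteq> inl x"
  by (metis sum_encode_inverse sum.inject Inl_Inr_False)+

definition enum :: "('c, 'o) hypergraph \<Rightarrow> nat list \<Rightarrow> nat list \<Rightarrow> bool" where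
  "enum G ns es \<longleftrightarrow> distinct ns \<and> set ns = nodes G \<and> distinct es \<and> set es = edges G"

text \<open>The enumerations are parameters, so that each step may take a convenient one;
  \<open>nf_enum\<close> shows that the arrow does not depend on them.\<close>

definition nf :: "('c, 'o) hypergraph \<Rightarrow> nat list \<Rightarrow> nat list \<Rightarrow> nat list \<Rightarrow> ('c, 'o) SFrob_arrow" where
  "nf G ns es zs = net (nlabel G) ns (\<lambda>e. name (op_arrow T (elabel G e))) (\<lambda>e. sources G e @ targets G e) es zs"

lemma is_net_enum:
  assumes G: "G \<in> Hyp T" and e: "enum G ns es"
  shows "is_net (nlabel G) ns (\<lambda>e. name (op_arrow T (elabel G e))) (\<lambda>e. sources G e @ targets G e) es"
proof -
  have "nlabel G ` set ns \<subseteq> C" using e Hyp_node[OF G] by (auto simp: enum_def C_colours)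
  moreover have "name (op_arrow T (elabel G d)) \<in> A \<and> dom (name (op_arrow T (elabel G d))) = [] \<and>
    cod (name (op_arrow T (elabel G d))) = map (nlabel G) (sources G d @ targets G d) \<and> set (sources G d @ targets G d) \<subseteq> set ns"
    if "d \<in> set es" for d
  proof -
    have d: "d \<in> edges G" using that e by (simp add: enum_def)
    show ?thesis
      using Hyp_attached[OF G d] ops_typ[of "elabel G d"] e by (simp add: enum_def)
  qed
  ultimately show ?thesis unfolding is_net_def by blast
qed

lemma nf_typ:
  assumes "G \<in> Hyp T" "enum G ns es" "set zs \<subseteq> nodes G"
  shows "nf G ns es zs \<in> A" "dom (nf G ns es zs) = map (nlabel G) zs" "cod (nf G ns es zs) = []"
  using net_typ[OF is_net_enum[OF assms(1,2)], of zs] assms by (simp_all add: nf_def enum_def)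

lemma nf_enum:
  assumes G: "G \<in> Hyp T" and e: "enum G ns es" "enum G ns' es'" and zs: "set zs \<subseteq> nodes G"
  shows "nf G ns es zs = nf G ns' es' zs"
proof -
  have e': "enum G ns' es" using e by (simp add: enum_def)
  show ?thesis unfolding nf_def
    using net_nodes[OF is_net_enum[OF G e(1)], of zs ns'] net_edges[OF is_net_enum[OF G e'], of zs es'] e zs
    by (simp add: enum_def)
qed

text \<open>An isomorphism renames nodes and hyperedges, which a net does not notice; the
  enumerations are adjusted by \<open>nf_enum\<close>.\<close>

lemma nf_iso:
  assumes iso: "cospan_iso (eff G zs) (eff H ys)" and G: "G \<in> Hyp T" "H \<in> Hyp T" "set zs \<subseteq> nodes G" "set ys \<subseteq> nodes H"
    and e: "enum G ns es" "enum H ns' es'"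
  shows "nf G ns es zs = nf H ns' es' ys"
proof -
  obtain f where f': "csrc (eff G zs) = csrc (eff H ys)" "f \<in> hyp_iso (apex (eff G zs)) (apex (eff H ys))"
    "\<forall>i<length (csrc (eff G zs)). nmap f (nmap (lleg (eff G zs)) i) = nmap (lleg (eff H ys)) i"
    using iso by (elim cospan_isoE)
  have f: "map (nlabel G) zs = map (nlabel H) ys" "f \<in> hyp_iso G H" using f'(1,2) by simp_all
  have fi: "\<forall>i<length zs. nmap f (zs ! i) = ys ! i" using f'(3) by simp
  have "length zs = length ys" using f(1) by (metis length_map)
  then have ys: "ys = map (nmap f) zs" using fi by (simp add: list_eq_iff_nth_eq)
  have fh: "f \<in> hyp_hom G H" and bn: "bij_betw (nmap f) (nodes G) (nodes H)" and be: "bij_betw (emap f) (edges G) (edges H)"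
    using f(2) by (auto simp: hyp_iso_def)
  have en: "enum H (map (nmap f) ns) (map (emap f) es)"
    using e(1) bn be by (auto simp: enum_def bij_betw_def distinct_map)
  have "nf H (map (nmap f) ns) (map (emap f) es) (map (nmap f) zs) = nf G ns es zs"
    unfolding nf_def
  proof (rule net_relabel[OF is_net_enum[OF G(1) e(1)]])
    show "set zs \<subseteq> set ns" "inj_on (nmap f) (set ns)" "\<forall>y\<in>set ns. nlabel H (nmap f y) = nlabel G y"
      using e(1) G(3) bn hom_nlabel[OF fh] by (auto simp: enum_def bij_betw_def)
    show "\<forall>d\<in>set es. name (op_arrow T (elabel H (emap f d))) = name (op_arrow T (elabel G d)) \<and>
      sources H (emap f d) @ targets H (emap f d) = map (nmap f) (sources G d @ targets G d)"
      using e(1) hom_elabel[OF fh] hom_sources[OF fh] hom_targets[OF fh] by (simp add: enum_def)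
  qed
  then show ?thesis using nf_enum[OF G(2) en e(2) G(4)] unfolding ys by simp
qed

definition normalisable :: "('c, 'o) SFrob_arrow \<Rightarrow> bool" where
  "normalisable X \<longleftrightarrow> (\<exists>G ns es zs. G \<in> Hyp T \<and> enum G ns es \<and> set zs \<subseteq> nodes G \<and>
     sem T X = ccls T (eff G zs) \<and> X = nf G ns es zs)"

text \<open>The interpretation determines the hypergraph and its interface up to isomorphism, and by
  \<open>nf_iso\<close> these determine the normal form.\<close>

lemma normalisable_unique:
  assumes "normalisable X" "normalisable Y" "sem T X = sem T Y"
  shows "X = Y"
proof -
  obtain G ns es zs where X: "G \<in> Hyp T" "enum G ns es" "set zs \<subseteq> nodes G" "sem T X = ccls T (eff G zs)" "X = nf G ns es zs"
    using assms(1) unfolding normalisable_def by blast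
  obtain H ns' es' ys where Y: "H \<in> Hyp T" "enum H ns' es'" "set ys \<subseteq> nodes H" "sem T Y = ccls T (eff H ys)" "Y = nf H ns' es' ys"
    using assms(2) unfolding normalisable_def by blast
  have "eff H ys \<in> ccls T (eff G zs)" using assms(3) X(4) Y(4) ccls_self[OF eff_Cospan[OF Y(1,3)]] by simp
  then have "cospan_iso (eff G zs) (eff H ys)" by (simp add: ccls_def)
  then show ?thesis using nf_iso X Y by simp
qed

lemma normalisableE:
  assumes "normalisable X" "dom X = u @ b"
  obtains G ns es as zs where "G \<in> Hyp T" "enum G ns es" "set as \<subseteq> nodes G" "set zs \<subseteq> nodes G"
    "sem T X = ccls T (eff G (as @ zs))" "X = nf G ns es (as @ zs)" "map (nlabel G) as = u" "map (nlabel G) zs = b"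
proof -
  obtain G ns es zs where X: "G \<in> Hyp T" "enum G ns es" "set zs \<subseteq> nodes G" "sem T X = ccls T (eff G zs)" "X = nf G ns es zs"
    using assms(1) unfolding normalisable_def by blast
  then have "map (nlabel G) zs = u @ b" using nf_typ(2)[OF X(1-3)] assms(2) by simp
  then obtain as zs' where "zs = as @ zs'" "map (nlabel G) as = u" "map (nlabel G) zs' = b"
    unfolding map_eq_append_conv by blast
  then show thesis using X that[of G ns es as zs'] by simp
qed

text \<open>The spectator wires \<open>b\<close> make the property stable under
  \<open>\<oplus>\<close>. With \<open>b\<close> empty and \<open>X\<close> the identity on the
  empty word, it makes every arrow into the empty word normalisable.\<close>

definition keeps_normal :: "('c, 'o) SFrob_arrow \<Rightarrow> bool" where
  "keeps_normal f \<longleftrightarrow> (\<forall>b X. b \<in> W \<longrightarrow> X \<in> A \<longrightarrow> normalisable X \<longrightarrow> dom X = cod f @ b \<longrightarrow> normalisable (L [] f b \<cdot> X))"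

lemma normalisableI: "\<lbrakk>G \<in> Hyp T; enum G ns es; set zs \<subseteq> nodes G; sem T X = ccls T (eff G zs); X = nf G ns es zs\<rbrakk> \<Longrightarrow> normalisable X"
  unfolding normalisable_def by blast

text \<open>\<open>D\<close> may be any representative of the class of
  \<open>eff G (as @ zs)\<close>: after a hyperedge has been added, deleting it gives a hypergraph
  isomorphic to \<open>G\<close> but in general not equal to it as a record.\<close>

lemma keeps_normalI:
  assumes f: "f \<in> A" and c: "sem T f = ccls T c" "c \<in> Cospan T"
    and step: "\<And>G ns es as zs. \<lbrakk>G \<in> Hyp T; enum G ns es; set as \<subseteq> nodes G; set zs \<subseteq> nodes G; map (nlabel G) as = cod f\<rbrakk> \<Longrightarrow>
      \<exists>D H ns' es' ys. D \<in> Cospan T \<and> ccls T (eff G (as @ zs)) = ccls T D \<and> H \<in> Hyp T \<and> enum H ns' es' \<and> set ys \<subseteq> nodes H \<and>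
        is_composite T (cospan_sum c (id_cospan (map (nlabel G) zs))) D (eff H ys) \<and>
        L [] f (map (nlabel G) zs) \<cdot> nf G ns es (as @ zs) = nf H ns' es' ys"
  shows "keeps_normal f"
  unfolding keeps_normal_def
proof (intro allI impI)
  fix b X assume b: "b \<in> W" and X: "X \<in> A" "normalisable X" "dom X = cod f @ b"
  obtain G ns es as zs where G: "G \<in> Hyp T" "enum G ns es" "set as \<subseteq> nodes G" "set zs \<subseteq> nodes G"
    "sem T X = ccls T (eff G (as @ zs))" "X = nf G ns es (as @ zs)" "map (nlabel G) as = cod f" "map (nlabel G) zs = b"
    using X(2,3) by (rule normalisableE)
  obtain D H ns' es' ys where H: "D \<in> Cospan T" "ccls T (eff G (as @ zs)) = ccls T D" "H \<in> Hyp T" "enum H ns' es'" "set ys \<subseteq> nodes H"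
    "is_composite T (cospan_sum c (id_cospan (map (nlabel G) zs))) D (eff H ys)"
    "L [] f (map (nlabel G) zs) \<cdot> nf G ns es (as @ zs) = nf H ns' es' ys"
    using step[OF G(1-4,7)] by blast
  have "sem T (L [] f b \<cdot> X) = ccls T (eff H ys)"
    using sem_layer[OF f X(1) X(3) b c _ H(1) eff_Cospan[OF H(3,5)]] H(2,6) G(5,8) by simp
  then show "normalisable (L [] f b \<cdot> X)" using H G by (intro normalisableI) auto
qed

lemma keeps_normal_mu: assumes "c \<in> C" shows "keeps_normal (frob_arrow T (Mu c))"
proof (rule keeps_normalI)
  show "frob_arrow T (Mu c) \<in> A" using assms by simp
  show "sem T (frob_arrow T (Mu c)) = ccls T (spider [c, c] [c] c)" using sem_gens[OF assms] by simp
  show "spider [c, c] [c] c \<in> Cospan T" using assms by (intro spider_Cospan) (auto simp: C_colours)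
  fix G ns es as zs assume G: "G \<in> Hyp T" "enum G ns es" "set as \<subseteq> nodes G" "set zs \<subseteq> nodes G"
    "map (nlabel G) as = cod (frob_arrow T (Mu c))"
  then obtain x where x: "as = [x]" "nlabel G x = c" "x \<in> nodes G" using assms by auto
  have "nf G ns es ([x, x] @ zs) = L [] (frob_arrow T (Mu c)) (map (nlabel G) zs) \<cdot> nf G ns es (as @ zs)"
    using net_mu[OF is_net_enum[OF G(1,2)], of x zs] x G by (simp add: nf_def enum_def)
  moreover have "set ([x, x] @ zs) \<subseteq> nodes G" "eff G (as @ zs) \<in> Cospan T" using x G by (simp_all add: eff_Cospan)
  ultimately show "\<exists>D H ns' es' ys. D \<in> Cospan T \<and> ccls T (eff G (as @ zs)) = ccls T D \<and> H \<in> Hyp T \<and> enum H ns' es' \<and> set ys \<subseteq> nodes H \<and>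
        is_composite T (cospan_sum (spider [c, c] [c] c) (id_cospan (map (nlabel G) zs))) D (eff H ys) \<and>
        L [] (frob_arrow T (Mu c)) (map (nlabel G) zs) \<cdot> nf G ns es (as @ zs) = nf H ns' es' ys"
    using layer_mu[OF G(1,4) x(3)] G x by metis
qed

lemma keeps_normal_eta: assumes "c \<in> C" shows "keeps_normal (frob_arrow T (Eta c))"
proof (rule keeps_normalI)
  show "frob_arrow T (Eta c) \<in> A" using assms by simp
  show "sem T (frob_arrow T (Eta c)) = ccls T (spider [] [c] c)" using sem_gens[OF assms] by simp
  show "spider [] [c] c \<in> Cospan T" using assms by (intro spider_Cospan) (auto simp: C_colours)
  fix G ns es as zs assume G: "G \<in> Hyp T" "enum G ns es" "set as \<subseteq> nodes G" "set zs \<subseteq> nodes G"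
    "map (nlabel G) as = cod (frob_arrow T (Eta c))"
  then obtain x where x: "as = [x]" "nlabel G x = c" "x \<in> nodes G" using assms by auto
  have "nf G ns es ([] @ zs) = L [] (frob_arrow T (Eta c)) (map (nlabel G) zs) \<cdot> nf G ns es (as @ zs)"
    using net_eta[OF is_net_enum[OF G(1,2)], of x zs] x G by (simp add: nf_def enum_def)
  moreover have "set ([] @ zs) \<subseteq> nodes G" "eff G (as @ zs) \<in> Cospan T" using x G by (simp_all add: eff_Cospan)
  moreover have "is_composite T (cospan_sum (spider [] [c] c) (id_cospan (map (nlabel G) zs))) (eff G (as @ zs)) (eff G ([] @ zs))"
    using layer_eta[OF G(1,4) x(3)] x by simp
  ultimately show "\<exists>D H ns' es' ys. D \<in> Cospan T \<and> ccls T (eff G (as @ zs)) = ccls T D \<and> H \<in> Hyp T \<and> enum H ns' es' \<and> set ys \<subseteq> nodes H \<and>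
        is_composite T (cospan_sum (spider [] [c] c) (id_cospan (map (nlabel G) zs))) D (eff H ys) \<and>
        L [] (frob_arrow T (Eta c)) (map (nlabel G) zs) \<cdot> nf G ns es (as @ zs) = nf H ns' es' ys"
    using G by - (rule exI[of _ "eff G (as @ zs)"], rule exI[of _ G], rule exI[of _ ns], rule exI[of _ es],
      rule exI[of _ "[] @ zs"], intro conjI, (assumption | rule HOL.refl | erule sym)+)
qed

lemma keeps_normal_S: assumes "u \<in> W" "v \<in> W" shows "keeps_normal (S u v)"
proof (rule keeps_normalI)
  show "S u v \<in> A" using assms by simp
  show "sem T (S u v) = ccls T (sym_cospan u v)" using sem_S assms by (simp add: FTerm_simps)
  show "sym_cospan u v \<in> Cospan T" using assms by (intro sym_cospan_Cospan) (auto simp: C_colours)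
  fix G ns es xs zs assume G: "G \<in> Hyp T" "enum G ns es" "set xs \<subseteq> nodes G" "set zs \<subseteq> nodes G"
    "map (nlabel G) xs = cod (S u v)"
  then have "map (nlabel G) xs = v @ u" using assms by simp
  then obtain as bs where x: "xs = bs @ as" "map (nlabel G) as = u" "map (nlabel G) bs = v"
    unfolding map_eq_append_conv by blast
  then have sub: "set as \<subseteq> nodes G" "set bs \<subseteq> nodes G" using G by auto
  have "nf G ns es ((as @ bs) @ zs) = L [] (S u v) (map (nlabel G) zs) \<cdot> nf G ns es (xs @ zs)"
    using net_sym[OF is_net_enum[OF G(1,2)], of as bs zs] x G by (simp add: nf_def enum_def)
  moreover have "set ((as @ bs) @ zs) \<subseteq> nodes G" "eff G (xs @ zs) \<in> Cospan T" using x sub G by (simp_all add: eff_Cospan)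
  ultimately show "\<exists>D H ns' es' ys. D \<in> Cospan T \<and> ccls T (eff G (xs @ zs)) = ccls T D \<and> H \<in> Hyp T \<and> enum H ns' es' \<and> set ys \<subseteq> nodes H \<and>
        is_composite T (cospan_sum (sym_cospan u v) (id_cospan (map (nlabel G) zs))) D (eff H ys) \<and>
        L [] (S u v) (map (nlabel G) zs) \<cdot> nf G ns es (xs @ zs) = nf H ns' es' ys"
    using layer_sym[OF G(1,4) sub] G x by metis
qed

lemma keeps_normal_delta: assumes "c \<in> C" shows "keeps_normal (frob_arrow T (Delta c))"
proof (rule keeps_normalI)
  show "frob_arrow T (Delta c) \<in> A" using assms by simp
  show "sem T (frob_arrow T (Delta c)) = ccls T (spider [c] [c, c] c)" using sem_gens[OF assms] by simp
  show "spider [c] [c, c] c \<in> Cospan T" using assms by (intro spider_Cospan) (auto simp: C_colours)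
  fix G ns es as zs assume G: "G \<in> Hyp T" "enum G ns es" "set as \<subseteq> nodes G" "set zs \<subseteq> nodes G"
    "map (nlabel G) as = cod (frob_arrow T (Delta c))"
  then obtain x y where x: "as = [x, y]" "nlabel G x = c" "x \<in> nodes G" "nlabel G y = c" "y \<in> nodes G"
    using assms by (auto simp: map_eq_Cons_conv)
  have D: "eff G (as @ zs) \<in> Cospan T" using x G by (simp_all add: eff_Cospan)
  show "\<exists>D H ns' es' ys. D \<in> Cospan T \<and> ccls T (eff G (as @ zs)) = ccls T D \<and> H \<in> Hyp T \<and> enum H ns' es' \<and> set ys \<subseteq> nodes H \<and>
        is_composite T (cospan_sum (spider [c] [c, c] c) (id_cospan (map (nlabel G) zs))) D (eff H ys) \<and>
        L [] (frob_arrow T (Delta c)) (map (nlabel G) zs) \<cdot> nf G ns es (as @ zs) = nf H ns' es' ys"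
  proof (cases "x = y")
    case True
    have "nf G ns es ([x] @ zs) = L [] (frob_arrow T (Delta c)) (map (nlabel G) zs) \<cdot> nf G ns es (as @ zs)"
      using net_delta_same[OF is_net_enum[OF G(1,2)], of x zs] x G True by (simp add: nf_def enum_def)
    moreover have "set ([x] @ zs) \<subseteq> nodes G" using x G by auto
    ultimately show ?thesis using layer_delta_same[OF G(1,4) x(3)] G x D True by metis
  next
    case False
    let ?r = "\<lambda>z. if z = y then x else z"
    let ?H = "hquot G ?r" and ?ns = "remove1 y ns"
    \<comment> \<open>\<open>net_delta\<close> removes the node at the head, so the enumeration is
      changed to start with \<open>y\<close>.\<close>
    have e: "enum G (y # ?ns) es" using G(2) x(5) by (auto simp: enum_def)
    have r: "nlabel G (?r n) = nlabel G n" for n using x by simp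
    have H: "?H \<in> Hyp T" by (rule hquot_Hyp[OF G(1) r])
    have "?r ` nodes G = nodes G - {y}" using x False by auto
    then have e': "enum ?H ?ns es" using G(2) by (simp add: enum_def)
    have sub: "set (x # map ?r zs) \<subseteq> nodes ?H"
      using G(4) imageI[OF x(3), of ?r] False by auto
    have "x \<in> set ?ns" "set zs \<subseteq> set (y # ?ns)" using e x(3) False G(4) by (auto simp: enum_def)
    note N = net_delta[OF is_net_enum[OF G(1) e] this(1) not_sym[OF False] _ this(2)]
    have "nf G (y # ?ns) es (as @ zs) = nf G ns es (as @ zs)"
      using x G by (intro nf_enum[OF G(1) e G(2)]) auto
    then have "L [] (frob_arrow T (Delta c)) (map (nlabel G) zs) \<cdot> nf G ns es (as @ zs) = nf ?H ?ns es (x # map ?r zs)"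
      using N x by (simp add: nf_def comp_def)
    moreover have "is_composite T (cospan_sum (spider [c] [c, c] c) (id_cospan (map (nlabel G) zs))) (eff G (as @ zs)) (eff ?H (x # map ?r zs))"
      using layer_delta[OF G(1,4) x(3,5)] x by simp
    ultimately show ?thesis using D H e' sub
      by - (rule exI[of _ "eff G (as @ zs)"], rule exI[of _ ?H], rule exI[of _ ?ns], rule exI[of _ es],
        rule exI[of _ "x # map ?r zs"], intro conjI, (assumption | rule HOL.refl)+)
  qed
qed

text \<open>A counit adds a node, so the new hypergraph is a disjoint union in which all old names
  move to the right summand. \<open>net_relabel\<close> accounts for this renaming and
  \<open>net_eps\<close> for the new node.\<close>

lemma keeps_normal_eps: assumes c: "c \<in> C" shows "keeps_normal (frob_arrow T (Eps c))"
  unfolding keeps_normal_def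
proof (intro allI impI)
  fix b X assume b: "b \<in> W" and X: "X \<in> A" "normalisable X" "dom X = cod (frob_arrow T (Eps c)) @ b"
  have "dom X = [] @ b" using X(3) c by simp
  with X(2) obtain G ns es as zs where G': "G \<in> Hyp T" "enum G ns es" "set as \<subseteq> nodes G" "set zs \<subseteq> nodes G"
    "sem T X = ccls T (eff G (as @ zs))" "X = nf G ns es (as @ zs)" "map (nlabel G) as = []" "map (nlabel G) zs = b"
    by (rule normalisableE)
  then have G: "G \<in> Hyp T" "enum G ns es" "set zs \<subseteq> nodes G" "sem T X = ccls T (eff G zs)" "X = nf G ns es zs" "map (nlabel G) zs = b"
    by simp_all
  let ?H = "hsum (discrete [c]) G" and ?zs = "inl 0 # map inr zs"
  have cT: "c \<in> colours T" using c by (simp add: C_colours)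
  have H: "?H \<in> Hyp T" using G(1) cT by (intro hsum_Hyp discrete_Hyp) auto
  have e: "enum ?H (inl 0 # map inr ns) (map inr es)" using G(2) by (auto simp: enum_def distinct_map inj_on_def)
  have sp: "spider [c] [] c \<in> Cospan T" using cT by (intro spider_Cospan) auto
  have Xt: "cod X = []" using nf_typ(3)[OF G(1-3)] G(5) by simp
  have "L [] (frob_arrow T (Eps c)) b \<cdot> X = frob_arrow T (Eps c) \<oplus> X"
    using par_L[of "frob_arrow T (Eps c)" X] c X by simp
  then have "sem T (L [] (frob_arrow T (Eps c)) b \<cdot> X) = ccls T (cospan_sum (spider [c] [] c) (eff G zs))"
    using sem_gens[OF c] G(4) c X(1) sp eff_Cospan[OF G(1,3)] by (simp add: sem_par FTerm_tensor)
  also have "\<dots> = ccls T (eff ?H ?zs)"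
    by (rule layer_eps[OF G(1) H cT hid_iso _ _ G(3)]) (simp_all add: hid_def)
  finally have s: "sem T (L [] (frob_arrow T (Eps c)) b \<cdot> X) = ccls T (eff ?H ?zs)" .
  let ?net = "\<lambda>ns es zs. net (nlabel ?H) ns (\<lambda>e. name (op_arrow T (elabel ?H e))) (\<lambda>e. sources ?H e @ targets ?H e) es zs"
  have "?net (map inr ns) (map inr es) (map inr zs) = nf G ns es zs"
    unfolding nf_def by (rule net_relabel[OF is_net_enum[OF G(1,2)]]) (use G(2,3) in \<open>auto simp: enum_def inj_on_def\<close>)
  moreover have "is_net (nlabel ?H) (map inr ns) (\<lambda>e. name (op_arrow T (elabel ?H e))) (\<lambda>e. sources ?H e @ targets ?H e) (map inr es)"
    using is_net_enum[OF G(1,2)] unfolding is_net_def by (auto simp: comp_def image_image subset_iff)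
  moreover have "inl 0 \<notin> set (map inr ns)" "set (map inr zs) \<subseteq> set (map inr ns)" "nlabel ?H (inl 0) \<in> C"
    using G(2) image_mono[OF G(3), of inr] c by (auto simp: enum_def)
  ultimately have "L [] (frob_arrow T (Eps (nlabel ?H (inl 0)))) (map (nlabel ?H) (map inr zs)) \<cdot> nf G ns es zs = nf ?H (inl 0 # map inr ns) (map inr es) ?zs"
    using net_eps[of "nlabel ?H" "map inr ns" "\<lambda>e. name (op_arrow T (elabel ?H e))" "\<lambda>e. sources ?H e @ targets ?H e" "map inr es" "inl 0" "map inr zs"]
      by (simp only: nf_def simp_thms)
  then have "L [] (frob_arrow T (Eps c)) b \<cdot> X = nf ?H (inl 0 # map inr ns) (map inr es) ?zs"
    using G(5,6) by (simp add: comp_def)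
  with s H e G(3) show "normalisable (L [] (frob_arrow T (Eps c)) b \<cdot> X)" by (intro normalisableI) auto
qed

text \<open>Precomposing a state adds a hyperedge under a fresh name; on nets this is
  \<open>net_Cons\<close> read backwards.\<close>

lemma keeps_normal_name_op: assumes f: "f \<in> ops T" shows "keeps_normal (name (op_arrow T f))"
proof (rule keeps_normalI)
  note t = ops_typ[OF f]
  note T = wf_T[OF mt]
  show "name (op_arrow T f) \<in> A" using t by simp
  show "sem T (name (op_arrow T f)) = ccls T (op_state T f)" by (rule sem_name_op[OF f])
  show "op_state T f \<in> Cospan T" by (rule op_state_Cospan[OF T f])
  fix G ns es as zs assume G: "G \<in> Hyp T" "enum G ns es" "set as \<subseteq> nodes G" "set zs \<subseteq> nodes G"
    "map (nlabel G) as = cod (name (op_arrow T f))"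
  then have as: "map (nlabel G) as = arity T f @ coarity T f" using t by simp
  define us where "us = take (length (arity T f)) as"
  define vs where "vs = drop (length (arity T f)) as"
  have x: "as = us @ vs" "map (nlabel G) us = arity T f" "map (nlabel G) vs = coarity T f"
    by (simp_all add: us_def vs_def take_map[symmetric] drop_map[symmetric] as)
  obtain e where e: "e \<notin> edges G" using ex_new_if_finite[OF infinite_UNIV_nat Hyp_finite(2)[OF G(1)]] by blast
  let ?H = "G \<lparr> edges := insert e (edges G), elabel := (elabel G)(e := f), sources := (sources G)(e := us), targets := (targets G)(e := vs) \<rparr>"
  have H: "?H \<in> Hyp T"
    using G(1,3) x f e Hyp_attached[OF G(1)] by (intro HypI) (auto simp: Hyp_finite Hyp_node)
  have en: "enum ?H ns (e # es)" using G(2) e by (auto simp: enum_def)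
  have sub: "set (as @ zs) \<subseteq> nodes G" using G by simp
  have D: "hdel ?H e \<in> Hyp T" using hdel_Hyp[OF H] .
  have "cospan_iso (eff G (as @ zs)) (eff (hdel ?H e) (as @ zs))"
  proof (rule cospan_isoI[where f = hid])
    have "hid \<in> hyp_hom G (hdel ?H e)" "hid \<in> hyp_hom (hdel ?H e) G" using e by (auto intro!: homI simp: hid_def)
    then show "hid \<in> hyp_iso (apex (eff G (as @ zs))) (apex (eff (hdel ?H e) (as @ zs)))"
      by (auto intro!: hyp_isoI simp: heq_def)
  qed auto
  then have cl: "ccls T (eff G (as @ zs)) = ccls T (eff (hdel ?H e) (as @ zs))"
    using G sub D by (intro ccls_eqI eff_Cospan) auto
  have comp: "is_composite T (cospan_sum (op_state T f) (id_cospan (map (nlabel G) zs))) (eff (hdel ?H e) (as @ zs)) (eff ?H zs)"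
    using layer_op[OF T H, of zs e] G(4) x by simp
  have "nf ?H ns (e # es) zs = L [] (name (op_arrow T f)) (map (nlabel G) zs) \<cdot> nf ?H ns es (as @ zs)"
    using net_Cons[OF is_net_enum[OF H en], of zs] G(2,4) x by (simp add: nf_def enum_def)
  also have "nf ?H ns es (as @ zs) = nf G ns es (as @ zs)"
    unfolding nf_def by simp (rule net_cong, use e G(2) in \<open>auto simp: enum_def\<close>)
  finally have nf_eq: "nf ?H ns (e # es) zs = L [] (name (op_arrow T f)) (map (nlabel G) zs) \<cdot> nf G ns es (as @ zs)" .
  have zs: "set zs \<subseteq> nodes ?H" and Dc: "eff (hdel ?H e) (as @ zs) \<in> Cospan T"
    using G(4) sub by (simp_all add: eff_Cospan[OF D])
  from nf_eq show "\<exists>D H ns' es' ys. D \<in> Cospan T \<and> ccls T (eff G (as @ zs)) = ccls T D \<and> H \<in> Hyp T \<and> enum H ns' es' \<and> set ys \<subseteq> nodes H \<and>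
        is_composite T (cospan_sum (op_state T f) (id_cospan (map (nlabel G) zs))) D (eff H ys) \<and>
        L [] (name (op_arrow T f)) (map (nlabel G) zs) \<cdot> nf G ns es (as @ zs) = nf H ns' es' ys"
    using H en comp cl zs Dc
    by - (rule exI[of _ "eff (hdel ?H e) (as @ zs)"], rule exI[of _ ?H], rule exI[of _ ns], rule exI[of _ "e # es"],
      rule exI[of _ zs], intro conjI, (assumption | rule sym)+)
qed

lemma keeps_normal_I: "w \<in> W \<Longrightarrow> keeps_normal (I w)"
  unfolding keeps_normal_def by simp

lemma keeps_normal_seq:
  assumes "f \<in> A" "g \<in> A" "cod f = dom g" "keeps_normal f" "keeps_normal g"
  shows "keeps_normal (f \<cdot> g)"
  unfolding keeps_normal_def
proof (intro allI impI)
  fix b X assume b: "b \<in> W" and X: "X \<in> A" "normalisable X" "dom X = cod (f \<cdot> g) @ b"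
  then have "normalisable (L [] g b \<cdot> X)" using assms unfolding keeps_normal_def by simp
  then have "normalisable (L [] f b \<cdot> L [] g b \<cdot> X)" using assms(4) b X assms(1-3) unfolding keeps_normal_def by simp
  then show "normalisable (L [] (f \<cdot> g) b \<cdot> X)" using b X assms(1-3) by simp
qed

text \<open>The property concerns the front wires only, so \<open>g\<close> is conjugated with
  crossings that bring its outputs to the front and its inputs back.\<close>

lemma keeps_normal_par:
  assumes "f \<in> A" "g \<in> A" "keeps_normal f" "keeps_normal g"
  shows "keeps_normal (f \<oplus> g)"
  unfolding keeps_normal_def
proof (intro allI impI)
  fix b X assume b: "b \<in> W" and X: "X \<in> A" "normalisable X" "dom X = cod (f \<oplus> g) @ b"
  note [simp] = assms(1,2) b X(1)
  have dX: "dom X = cod f @ cod g @ b" using X by simp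
  let ?X1 = "L [] (S (cod g) (cod f)) b \<cdot> X"
  have 1: "normalisable ?X1" using keeps_normal_S[of "cod g" "cod f"] X(2) dX unfolding keeps_normal_def by simp
  have 2: "normalisable (L [] g (cod f @ b) \<cdot> ?X1)" using assms(4) 1 dX unfolding keeps_normal_def by simp
  have 3: "normalisable (L [] (S (cod f) (dom g)) b \<cdot> L [] g (cod f @ b) \<cdot> ?X1)"
    using keeps_normal_S[of "cod f" "dom g"] 2 dX unfolding keeps_normal_def by simp
  have "L [] (S (cod f) (dom g)) b \<cdot> L [] g (cod f @ b) \<cdot> ?X1 = L (cod f) g b \<cdot> X"
    using slideL_x[of g "cod f" "[]" b X] S_inv_x[of "[]" b "cod f" "dom g" "L (cod f) g b \<cdot> X"] dX by simp
  with 3 have "normalisable (L [] f (dom g @ b) \<cdot> L (cod f) g b \<cdot> X)" using assms(3) dX unfolding keeps_normal_def by simp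
  then show "normalisable (L [] (f \<oplus> g) b \<cdot> X)" using dX par_L[of f g] by simp
qed

lemma keeps_normal_cap: "w \<in> W \<Longrightarrow> keeps_normal (cap w)"
proof (induction w)
  case Nil
  then show ?case using keeps_normal_I[of "[]"] by simp
next
  case (Cons c w)
  then have c: "c \<in> C" "w \<in> W" by auto
  have "keeps_normal (I [c] \<oplus> (S w [c] \<oplus> I w))" using c by (intro keeps_normal_par keeps_normal_I keeps_normal_S) simp_all
  moreover have "keeps_normal (frob_arrow T (Mu c) \<oplus> I (w @ w))" "keeps_normal (frob_arrow T (Eps c) \<oplus> I (w @ w))"
    using c by (simp_all add: keeps_normal_par keeps_normal_I keeps_normal_mu keeps_normal_eps)
  moreover have "keeps_normal (cap w)" using Cons.IH c by simp
  ultimately show ?case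
    using c unfolding cap.simps L_def by (intro keeps_normal_seq) simp_all
qed

text \<open>By \<open>unname\<close> an operation is its name with the inputs bent by a cap, and
  both of these keep normal forms.\<close>

lemma keeps_normal_op: assumes f: "f \<in> ops T" shows "keeps_normal (op_arrow T f)"
proof -
  note t = ops_typ[OF f]
  let ?o = "op_arrow T f"
  have "keeps_normal (I (arity T f) \<oplus> name ?o)" using t by (intro keeps_normal_par keeps_normal_I keeps_normal_name_op f) simp_all
  moreover have "keeps_normal (cap (arity T f) \<oplus> I (coarity T f))" using t by (intro keeps_normal_par keeps_normal_I keeps_normal_cap) simp_all
  moreover have "(I (arity T f) \<oplus> name ?o) \<cdot> (cap (arity T f) \<oplus> I (coarity T f)) = ?o"
    using unname[of ?o] t by (simp add: L_def)
  ultimately show ?thesis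
    using keeps_normal_seq[of "I (arity T f) \<oplus> name ?o" "cap (arity T f) \<oplus> I (coarity T f)"] t by simp
qed

lemma keeps_normal_all: assumes "X \<in> A" shows "keeps_normal X"
proof (rule SFrob_induct[OF mt assms])
  show "keeps_normal (op_arrow T f)" if "f \<in> ops T" for f using keeps_normal_op[OF that] .
  show "keeps_normal (frob_arrow T (Mu c)) \<and> keeps_normal (frob_arrow T (Eta c)) \<and> keeps_normal (frob_arrow T (Delta c)) \<and> keeps_normal (frob_arrow T (Eps c))"
    if "c \<in> colours T" for c using that keeps_normal_mu keeps_normal_eta keeps_normal_delta keeps_normal_eps by (simp add: C_colours)
  show "keeps_normal (I w)" if "w \<in> lists (colours T)" for w using that keeps_normal_I by (simp add: C_colours)
  show "keeps_normal (S w v)" if "w \<in> lists (colours T)" "v \<in> lists (colours T)" for w v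
    using that keeps_normal_S by (simp add: C_colours)
  show "keeps_normal (f \<cdot> g)" if "f \<in> Arr (SFrob T) u v" "g \<in> Arr (SFrob T) v w" "keeps_normal f" "keeps_normal g" for f g u v w
    using that by (intro keeps_normal_seq) (auto simp: Arr_iff)
  show "keeps_normal (f \<oplus> g)" if "f \<in> Arr (SFrob T) u v" "g \<in> Arr (SFrob T) u' v'" "keeps_normal f" "keeps_normal g" for f g u v u' v'
    using that by (intro keeps_normal_par) (auto simp: Arr_iff)
qed

lemma normalisable_I: "normalisable (I [])"
proof (rule normalisableI[where G = "discrete []" and ns = "[]" and es = "[]" and zs = "[]"])
  have "cospan_iso (id_cospan [] :: ('c, 'o) cospan) (eff (discrete []) [])"
    by (rule cospan_isoI[where f = hid]) (auto simp: hid_iso)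
  then show "sem T (I []) = ccls T (eff (discrete []) [])"
    using sem_I[of "[]"] by (simp add: FTerm_simps) (intro ccls_eqI id_cospan_Cospan eff_Cospan discrete_Hyp; simp)
  show "I [] = nf (discrete []) [] [] []" by (simp add: nf_def net_def discard_def)
qed (auto simp: enum_def discrete_Hyp)

lemma normalisable_all: assumes "X \<in> A" "cod X = []" shows "normalisable X"
  using keeps_normal_all[OF assms(1)] normalisable_I assms unfolding keeps_normal_def by (metis I_typ L_Nil append_Nil lists.Nil seq_I)

text \<open>Bending the outputs gives arrows into the empty word, which agree by uniqueness of
  normal forms; \<open>coname\<close> undoes the bending.\<close>

lemma sem_faithful:
  assumes ab: "a \<in> A" "b \<in> A" "dom a = dom b" "cod a = cod b" and "sem T a = sem T b"
  shows "a = b"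
proof -
  let ?h = "\<lambda>a. L [] a (cod a) \<cdot> cap (cod a)"
  have "sem T (?h a) = sem T (?h b)"
    using ab assms(5) by (simp add: sem_seq L_def sem_par)
  moreover have "normalisable (?h a)" "normalisable (?h b)" using ab by (auto intro!: normalisable_all)
  ultimately have eq: "?h a = ?h b" by (intro normalisable_unique)
  have "a = L (dom a) (cup (cod a)) [] \<cdot> L [] (?h a) (cod a)" by (rule coname[OF ab(1), symmetric])
  also have "\<dots> = L (dom b) (cup (cod b)) [] \<cdot> L [] (?h b) (cod b)" unfolding eq by (simp only: ab(3,4))
  also have "\<dots> = b" by (rule coname[OF ab(2)])
  finally show ?thesis .
qed

subsection \<open>Fullness\<close>

definition realised :: "('c, 'o) hypergraph \<Rightarrow> nat list \<Rightarrow> bool" where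
  "realised G zs \<longleftrightarrow> (\<exists>X\<in>A. dom X = map (nlabel G) zs \<and> cod X = [] \<and> sem T X = ccls T (eff G zs))"

lemma realised_layer:
  assumes "realised G (as' @ zs)" "f \<in> A" "sem T f = ccls T c" "c \<in> Cospan T" "cod f = map (nlabel G) as'" "dom f = map (nlabel G) as"
    "G \<in> Hyp T" "set as' \<subseteq> nodes G" "set zs \<subseteq> nodes G" "set as \<subseteq> nodes G"
    "is_composite T (cospan_sum c (id_cospan (map (nlabel G) zs))) (eff G (as' @ zs)) (eff G (as @ zs))"
  shows "realised G (as @ zs)"
proof -
  obtain X where X: "X \<in> A" "dom X = map (nlabel G) (as' @ zs)" "cod X = []" "sem T X = ccls T (eff G (as' @ zs))"
    using assms(1) unfolding realised_def by blast
  have b: "map (nlabel G) zs \<in> W" using Hyp_word[OF assms(7,9)] by (simp add: C_colours)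
  have "sem T (L [] f (map (nlabel G) zs) \<cdot> X) = ccls T (eff G (as @ zs))"
    using assms X b by (intro sem_layer[OF assms(2) X(1) _ b assms(3,4) X(4) _ _ assms(11)]) (simp_all add: eff_Cospan)
  then show ?thesis unfolding realised_def using X b assms(2,5,6) by (intro bexI[of _ "L [] f (map (nlabel G) zs) \<cdot> X"]) simp_all
qed

lemma Hyp_C: "G \<in> Hyp T \<Longrightarrow> x \<in> nodes G \<Longrightarrow> nlabel G x \<in> C"
  using Hyp_node by (simp add: C_colours)

lemma realised_mu:
  assumes "realised G ([x] @ zs)" and G: "G \<in> Hyp T" "set zs \<subseteq> nodes G" "x \<in> nodes G"
  shows "realised G ([x, x] @ zs)"
proof (rule realised_layer[OF assms(1) _ sem_gens(1)[OF Hyp_C[OF G(1,3)]] _ _ _ G(1) _ G(2) _ layer_mu[OF G]])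
  show "spider [nlabel G x, nlabel G x] [nlabel G x] (nlabel G x) \<in> Cospan T"
    using Hyp_node[OF G(1,3)] by (intro spider_Cospan) auto
qed (use G Hyp_C[OF G(1,3)] in simp_all)

lemma realised_eta:
  assumes "realised G ([x] @ zs)" and G: "G \<in> Hyp T" "set zs \<subseteq> nodes G" "x \<in> nodes G"
  shows "realised G ([] @ zs)"
proof (rule realised_layer[OF assms(1) _ sem_gens(2)[OF Hyp_C[OF G(1,3)]] _ _ _ G(1) _ G(2) _ layer_eta[OF G]])
  show "spider [] [nlabel G x] (nlabel G x) \<in> Cospan T"
    using Hyp_node[OF G(1,3)] by (intro spider_Cospan) auto
qed (use G Hyp_C[OF G(1,3)] in simp_all)

lemma realised_sym:
  assumes "realised G ((bs @ as) @ zs)" and G: "G \<in> Hyp T" "set zs \<subseteq> nodes G" "set as \<subseteq> nodes G" "set bs \<subseteq> nodes G"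
  shows "realised G ((as @ bs) @ zs)"
proof -
  have w: "map (nlabel G) as \<in> lists (colours T)" "map (nlabel G) bs \<in> lists (colours T)"
    using Hyp_word[OF G(1)] G(3,4) by blast+
  then have W: "map (nlabel G) as \<in> W" "map (nlabel G) bs \<in> W" by (simp_all only: C_colours)
  show ?thesis
    by (rule realised_layer[OF assms(1) _ sem_S[OF W, unfolded FTerm_simps] sym_cospan_Cospan[OF w] _ _ G(1) _ G(2) _ layer_sym[OF G]])
      (use G W in \<open>simp_all del: map_W\<close>)
qed

text \<open>A node reached by exactly one wire, standing at the front, splits off as a counit.
  Otherwise a wire is supplied by a unit when the interface is empty, and a repeated wire is merged
  by a multiplication. The outer induction counts nodes, the inner one wires.\<close>

lemma realised_discrete:
  assumes "G \<in> Hyp T" "edges G = {}" "set zs \<subseteq> nodes G"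
  shows "realised G zs"
  using assms
proof (induction "card (nodes G)" arbitrary: G zs rule: less_induct)
  case (less G)
  note G = less.prems(1) and E = less.prems(2)
  have remove: "realised G (x # ys)" if x: "x \<in> nodes G" "x \<notin> set ys" and ys: "set ys \<subseteq> nodes G" for x ys
  proof -
    let ?G = "G \<lparr> nodes := nodes G - {x} \<rparr>" and ?c = "nlabel G x"
    have G': "?G \<in> Hyp T" using G E by (simp add: Hyp_def)
    have c: "?c \<in> C" "?c \<in> colours T" using Hyp_C[OF G x(1)] Hyp_node[OF G x(1)] by auto
    have "card (nodes ?G) < card (nodes G)" using x Hyp_finite(1)[OF G] by (simp add: card_Diff1_less del: card_Diff_insert)
    moreover have sub: "set ys \<subseteq> nodes ?G" using x ys by auto
    ultimately obtain X where X: "X \<in> A" "dom X = map (nlabel G) ys" "cod X = []" "sem T X = ccls T (eff ?G ys)"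
      using less.hyps[of ?G ys] G' E unfolding realised_def by auto
    let ?f = "hcase \<lparr> nmap = \<lambda>_. x, emap = id \<rparr> hid" and ?g = "\<lparr> nmap = \<lambda>n. if n = x then inl 0 else inr n, emap = id \<rparr>"
    have iso: "?f \<in> hyp_iso (hsum (discrete [?c]) ?G) G"
    proof (rule hyp_isoI[where g = ?g])
      show "?f \<in> hyp_hom (hsum (discrete [?c]) ?G) G" by (rule homI) (use x E in auto)
      show "?g \<in> hyp_hom G (hsum (discrete [?c]) ?G)" by (rule homI) (use x E in auto)
    qed (use E in \<open>auto simp: heq_def\<close>)
    have sp: "spider [?c] [] ?c \<in> Cospan T" using c(2) by (intro spider_Cospan) auto
    have "sem T (frob_arrow T (Eps ?c) \<oplus> X) = ccls T (cospan_sum (spider [?c] [] ?c) (eff ?G ys))"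
      using sem_gens(4)[OF c(1)] X c sp eff_Cospan[OF G' sub] by (simp add: sem_par FTerm_tensor)
    also have "\<dots> = ccls T (eff G (x # ys))"
      by (rule layer_eps[OF G' G c(2) iso _ _ sub]) (simp_all add: comp_def)
    finally show ?thesis unfolding realised_def using X c by (intro bexI[of _ "frob_arrow T (Eps ?c) \<oplus> X"]) simp_all
  qed
  show ?case using less.prems(3)
  proof (induction "length zs" arbitrary: zs rule: less_induct)
    case (less zs)
    show ?case
    proof (cases zs)
      case Nil
      show ?thesis
      proof (cases "nodes G = {}")
        case True
        have "cospan_iso (id_cospan []) (eff G [])"
          by (rule cospan_isoI[where f = hid])
            (use True E in \<open>auto intro!: hyp_isoI[where g = hid] homI simp: heq_def\<close>)
        then have "ccls T (id_cospan []) = ccls T (eff G [])" using G by (intro ccls_eqI id_cospan_Cospan eff_Cospan) auto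
        then show ?thesis unfolding realised_def Nil using sem_I[of "[]"]
          by (intro bexI[of _ "I []"]) (simp_all add: FTerm_simps)
      next
        case False
        then obtain x where x: "x \<in> nodes G" by blast
        then show ?thesis using realised_eta[of G x "[]"] remove[OF x, of "[]"] G Nil by simp
      qed
    next
      case (Cons x ys)
      then have x: "x \<in> nodes G" "set ys \<subseteq> nodes G" using less.prems by auto
      show ?thesis
      proof (cases "x \<in> set ys")
        case True
        then obtain p q where pq: "ys = p @ x # q" by (meson split_list)
        have "realised G ([x] @ p @ q)" using less.hyps[of "[x] @ p @ q"] x pq Cons by simp
        then have "realised G ([x, x] @ p @ q)" using x pq by (intro realised_mu G) auto
        \<comment> \<open>Regrouping prepares the crossing that returns the second copy of
          \<open>x\<close> to its position in \<open>ys\<close>.\<close>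
        then have "realised G (([x] @ x # p) @ q)" by simp
        then have "realised G (((x # p) @ [x]) @ q)" by (rule realised_sym[OF _ G]) (use x pq in auto)
        then show ?thesis using pq Cons by simp
      qed (use remove[OF x(1) _ x(2)] Cons in simp)
    qed
  qed
qed

text \<open>Hyperedges are split off one at a time as folded operations, down to the edge-free
  case.\<close>

lemma realised_all:
  assumes "G \<in> Hyp T" "set zs \<subseteq> nodes G"
  shows "realised G zs"
  using assms
proof (induction "card (edges G)" arbitrary: G zs rule: less_induct)
  case (less G)
  note G = less.prems(1) and T = wf_T[OF mt]
  show ?case
  proof (cases "edges G = {}")
    case True
    then show ?thesis using realised_discrete less.prems by blast
  next
    case False
    then obtain e where e: "e \<in> edges G" by blast
    let ?D = "hdel G e" and ?as = "sources G e @ targets G e" and ?f = "elabel G e" and ?Z = "map (nlabel G) zs"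
    note att = Hyp_attached[OF G e]
    note t = ops_typ[OF att(5)]
    have D: "?D \<in> Hyp T" "set (?as @ zs) \<subseteq> nodes ?D" using hdel_Hyp[OF G] att less.prems(2) by simp_all
    have "card (edges ?D) < card (edges G)" using e Hyp_finite(2)[OF G] by (simp add: card_Diff1_less del: card_Diff_insert)
    then obtain X where X: "X \<in> A" "dom X = map (nlabel G) (?as @ zs)" "cod X = []" "sem T X = ccls T (eff ?D (?as @ zs))"
      using less.hyps[OF _ D] unfolding realised_def by auto
    have b: "?Z \<in> W" using Hyp_word[OF less.prems] by (simp add: C_colours)
    have "sem T (L [] (name (op_arrow T ?f)) ?Z \<cdot> X) = ccls T (eff G zs)"
      using sem_layer[OF _ X(1) _ b sem_name_op[OF att(5)] op_state_Cospan[OF T att(5)] X(4) eff_Cospan[OF D]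
          eff_Cospan[OF less.prems] layer_op[OF T less.prems e]] X(2) t att by simp
    then show ?thesis unfolding realised_def
      using X b t att by (intro bexI[of _ "L [] (name (op_arrow T ?f)) ?Z \<cdot> X"]) simp_all
  qed
qed

text \<open>The interpretation preserves the snake equation, so \<open>Y\<close> can be bent inside
  \<open>FTerm\<close> into an arrow to the empty word. That arrow is realised and its preimage is
  bent back.\<close>

lemma sem_full:
  assumes Y: "Y \<in> Arr (FTerm T) w v"
  obtains X where "X \<in> Arr (SFrob T) w v" "sem T X = Y"
proof -
  interpret FT: coloured_prop "FTerm T" by (rule coloured_prop_FTerm)
  have WF: "FT.W = W" by (simp add: FTerm_simps C_colours)
  have wv: "w \<in> W" "v \<in> W" using FT.arr_words[OF Y] unfolding WF by auto
  have semL: "sem T (L a f b) = FT.L a (sem T f) b" if "a \<in> W" "f \<in> A" "b \<in> W" for a f b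
    using that by (simp add: L_def FT.L_def sem_par sem_I)
  have semA: "sem T f \<in> FT.A" "FT.dom (sem T f) = dom f" "FT.cod (sem T f) = cod f" if "f \<in> A" for f
    using sem_Arr[OF that] by (auto simp: FT.Arr_iff)
  have Yt: "Y \<in> FT.A" "FT.dom Y = w" "FT.cod Y = v" using Y by (auto simp: FT.Arr_iff)
  note wv' = wv[folded WF]
  let ?k = "cup v" and ?q = "cap v"
  have kq: "?k \<in> A" "dom ?k = []" "cod ?k = v @ v" "?q \<in> A" "dom ?q = v @ v" "cod ?q = []" using wv by simp_all
  let ?H = "pcomp (FTerm T) (FT.L [] Y v) (sem T ?q)"
  have "?H \<in> Arr (FTerm T) (w @ v) []"
    using Yt wv' kq semA by (simp add: FT.Arr_iff)
  then obtain d where d: "d \<in> Cospan T" "csrc d = w @ v" "ctgt d = []" "?H = ccls T d" by (rule FTerm_ArrE)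
  obtain zs where zs: "set zs \<subseteq> nodes (apex d)" "ccls T d = ccls T (eff (apex d) zs)" "csrc d = map (nlabel (apex d)) zs"
    using eff_of_cospan[OF d(1,3)] by blast
  obtain X where X: "X \<in> A" "dom X = w @ v" "cod X = []" "sem T X = ?H"
    using realised_all[OF CospanD(3)[OF d(1)] zs(1)] zs(2,3) d(2,4) unfolding realised_def by auto
  let ?X = "L w ?k [] \<cdot> L [] X v"
  have "FT.seq (FT.L v (sem T ?k) []) (FT.L [] (sem T ?q) v) = sem T (L v ?k [] \<cdot> L [] ?q v)"
    using kq wv by (simp add: sem_seq semL)
  also have "\<dots> = FT.I v" using snake[OF wv(2)] sem_I[OF wv(2)] by simp
  finally have sn: "FT.seq (FT.L v (sem T ?k) []) (FT.L [] (sem T ?q) v) = FT.I v" .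
  have "sem T ?X = FT.seq (FT.L w (sem T ?k) []) (FT.L [] ?H v)"
    using X kq wv by (simp add: sem_seq semL)
  also have "\<dots> = Y"
    using FT.bend[OF Yt(1,3), of "sem T ?k" "sem T ?q"] semA(1)[OF kq(1)] semA[OF kq(1)] semA[OF kq(4)] kq sn Yt(2) by simp
  finally have "sem T ?X = Y" .
  moreover have "?X \<in> Arr (SFrob T) w v" using X kq wv by (simp add: Arr_iff)
  ultimately show thesis using that by blast
qed

text \<open>Fullness supplies a preimage of the context \<open>Y\<close>; faithfulness shows that it
  satisfies both equations.\<close>

lemma name_factor_iff:
  assumes "l \<in> Arr (SFrob T) v1 v2" "r \<in> Arr (SFrob T) v1 v2" "a \<in> Arr (SFrob T) w1 w2" "b \<in> Arr (SFrob T) w1 w2"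
  shows "(\<exists>c\<in>Arr (SFrob T) (v1 @ v2) (w1 @ w2). name l \<cdot> c = name a \<and> name r \<cdot> c = name b) \<longleftrightarrow>
    (\<exists>Y\<in>Arr (FTerm T) (v1 @ v2) (w1 @ w2). pcomp (FTerm T) (sem T (name l)) Y = sem T (name a) \<and>
       pcomp (FTerm T) (sem T (name r)) Y = sem T (name b))" (is "?L \<longleftrightarrow> ?R")
proof
  have t: "l \<in> A" "dom l = v1" "cod l = v2" "r \<in> A" "dom r = v1" "cod r = v2" "a \<in> A" "dom a = w1" "cod a = w2"
    "b \<in> A" "dom b = w1" "cod b = w2" using assms by (auto simp: Arr_iff)
  show ?R if ?L
  proof -
    obtain c where c: "c \<in> Arr (SFrob T) (v1 @ v2) (w1 @ w2)" "name l \<cdot> c = name a" "name r \<cdot> c = name b"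
      using \<open>?L\<close> by blast
    then have ct: "c \<in> A" "dom c = v1 @ v2" "cod c = w1 @ w2" by (auto simp: Arr_iff)
    then have "sem T c \<in> Arr (FTerm T) (v1 @ v2) (w1 @ w2)" using sem_Arr[OF ct(1)] by simp
    moreover have "pcomp (FTerm T) (sem T (name l)) (sem T c) = sem T (name a)"
      "pcomp (FTerm T) (sem T (name r)) (sem T c) = sem T (name b)"
      unfolding c(2,3)[symmetric] using t ct by (simp_all add: sem_seq)
    ultimately show ?R by blast
  qed
  show ?L if ?R
  proof -
    obtain Y where Y: "Y \<in> Arr (FTerm T) (v1 @ v2) (w1 @ w2)" "pcomp (FTerm T) (sem T (name l)) Y = sem T (name a)"
      "pcomp (FTerm T) (sem T (name r)) Y = sem T (name b)" using \<open>?R\<close> by blast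
    obtain c where c: "c \<in> Arr (SFrob T) (v1 @ v2) (w1 @ w2)" "sem T c = Y" using sem_full[OF Y(1)] by blast
    then have ct: "c \<in> A" "dom c = v1 @ v2" "cod c = w1 @ w2" by (auto simp: Arr_iff)
    have "name l \<cdot> c = name a"
      by (rule sem_faithful) (use t ct c(2) Y(2) in \<open>simp_all add: sem_seq\<close>)
    moreover have "name r \<cdot> c = name b"
      by (rule sem_faithful) (use t ct c(2) Y(3) in \<open>simp_all add: sem_seq\<close>)
    ultimately show ?L using c(1) by blast
  qed
qed

lemma syn_rewrites_iff_FTerm:
  assumes "l \<in> Arr (SFrob T) v1 v2" "r \<in> Arr (SFrob T) v1 v2" "a \<in> Arr (SFrob T) w1 w2" "b \<in> Arr (SFrob T) w1 w2"
  shows "syn_rewrites (SFrob T) (l, r) a b \<longleftrightarrow>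
    (\<exists>Y\<in>Arr (FTerm T) (v1 @ v2) (w1 @ w2). pcomp (FTerm T) (sem T (fold_arrow T l)) Y = sem T (fold_arrow T a) \<and>
       pcomp (FTerm T) (sem T (fold_arrow T r)) Y = sem T (fold_arrow T b))"
  unfolding fold_arrow_name using syn_rewrites_iff_name[OF assms] name_factor_iff[OF assms] by simp

lemma sem_fold_Arr: "a \<in> Arr (SFrob T) w1 w2 \<Longrightarrow> sem T (fold_arrow T a) \<in> Arr (FTerm T) [] (w1 @ w2)"
  unfolding fold_arrow_name using sem_Arr[of "name a"] by (auto simp: Arr_iff)

end

section \<open>Double-pushout rewriting as composition of cospans\<close>

lemma rooted_simps [simp]: "csrc (rooted G w i) = []" "ctgt (rooted G w i) = w" "apex (rooted G w i) = G"
  "lleg (rooted G w i) = hid" "rleg (rooted G w i) = i"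
  by (simp_all add: rooted_def)

lemma rooted_mem:
  assumes c: "c \<in> Cospan T" and "csrc c = []"
  shows "rooted (apex c) (ctgt c) (rleg c) \<in> ccls T c"
proof -
  have "rooted (apex c) (ctgt c) (rleg c) \<in> Cospan T"
    using CospanD[OF c] by (intro CospanI) simp_all
  moreover have "cospan_iso c (rooted (apex c) (ctgt c) (rleg c))"
    by (rule cospan_isoI[where f = hid]) (simp_all add: assms(2) hid_iso)
  ultimately show ?thesis by (simp add: ccls_def)
qed

text \<open>With an empty left interface the condition on left legs is void. What remains is one
  square of a DPOI step and its condition on the interface map.\<close>

lemma rooted_composite_iff:
  fixes c :: "('c, 'o) cospan"
  assumes "csrc c = J" "ctgt c = w"
  shows "is_composite T (rooted L J j) c (rooted G w i) \<longleftrightarrow>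
    (\<exists>p q. pushout T (discrete J) L (apex c) G j (lleg c) p q \<and> heq (discrete w :: ('c, 'o) hypergraph) i (hcomp (rleg c) q))"
proof -
  have "heq (discrete [] :: ('c, 'o) hypergraph) f g" for f g by (simp add: discrete_heq)
  then show ?thesis using assms unfolding is_composite_def by simp
qed

text \<open>The apex \<open>K\<close> of the step, with its maps from \<open>J\<close> and
  \<open>w\<close>, is the common second factor of the two composites.\<close>

lemma dpoi_step_composite:
  fixes i i' :: hmap
  assumes "dpoi_step T (L, jL, discrete J, jR, R) (discrete w) (G, i) (H, i')" "J \<in> lists (colours T)" "w \<in> lists (colours T)"
  obtains c where "c \<in> Cospan T" "csrc c = J" "ctgt c = w"
    "is_composite T (rooted L J jL) c (rooted G w i)" "is_composite T (rooted R J jR) c (rooted H w i')"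
proof -
  obtain K m m' k q g h where K: "K \<in> Hyp T" "k \<in> hyp_hom (discrete J) K" "q \<in> hyp_hom (discrete w) K"
    "pushout T (discrete J) L K G jL k m g" "pushout T (discrete J) R K H jR k m' h"
    "heq (discrete w :: ('a, 'b) hypergraph) i (hcomp q g)" "heq (discrete w :: ('a, 'b) hypergraph) i' (hcomp q h)"
    using assms(1) unfolding dpoi_step_def prod.case by (elim conjE bexE)
  let ?c = "\<lparr> csrc = J, ctgt = w, apex = K, lleg = k, rleg = q \<rparr>"
  have c: "?c \<in> Cospan T" using K(1-3) assms(2,3) by (simp add: Cospan_def)
  have 1: "is_composite T (rooted L J jL) ?c (rooted G w i)" "is_composite T (rooted R J jR) ?c (rooted H w i')"
    using K(4-7) by (auto simp: rooted_composite_iff)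
  show thesis by (rule that[OF c _ _ 1]) simp_all
qed

lemma composite_dpoi_step:
  assumes c: "c \<in> Cospan T" "csrc c = J" "ctgt c = w"
    and comp: "is_composite T (rooted L J jL) c (rooted G w i)" "is_composite T (rooted R J jR) c (rooted H w i')"
    and i: "i \<in> hyp_hom (discrete w) G" "i' \<in> hyp_hom (discrete w) H"
  shows "dpoi_step T (L, jL, discrete J, jR, R) (discrete w) (G, i) (H, i')"
proof -
  obtain m g where 1: "pushout T (discrete J) L (apex c) G jL (lleg c) m g" "heq (discrete w :: ('a, 'b) hypergraph) i (hcomp (rleg c) g)"
    using comp(1) unfolding rooted_composite_iff[OF c(2,3)] by (elim exE conjE)
  obtain m' h where 2: "pushout T (discrete J) R (apex c) H jR (lleg c) m' h" "heq (discrete w :: ('a, 'b) hypergraph) i' (hcomp (rleg c) h)"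
    using comp(2) unfolding rooted_composite_iff[OF c(2,3)] by (elim exE conjE)
  note C = CospanD[OF c(1)]
  have k: "lleg c \<in> hyp_hom (discrete J) (apex c)" "rleg c \<in> hyp_hom (discrete w) (apex c)"
    using C(4,5) unfolding c(2,3) .
  show ?thesis unfolding dpoi_step_def prod.case
    by (intro conjI i bexI[OF _ C(3)] bexI[OF _ pushoutD(1)[OF 1(1)]] bexI[OF _ pushoutD(1)[OF 2(1)]] bexI[OF _ k(1)]
        bexI[OF _ k(2)] bexI[OF _ pushoutD(2)[OF 1(1)]] bexI[OF _ pushoutD(2)[OF 2(1)]] 1 2)
qed

theorem theorem19:
  fixes T :: "('c, 'o) signature"
    and l r a b :: "('c, 'o) SFrob_arrow"
    and v1 v2 w1 w2 :: "'c list"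
  assumes "monoidal_theory T"
    and "l \<in> Arr (SFrob T) v1 v2" and "r \<in> Arr (SFrob T) v1 v2"
    and "a \<in> Arr (SFrob T) w1 w2" and "b \<in> Arr (SFrob T) w1 w2"
  shows "syn_rewrites (SFrob T) (l, r) a b \<longleftrightarrow>
    (\<exists>L jL R jR. rooted L (v1 @ v2) jL \<in> sem T (fold_arrow T l) \<and>
                 rooted R (v1 @ v2) jR \<in> sem T (fold_arrow T r) \<and>
                 dpoi_rewrites T (L, jL, discrete (v1 @ v2), jR, R)
                   (sem T (fold_arrow T a)) (sem T (fold_arrow T b)))" (is "_ \<longleftrightarrow> ?R")
proof -
  note mt = assms(1)
  let ?s = "\<lambda>x. sem T (fold_arrow T x)" and ?J = "v1 @ v2" and ?w = "w1 @ w2"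
  note l = sem_fold_Arr[OF mt assms(2)] and r = sem_fold_Arr[OF mt assms(3)]
  note a = sem_fold_Arr[OF mt assms(4)] and b = sem_fold_Arr[OF mt assms(5)]
  have J: "?J \<in> lists (colours T)" and w: "?w \<in> lists (colours T)"
    using coloured_prop.arr_words[OF coloured_prop_FTerm l] coloured_prop.arr_words[OF coloured_prop_FTerm a]
    by (simp_all add: FTerm_simps)
  have "(\<exists>Y\<in>Arr (FTerm T) ?J ?w. pcomp (FTerm T) (?s l) Y = ?s a \<and> pcomp (FTerm T) (?s r) Y = ?s b) \<longleftrightarrow> ?R"
  proof
    assume "\<exists>Y\<in>Arr (FTerm T) ?J ?w. pcomp (FTerm T) (?s l) Y = ?s a \<and> pcomp (FTerm T) (?s r) Y = ?s b"
    then obtain Y where Y: "Y \<in> Arr (FTerm T) ?J ?w" "pcomp (FTerm T) (?s l) Y = ?s a" "pcomp (FTerm T) (?s r) Y = ?s b"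
      by blast
    obtain c where c: "c \<in> Cospan T" "csrc c = ?J" "ctgt c = ?w" "Y = ccls T c" using Y(1) by (rule FTerm_ArrE)
    \<comment> \<open>Stated for arbitrary \<open>X\<close> and \<open>Z\<close>, so that it applies
      with the same \<open>c\<close> to both sides of the rule. Members of a class may carry any
      record as left leg, so rooted representatives have to be selected.\<close>
    have key: "\<exists>L j G i. rooted L ?J j \<in> X \<and> rooted G ?w i \<in> Z \<and> is_composite T (rooted L ?J j) c (rooted G ?w i) \<and>
        i \<in> hyp_hom (discrete ?w) G"
      if X: "X \<in> Arr (FTerm T) [] ?J" and Z: "pcomp (FTerm T) X Y = Z" for X Z
    proof -
      obtain x where x: "x \<in> Cospan T" "csrc x = []" "ctgt x = ?J" "X = ccls T x" using X by (rule FTerm_ArrE)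
      let ?x = "rooted (apex x) ?J (rleg x)"
      have x': "?x \<in> X" using rooted_mem[OF x(1,2)] x(3,4) by simp
      note xm = FTerm_mem[OF X x']
      obtain e where e: "e \<in> Cospan T" "is_composite T ?x c e" using composite_ex[OF xm(1) c(1)] c(2) by auto
      have ew: "csrc e = []" "ctgt e = ?w" using e(2) c(3) by (simp_all add: is_composite_def)
      have Ze: "Z = ccls T e" using FTerm_comp[OF xm(1) c(1) e] Z xm(2) c(4) by simp
      let ?e = "rooted (apex e) ?w (rleg e)"
      have e': "?e \<in> ccls T e" using rooted_mem[OF e(1) ew(1)] ew(2) by simp
      then have eC: "?e \<in> Cospan T" "cospan_iso e ?e" by (auto simp: ccls_def)
      have "is_composite T ?x c ?e"
        by (rule composite_iso[OF e(2) cospan_iso_refl cospan_iso_refl eC(2) xm(1) c(1) e(1) xm(1) c(1) eC(1)])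
      moreover have "rleg e \<in> hyp_hom (discrete ?w) (apex e)" using CospanD(5)[OF e(1)] ew(2) by simp
      ultimately show ?thesis using x' e' Ze by blast
    qed
    obtain L jL G i where 1: "rooted L ?J jL \<in> ?s l" "rooted G ?w i \<in> ?s a" "is_composite T (rooted L ?J jL) c (rooted G ?w i)"
      "i \<in> hyp_hom (discrete ?w) G" using key[OF l Y(2)] by blast
    obtain R jR H i' where 2: "rooted R ?J jR \<in> ?s r" "rooted H ?w i' \<in> ?s b" "is_composite T (rooted R ?J jR) c (rooted H ?w i')"
      "i' \<in> hyp_hom (discrete ?w) H" using key[OF r Y(3)] by blast
    have "dpoi_step T (L, jL, discrete ?J, jR, R) (discrete ?w) (G, i) (H, i')"
      by (rule composite_dpoi_step[OF c(1-3) 1(3) 2(3) 1(4) 2(4)])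
    then have "dpoi_rewrites T (L, jL, discrete ?J, jR, R) (?s a) (?s b)"
      unfolding dpoi_rewrites_def using 1(2) 2(2) by blast
    then show ?R using 1(1) 2(1) by blast
  next
    assume ?R
    then obtain L jL R jR where LR: "rooted L ?J jL \<in> ?s l" "rooted R ?J jR \<in> ?s r"
      and d: "dpoi_rewrites T (L, jL, discrete ?J, jR, R) (?s a) (?s b)" by blast
    obtain w G i H i' where GH: "rooted G w i \<in> ?s a" "rooted H w i' \<in> ?s b"
      and step: "dpoi_step T (L, jL, discrete ?J, jR, R) (discrete w) (G, i) (H, i')"
      using d unfolding dpoi_rewrites_def by blast
    \<comment> \<open>\<open>dpoi_rewrites\<close> leaves the interface word open, but the class of
      \<open>a\<close> fixes it.\<close>
    have ww: "w = ?w" using FTerm_mem(4)[OF a GH(1)] by simp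
    note GH = GH[unfolded ww] and step = step[unfolded ww]
    obtain c where c: "c \<in> Cospan T" "csrc c = ?J" "ctgt c = ?w"
      "is_composite T (rooted L ?J jL) c (rooted G ?w i)" "is_composite T (rooted R ?J jR) c (rooted H ?w i')"
      using dpoi_step_composite[OF step J] \<open>?w \<in> lists (colours T)\<close> by blast
    have "ccls T c \<in> Arr (FTerm T) ?J ?w" using c unfolding FTerm_Arr by blast
    moreover have "pcomp (FTerm T) (?s l) (ccls T c) = ?s a"
      using FTerm_comp[OF FTerm_mem(1)[OF l LR(1)] c(1) FTerm_mem(1)[OF a GH(1)] c(4)]
        FTerm_mem(2)[OF l LR(1)] FTerm_mem(2)[OF a GH(1)] by simp
    moreover have "pcomp (FTerm T) (?s r) (ccls T c) = ?s b"
      using FTerm_comp[OF FTerm_mem(1)[OF r LR(2)] c(1) FTerm_mem(1)[OF b GH(2)] c(5)]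
        FTerm_mem(2)[OF r LR(2)] FTerm_mem(2)[OF b GH(2)] by simp
    ultimately show "\<exists>Y\<in>Arr (FTerm T) ?J ?w. pcomp (FTerm T) (?s l) Y = ?s a \<and> pcomp (FTerm T) (?s r) Y = ?s b" by blast
  qed
  then show ?thesis using syn_rewrites_iff_FTerm[OF mt assms(2-5)] by blast
qed

end
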